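(* Let $U$, $\hat u$, $\varrho$, $\varrho^{(n)}$, $f_1,\dots,f_{k+1}$, $\bar f_j$, $\mu_j$, $I_j$ and $\xi_j(\cdot)$ be as defined in the context (in particular $U$ is compact and the optimal solution $\hat u$ is unique). Suppose the following conditions are satisfied: (i) $\int_{\mathcal X}\|f_j(u,\eta_j,x)\|^2\,P(dx)<\infty$ for all $\eta_j\in I_j$, $u\in U$, $j=1,\dots,k$, and $\int_{\mathcal X}\|f_{k+1}(u,x)\|^2\,P(dx)<\infty$ for all $u\in U$; (ii) the functions $f_j(\cdot,\cdot,x)$, $j=1,\dots,k$, and $f_{k+1}(\cdot,x)$ are Lipschitz continuous for every $x\in\mathcal X$: $$\|f_j(u',\eta_j',x)-f_j(u'',\eta_j'',x)\|\le\gamma_j(x)\big(\|u'-u''\|+\|\eta_j'-\eta_j''\|\big),\quad j=1,\dots,k,$$ $$\|f_{k+1}(u',x)-f_{k+1}(u'',x)\|\le\gamma_{k+1}(x)\|u'-u''\|,$$ for all $\eta_j',\eta_j''\in I_j$, $u',u''\in U$; moreover, $\int\gamma_j^2(x)\,P(dx)<\infty$, $j=1,\dots,k+1$; (iii) the functions $f_j(u,\cdot,x)$, $j=1,\dots,k$, are continuously differentiable for every $x\in\mathcal X$, $u\in U$; moreover, their derivatives are continuous with respect to the first two arguments. Then $$\sqrt n\,\big[\varrho^{(n)}-\varrho\big]\xrightarrow{\ \mathcal D\ }\xi_1(W)\qquad(n\to\infty),$$ where $W(\cdot)=(W_1(\cdot),\dots,W_k(\cdot),W_{k+1})$ is a zero-mean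 Brownian process on $I=I_1\times\cdots\times I_k$; here $W_j(\cdot)$ is a Brownian process of dimension $m_{j-1}$ on $I_j$, $j=1,\dots,k$, and $W_{k+1}$ is an $m_k$-dimensional normal vector. The covariance function of $W$ is $$\mathrm{cov}[W_i(\eta_i),W_j(\eta_j)]=\int_{\mathcal X}[f_i(\hat u,\eta_i,x)-\bar f_i(\hat u,\eta_i)][f_j(\hat u,\eta_j,x)-\bar f_j(\hat u,\eta_j)]^\top P(dx),\quad\eta_i\in I_i,\ \eta_j\in I_j,\ i,j=1,\dots,k,$$ $$\mathrm{cov}[W_i(\eta_i),W_{k+1}]=\int_{\mathcal X}[f_i(\hat u,\eta_i,x)-\bar f_i(\hat u,\eta_i)][f_{k+1}(\hat u,x)-\bar f_{k+1}(\hat u)]^\top P(dx),\quad\eta_i\in I_i,\ i=1,\dots,k,$$ $$\mathrm{cov}[W_{k+1},W_{k+1}]=\int_{\mathcal X}[f_{k+1}(\hat u,x)-\bar f_{k+1}(\hat u)][f_{k+1}(\hat u,x)-\bar f_{k+1}(\hat u)]^\top P(dx).$$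
   Context: $X$ is an $m$-dimensional random vector with probability distribution $P$ and domain (set of values) $\mathcal X\subset\mathbb R^m$. $U$ is a compact set in a finite-dimensional space. Let $k\ge1$, $m_0=1$, $m_1,\dots,m_k\ge1$ be integers, $f_j:U\times\mathbb R^{m_j}\times\mathbb R^m\to\mathbb R^{m_{j-1}}$ for $j=1,\dots,k$, and $f_{k+1}:U\times\mathbb R^m\to\mathbb R^{m_k}$. The optimized composite functional is $$\varrho=\min_{u\in U}\mathbb E\Big[f_1\Big(u,\mathbb E\big[f_2\big(u,\mathbb E[\cdots f_k(u,\mathbb E[f_{k+1}(u,X)],X)]\cdots,X\big)\big],X\Big)\Big],$$ and it is assumed that the optimal solution $\hat u$ of this problem is unique. Given independent identically distributed observations $X_1,\dots,X_n$ of $X$, the empirical estimator is $$\varrho^{(n)}=\min_{u\in U}\sum_{i_0=1}^n\frac1n\Big[f_1\Big(u,\sum_{i_1=1}^n\frac1n\big[f_2\big(u,\sum_{i_2=1}^n\frac1n[\cdots f_k(u,\sum_{i_k=1}^n\frac1nf_{k+1}(u,X_{i_k}),X_{i_{k-1}})]\cdots,X_{i_1}\big)\big],X_{i_0}\Big)\Big].$$ Define $\bar f_j(u,\eta_j)=\int_{\mathcal X}f_j(u,\eta_j,x)\,P(dx)$ for $j=1,\dots,k$, $\bar f_{k+1}(u)=\int_{\mathcal X}f_{k+1}(u,x)\,P(dx)$, $\mu_{k+1}=\bar f_{k+1}(\hat u)$, and $\mu_j=\bar f_j(\hat u,\mu_{j+1})$ for $j=k,k-1,\dots,1$. The compact sets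 $I_j\subset\mathbb R^{m_j}$, $j=1,\dots,k$, are selected so that $\mathrm{int}(I_k)\supset\bar f_{k+1}(U)$ and $\mathrm{int}(I_j)\supset\bar f_{j+1}(U,I_{j+1})$ for $j=1,\dots,k-1$. $f_j'(u,\eta_j^*,x)$ denotes the Jacobian of $f_j(u,\eta_j,x)$ with respect to the second argument at $\eta_j^*\in I_j$. For $d=(d_1,\dots,d_k,d_{k+1})$ with $d_j:I_j\to\mathbb R^{m_{j-1}}$ continuous ($j=1,\dots,k$) and $d_{k+1}\in\mathbb R^{m_k}$, define recursively $$\xi_{k+1}(d)=d_{k+1},\qquad\xi_j(d)=\int_{\mathcal X}f_j'(\hat u,\mu_{j+1},x)\,\xi_{j+1}(d)\,P(dx)+d_j(\mu_{j+1}),\quad j=k,k-1,\dots,1.$$ A "zero-mean Brownian process" means a zero-mean (jointly) Gaussian process with continuous sample paths and the stated covariance function. $\xrightarrow{\mathcal D}$ denotes convergence in distribution. *)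

theory Defs
  imports "HOL-Probability.Probability"
begin

text \<open>
  The dimensions \<open>m 0, \<dots>, m k\<close> depend on a running index, so \<open>n\<close>-dimensional real space is
  \<^term>\<open>Euclidean_space n\<close>: functions \<open>nat \<Rightarrow> real\<close> vanishing from index \<open>n\<close> on, with the product
  topology. Coordinates are numbered from 0; in particular the scalar level (\<open>m 0 = 1\<close>) is read
  off at coordinate 0.
\<close>

abbreviation Rn :: "nat \<Rightarrow> (nat \<Rightarrow> real) set" where
  "Rn n \<equiv> topspace (Euclidean_space n)"

definition vnorm :: "nat \<Rightarrow> (nat \<Rightarrow> real) \<Rightarrow> real" where
  "vnorm n v = L2_set v {..<n}"

definition vdist :: "nat \<Rightarrow> (nat \<Rightarrow> real) \<Rightarrow> (nat \<Rightarrow> real) \<Rightarrow> real" where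
  "vdist n v w = vnorm n (\<lambda>i. v i - w i)"

definition vexp :: "'a measure \<Rightarrow> ('a \<Rightarrow> nat \<Rightarrow> real) \<Rightarrow> nat \<Rightarrow> real" where
  "vexp N Y = (\<lambda>i. \<integral>\<omega>. Y \<omega> i \<partial>N)"

definition emp_mean :: "nat \<Rightarrow> (nat \<Rightarrow> 'x) \<Rightarrow> ('x \<Rightarrow> nat \<Rightarrow> real) \<Rightarrow> nat \<Rightarrow> real" where
  "emp_mean n x h = (\<lambda>i. \<Sum>l = 1..n. (1 / real n) * h (x l) i)"

text \<open>
  \<open>nested E k f g u j\<close> is the part of the composite functional starting at level \<open>j\<close>, that is
  \<open>E[f j (u, E[f (j+1) (u, \<dots> E[f k (u, E[g (u, X)], X)] \<dots>, X)], X)]\<close>, where \<open>g\<close> is the innermost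
  function (with index \<open>k + 1\<close>) and the averaging operator \<open>E\<close> is either an expectation or an
  empirical mean.
\<close>

function nested ::
  "(('x \<Rightarrow> nat \<Rightarrow> real) \<Rightarrow> nat \<Rightarrow> real) \<Rightarrow> nat \<Rightarrow>
   (nat \<Rightarrow> 'u \<Rightarrow> (nat \<Rightarrow> real) \<Rightarrow> 'x \<Rightarrow> nat \<Rightarrow> real) \<Rightarrow> ('u \<Rightarrow> 'x \<Rightarrow> nat \<Rightarrow> real) \<Rightarrow>
   'u \<Rightarrow> nat \<Rightarrow> nat \<Rightarrow> real" where
  "nested E k f g u j =
     (if j \<le> k then E (\<lambda>x. f j u (nested E k f g u (Suc j)) x) else E (\<lambda>x. g u x))"
  by pat_completeness auto
termination
  by (relation "Wellfounded.measure (\<lambda>(E, k, f, g, u, j). Suc k - j)") auto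

declare nested.simps [simp del]

definition comp_min ::
  "(('x \<Rightarrow> nat \<Rightarrow> real) \<Rightarrow> nat \<Rightarrow> real) \<Rightarrow> nat \<Rightarrow>
   (nat \<Rightarrow> 'u \<Rightarrow> (nat \<Rightarrow> real) \<Rightarrow> 'x \<Rightarrow> nat \<Rightarrow> real) \<Rightarrow> ('u \<Rightarrow> 'x \<Rightarrow> nat \<Rightarrow> real) \<Rightarrow>
   'u set \<Rightarrow> real" where
  "comp_min E k f g U = (INF u\<in>U. nested E k f g u 1 0)"

text \<open>Entry \<open>(a, b)\<close> of the Jacobian is the partial derivative of component \<open>a\<close> in direction \<open>b\<close>.\<close>

definition jac_entry :: "((nat \<Rightarrow> real) \<Rightarrow> nat \<Rightarrow> real) \<Rightarrow> (nat \<Rightarrow> real) \<Rightarrow> nat \<Rightarrow> nat \<Rightarrow> real" where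
  "jac_entry F \<eta> a b = deriv (\<lambda>t. F (\<eta>(b := t)) a) (\<eta> b)"

text \<open>Frechet differentiability; the derivative, if it exists, is necessarily the Jacobian.\<close>

definition differentiable_Rn ::
  "nat \<Rightarrow> nat \<Rightarrow> ((nat \<Rightarrow> real) \<Rightarrow> nat \<Rightarrow> real) \<Rightarrow> (nat \<Rightarrow> real) \<Rightarrow> bool" where
  "differentiable_Rn p q F \<eta> \<longleftrightarrow>
     (\<forall>e>0. \<exists>d>0. \<forall>v\<in>Rn p. vdist p v \<eta> < d \<longrightarrow>
        vnorm q (\<lambda>a. F v a - F \<eta> a - (\<Sum>b<p. jac_entry F \<eta> a b * (v b - \<eta> b)))
          \<le> e * vdist p v \<eta>)"

text \<open>
  \<open>xi P k m f u mu (d, e) j\<close>: here \<open>u\<close> is the optimal solution, \<open>mu j\<close> the nested expectations at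
  \<open>u\<close>, \<open>d 1, \<dots>, d k\<close> the functional arguments and \<open>e\<close> the vector \<open>d (k + 1)\<close>.
\<close>

function xi ::
  "'x measure \<Rightarrow> nat \<Rightarrow> (nat \<Rightarrow> nat) \<Rightarrow>
   (nat \<Rightarrow> 'u \<Rightarrow> (nat \<Rightarrow> real) \<Rightarrow> 'x \<Rightarrow> nat \<Rightarrow> real) \<Rightarrow> 'u \<Rightarrow> (nat \<Rightarrow> nat \<Rightarrow> real) \<Rightarrow>
   (nat \<Rightarrow> (nat \<Rightarrow> real) \<Rightarrow> nat \<Rightarrow> real) \<times> (nat \<Rightarrow> real) \<Rightarrow> nat \<Rightarrow> nat \<Rightarrow> real" where
  "xi P k m f u mu de j =
     (if j \<le> k
      then (\<lambda>a. (\<integral>x. (\<Sum>b<m j. jac_entry (\<lambda>\<eta>. f j u \<eta> x) (mu (Suc j)) a b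
                              * xi P k m f u mu de (Suc j) b) \<partial>P)
                + fst de j (mu (Suc j)) a)
      else snd de)"
  by pat_completeness auto
termination
  by (relation "Wellfounded.measure (\<lambda>(P, k, m, f, u, mu, de, j). Suc k - j)") auto

declare xi.simps [simp del]

text \<open>Normal random variables, point masses (variance 0) included.\<close>

definition normal_rv :: "'w measure \<Rightarrow> ('w \<Rightarrow> real) \<Rightarrow> bool" where
  "normal_rv N Y \<longleftrightarrow>
     Y \<in> borel_measurable N \<and>
     ((\<exists>c s. 0 < s \<and> distributed N lborel Y (normal_density c s)) \<or>
      (\<exists>c. AE \<omega> in N. Y \<omega> = c))"

definition jointly_gaussian :: "'w measure \<Rightarrow> 's set \<Rightarrow> ('s \<Rightarrow> 'w \<Rightarrow> real) \<Rightarrow> bool" where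
  "jointly_gaussian N A Y \<longleftrightarrow>
     (\<forall>S c. finite S \<and> S \<subseteq> A \<longrightarrow> normal_rv N (\<lambda>\<omega>. \<Sum>s\<in>S. c s * Y s \<omega>))"

definition covar :: "'w measure \<Rightarrow> ('w \<Rightarrow> real) \<Rightarrow> ('w \<Rightarrow> real) \<Rightarrow> real" where
  "covar N A B = (\<integral>\<omega>. (A \<omega> - (\<integral>\<omega>'. A \<omega>' \<partial>N)) * (B \<omega> - (\<integral>\<omega>'. B \<omega>' \<partial>N)) \<partial>N)"

text \<open>
  The process \<open>(W 1, \<dots>, W k, V)\<close> is given by \<open>W j \<eta> \<omega>\<close> for \<open>\<eta> \<in> I j\<close> and the vector \<open>V \<omega>\<close>, which is
  its component with index \<open>k + 1\<close>. Its scalar coordinates are indexed by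
  \<open>Inl (j, \<eta>, a)\<close> (coordinate \<open>a\<close> of \<open>W j \<eta>\<close>) and \<open>Inr a\<close> (coordinate \<open>a\<close> of \<open>V\<close>).
\<close>

definition coord_index ::
  "nat \<Rightarrow> (nat \<Rightarrow> nat) \<Rightarrow> (nat \<Rightarrow> (nat \<Rightarrow> real) set) \<Rightarrow> ((nat \<times> (nat \<Rightarrow> real) \<times> nat) + nat) set" where
  "coord_index k m I =
     {Inl (j, \<eta>, a) | j \<eta> a. j \<in> {1..k} \<and> \<eta> \<in> I j \<and> a < m (j - 1)} \<union> {Inr a | a. a < m k}"

definition coord ::
  "(nat \<Rightarrow> (nat \<Rightarrow> real) \<Rightarrow> 'w \<Rightarrow> nat \<Rightarrow> real) \<Rightarrow> ('w \<Rightarrow> nat \<Rightarrow> real) \<Rightarrow>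
   (nat \<times> (nat \<Rightarrow> real) \<times> nat) + nat \<Rightarrow> 'w \<Rightarrow> real" where
  "coord W V s \<omega> = (case s of Inl (j, \<eta>, a) \<Rightarrow> W j \<eta> \<omega> a | Inr a \<Rightarrow> V \<omega> a)"

definition zero_mean_brownian ::
  "nat \<Rightarrow> (nat \<Rightarrow> nat) \<Rightarrow> (nat \<Rightarrow> (nat \<Rightarrow> real) set) \<Rightarrow> 'w measure \<Rightarrow>
   (nat \<Rightarrow> (nat \<Rightarrow> real) \<Rightarrow> 'w \<Rightarrow> nat \<Rightarrow> real) \<Rightarrow> ('w \<Rightarrow> nat \<Rightarrow> real) \<Rightarrow> bool" where
  "zero_mean_brownian k m I N W V \<longleftrightarrow>
     prob_space N \<and>
     (\<forall>\<omega>\<in>space N. \<forall>j\<in>{1..k}.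
        continuous_map (subtopology (Euclidean_space (m j)) (I j)) (Euclidean_space (m (j - 1)))
          (\<lambda>\<eta>. W j \<eta> \<omega>)) \<and>
     (\<forall>\<omega>\<in>space N. V \<omega> \<in> Rn (m k)) \<and>
     jointly_gaussian N (coord_index k m I) (coord W V) \<and>
     (\<forall>s\<in>coord_index k m I. (\<integral>\<omega>. coord W V s \<omega> \<partial>N) = 0)"

definition has_limit_covariance ::
  "'x measure \<Rightarrow> nat \<Rightarrow> (nat \<Rightarrow> nat) \<Rightarrow> (nat \<Rightarrow> (nat \<Rightarrow> real) set) \<Rightarrow>
   (nat \<Rightarrow> 'u \<Rightarrow> (nat \<Rightarrow> real) \<Rightarrow> 'x \<Rightarrow> nat \<Rightarrow> real) \<Rightarrow> ('u \<Rightarrow> 'x \<Rightarrow> nat \<Rightarrow> real) \<Rightarrow> 'u \<Rightarrow>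
   'w measure \<Rightarrow> (nat \<Rightarrow> (nat \<Rightarrow> real) \<Rightarrow> 'w \<Rightarrow> nat \<Rightarrow> real) \<Rightarrow> ('w \<Rightarrow> nat \<Rightarrow> real) \<Rightarrow> bool" where
  "has_limit_covariance P k m I f g u N W V \<longleftrightarrow>
     (\<forall>i\<in>{1..k}. \<forall>j\<in>{1..k}. \<forall>\<eta>\<in>I i. \<forall>\<theta>\<in>I j. \<forall>a<m (i - 1). \<forall>b<m (j - 1).
        covar N (\<lambda>\<omega>. W i \<eta> \<omega> a) (\<lambda>\<omega>. W j \<theta> \<omega> b) =
          (\<integral>x. (f i u \<eta> x a - vexp P (f i u \<eta>) a) * (f j u \<theta> x b - vexp P (f j u \<theta>) b) \<partial>P)) \<and>
     (\<forall>i\<in>{1..k}. \<forall>\<eta>\<in>I i. \<forall>a<m (i - 1). \<forall>b<m k.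
        covar N (\<lambda>\<omega>. W i \<eta> \<omega> a) (\<lambda>\<omega>. V \<omega> b) =
          (\<integral>x. (f i u \<eta> x a - vexp P (f i u \<eta>) a) * (g u x b - vexp P (g u) b) \<partial>P)) \<and>
     (\<forall>a<m k. \<forall>b<m k.
        covar N (\<lambda>\<omega>. V \<omega> a) (\<lambda>\<omega>. V \<omega> b) =
          (\<integral>x. (g u x a - vexp P (g u) a) * (g u x b - vexp P (g u) b) \<partial>P))"

end

theory Submission
  imports Defs
begin

text \<open>
  No weak convergence of processes is needed. Let \<open>G n\<close> be the empirical process of all the
  functions \<open>f j u \<eta>\<close>. Symmetrization and chaining show that it is stochastically bounded and
  equicontinuous, uniformly over \<open>u\<close> and \<open>\<eta>\<close>. On the event that \<open>G n\<close> is bounded and has a small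
  modulus of continuity, the delta method is deterministic: empirical minimizers stay close to
  \<open>uhat\<close>, and the expansion of the composition there, together with strict differentiability, gives
  \<open>sqrt n * (rho_n - rho) = xi 1 (G n) + o(1)\<close>. Since \<open>xi 1\<close> sees \<open>G n\<close> only at \<open>uhat\<close> and at the points
  \<open>mu (j + 1)\<close>, \<open>xi 1 (G n)\<close> is a normalized sum of centred i.i.d. scalars, with the variance of
  \<open>xi 1 (W)\<close>; the scalar central limit theorem, Slutsky and Levy finish the proof. The process \<open>W\<close> is
  built from independent standard normal variables: Gram--Schmidt in \<open>L\<^sup>2(P)\<close> over a countable dense
  set of indices, and the same chaining bound for continuity.
\<close>

section \<open>Chaining\<close>

text \<open>The suprema in question run over uncountable index sets and need not be measurable.
  Every probabilistic estimate is therefore made for \<open>tail\<close>, a random variable built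
  from countably many indices; Markov's inequality turns it into a measurable event, and on that
  event chaining bounds all indices path by path. The maximal inequalities carry
  \<open>ln card + 16\<close> where the sharp bound has a square root. This is enough because the
  index set is finite-dimensional: the logarithm of the number of links grows linearly in the level,
  against radii that shrink geometrically. The Lipschitz bounds hold on the sets \<open>I j\<close>
  only, whereas for small \<open>n\<close> the empirical values may leave them. The expansion has to
  show that the values are eventually inside, and measurability of the empirical optimum for every
  \<open>n\<close> draws on the continuity of the derivatives instead. Since \<open>xi\<close> is
  linear in finitely many coordinates of the process, the limit law depends on \<open>W\<close>
  through its covariance alone; convergence can be proved for any such \<open>W\<close>,
  independently of the construction of one.\<close>

locale bounded_coords =
  fixes T :: "'t set" and B :: "'b set" and c :: "'t \<Rightarrow> 'b \<Rightarrow> real" and K :: real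
  assumes finB: "finite B" and Tne: "T \<noteq> {}"
    and bnd: "\<And>t b. t \<in> T \<Longrightarrow> b \<in> B \<Longrightarrow> \<bar>c t b\<bar> \<le> K"
begin

section \<open>Finite nets from a grid of coordinates\<close>

definition dd :: "'t \<Rightarrow> 't \<Rightarrow> real" where
  "dd s t = (\<Sum>b\<in>B. \<bar>c s b - c t b\<bar>)"

lemma dd_commute: "dd s t = dd t s"
  unfolding dd_def by (rule sum.cong) auto

lemma dd_self [simp]: "dd s s = 0"
  unfolding dd_def by simp

lemma dd_triangle: "dd s u \<le> dd s t + dd t u"
  unfolding dd_def sum.distrib[symmetric] by (rule sum_mono) auto

text \<open>The factor \<open>card B + 1\<close> turns a coordinatewise error of one mesh into a
  \<open>dd\<close> error of at most \<open>(1/2) ^ n\<close>; the added 1 keeps the factor positive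
  for empty \<open>B\<close>.\<close>

definition cell :: "nat \<Rightarrow> 't \<Rightarrow> 'b \<Rightarrow> int" where
  "cell n t = (\<lambda>b\<in>B. \<lfloor>c t b * ((real (card B) + 1) * 2 ^ n)\<rfloor>)"

text \<open>The chosen point depends on \<open>t\<close> only through its cell, so the net has at
  most one point per occupied cell, and it lies in \<open>T\<close> itself, where the process is
  defined.\<close>

definition rep :: "nat \<Rightarrow> 't \<Rightarrow> 't" where
  "rep n t = (SOME s. s \<in> T \<and> cell n s = cell n t)"

lemma rep: assumes "t \<in> T" shows "rep n t \<in> T" "cell n (rep n t) = cell n t"
  using someI[of "\<lambda>s. s \<in> T \<and> cell n s = cell n t" t] assms unfolding rep_def by auto

lemma dd_rep: assumes t: "t \<in> T" shows "dd t (rep n t) \<le> (1/2) ^ n"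
proof -
  let ?L = "(real (card B) + 1) * 2 ^ n"
  have L: "?L > 0" by simp
  have "\<bar>c t b - c (rep n t) b\<bar> \<le> 1 / ?L" if b: "b \<in> B" for b
  proof -
    have "\<lfloor>c (rep n t) b * ?L\<rfloor> = \<lfloor>c t b * ?L\<rfloor>"
      using fun_cong[OF rep(2)[OF t, of n], of b] b by (simp add: cell_def)
    hence "\<bar>c t b * ?L - c (rep n t) b * ?L\<bar> \<le> 1" by linarith
    hence "\<bar>c t b - c (rep n t) b\<bar> * ?L \<le> 1"
      using L by (metis abs_mult abs_of_pos left_diff_distrib)
    thus ?thesis using L by (simp add: pos_le_divide_eq)
  qed
  hence "dd t (rep n t) \<le> (\<Sum>b\<in>B. 1 / ?L)" unfolding dd_def by (rule sum_mono)
  also have "\<dots> = real (card B) / (real (card B) + 1) * (1/2) ^ n"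
    by (simp add: power_one_over divide_simps)
  also have "\<dots> \<le> 1 * (1/2) ^ n" by (rule mult_right_mono) (auto simp: divide_simps)
  finally show ?thesis by simp
qed

text \<open>Cells are integer vectors in a box of side proportional to \<open>2 ^ n\<close>: the net
  grows exponentially in \<open>n\<close>, with the number of coordinates in the exponent.\<close>

lemma card_rep:
  "finite (rep n ` T) \<and> real (card (rep n ` T)) \<le> ((2 * \<bar>K\<bar> * (real (card B) + 1) + 5) * 2 ^ n) ^ card B"
proof -
  let ?L = "(real (card B) + 1) * 2 ^ n"
  define z where "z = \<lceil>\<bar>K\<bar> * ?L\<rceil> + 1"
  have "0 \<le> \<bar>K\<bar> * ?L" by simp
  hence z0: "z \<ge> 1" unfolding z_def by linarith
  have sub: "cell n ` T \<subseteq> PiE B (\<lambda>_. {-z..z})"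
  proof (rule image_subsetI)
    fix t assume t: "t \<in> T"
    show "cell n t \<in> PiE B (\<lambda>_. {-z..z})"
    proof (rule PiE_I)
      fix b assume b: "b \<in> B"
      have "\<bar>c t b * ?L\<bar> \<le> \<bar>K\<bar> * ?L"
        using bnd[OF t b] by (simp add: abs_mult mult_right_mono)
      hence "-z \<le> \<lfloor>c t b * ?L\<rfloor>" "\<lfloor>c t b * ?L\<rfloor> \<le> z"
        unfolding z_def by linarith+
      thus "cell n t b \<in> {-z..z}" using b by (simp add: cell_def)
    qed (simp add: cell_def)
  qed
  have finP: "finite (PiE B (\<lambda>_. {-z..z}))" using finB by (intro finite_PiE) auto
  have finC: "finite (cell n ` T)" by (rule finite_subset[OF sub finP])
  have "rep n ` T = (\<lambda>q. SOME s. s \<in> T \<and> cell n s = q) ` cell n ` T"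
    unfolding rep_def image_image by simp
  hence 1: "finite (rep n ` T)" "card (rep n ` T) \<le> card (cell n ` T)"
    using finC by (auto intro: card_image_le)
  have "card (cell n ` T) \<le> card (PiE B (\<lambda>_. {-z..z}))" by (rule card_mono[OF finP sub])
  also have "\<dots> = nat (2 * z + 1) ^ card B" using finB by (simp add: card_PiE)
  finally have "real (card (rep n ` T)) \<le> real (nat (2 * z + 1) ^ card B)"
    using 1(2) by (metis of_nat_le_iff le_trans)
  also have "\<dots> = real_of_int (2 * z + 1) ^ card B" using z0 by simp
  also have "\<dots> \<le> ((2 * \<bar>K\<bar> * (real (card B) + 1) + 5) * 2 ^ n) ^ card B"
  proof (rule power_mono)
    have "real_of_int z \<le> \<bar>K\<bar> * ?L + 2" unfolding z_def by linarith
    hence "real_of_int (2 * z + 1) \<le> 2 * \<bar>K\<bar> * ?L + 5" by simp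
    also have "\<dots> \<le> 2 * \<bar>K\<bar> * ?L + 5 * 2 ^ n" by simp
    finally show "real_of_int (2 * z + 1) \<le> (2 * \<bar>K\<bar> * (real (card B) + 1) + 5) * 2 ^ n"
      by (simp add: algebra_simps)
    show "0 \<le> real_of_int (2 * z + 1)" using z0 by simp
  qed
  finally show ?thesis using 1(1) by simp
qed

text \<open>Two kinds of pairs are needed: a net point with its successor one level on, and two net
  points of one level whose originals are within \<open>(1/2) ^ n\<close>. The triangle inequality
  gives \<open>3/2\<close> and \<open>3\<close> times \<open>(1/2) ^ n\<close> respectively; the
  radius covers both.\<close>

definition links :: "nat \<Rightarrow> ('t \<times> 't) set" where
  "links n = {(s, t). s \<in> rep n ` T \<union> rep (Suc n) ` T \<and> t \<in> rep n ` T \<union> rep (Suc n) ` T \<and>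
                dd s t \<le> 3 * (1/2) ^ n}"

lemma links_sub: "links n \<subseteq> (rep n ` T \<union> rep (Suc n) ` T) \<times> (rep n ` T \<union> rep (Suc n) ` T)"
  by (auto simp: links_def)

lemma finite_links: "finite (links n)"
  by (rule finite_subset[OF links_sub]) (use card_rep in auto)

lemma links_ne: "links n \<noteq> {}"
proof -
  from Tne obtain t where "t \<in> T" by auto
  hence "(rep n t, rep n t) \<in> links n" by (auto simp: links_def)
  thus ?thesis by auto
qed

text \<open>Links are pairs from the union of two nets whose sizes are exponential in
  \<open>n\<close>, so the logarithm is at most affine in the level.\<close>

lemma ln_card_links: "\<exists>\<alpha> \<beta>. \<forall>n. ln (real (card (links n))) \<le> \<alpha> + \<beta> * real n"
proof -
  let ?A = "2 * \<bar>K\<bar> * (real (card B) + 1) + 5"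
  let ?D = "card B"
  have A: "?A \<ge> 1" by simp
  have "ln (real (card (links n))) \<le> (2 * ln 2 + 2 * real ?D * (ln ?A + ln 2)) + 2 * real ?D * ln 2 * real n" for n
  proof -
    let ?R = "rep n ` T \<union> rep (Suc n) ` T"
    let ?b = "(?A * 2 ^ Suc n) ^ ?D"
    have "real (card (rep n ` T)) \<le> ?b"
      by (rule order_trans[OF conjunct2[OF card_rep]]) (intro power_mono mult_left_mono, auto)
    moreover have "real (card (rep (Suc n) ` T)) \<le> ?b" using card_rep by blast
    moreover have "card ?R \<le> card (rep n ` T) + card (rep (Suc n) ` T)" by (rule card_Un_le)
    ultimately have R: "real (card ?R) \<le> 2 * ?b" by linarith
    have "card (links n) \<le> card (?R \<times> ?R)"
      by (rule card_mono[OF _ links_sub]) (use card_rep in auto)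
    hence "real (card (links n)) \<le> real (card ?R) * real (card ?R)"
      by (simp add: card_cartesian_product flip: of_nat_mult)
    also have "\<dots> \<le> (2 * ?b) * (2 * ?b)" using R by (intro mult_mono) auto
    finally have le: "real (card (links n)) \<le> (2 * ?b) * (2 * ?b)" .
    have pos: "card (links n) > 0" using finite_links links_ne by (simp add: card_gt_0_iff)
    have "ln (real (card (links n))) \<le> ln ((2 * ?b) * (2 * ?b))"
      using le pos by (subst ln_le_cancel_iff) (auto intro: less_le_trans)
    also have "\<dots> = 2 * (ln 2 + real ?D * (ln ?A + (real n + 1) * ln 2))"
    proof -
      have "ln ((2 * ((a * x) ^ d)) * (2 * ((a * x) ^ d))) = 2 * (ln 2 + real d * (ln a + ln x))"
        if "a > 0" "x > 0" for a x :: real and d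
        using that ln_realpow[of 2 2] by (simp add: ln_mult_pos ln_realpow algebra_simps)
      from this[of ?A "2 ^ Suc n" ?D] A show ?thesis by (simp add: ln_realpow del: power_Suc)
    qed
    finally show ?thesis by (simp add: algebra_simps)
  qed
  thus ?thesis by blast
qed

section \<open>Oscillation along links and its sum over the levels\<close>

definition osc :: "('t \<Rightarrow> real) \<Rightarrow> nat \<Rightarrow> real" where
  "osc z n = Max ((\<lambda>(s, t). \<bar>z s - z t\<bar>) ` links n)"

lemma osc_ge: "(s, t) \<in> links n \<Longrightarrow> \<bar>z s - z t\<bar> \<le> osc z n"
  unfolding osc_def by (rule Max_ge) (use finite_links in \<open>auto intro!: image_eqI[of _ _ "(s,t)"]\<close>)

lemma osc_nonneg: "0 \<le> osc z n"
  using links_ne osc_ge by (metis abs_ge_zero order_trans ex_in_conv surj_pair)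

lemma link_rep: assumes "t \<in> T" shows "(rep (Suc n) t, rep n t) \<in> links n"
proof -
  have "dd (rep (Suc n) t) (rep n t) \<le> dd (rep (Suc n) t) t + dd t (rep n t)" by (rule dd_triangle)
  also have "\<dots> \<le> (1/2) ^ Suc n + (1/2) ^ n"
    using dd_rep[OF assms, of n] dd_rep[OF assms, of "Suc n"] by (simp add: dd_commute)
  also have "\<dots> \<le> 3 * (1/2) ^ n" by simp
  finally show ?thesis using assms by (auto simp: links_def)
qed

lemma link_close: assumes "s \<in> T" "t \<in> T" "dd s t \<le> (1/2) ^ n" shows "(rep n s, rep n t) \<in> links n"
proof -
  have "dd (rep n s) (rep n t) \<le> dd (rep n s) s + (dd s t + dd t (rep n t))"
    by (meson add_left_mono dd_triangle order_trans)
  also have "\<dots> \<le> 3 * (1/2) ^ n"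
    using dd_rep[OF assms(1), of n] dd_rep[OF assms(2), of n] assms(3) by (simp add: dd_commute)
  finally show ?thesis using assms by (auto simp: links_def)
qed

lemma chain_sum: assumes "t \<in> T"
  shows "\<bar>z (rep (N + n) t) - z (rep N t)\<bar> \<le> (\<Sum>i<n. osc z (N + i))"
proof (induction n)
  case (Suc n)
  have "\<bar>z (rep (N + Suc n) t) - z (rep (N + n) t)\<bar> \<le> osc z (N + n)"
    using osc_ge[OF link_rep[OF assms, of "N + n"]] by simp
  with Suc show ?case by simp
qed simp

text \<open>Valued in \<open>ennreal\<close> because the sum may diverge for a process without
  continuous paths; finiteness of \<open>tail z 0\<close> is later the event on which a Gaussian
  process is extended.\<close>

definition tail :: "('t \<Rightarrow> real) \<Rightarrow> nat \<Rightarrow> ennreal" where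
  "tail z N = (\<Sum>i. ennreal (osc z (N + i)))"

lemma sum_osc_le_tail: "ennreal (\<Sum>i<n. osc z (N + i)) \<le> tail z N"
proof -
  have "(\<Sum>i<n. ennreal (osc z (N + i))) \<le> tail z N"
    unfolding tail_def by (rule sum_le_suminf) auto
  thus ?thesis by (simp add: sum_ennreal osc_nonneg)
qed

text \<open>The chaining bound. The limit \<open>w\<close> along the nets is \<open>z\<close> itself for a continuous process and
  the continuous modification for a Gaussian one.\<close>

lemma chaining:
  assumes s: "s \<in> T" and t: "t \<in> T" and st: "dd s t \<le> (1/2) ^ N"
    and ws: "(\<lambda>n. z (rep n s)) \<longlonglongrightarrow> w s" and wt: "(\<lambda>n. z (rep n t)) \<longlonglongrightarrow> w t"
  shows "ennreal \<bar>w s - w t\<bar> \<le> 3 * tail z N"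
proof (cases "tail z N = top")
  case True thus ?thesis by (simp add: ennreal_mult_eq_top_iff)
next
  case False
  then obtain S where S: "S \<ge> 0" "tail z N = ennreal S" by (cases "tail z N") auto
  have sum: "(\<Sum>i<n. osc z (N + i)) \<le> S" for n
    using sum_osc_le_tail[where n = n and N = N and z = z] S by (simp add: ennreal_le_iff)
  \<comment> \<open>Telescoping from level \<open>N\<close> on bounds the distance between the value
    at level \<open>N\<close> and the limit by one \<open>tail\<close>.\<close>
  have *: "\<bar>w u - z (rep N u)\<bar> \<le> S" if u: "u \<in> T" "(\<lambda>n. z (rep n u)) \<longlonglongrightarrow> w u" for u
  proof (rule LIMSEQ_le_const2)
    show "(\<lambda>n. \<bar>z (rep (N + n) u) - z (rep N u)\<bar>) \<longlonglongrightarrow> \<bar>w u - z (rep N u)\<bar>"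
      using LIMSEQ_ignore_initial_segment[OF u(2), of N]
      by (intro tendsto_intros) (simp add: add.commute)
    show "\<exists>M. \<forall>n\<ge>M. \<bar>z (rep (N + n) u) - z (rep N u)\<bar> \<le> S"
      using chain_sum[OF u(1)] sum order_trans by blast
  qed
  \<comment> \<open>The level-\<open>N\<close> net points of \<open>s\<close> and \<open>t\<close>
    form a link because \<open>dd s t\<close> is small; this link and the two limits account for the
    factor 3.\<close>
  have "\<bar>z (rep N s) - z (rep N t)\<bar> \<le> osc z N" by (rule osc_ge[OF link_close[OF s t st]])
  also have "\<dots> \<le> S" using sum[of 1] by simp
  finally have "\<bar>w s - w t\<bar> \<le> 3 * S" using *[OF s ws] *[OF t wt] by linarith
  hence "ennreal \<bar>w s - w t\<bar> \<le> ennreal (3 * S)" by (simp add: ennreal_leI)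
  thus ?thesis using S by (simp add: ennreal_mult)
qed

text \<open>All nets together: a countable set that carries every measurability argument, and on
  which alone the Gaussian process has to be constructed at first.\<close>

definition skeleton :: "'t set" where
  "skeleton = (\<Union>n. rep n ` T)"

lemma skeleton_sub: "skeleton \<subseteq> T"
  using rep(1) by (auto simp: skeleton_def)

lemma rep_skeleton: "t \<in> T \<Longrightarrow> rep n t \<in> skeleton"
  by (auto simp: skeleton_def)

lemma countable_skeleton: "countable skeleton"
  unfolding skeleton_def using card_rep by (intro countable_UN) (auto intro: countable_finite)

lemma links_skeleton: "links n \<subseteq> skeleton \<times> skeleton"
  using links_sub[of n] unfolding skeleton_def by blast

lemma osc_measurable:
  assumes "\<And>t. t \<in> skeleton \<Longrightarrow> Z t \<in> borel_measurable M"
  shows "(\<lambda>\<omega>. osc (\<lambda>t. Z t \<omega>) n) \<in> borel_measurable M"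
  unfolding osc_def
proof (rule borel_measurable_Max)
  fix p assume "p \<in> links n"
  then obtain s t where "p = (s, t)" "s \<in> skeleton" "t \<in> skeleton"
    using links_skeleton by (cases p) blast
  thus "(\<lambda>\<omega>. case p of (s, t) \<Rightarrow> \<bar>Z s \<omega> - Z t \<omega>\<bar>) \<in> borel_measurable M"
    using assms by simp
qed (rule finite_links)

lemma tail_measurable:
  assumes "\<And>t. t \<in> skeleton \<Longrightarrow> Z t \<in> borel_measurable M"
  shows "(\<lambda>\<omega>. tail (\<lambda>t. Z t \<omega>) N) \<in> borel_measurable M"
  unfolding tail_def using osc_measurable[OF assms] by measurable

text \<open>An entropy sum of Dudley type with the logarithm in place of its square root. Each term
  is the radius of the links at a level times the factor from the maximal inequalities, where the
  constant 16 originates.\<close>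

definition J :: "nat \<Rightarrow> real" where
  "J N = (\<Sum>i. 3 * (1/2) ^ (N + i) * (ln (real (card (links (N + i)))) + 16))"

text \<open>Logarithms of cardinalities grow linearly while radii shrink geometrically; being the
  remainder of a convergent series, \<open>J N\<close> vanishes as \<open>N\<close> grows.\<close>

lemma J_summable: "summable (\<lambda>i. 3 * (1/2) ^ (N + i) * (ln (real (card (links (N + i)))) + 16))"
  and J_tendsto: "J \<longlonglongrightarrow> 0"
proof -
  let ?f = "\<lambda>i. 3 * (1/2) ^ i * (ln (real (card (links i))) + 16 :: real)"
  obtain \<alpha> \<beta> where ab: "\<And>n. ln (real (card (links n))) \<le> \<alpha> + \<beta> * real n" using ln_card_links by blast
  have pos: "ln (real (card (links n))) \<ge> 0" for n
    using finite_links links_ne by (intro ln_ge_zero) (simp add: Suc_le_eq card_gt_0_iff)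
  have "summable (\<lambda>i. real i * (1/2::real) ^ i)"
    proof -
    have "summable (\<lambda>i. real (Suc i) * (1/2) ^ i - (1/2::real) ^ i)"
      using geometric_deriv_sums[of "1/2::real"]
      by (intro summable_diff) (auto simp: sums_iff intro: summable_geometric)
    thus ?thesis by (simp add: algebra_simps)
  qed
  hence s: "summable (\<lambda>i. (\<alpha> + 16) * (3 * (1/2) ^ i) + 3 * \<beta> * (real i * (1/2::real) ^ i))"
    by (intro summable_add summable_mult) (auto intro: summable_geometric)
  have f: "summable ?f"
  proof (rule summable_comparison_test[OF _ s], intro exI allI impI)
    fix n
    have "norm (?f n) = ?f n" using pos[of n] by simp
    also have "\<dots> \<le> 3 * (1/2) ^ n * ((\<alpha> + \<beta> * real n) + 16)"
      using ab[of n] by (intro mult_left_mono) auto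
    finally show "norm (?f n) \<le> (\<alpha> + 16) * (3 * (1/2) ^ n) + 3 * \<beta> * (real n * (1/2) ^ n)"
      by (simp add: algebra_simps)
  qed
  show "summable (\<lambda>i. ?f (N + i))" for N
    using summable_ignore_initial_segment[OF f, of N] by (simp add: add.commute)
  have "J = (\<lambda>N. suminf ?f - (\<Sum>i<N. ?f i))"
    unfolding J_def fun_eq_iff using suminf_minus_initial_segment[OF f] by (simp add: add.commute)
  moreover have "(\<lambda>N. suminf ?f - (\<Sum>i<N. ?f i)) \<longlonglongrightarrow> suminf ?f - suminf ?f"
    by (intro tendsto_intros summable_LIMSEQ f)
  ultimately show "J \<longlonglongrightarrow> 0" by simp
qed

text \<open>The premise \<open>H\<close> abstracts a maximal inequality for increments, so that the
  empirical process and the Gaussian one are chained by the same lemma. Only radii up to 3 occur,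
  the radius at level 0.\<close>

lemma tail_expectation:
  assumes meas: "\<And>t. t \<in> skeleton \<Longrightarrow> Z t \<in> borel_measurable M" and C: "C \<ge> 0"
    and H: "\<And>Q \<sigma>. finite Q \<Longrightarrow> Q \<noteq> {} \<Longrightarrow> Q \<subseteq> skeleton \<times> skeleton \<Longrightarrow> 0 < \<sigma> \<Longrightarrow> \<sigma> \<le> 3 \<Longrightarrow> (\<And>s t. (s, t) \<in> Q \<Longrightarrow> dd s t \<le> \<sigma>) \<Longrightarrow>
      (\<integral>\<^sup>+\<omega>. ennreal (Max ((\<lambda>(s, t). \<bar>Z s \<omega> - Z t \<omega>\<bar>) ` Q)) \<partial>M) \<le> ennreal (C * (\<sigma> * (ln (real (card Q)) + 16)))"
  shows "(\<integral>\<^sup>+\<omega>. tail (\<lambda>t. Z t \<omega>) N \<partial>M) \<le> ennreal (C * J N)"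
proof -
  let ?f = "\<lambda>i. 3 * (1/2) ^ i * (ln (real (card (links i))) + 16 :: real)"
  have pos: "ln (real (card (links n))) \<ge> 0" for n
    using finite_links links_ne by (intro ln_ge_zero) (simp add: Suc_le_eq card_gt_0_iff)
  have "(\<integral>\<^sup>+\<omega>. tail (\<lambda>t. Z t \<omega>) N \<partial>M) = (\<Sum>i. \<integral>\<^sup>+\<omega>. ennreal (osc (\<lambda>t. Z t \<omega>) (N + i)) \<partial>M)"
    unfolding tail_def using osc_measurable[OF meas] by (intro nn_integral_suminf) auto
  also have "\<dots> \<le> (\<Sum>i. ennreal (C * ?f (N + i)))"
  proof (rule suminf_le)
    fix i
    show "(\<integral>\<^sup>+\<omega>. ennreal (osc (\<lambda>t. Z t \<omega>) (N + i)) \<partial>M) \<le> ennreal (C * ?f (N + i))"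
      unfolding osc_def
    proof (rule H)
      show "links (N + i) \<subseteq> skeleton \<times> skeleton" by (rule links_skeleton)
      show "3 * (1/2::real) ^ (N + i) \<le> 3" by (simp add: power_le_one)
    qed (use finite_links links_ne in \<open>auto simp: links_def\<close>)
  qed auto
  also have "\<dots> = ennreal (\<Sum>i. C * ?f (N + i))"
    using C pos J_summable[of N] by (intro suminf_ennreal2) (auto intro!: summable_mult)
  also have "(\<Sum>i. C * ?f (N + i)) = C * J N"
    unfolding J_def using J_summable[of N] by (rule suminf_mult)
  finally show ?thesis .
qed

end

section \<open>Symmetrization and the maximal inequality\<close>

text \<open>The moment generating function of a random sign is subgaussian. The quotient of the left
  side by the right side decreases on the positive axis, its derivative having the sign of
  \<open>sinh x - x * cosh x\<close>.\<close>

lemma cosh_le_exp_half_square: "cosh (x::real) \<le> exp (x\<^sup>2 / 2)"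
proof -
  have *: "sinh x \<le> x * cosh x" if "x \<ge> 0" for x :: real
  proof -
    have "0 * cosh 0 - sinh 0 \<le> x * cosh x - sinh x"
      by (rule DERIV_nonneg_imp_nondecreasing[OF that])
         (auto intro!: exI derivative_eq_intros)
    thus ?thesis by simp
  qed
  have "cosh x \<le> exp (x\<^sup>2 / 2)" if "x \<ge> 0" for x :: real
  proof -
    have "exp (- (x\<^sup>2 / 2)) * cosh x \<le> exp (- (0\<^sup>2 / 2)) * cosh 0"
    proof (rule DERIV_nonpos_imp_nonincreasing[OF that])
      fix y :: real assume y: "0 \<le> y" "y \<le> x"
      have "((\<lambda>x. exp (- (x\<^sup>2 / 2)) * cosh x) has_real_derivative
               exp (- (y\<^sup>2 / 2)) * (sinh y - y * cosh y)) (at y)"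
        by (auto intro!: derivative_eq_intros simp: algebra_simps)
      moreover have "exp (- (y\<^sup>2 / 2)) * (sinh y - y * cosh y) \<le> 0"
        using *[OF y(1)] by (simp add: mult_le_0_iff)
      ultimately show "\<exists>z. ((\<lambda>x. exp (- (x\<^sup>2 / 2)) * cosh x) has_real_derivative z) (at y) \<and> z \<le> 0"
        by blast
    qed
    thus ?thesis by (simp add: exp_minus field_simps)
  qed
  from this[of "\<bar>x\<bar>"] show ?thesis by simp
qed

section \<open>Maxima over finite sets and averages over random signs\<close>

definition mx :: "'h set \<Rightarrow> ('h \<Rightarrow> real) \<Rightarrow> real" where
  "mx H v = Max ((\<lambda>h. \<bar>v h\<bar>) ` H)"

lemma mx_ge: "finite H \<Longrightarrow> h \<in> H \<Longrightarrow> \<bar>v h\<bar> \<le> mx H v"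
  unfolding mx_def by (rule Max_ge) auto

lemma mx_obtain: assumes "finite H" "H \<noteq> {}" obtains h where "h \<in> H" "mx H v = \<bar>v h\<bar>"
proof -
  have "mx H v \<in> (\<lambda>h. \<bar>v h\<bar>) ` H" unfolding mx_def by (rule Max_in) (use assms in auto)
  thus ?thesis using that by blast
qed

lemma mx_le: "finite H \<Longrightarrow> H \<noteq> {} \<Longrightarrow> (\<And>h. h \<in> H \<Longrightarrow> \<bar>v h\<bar> \<le> a) \<Longrightarrow> mx H v \<le> a"
  by (metis mx_obtain)

lemma mx_nonneg: "finite H \<Longrightarrow> H \<noteq> {} \<Longrightarrow> 0 \<le> mx H v"
  by (metis mx_obtain abs_ge_zero)

lemma mx_scale: assumes "finite H" "H \<noteq> {}" "a \<ge> 0" shows "mx H (\<lambda>h. v h / a) = mx H v / a"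
proof (rule antisym)
  show "mx H (\<lambda>h. v h / a) \<le> mx H v / a"
    using assms by (intro mx_le) (auto simp: mx_ge divide_right_mono)
  obtain h where "h \<in> H" "mx H v = \<bar>v h\<bar>" using mx_obtain[OF assms(1,2)] .
  thus "mx H v / a \<le> mx H (\<lambda>h. v h / a)"
    using mx_ge[OF assms(1), of h "\<lambda>h. v h / a"] assms by simp
qed

lemma mx_measurable [measurable]:
  "finite H \<Longrightarrow> (\<And>h. h \<in> H \<Longrightarrow> (\<lambda>x. v x h) \<in> borel_measurable M) \<Longrightarrow> (\<lambda>x. mx H (v x)) \<in> borel_measurable M"
  unfolding mx_def by (rule borel_measurable_Max) auto

lemma integrable_mx:
  assumes "finite H" "H \<noteq> {}" "\<And>h. h \<in> H \<Longrightarrow> integrable M (\<lambda>x. v x h)"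
  shows "integrable M (\<lambda>x. mx H (v x))"
proof (rule Bochner_Integration.integrable_bound)
  show "integrable M (\<lambda>x. \<Sum>h\<in>H. \<bar>v x h\<bar>)" using assms by auto
  show "(\<lambda>x. mx H (v x)) \<in> borel_measurable M" using assms by (intro mx_measurable) auto
  have "mx H v \<le> (\<Sum>h\<in>H. \<bar>v h\<bar>)" for v :: "_ \<Rightarrow> real"
    using assms by (intro mx_le) (auto intro!: member_le_sum)
  thus "AE x in M. norm (mx H (v x)) \<le> norm (\<Sum>h\<in>H. \<bar>v x h\<bar>)"
    using mx_nonneg[OF assms(1,2)] by (intro AE_I2) (simp add: sum_nonneg)
qed

text \<open>A soft maximum: the inequality \<open>y \<le> exp y\<close>, taken at
  \<open>l * \<bar>v h\<bar>\<close> minus the logarithm of the cardinality, replaces the usual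
  logarithm of an exponential mean. The bound is affine in the \<open>cosh\<close> terms and can be
  averaged without Jensen's inequality.\<close>

lemma mx_le_cosh:
  assumes H: "finite H" "H \<noteq> {}" and l: "l > 0"
  shows "mx H v \<le> (ln (real (card H)) + (2 / real (card H)) * (\<Sum>h\<in>H. cosh (l * v h))) / l"
proof -
  let ?N = "real (card H)"
  have N: "?N > 0" using H by (simp add: card_gt_0_iff)
  obtain h where h: "h \<in> H" "mx H v = \<bar>v h\<bar>" using mx_obtain[OF H] .
  have "l * \<bar>v h\<bar> - ln ?N \<le> exp (l * \<bar>v h\<bar> - ln ?N)"
    using exp_ge_add_one_self[of "l * \<bar>v h\<bar> - ln ?N"] by linarith
  also have "\<dots> = exp (l * \<bar>v h\<bar>) / ?N" using N by (simp add: exp_diff)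
  also have "exp (l * \<bar>v h\<bar>) \<le> 2 * cosh (l * v h)"
    by (cases "v h \<ge> 0") (auto simp: cosh_def scaleR_conv_of_real)
  also have "cosh (l * v h) \<le> (\<Sum>h\<in>H. cosh (l * v h))"
    using H h by (intro member_le_sum) auto
  finally have "l * \<bar>v h\<bar> \<le> ln ?N + (2 / ?N) * (\<Sum>h\<in>H. cosh (l * v h))"
    using N by (simp add: divide_right_mono)
  thus ?thesis using l h(2) by (simp add: pos_le_divide_eq mult.commute)
qed

text \<open>Average over independent signs of \<open>\<Phi> (A + 2 \<Sum>i<n. \<epsilon>\<^sub>i y\<^sub>i)\<close>.\<close>

fun rad :: "(('h \<Rightarrow> real) \<Rightarrow> real) \<Rightarrow> (nat \<Rightarrow> 'h \<Rightarrow> real) \<Rightarrow> nat \<Rightarrow> ('h \<Rightarrow> real) \<Rightarrow> real" where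
  "rad \<Phi> y 0 A = \<Phi> A"
| "rad \<Phi> y (Suc n) A = (rad \<Phi> y n (\<lambda>h. A h + 2 * y n h) + rad \<Phi> y n (\<lambda>h. A h - 2 * y n h)) / 2"

lemma rad_mono: "(\<And>A. \<Phi> A \<le> \<Psi> A) \<Longrightarrow> rad \<Phi> y n A \<le> rad \<Psi> y n A"
proof (induction n arbitrary: A)
  case (Suc n)
  show ?case using Suc.IH[of "\<lambda>h. A h + 2 * y n h"] Suc.IH[of "\<lambda>h. A h - 2 * y n h"] Suc.prems by simp
qed auto

lemma rad_affine:
  "rad (\<lambda>v. (a + b * (\<Sum>h\<in>H. \<Psi> h v)) / d) y n A = (a + b * (\<Sum>h\<in>H. rad (\<Psi> h) y n A)) / (d::real)"
proof (induction n arbitrary: A)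
  case (Suc n)
  have "(\<Sum>h\<in>H. (rad (\<Psi> h) y n A + rad (\<Psi> h) y n A') / 2) =
     ((\<Sum>h\<in>H. rad (\<Psi> h) y n A) + (\<Sum>h\<in>H. rad (\<Psi> h) y n A')) / 2" for A A'
    by (simp add: sum.distrib flip: sum_divide_distrib)
  moreover have "((a + b * p) / d + (a + b * q) / d) / 2 = (a + b * ((p + q) / 2)) / d" for p q
    by (cases "d = 0") (simp_all add: field_simps)
  ultimately show ?case by (simp only: rad.simps Suc)
qed simp

text \<open>The addition theorem for \<open>cosh\<close> splits off each random sign as a
  factor.\<close>

lemma rad_cosh:
  "rad (\<lambda>v. cosh (l * v h)) y n A = cosh (l * A h) * (\<Prod>i<n. cosh (2 * l * y i h))"
proof (induction n arbitrary: A)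
  case (Suc n)
  have "cosh (l * (A h + 2 * y n h)) + cosh (l * (A h - 2 * y n h)) =
    2 * cosh (l * A h) * cosh (2 * l * y n h)"
    by (simp add: ring_distribs cosh_add cosh_diff mult_ac)
  hence "(cosh (l * (A h + 2 * y n h)) * p + cosh (l * (A h - 2 * y n h)) * p) / 2 =
     cosh (l * A h) * (p * cosh (2 * l * y n h))" for p
    by (metis (no_types, opaque_lifting) distrib_right mult.assoc mult.commute nonzero_mult_div_cancel_left zero_neq_numeral)
  thus ?case by (simp add: Suc)
qed simp

text \<open>Hoeffding's argument: with \<open>l\<close> the reciprocal of
  \<open>\<sigma> * sqrt S\<close> each product of \<open>cosh\<close> factors is at most
  \<open>exp 2 < 8\<close>, and the factor 2 of \<open>mx_le_cosh\<close> makes this the 16 seen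
  throughout. The lower bound on \<open>g\<close> keeps \<open>S\<close> positive.\<close>

lemma rad_mx_bound:
  assumes H: "finite H" "H \<noteq> {}" and \<sigma>: "\<sigma> > 0" and n: "n \<ge> 1"
    and y: "\<And>i h. i < n \<Longrightarrow> h \<in> H \<Longrightarrow> \<bar>y i h\<bar> \<le> \<sigma> * g i" and g: "\<And>i. i < n \<Longrightarrow> g i \<ge> 1"
  shows "rad (mx H) y n (\<lambda>_. 0) \<le> \<sigma> * (ln (real (card H)) + 16) * sqrt (\<Sum>i<n. (g i)\<^sup>2)"
proof -
  let ?N = "real (card H)"
  have N: "?N > 0" using H by (simp add: card_gt_0_iff)
  define S where "S = (\<Sum>i<n. (g i)\<^sup>2)"
  have "(g 0)\<^sup>2 \<le> S" unfolding S_def using n by (intro member_le_sum) auto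
  moreover have "(g 0)\<^sup>2 \<ge> 1" using g[of 0] n by simp
  ultimately have S: "S > 0" by linarith
  define l where "l = 1 / (\<sigma> * sqrt S)"
  have l: "l > 0" using \<sigma> S by (simp add: l_def)
  have l2: "l\<^sup>2 * (\<sigma>\<^sup>2 * S) = 1" using \<sigma> S by (simp add: l_def power_mult_distrib power_divide)
  have b: "(\<Prod>i<n. cosh (2 * l * y i h)) \<le> 8" if h: "h \<in> H" for h
  proof -
    have "(\<Prod>i<n. cosh (2 * l * y i h)) \<le> (\<Prod>i<n. exp (2 * l\<^sup>2 * (\<sigma>\<^sup>2 * (g i)\<^sup>2)))"
    proof (rule prod_mono, safe)
      fix i assume i: "i < n"
      have "(y i h)\<^sup>2 \<le> (\<sigma> * g i)\<^sup>2" using y[OF i h] by (metis abs_ge_zero power2_abs power_mono)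
      hence "2 * l\<^sup>2 * (y i h)\<^sup>2 \<le> 2 * l\<^sup>2 * (\<sigma>\<^sup>2 * (g i)\<^sup>2)"
        by (intro mult_left_mono) (auto simp: power_mult_distrib)
      moreover have "cosh (2 * l * y i h) \<le> exp (2 * l\<^sup>2 * (y i h)\<^sup>2)"
        using cosh_le_exp_half_square[of "2 * l * y i h"] by (simp add: power_mult_distrib mult.assoc)
      ultimately show "cosh (2 * l * y i h) \<le> exp (2 * l\<^sup>2 * (\<sigma>\<^sup>2 * (g i)\<^sup>2))"
        by (meson exp_le_cancel_iff order_trans)
    qed simp
    also have "\<dots> = exp (2 * (l\<^sup>2 * (\<sigma>\<^sup>2 * S)))"
      by (simp add: S_def exp_sum[symmetric] sum_distrib_left mult_ac)
    also have "\<dots> = exp 1 * exp (1::real)" by (simp add: l2 flip: exp_add)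
    also have "\<dots> \<le> 272/100 * (272/100)" using e_less_272 by (intro mult_mono) auto
    finally show ?thesis by simp
  qed
  have "rad (mx H) y n (\<lambda>_. 0) \<le> rad (\<lambda>v. (ln ?N + (2 / ?N) * (\<Sum>h\<in>H. cosh (l * v h))) / l) y n (\<lambda>_. 0)"
    by (intro rad_mono mx_le_cosh H l)
  also have "\<dots> = (ln ?N + (2 / ?N) * (\<Sum>h\<in>H. \<Prod>i<n. cosh (2 * l * y i h))) / l"
    by (simp only: rad_affine rad_cosh) simp
  also have "\<dots> \<le> (ln ?N + (2 / ?N) * (\<Sum>h\<in>H. 8)) / l"
    using l N b by (intro divide_right_mono add_left_mono mult_left_mono sum_mono) auto
  also have "\<dots> = (ln ?N + 16) / l" using N by simp
  also have "\<dots> = \<sigma> * (ln ?N + 16) * sqrt S" by (simp add: l_def)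
  finally show ?thesis by (simp add: S_def)
qed

text \<open>Symmetrization without a ghost sample: \<open>A + Y\<close> is the midpoint of \<open>A + 2 Y\<close> and \<open>A\<close>, and
  \<open>A\<close> is the mean of \<open>A - 2 Y\<close>.\<close>

lemma (in prob_space) symmetrize_step:
  assumes H: "finite H" "H \<noteq> {}" and Y: "\<And>h. h \<in> H \<Longrightarrow> integrable M (Y h)"
    and Y0: "\<And>h. h \<in> H \<Longrightarrow> expectation (Y h) = 0"
  shows "expectation (\<lambda>x. mx H (\<lambda>h. A h + Y h x)) \<le>
    expectation (\<lambda>x. mx H (\<lambda>h. A h + 2 * Y h x) / 2 + mx H (\<lambda>h. A h - 2 * Y h x) / 2)"
proof -
  have int: "integrable M (\<lambda>x. mx H (\<lambda>h. A h + c * Y h x))" for c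
    by (rule integrable_mx[OF H]) (use Y in auto)
  obtain h where h: "h \<in> H" "mx H A = \<bar>A h\<bar>" using mx_obtain[OF H] .
  have "mx H A = \<bar>expectation (\<lambda>x. A h - 2 * Y h x)\<bar>"
    using h Y Y0 by (simp add: prob_space)
  also have "\<dots> \<le> expectation (\<lambda>x. \<bar>A h - 2 * Y h x\<bar>)" by (rule integral_abs_bound)
  also have "\<dots> \<le> expectation (\<lambda>x. mx H (\<lambda>h. A h - 2 * Y h x))"
    using Y h int[of "-2"] H by (intro integral_mono) (auto intro!: mx_ge[of H h "\<lambda>h. A h - 2 * Y h _"])
  finally have A: "mx H A \<le> expectation (\<lambda>x. mx H (\<lambda>h. A h - 2 * Y h x))" .
  have pt: "mx H (\<lambda>h. A h + Y h x) \<le> mx H (\<lambda>h. A h + 2 * Y h x) / 2 + mx H A / 2" for x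
  proof (rule mx_le[OF H])
    fix h assume "h \<in> H"
    hence "\<bar>A h + 2 * Y h x\<bar> \<le> mx H (\<lambda>h. A h + 2 * Y h x)" "\<bar>A h\<bar> \<le> mx H A"
      using mx_ge[OF H(1), of h "\<lambda>h. A h + 2 * Y h x"] mx_ge[OF H(1), of h A] by auto
    thus "\<bar>A h + Y h x\<bar> \<le> mx H (\<lambda>h. A h + 2 * Y h x) / 2 + mx H A / 2" by linarith
  qed
  have "expectation (\<lambda>x. mx H (\<lambda>h. A h + Y h x)) \<le> expectation (\<lambda>x. mx H (\<lambda>h. A h + 2 * Y h x) / 2 + mx H A / 2)"
    using int[of 1] int[of 2] pt by (intro integral_mono) auto
  also have "\<dots> = expectation (\<lambda>x. mx H (\<lambda>h. A h + 2 * Y h x)) / 2 + mx H A / 2"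
    using int[of 2] by (simp add: prob_space)
  also have "\<dots> \<le> expectation (\<lambda>x. mx H (\<lambda>h. A h + 2 * Y h x)) / 2 + expectation (\<lambda>x. mx H (\<lambda>h. A h - 2 * Y h x)) / 2"
    using A by simp
  also have "\<dots> = expectation (\<lambda>x. mx H (\<lambda>h. A h + 2 * Y h x) / 2 + mx H (\<lambda>h. A h - 2 * Y h x) / 2)"
    using int[of 2] int[of "-2"] by simp
  finally show ?thesis .
qed

lemma rad_nonneg: "finite H \<Longrightarrow> H \<noteq> {} \<Longrightarrow> 0 \<le> rad (mx H) y n A"
  by (induction n arbitrary: A) (auto intro: mx_nonneg)

lemma rad_cong: "(\<And>i. i < n \<Longrightarrow> y i = y' i) \<Longrightarrow> rad \<Phi> y n A = rad \<Phi> y' n A"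
  by (induction n arbitrary: A) auto

lemma rad_measurable:
  assumes H: "finite H" and y: "\<And>i h. i < n \<Longrightarrow> h \<in> H \<Longrightarrow> (\<lambda>x. y x i h) \<in> borel_measurable N"
    and A: "\<And>h. h \<in> H \<Longrightarrow> (\<lambda>x. A x h) \<in> borel_measurable N"
  shows "(\<lambda>x. rad (mx H) (y x) n (A x)) \<in> borel_measurable N"
  using y A
proof (induction n arbitrary: A)
  case (Suc n)
  have "(\<lambda>x. rad (mx H) (y x) n (\<lambda>h. A x h + 2 * y x n h)) \<in> borel_measurable N"
       "(\<lambda>x. rad (mx H) (y x) n (\<lambda>h. A x h - 2 * y x n h)) \<in> borel_measurable N"
    by (rule Suc.IH; use Suc.prems in auto)+
  thus ?case by simp
qed (use H in auto)

text \<open>Induction on the sample size, symmetrizing one observation at a time. The vector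
  \<open>A\<close> is arbitrary so that it can absorb the remaining observations in
  \<open>symmetrize_step\<close> and the signed last observation in the induction
  hypothesis.\<close>

lemma (in prob_space) symmetrization:
  assumes H: "finite H" "H \<noteq> {}" and Y: "\<And>h. h \<in> H \<Longrightarrow> integrable M (Y h)"
    and Y0: "\<And>h. h \<in> H \<Longrightarrow> expectation (Y h) = 0"
  shows "(\<integral>\<^sup>+x. ennreal (mx H (\<lambda>h. A h + (\<Sum>i<n. Y h (x i)))) \<partial>PiM {..<n} (\<lambda>_. M))
     \<le> (\<integral>\<^sup>+x. ennreal (rad (mx H) (\<lambda>i h. Y h (x i)) n A) \<partial>PiM {..<n} (\<lambda>_. M))"
proof (induction n arbitrary: A)
  case (Suc n)
  interpret PP: product_sigma_finite "\<lambda>_::nat. M" ..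
  let ?P = "PiM {..<n} (\<lambda>_. M)"
  have [measurable]: "h \<in> H \<Longrightarrow> Y h \<in> borel_measurable M" for h using Y by auto
  define s where "s = (\<lambda>x. \<lambda>h. \<Sum>i<n. Y h (x i))"
  define F where "F = (\<lambda>y x. ennreal (mx H (\<lambda>h. A h + 2 * Y h y + s x h) / 2 + mx H (\<lambda>h. A h - 2 * Y h y + s x h) / 2))"
  have ins: "{..<Suc n} = insert n {..<n}" by auto
  have sup: "s (x(n := y)) = s x" for x y by (auto simp: s_def fun_eq_iff)
  have Fsup: "F y (x(n := z)) = F y x" for x y z by (simp add: F_def sup)
  have [measurable]: "(\<lambda>x. s x h) \<in> borel_measurable (PiM (insert n {..<n}) (\<lambda>_. M))" if "h \<in> H" for h
    unfolding s_def using that by measurable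
  have [measurable]: "(\<lambda>x. s x h) \<in> borel_measurable ?P" if "h \<in> H" for h
    unfolding s_def using that by measurable
  have [measurable]: "(\<lambda>x. F (x n) x) \<in> borel_measurable (PiM (insert n {..<n}) (\<lambda>_. M))"
    unfolding F_def using H(1) by measurable
  have [measurable]: "(\<lambda>x. ennreal (mx H (\<lambda>h. A h + (s x h + Y h (x n))))) \<in> borel_measurable (PiM (insert n {..<n}) (\<lambda>_. M))"
    using H(1) by measurable
  have [measurable]: "(\<lambda>x. rad (mx H) (\<lambda>i h. Y h (x i)) (Suc n) A) \<in> borel_measurable (PiM (insert n {..<n}) (\<lambda>_. M))"
  proof (rule rad_measurable[OF H(1)])
    fix i h assume [measurable]: "i < Suc n" "h \<in> H"
    hence [measurable]: "i \<in> insert n {..<n}" by auto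
    show "(\<lambda>x. Y h (x i)) \<in> borel_measurable (PiM (insert n {..<n}) (\<lambda>_. M))" by measurable
  qed auto
  have "(\<integral>\<^sup>+x. ennreal (mx H (\<lambda>h. A h + (\<Sum>i<Suc n. Y h (x i)))) \<partial>PiM {..<Suc n} (\<lambda>_. M)) =
     (\<integral>\<^sup>+x. ennreal (mx H (\<lambda>h. A h + (s x h + Y h (x n)))) \<partial>PiM (insert n {..<n}) (\<lambda>_. M))"
    by (simp add: ins s_def add.commute)
  also have "\<dots> = (\<integral>\<^sup>+x. \<integral>\<^sup>+y. ennreal (mx H (\<lambda>h. (A h + s x h) + Y h y)) \<partial>M \<partial>?P)"
    by (subst PP.product_nn_integral_insert) (auto simp: sup add.assoc)
  \<comment> \<open>With the first \<open>n\<close> observations fixed, their sum joins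
    \<open>A\<close> and only the last observation is symmetrized.\<close>
  also have "\<dots> \<le> (\<integral>\<^sup>+x. \<integral>\<^sup>+y. F y x \<partial>M \<partial>?P)"
  proof (rule nn_integral_mono)
    fix x
    have int: "integrable M (\<lambda>y. mx H (\<lambda>h. (A h + s x h) + c * Y h y))" for c
      by (rule integrable_mx[OF H]) (use Y in auto)
    have "(\<integral>\<^sup>+y. ennreal (mx H (\<lambda>h. (A h + s x h) + Y h y)) \<partial>M) =
      ennreal (expectation (\<lambda>y. mx H (\<lambda>h. (A h + s x h) + Y h y)))"
      using int[of 1] mx_nonneg[OF H] by (intro nn_integral_eq_integral) auto
    also have "\<dots> \<le> ennreal (expectation (\<lambda>y. mx H (\<lambda>h. (A h + s x h) + 2 * Y h y) / 2 + mx H (\<lambda>h. (A h + s x h) - 2 * Y h y) / 2))"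
      by (intro ennreal_leI symmetrize_step H Y Y0)
    also have "\<dots> = (\<integral>\<^sup>+y. ennreal (mx H (\<lambda>h. (A h + s x h) + 2 * Y h y) / 2 + mx H (\<lambda>h. (A h + s x h) - 2 * Y h y) / 2) \<partial>M)"
      using int[of 2] int[of "-2"] mx_nonneg[OF H] by (intro nn_integral_eq_integral[symmetric]) auto
    also have "\<dots> = (\<integral>\<^sup>+y. F y x \<partial>M)"
      unfolding F_def by (simp add: algebra_simps)
    finally show "(\<integral>\<^sup>+y. ennreal (mx H (\<lambda>h. (A h + s x h) + Y h y)) \<partial>M) \<le> (\<integral>\<^sup>+y. F y x \<partial>M)" .
  qed
  also have "\<dots> = (\<integral>\<^sup>+x. F (x n) x \<partial>PiM (insert n {..<n}) (\<lambda>_. M))"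
    by (subst PP.product_nn_integral_insert) (auto simp: Fsup)
  \<comment> \<open>The order of integration is exchanged: the induction hypothesis integrates the
    first \<open>n\<close> observations while the last one, now inside \<open>A\<close>, is held
    fixed.\<close>
  also have "\<dots> = (\<integral>\<^sup>+y. \<integral>\<^sup>+x. F y x \<partial>?P \<partial>M)"
    by (subst PP.product_nn_integral_insert_rev) (auto simp: Fsup)
  also have "\<dots> \<le> (\<integral>\<^sup>+y. \<integral>\<^sup>+x. ennreal (rad (mx H) (\<lambda>i h. Y h ((x(n := y)) i)) (Suc n) A) \<partial>?P \<partial>M)"
  proof (rule nn_integral_mono)
    fix y
    let ?r = "\<lambda>x c. rad (mx H) (\<lambda>i h. Y h (x i)) n (\<lambda>h. A h + c * Y h y)"
    have half: "ennreal (a / 2 + b / 2) = ennreal a / 2 + ennreal b / 2" if "a \<ge> 0" "b \<ge> 0" for a b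
      using that by (simp add: ennreal_plus divide_ennreal flip: ennreal_numeral)
    have half': "ennreal (a / 2) = ennreal a / 2" if "a \<ge> 0" for a
      using that by (simp add: divide_ennreal flip: ennreal_numeral)
    have [measurable]: "(\<lambda>x. ?r x c) \<in> borel_measurable ?P" for c
      by (rule rad_measurable[OF H(1)]) auto
    have [measurable]: "(\<lambda>x. mx H (\<lambda>h. A h + c * Y h y + s x h)) \<in> borel_measurable ?P" for c
      using H(1) by measurable
    have [measurable]: "(\<lambda>x. rad (mx H) (\<lambda>i h. Y h (x i)) n (\<lambda>h. A h - 2 * Y h y)) \<in> borel_measurable ?P"
      by (rule rad_measurable[OF H(1)]) auto
    have [measurable]: "(\<lambda>x. mx H (\<lambda>h. A h - 2 * Y h y + s x h)) \<in> borel_measurable ?P"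
      using H(1) by measurable
    have "(\<integral>\<^sup>+x. F y x \<partial>?P) = (\<integral>\<^sup>+x. ennreal (mx H (\<lambda>h. A h + 2 * Y h y + s x h)) / 2 + ennreal (mx H (\<lambda>h. A h + (-2) * Y h y + s x h)) / 2 \<partial>?P)"
      unfolding F_def by (simp add: half half' mx_nonneg[OF H])
    also have "\<dots> = (\<integral>\<^sup>+x. ennreal (mx H (\<lambda>h. A h + 2 * Y h y + s x h)) \<partial>?P) / 2 + (\<integral>\<^sup>+x. ennreal (mx H (\<lambda>h. A h + (-2) * Y h y + s x h)) \<partial>?P) / 2"
      by (simp add: nn_integral_add nn_integral_divide del: mult_minus_left)
    also have "\<dots> \<le> (\<integral>\<^sup>+x. ennreal (?r x 2) \<partial>?P) / 2 + (\<integral>\<^sup>+x. ennreal (?r x (-2)) \<partial>?P) / 2"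
      unfolding s_def by (intro add_mono divide_right_mono_ennreal Suc.IH)
    also have "\<dots> = (\<integral>\<^sup>+x. ennreal (?r x 2) / 2 + ennreal (?r x (-2)) / 2 \<partial>?P)"
      by (simp add: nn_integral_add nn_integral_divide del: mult_minus_left)
    also have "\<dots> = (\<integral>\<^sup>+x. ennreal (?r x 2 / 2 + ?r x (-2) / 2) \<partial>?P)"
      by (simp add: half half' rad_nonneg[OF H])
    also have "\<dots> = (\<integral>\<^sup>+x. ennreal (rad (mx H) (\<lambda>i h. Y h ((x(n := y)) i)) (Suc n) A) \<partial>?P)"
    proof -
      have "rad (mx H) (\<lambda>i h. Y h ((x(n := y)) i)) n B = rad (mx H) (\<lambda>i h. Y h (x i)) n B" for x B
        by (rule rad_cong) auto
      thus ?thesis by (simp add: add_divide_distrib)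
    qed
    finally show "(\<integral>\<^sup>+x. F y x \<partial>?P) \<le> (\<integral>\<^sup>+x. ennreal (rad (mx H) (\<lambda>i h. Y h ((x(n := y)) i)) (Suc n) A) \<partial>?P)" .
  qed
  also have "\<dots> = (\<integral>\<^sup>+x. ennreal (rad (mx H) (\<lambda>i h. Y h (x i)) (Suc n) A) \<partial>PiM (insert n {..<n}) (\<lambda>_. M))"
    by (subst PP.product_nn_integral_insert_rev) (auto simp del: rad.simps)
  finally show ?case by (simp add: ins)
qed simp

text \<open>Given the sample, \<open>rad_mx_bound\<close> applies with the envelope values as
  \<open>g\<close>. The arithmetic-geometric mean inequality linearizes the square root of the sum
  of squares, so that the second moment of \<open>\<Gamma>\<close> is all that enters the
  constant.\<close>

lemma (in prob_space) empirical_maximal_inequality: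
  assumes H: "finite H" "H \<noteq> {}" and Y: "\<And>h. h \<in> H \<Longrightarrow> integrable M (Y h)"
    and Y0: "\<And>h. h \<in> H \<Longrightarrow> expectation (Y h) = 0"
    and \<sigma>: "\<sigma> > 0" and n: "n \<ge> 1"
    and le: "\<And>h x. h \<in> H \<Longrightarrow> x \<in> space M \<Longrightarrow> \<bar>Y h x\<bar> \<le> \<sigma> * \<Gamma> x"
    and \<Gamma>: "\<And>x. x \<in> space M \<Longrightarrow> \<Gamma> x \<ge> 1" "\<Gamma> \<in> borel_measurable M" "integrable M (\<lambda>x. (\<Gamma> x)\<^sup>2)"
  shows "(\<integral>\<^sup>+x. ennreal (mx H (\<lambda>h. (\<Sum>i<n. Y h (x i)) / sqrt (real n))) \<partial>PiM {..<n} (\<lambda>_. M))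
     \<le> ennreal ((expectation (\<lambda>x. (\<Gamma> x)\<^sup>2) + 1) / 2 * (\<sigma> * (ln (real (card H)) + 16)))"
proof -
  interpret PP: product_prob_space "\<lambda>_::nat. M" "{..<n}" ..
  let ?P = "PiM {..<n} (\<lambda>_. M)"
  let ?c = "\<sigma> * (ln (real (card H)) + 16)"
  let ?G = "expectation (\<lambda>x. (\<Gamma> x)\<^sup>2)"
  note [measurable] = \<Gamma>(2)
  have [measurable]: "h \<in> H \<Longrightarrow> Y h \<in> borel_measurable M" for h using Y by auto
  have c: "?c \<ge> 0" using \<sigma> H by (simp add: Suc_le_eq card_gt_0_iff)
  have comp: "(\<integral>\<^sup>+x. ennreal ((\<Gamma> (x i))\<^sup>2) \<partial>?P) = ennreal ?G" if "i < n" for i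
  proof -
    have "(\<integral>\<^sup>+x. ennreal ((\<Gamma> (x i))\<^sup>2) \<partial>?P) = (\<integral>\<^sup>+z. ennreal ((\<Gamma> z)\<^sup>2) \<partial>distr ?P M (\<lambda>x. x i))"
      using that by (subst nn_integral_distr) auto
    also have "distr ?P M (\<lambda>x. x i) = M" using PP.PiM_component[of i] that by simp
    also have "(\<integral>\<^sup>+z. ennreal ((\<Gamma> z)\<^sup>2) \<partial>M) = ennreal ?G"
      using \<Gamma>(3) by (intro nn_integral_eq_integral) auto
    finally show ?thesis .
  qed
  have "(\<integral>\<^sup>+x. ennreal (mx H (\<lambda>h. (\<Sum>i<n. Y h (x i)) / sqrt (real n))) \<partial>?P) =
     (\<integral>\<^sup>+x. ennreal (1 / sqrt n) * ennreal (mx H (\<lambda>h. 0 + (\<Sum>i<n. Y h (x i)))) \<partial>?P)"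
    using mx_nonneg[OF H] by (simp add: mx_scale[OF H] flip: ennreal_mult)
  also have "\<dots> = ennreal (1 / sqrt n) * (\<integral>\<^sup>+x. ennreal (mx H (\<lambda>h. 0 + (\<Sum>i<n. Y h (x i)))) \<partial>?P)"
    by (rule nn_integral_cmult) (use H(1) in measurable)
  also have "\<dots> \<le> ennreal (1 / sqrt n) * (\<integral>\<^sup>+x. ennreal (rad (mx H) (\<lambda>i h. Y h (x i)) n (\<lambda>_. 0)) \<partial>?P)"
    by (rule mult_left_mono[OF symmetrization[OF H Y Y0]]) auto
  also have "\<dots> \<le> ennreal (1 / sqrt n) * (\<integral>\<^sup>+x. ennreal (?c * sqrt n / 2 + ?c / (2 * sqrt n) * (\<Sum>i<n. (\<Gamma> (x i))\<^sup>2)) \<partial>?P)"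
  proof (intro mult_left_mono nn_integral_mono ennreal_leI)
    fix x assume x: "x \<in> space ?P"
    hence xi: "x i \<in> space M" if "i < n" for i using that by (auto simp: space_PiM)
    let ?S = "\<Sum>i<n. (\<Gamma> (x i))\<^sup>2"
    have "rad (mx H) (\<lambda>i h. Y h (x i)) n (\<lambda>_. 0) \<le> ?c * sqrt ?S"
      by (rule rad_mx_bound[OF H \<sigma> n]) (use le \<Gamma>(1) xi in auto)
    also have "sqrt ?S \<le> sqrt n / 2 + ?S / (2 * sqrt n)"
    proof -
      have "0 \<le> (sqrt ?S - sqrt n)\<^sup>2" by simp
      also have "\<dots> = ?S - 2 * sqrt ?S * sqrt n + n" by (simp add: power2_diff sum_nonneg)
      finally show ?thesis using n by (simp add: field_simps power2_eq_square)
    qed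
    finally have "rad (mx H) (\<lambda>i h. Y h (x i)) n (\<lambda>_. 0) \<le> ?c * (sqrt n / 2 + ?S / (2 * sqrt n))"
      using c by (simp add: mult_left_mono)
    also have "\<dots> = ?c * sqrt n / 2 + ?c / (2 * sqrt n) * ?S" by (simp add: distrib_left)
    finally show "rad (mx H) (\<lambda>i h. Y h (x i)) n (\<lambda>_. 0) \<le> ?c * sqrt n / 2 + ?c / (2 * sqrt n) * ?S" .
  qed auto
  also have "\<dots> = ennreal (1 / sqrt n) * (\<integral>\<^sup>+x. ennreal (?c * sqrt n / 2) + ennreal (?c / (2 * sqrt n)) * (\<Sum>i<n. ennreal ((\<Gamma> (x i))\<^sup>2)) \<partial>?P)"
  proof -
    have "ennreal (a + b * (\<Sum>i<n. (\<Gamma> (x i))\<^sup>2)) = ennreal a + ennreal b * (\<Sum>i<n. ennreal ((\<Gamma> (x i))\<^sup>2))"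
      if "a \<ge> 0" "b \<ge> 0" for a b x
      using that by (simp add: ennreal_plus ennreal_mult sum_nonneg sum_ennreal)
    from this[of "?c * sqrt n / 2" "?c / (2 * sqrt n)"] c show ?thesis by simp
  qed
  also have "\<dots> = ennreal (1 / sqrt n) * (ennreal (?c * sqrt n / 2) + ennreal (?c / (2 * sqrt n)) * (\<Sum>i<n. ennreal ?G))"
    by (simp add: nn_integral_add nn_integral_cmult nn_integral_sum comp PP.emeasure_space_1 del: sum_ennreal)
  also have "\<dots> = ennreal (1 / sqrt n * (?c * sqrt n / 2 + ?c / (2 * sqrt n) * (real n * ?G)))"
  proof -
    have "ennreal r * (ennreal a + ennreal b * (\<Sum>i<n. ennreal g)) = ennreal (r * (a + b * (real n * g)))"
      if "r \<ge> 0" "a \<ge> 0" "b \<ge> 0" "g \<ge> 0" for r a b g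
      using that by (simp add: ennreal_plus ennreal_mult ennreal_of_nat_eq_real_of_nat)
    from this[of "1 / sqrt n" "?c * sqrt n / 2" "?c / (2 * sqrt n)" ?G] c show ?thesis by simp
  qed
  also have "1 / sqrt n * (?c * sqrt n / 2 + ?c / (2 * sqrt n) * (real n * ?G)) = (?G + 1) / 2 * ?c"
  proof -
    have "1 / r * (a * r / 2 + a / (2 * r) * (r * r * G)) = (G + 1) / 2 * a" if "r > 0" for a r G :: real
      using that by (simp add: field_simps)
    from this[of "sqrt n" ?c ?G] n show ?thesis by simp
  qed
  finally show ?thesis .
qed

section \<open>Empirical processes over Lipschitz classes\<close>

locale iid_sample = M: prob_space M + P: prob_space P for M :: "'b measure" and P :: "'x measure" +
  fixes Xs :: "nat \<Rightarrow> 'b \<Rightarrow> 'x"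
  assumes indep: "M.indep_vars (\<lambda>_. P) Xs {1..}"
    and Xs_distr: "\<And>i. i \<ge> 1 \<Longrightarrow> distr M P (Xs i) = P"
begin

lemma Xs_measurable: "i \<ge> 1 \<Longrightarrow> Xs i \<in> M \<rightarrow>\<^sub>M P"
  using indep unfolding M.indep_vars_def2 by auto

lemma Xs_space: "i \<ge> 1 \<Longrightarrow> \<omega> \<in> space M \<Longrightarrow> Xs i \<omega> \<in> space P"
  using Xs_measurable by (auto dest: measurable_space)

text \<open>Observations are numbered from 1, the products over \<open>{..<n}\<close> from 0;
  reindexing the infinite product along \<open>Suc\<close> provides the joint law of the shifted
  family.\<close>

lemma distr_reindex:
  assumes A: "A \<noteq> {}"
  shows "distr M (PiM A (\<lambda>_. P)) (\<lambda>\<omega>. \<lambda>i\<in>A. Xs (Suc i) \<omega>) = PiM A (\<lambda>_. P)"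
proof -
  let ?X = "\<lambda>\<omega>. \<lambda>i\<in>{1..}. Xs i \<omega>" and ?S = "\<lambda>\<omega>. \<lambda>i\<in>A. \<omega> (Suc i)"
  have X: "?X \<in> M \<rightarrow>\<^sub>M PiM {1..} (\<lambda>_. P)"
    by (rule measurable_restrict) (simp add: Xs_measurable)
  have S: "?S \<in> PiM {1..} (\<lambda>_. P) \<rightarrow>\<^sub>M PiM A (\<lambda>_. P)"
    by (rule measurable_restrict) (simp add: measurable_component_singleton)
  have "distr M (PiM {1..} (\<lambda>_. P)) ?X = PiM {1..} (\<lambda>i. distr M P (Xs i))"
    using indep Xs_measurable by (subst (asm) M.indep_vars_iff_distr_eq_PiM') auto
  also have "\<dots> = PiM {1..} (\<lambda>_. P)" by (rule PiM_cong) (auto simp: Xs_distr)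
  finally have "PiM A (\<lambda>_. P) = distr (distr M (PiM {1..} (\<lambda>_. P)) ?X) (PiM A (\<lambda>_. P)) ?S"
    using distr_PiM_reindex[of "{1..}" "\<lambda>_. P" Suc A] P.prob_space_axioms by simp
  also have "\<dots> = distr M (PiM A (\<lambda>_. P)) (?S \<circ> ?X)" by (rule distr_distr[OF S X])
  also have "?S \<circ> ?X = (\<lambda>\<omega>. \<lambda>i\<in>A. Xs (Suc i) \<omega>)" by (auto simp: fun_eq_iff)
  finally show ?thesis by (simp only:)
qed

lemma indep_Suc: "M.indep_vars (\<lambda>_. P) (\<lambda>i. Xs (Suc i)) A"
proof (cases "A = {}")
  case True
  thus ?thesis by (simp add: M.indep_vars_def2 M.indep_sets_def)
next
  case False
  thus ?thesis using Xs_measurable distr_reindex[OF False]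
    by (subst M.indep_vars_iff_distr_eq_PiM') (auto simp: Xs_distr)
qed

lemma distr_sample:
  assumes "n \<ge> 1"
  shows "distr M (PiM {..<n} (\<lambda>_. P)) (\<lambda>\<omega>. \<lambda>i\<in>{..<n}. Xs (Suc i) \<omega>) = PiM {..<n} (\<lambda>_. P)"
  by (rule distr_reindex) (use assms in \<open>auto simp: lessThan_empty_iff\<close>)

lemma sum_shift: "(\<Sum>i=1..n. f i) = (\<Sum>i<n. f (Suc i))" for f :: "nat \<Rightarrow> real"
  using sum.shift_bounds_cl_Suc_ivl[of f 0 "n - 1"]
  by (cases n) (auto simp: lessThan_Suc_atMost atLeast0AtMost)

lemma maximal_inequality:
  assumes H: "finite H" "H \<noteq> {}" and Y: "\<And>h. h \<in> H \<Longrightarrow> integrable P (Y h)"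
    and Y0: "\<And>h. h \<in> H \<Longrightarrow> P.expectation (Y h) = 0"
    and \<sigma>: "\<sigma> > 0" and n: "n \<ge> 1"
    and le: "\<And>h x. h \<in> H \<Longrightarrow> x \<in> space P \<Longrightarrow> \<bar>Y h x\<bar> \<le> \<sigma> * \<Gamma> x"
    and \<Gamma>: "\<And>x. x \<in> space P \<Longrightarrow> \<Gamma> x \<ge> 1" "\<Gamma> \<in> borel_measurable P" "integrable P (\<lambda>x. (\<Gamma> x)\<^sup>2)"
  shows "(\<integral>\<^sup>+\<omega>. ennreal (mx H (\<lambda>h. (\<Sum>i=1..n. Y h (Xs i \<omega>)) / sqrt (real n))) \<partial>M)
     \<le> ennreal ((P.expectation (\<lambda>x. (\<Gamma> x)\<^sup>2) + 1) / 2 * (\<sigma> * (ln (real (card H)) + 16)))"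
proof -
  let ?P = "PiM {..<n} (\<lambda>_. P)"
  have [measurable]: "h \<in> H \<Longrightarrow> Y h \<in> borel_measurable P" for h using Y by auto
  have [measurable]: "(\<lambda>\<omega>. \<lambda>i\<in>{..<n}. Xs (Suc i) \<omega>) \<in> M \<rightarrow>\<^sub>M ?P"
    by (rule measurable_restrict) (simp add: Xs_measurable)
  have [measurable]: "(\<lambda>x. mx H (\<lambda>h. (\<Sum>i<n. Y h (x i)) / sqrt (real n))) \<in> borel_measurable ?P"
    using H(1) by measurable
  have "(\<integral>\<^sup>+\<omega>. ennreal (mx H (\<lambda>h. (\<Sum>i=1..n. Y h (Xs i \<omega>)) / sqrt (real n))) \<partial>M) =
    (\<integral>\<^sup>+x. ennreal (mx H (\<lambda>h. (\<Sum>i<n. Y h (x i)) / sqrt (real n))) \<partial>distr M ?P (\<lambda>\<omega>. \<lambda>i\<in>{..<n}. Xs (Suc i) \<omega>))"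
    by (subst nn_integral_distr) (auto simp: sum_shift simp del: One_nat_def)
  also have "\<dots> \<le> ennreal ((P.expectation (\<lambda>x. (\<Gamma> x)\<^sup>2) + 1) / 2 * (\<sigma> * (ln (real (card H)) + 16)))"
    unfolding distr_sample[OF n] by (rule P.empirical_maximal_inequality[OF assms])
  finally show ?thesis .
qed

end

text \<open>Markov's inequality in the form used from here on: a measurable event of large
  probability on which the bound holds pointwise. Statements about uncountably many indices can then
  be deduced on the event without being measurable themselves.\<close>

lemma (in prob_space) markov_event:
  assumes u: "u \<in> borel_measurable M" "(\<integral>\<^sup>+\<omega>. u \<omega> \<partial>M) \<le> ennreal a" and a: "a \<le> \<epsilon> * \<eta>" and \<epsilon>: "\<epsilon> > 0" "\<eta> > 0"
  shows "\<exists>A\<in>events. prob A \<ge> 1 - \<eta> \<and> (\<forall>\<omega>\<in>A. u \<omega> \<le> ennreal \<epsilon>)"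
proof -
  note [measurable] = u(1)
  define D where "D = {\<omega> \<in> space M. 1 \<le> ennreal (1 / \<epsilon>) * u \<omega>}"
  have D[measurable]: "D \<in> events" unfolding D_def by measurable
  have "emeasure M D \<le> ennreal (1 / \<epsilon>) * (\<integral>\<^sup>+\<omega>. u \<omega> \<partial>M)"
    using nn_integral_Markov_inequality[of u "space M" M "ennreal (1 / \<epsilon>)"] unfolding D_def by simp
  also have "\<dots> \<le> ennreal (1 / \<epsilon>) * ennreal (\<epsilon> * \<eta>)"
    using u(2) a by (intro mult_left_mono) (auto intro: order_trans ennreal_leI)
  also have "\<dots> = ennreal \<eta>" using \<epsilon> by (simp flip: ennreal_mult)
  finally have "prob D \<le> \<eta>" using \<epsilon> by (simp add: emeasure_eq_measure)
  hence "prob (space M - D) \<ge> 1 - \<eta>" using prob_compl[OF D] by simp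
  moreover have "u \<omega> \<le> ennreal \<epsilon>" if "\<omega> \<in> space M - D" for \<omega>
  proof -
    have "ennreal (1 / \<epsilon>) * u \<omega> < 1" using that by (auto simp: D_def not_le)
    thus ?thesis using \<epsilon>
      by (cases "u \<omega>") (auto simp: ennreal_mult[symmetric] ennreal_less_one_iff divide_simps ennreal_mult_top
            intro!: ennreal_leI split: if_splits)
  qed
  ultimately show ?thesis using D by (intro bexI[of _ "space M - D"]) auto
qed

lemma (in prob_space) events_Int:
  assumes "A \<in> events" "B \<in> events" "prob A \<ge> 1 - a" "prob B \<ge> 1 - b"
  shows "A \<inter> B \<in> events \<and> prob (A \<inter> B) \<ge> 1 - (a + b)"
proof -
  have "prob (A \<union> B) + prob (A \<inter> B) = prob A + prob B"
    using assms by (simp add: measure_Un3 fmeasurable_eq_sets)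
  moreover have "prob (A \<union> B) \<le> 1" by simp
  ultimately have "prob (A \<inter> B) \<ge> 1 - (a + b)" using assms(3,4) by linarith
  thus ?thesis using assms by auto
qed

text \<open>The Lipschitz bound is demanded up to distance 3 only, the largest radius of a link, so
  the class may consist of several unrelated families placed further apart. The lower bound on
  \<open>\<Gamma>\<close> is what \<open>rad_mx_bound\<close> expects of an envelope.\<close>

locale lip_class = bounded_coords T B c K + P: prob_space P
  for T :: "'t set" and B :: "'b set" and c K and P :: "'x measure" +
  fixes \<phi> :: "'t \<Rightarrow> 'x \<Rightarrow> real" and \<Gamma> :: "'x \<Rightarrow> real"
  assumes \<phi>_meas: "\<And>t. t \<in> T \<Longrightarrow> \<phi> t \<in> borel_measurable P"
    and \<phi>_sq: "\<And>t. t \<in> T \<Longrightarrow> integrable P (\<lambda>x. (\<phi> t x)\<^sup>2)"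
    and \<phi>_mean: "\<And>t. t \<in> T \<Longrightarrow> P.expectation (\<phi> t) = 0"
    and \<phi>_lip: "\<And>s t x. s \<in> T \<Longrightarrow> t \<in> T \<Longrightarrow> dd s t \<le> 3 \<Longrightarrow> x \<in> space P \<Longrightarrow> \<bar>\<phi> s x - \<phi> t x\<bar> \<le> \<Gamma> x * dd s t"
    and \<Gamma>_ge: "\<And>x. x \<in> space P \<Longrightarrow> \<Gamma> x \<ge> 1"
    and \<Gamma>_meas: "\<Gamma> \<in> borel_measurable P"
    and \<Gamma>_sq: "integrable P (\<lambda>x. (\<Gamma> x)\<^sup>2)"
begin

lemma \<phi>_int: "t \<in> T \<Longrightarrow> integrable P (\<phi> t)"
  by (rule P.square_integrable_imp_integrable[OF \<phi>_meas \<phi>_sq])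

end

locale empirical_process = lip_class T B c K P \<phi> \<Gamma> + iid_sample M P Xs
  for T :: "'t set" and B :: "'b set" and c K and P :: "'x measure" and \<phi> \<Gamma>
    and M :: "'w measure" and Xs
begin

definition G :: "nat \<Rightarrow> 't \<Rightarrow> 'w \<Rightarrow> real" where
  "G n t \<omega> = (\<Sum>i=1..n. \<phi> t (Xs i \<omega>)) / sqrt (real n)"

lemma G_measurable: "t \<in> T \<Longrightarrow> G n t \<in> borel_measurable M"
proof -
  assume t: "t \<in> T"
  have "(\<lambda>\<omega>. \<phi> t (Xs i \<omega>)) \<in> borel_measurable M" if "i \<in> {1..n}" for i
    by (rule measurable_compose[OF Xs_measurable \<phi>_meas]) (use that t in auto)
  thus ?thesis unfolding G_def[abs_def] by (intro borel_measurable_divide borel_measurable_sum) auto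
qed

text \<open>The maximal inequality for the differences of \<open>\<phi> s\<close> and
  \<open>\<phi> t\<close>, which the Lipschitz bound dominates by
  \<open>\<sigma> * \<Gamma> x\<close>. This is premise \<open>H\<close> of
  \<open>tail_expectation\<close>, with a constant independent of \<open>n\<close>.\<close>

lemma G_increments:
  assumes n: "n \<ge> 1" and Q: "finite Q" "Q \<noteq> {}" "Q \<subseteq> T \<times> T" and \<sigma>: "0 < \<sigma>" "\<sigma> \<le> 3"
    and d: "\<And>s t. (s, t) \<in> Q \<Longrightarrow> dd s t \<le> \<sigma>"
  shows "(\<integral>\<^sup>+\<omega>. ennreal (Max ((\<lambda>(s, t). \<bar>G n s \<omega> - G n t \<omega>\<bar>) ` Q)) \<partial>M)
    \<le> ennreal ((P.expectation (\<lambda>x. (\<Gamma> x)\<^sup>2) + 1) / 2 * (\<sigma> * (ln (real (card Q)) + 16)))"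
proof -
  let ?Y = "\<lambda>(s, t) x. \<phi> s x - \<phi> t x"
  have "Max ((\<lambda>(s, t). \<bar>G n s \<omega> - G n t \<omega>\<bar>) ` Q) = mx Q (\<lambda>h. (\<Sum>i=1..n. ?Y h (Xs i \<omega>)) / sqrt (real n))" for \<omega>
  proof -
    have "G n s \<omega> - G n t \<omega> = (\<Sum>i=1..n. \<phi> s (Xs i \<omega>) - \<phi> t (Xs i \<omega>)) / sqrt (real n)" for s t
      by (simp add: G_def sum_subtractf diff_divide_distrib)
    thus ?thesis unfolding mx_def by (intro arg_cong[where f = Max] image_cong) auto
  qed
  moreover have "(\<integral>\<^sup>+\<omega>. ennreal (mx Q (\<lambda>h. (\<Sum>i=1..n. ?Y h (Xs i \<omega>)) / sqrt (real n))) \<partial>M)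
    \<le> ennreal ((P.expectation (\<lambda>x. (\<Gamma> x)\<^sup>2) + 1) / 2 * (\<sigma> * (ln (real (card Q)) + 16)))"
  proof (rule maximal_inequality[OF Q(1,2) _ _ \<sigma>(1) n])
    fix h x assume h: "h \<in> Q" "x \<in> space P"
    then obtain s t where st: "h = (s, t)" "s \<in> T" "t \<in> T" "dd s t \<le> \<sigma>" using Q d by (cases h) auto
    hence "\<bar>?Y h x\<bar> \<le> \<Gamma> x * dd s t" using \<phi>_lip[of s t x] h \<sigma> by auto
    also have "\<dots> \<le> \<Gamma> x * \<sigma>" using st \<Gamma>_ge[OF h(2)] by (intro mult_left_mono) auto
    finally show "\<bar>?Y h x\<bar> \<le> \<sigma> * \<Gamma> x" by (simp add: mult.commute)
  next
    fix h assume "h \<in> Q"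
    then obtain s t where st: "h = (s, t)" "s \<in> T" "t \<in> T" using Q by (cases h) auto
    show "integrable P (?Y h)" using st \<phi>_int by simp
    show "P.expectation (?Y h) = 0" using st \<phi>_int \<phi>_mean by simp
  qed (rule \<Gamma>_ge \<Gamma>_meas \<Gamma>_sq, assumption?)+
  ultimately show ?thesis by (simp only:)
qed

text \<open>For one path and one \<open>n\<close> the process is Lipschitz with a constant depending
  on both. This is no uniform estimate; it identifies the limit along the nets in
  \<open>chaining\<close> with the process itself.\<close>

lemma G_continuous: assumes "t \<in> T" "\<omega> \<in> space M" shows "(\<lambda>j. G n (rep j t) \<omega>) \<longlonglongrightarrow> G n t \<omega>"
proof -
  let ?L = "(\<Sum>i=1..n. \<Gamma> (Xs i \<omega>)) / sqrt (real n)"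
  have L: "?L \<ge> 0"
  proof (intro divide_nonneg_nonneg sum_nonneg)
    fix i assume "i \<in> {1..n}"
    hence "\<Gamma> (Xs i \<omega>) \<ge> 1" using Xs_space assms(2) by (intro \<Gamma>_ge) auto
    thus "\<Gamma> (Xs i \<omega>) \<ge> 0" by simp
  qed simp
  have le: "\<bar>G n (rep j t) \<omega> - G n t \<omega>\<bar> \<le> ?L * (1/2) ^ j" for j
  proof -
    have d: "dd (rep j t) t \<le> (1/2) ^ j" using dd_rep[OF assms(1)] by (simp add: dd_commute)
    also have "(1/2::real) ^ j \<le> 1" by (simp add: power_le_one)
    finally have d1: "dd (rep j t) t \<le> 3" by simp
    have "\<bar>G n (rep j t) \<omega> - G n t \<omega>\<bar> = \<bar>\<Sum>i=1..n. \<phi> (rep j t) (Xs i \<omega>) - \<phi> t (Xs i \<omega>)\<bar> / sqrt n"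
    proof -
      have "G n (rep j t) \<omega> - G n t \<omega> = (\<Sum>i=1..n. \<phi> (rep j t) (Xs i \<omega>) - \<phi> t (Xs i \<omega>)) / sqrt n"
        by (simp add: G_def sum_subtractf diff_divide_distrib)
      thus ?thesis by (simp only: abs_divide) simp
    qed
    also have "\<dots> \<le> (\<Sum>i=1..n. \<Gamma> (Xs i \<omega>) * (1/2) ^ j) / sqrt n"
    proof (intro divide_right_mono order_trans[OF sum_abs] sum_mono)
      fix i assume "i \<in> {1..n}"
      hence x: "Xs i \<omega> \<in> space P" using Xs_space assms(2) by auto
      have "\<bar>\<phi> (rep j t) (Xs i \<omega>) - \<phi> t (Xs i \<omega>)\<bar> \<le> \<Gamma> (Xs i \<omega>) * dd (rep j t) t"
        using \<phi>_lip[OF rep(1)[OF assms(1)] assms(1) d1 x] .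
      also have "\<dots> \<le> \<Gamma> (Xs i \<omega>) * (1/2) ^ j" using d \<Gamma>_ge[OF x] by (intro mult_left_mono) auto
      finally show "\<bar>\<phi> (rep j t) (Xs i \<omega>) - \<phi> t (Xs i \<omega>)\<bar> \<le> \<Gamma> (Xs i \<omega>) * (1/2) ^ j" .
    qed simp
    also have "\<dots> = ?L * (1/2) ^ j" unfolding sum_distrib_right[symmetric] times_divide_eq_left ..
    finally show ?thesis .
  qed
  have "(\<lambda>j. ?L * (1/2::real) ^ j) \<longlonglongrightarrow> ?L * 0"
    by (rule tendsto_mult[OF tendsto_const LIMSEQ_power_zero]) simp
  hence lim: "(\<lambda>j. ?L * (1/2::real) ^ j) \<longlonglongrightarrow> 0" unfolding mult_zero_right .
  have "(\<lambda>j. G n (rep j t) \<omega> - G n t \<omega>) \<longlonglongrightarrow> 0"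
    by (rule Lim_null_comparison[OF always_eventually lim]) (unfold real_norm_def, rule allI, rule le)
  thus ?thesis by (rule LIM_zero_cancel)
qed

text \<open>The level \<open>N\<close> is chosen from \<open>J\<close> and the second moment of
  \<open>\<Gamma>\<close>, hence serves all \<open>n\<close>. The event comes from Markov's
  inequality for \<open>tail\<close>, and the factor 3 of \<open>chaining\<close> explains the
  threshold \<open>\<epsilon> / 3\<close>.\<close>

theorem stochastic_equicontinuity:
  assumes \<epsilon>: "\<epsilon> > 0" and \<eta>: "\<eta> > 0"
  shows "\<exists>\<delta>>0. \<forall>n\<ge>1. \<exists>A\<in>sets M. measure M A \<ge> 1 - \<eta> \<and>
    (\<forall>\<omega>\<in>A. \<forall>s\<in>T. \<forall>t\<in>T. dd s t \<le> \<delta> \<longrightarrow> \<bar>G n s \<omega> - G n t \<omega>\<bar> \<le> \<epsilon>)"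
proof -
  let ?C = "(P.expectation (\<lambda>x. (\<Gamma> x)\<^sup>2) + 1) / 2"
  have C: "?C \<ge> 0" by simp
  have "0 < (\<epsilon> / 3) * \<eta>" using \<epsilon> \<eta> by simp
  from order_tendstoD(2)[OF tendsto_mult_right_zero[OF J_tendsto] this]
  have "\<forall>\<^sub>F N in sequentially. ?C * J N < (\<epsilon> / 3) * \<eta>" .
  then obtain N where N: "?C * J N \<le> (\<epsilon> / 3) * \<eta>"
    by (metis eventually_sequentially less_imp_le order_refl)
  show ?thesis
  proof (intro exI[of _ "(1/2) ^ N"] conjI allI impI)
    fix n :: nat assume n: "n \<ge> 1"
    have int: "(\<integral>\<^sup>+\<omega>. tail (\<lambda>t. G n t \<omega>) N \<partial>M) \<le> ennreal (?C * J N)"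
      using skeleton_sub by (intro tail_expectation C G_measurable G_increments[OF n]) auto
    have ms: "(\<lambda>\<omega>. tail (\<lambda>t. G n t \<omega>) N) \<in> borel_measurable M"
      using skeleton_sub by (intro tail_measurable G_measurable) auto
    obtain A where A: "A \<in> sets M" "measure M A \<ge> 1 - \<eta>" "\<And>\<omega>. \<omega> \<in> A \<Longrightarrow> tail (\<lambda>t. G n t \<omega>) N \<le> ennreal (\<epsilon> / 3)"
      using M.markov_event[OF ms int N _ \<eta>] \<epsilon> by auto
    show "\<exists>A\<in>sets M. measure M A \<ge> 1 - \<eta> \<and>
      (\<forall>\<omega>\<in>A. \<forall>s\<in>T. \<forall>t\<in>T. dd s t \<le> (1/2) ^ N \<longrightarrow> \<bar>G n s \<omega> - G n t \<omega>\<bar> \<le> \<epsilon>)"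
    proof (intro bexI[of _ A] conjI ballI impI A)
      fix \<omega> s t assume st: "\<omega> \<in> A" "s \<in> T" "t \<in> T" "dd s t \<le> (1/2) ^ N"
      have \<omega>: "\<omega> \<in> space M" using A(1) st(1) sets.sets_into_space by auto
      have "ennreal \<bar>G n s \<omega> - G n t \<omega>\<bar> \<le> 3 * tail (\<lambda>t. G n t \<omega>) N"
        using G_continuous[OF _ \<omega>] st by (intro chaining[where w = "\<lambda>t. G n t \<omega>"]) auto
      also have "\<dots> \<le> 3 * ennreal (\<epsilon> / 3)" using A(3)[OF st(1)] by (intro mult_left_mono) auto
      also have "\<dots> = ennreal \<epsilon>" using \<epsilon> by (simp flip: ennreal_mult ennreal_numeral)
      finally show "\<bar>G n s \<omega> - G n t \<omega>\<bar> \<le> \<epsilon>" using \<epsilon> by (simp add: ennreal_le_iff)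
    qed
  qed simp
qed

text \<open>Equicontinuity with tolerance 1 reduces the whole index set to a finite net, on which
  the maximal inequality applies to the functions themselves instead of their increments.\<close>

theorem stochastic_boundedness:
  assumes \<eta>: "\<eta> > 0"
  shows "\<exists>C. \<forall>n\<ge>1. \<exists>A\<in>sets M. measure M A \<ge> 1 - \<eta> \<and> (\<forall>\<omega>\<in>A. \<forall>t\<in>T. \<bar>G n t \<omega>\<bar> \<le> C)"
proof -
  obtain \<delta> where \<delta>: "\<delta> > 0" "\<And>n. n \<ge> 1 \<Longrightarrow> \<exists>A\<in>sets M. measure M A \<ge> 1 - \<eta> / 2 \<and>
    (\<forall>\<omega>\<in>A. \<forall>s\<in>T. \<forall>t\<in>T. dd s t \<le> \<delta> \<longrightarrow> \<bar>G n s \<omega> - G n t \<omega>\<bar> \<le> 1)"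
    using stochastic_equicontinuity[of 1 "\<eta> / 2"] \<eta> by auto
  obtain N where N: "(1/2::real) ^ N < \<delta>" using real_arch_pow_inv[OF \<delta>(1), of "1/2"] by auto
  define R where "R = rep N ` T"
  have R: "finite R" "R \<noteq> {}" "R \<subseteq> T" using card_rep Tne rep(1) by (auto simp: R_def)
  \<comment> \<open>An envelope of the finitely many net functions; 1 is added to meet the lower
    bound required of an envelope.\<close>
  define g where "g x = (\<Sum>t\<in>R. \<bar>\<phi> t x\<bar>) + 1" for x
  have g_ge: "g x \<ge> 1" for x by (simp add: g_def sum_nonneg)
  have g_meas: "g \<in> borel_measurable P"
  proof -
    have [measurable]: "t \<in> R \<Longrightarrow> \<phi> t \<in> borel_measurable P" for t using R \<phi>_meas by auto
    show ?thesis unfolding g_def[abs_def] by measurable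
  qed
  have g_sq: "integrable P (\<lambda>x. (g x)\<^sup>2)"
  proof (rule Bochner_Integration.integrable_bound)
    show "integrable P (\<lambda>x. 2 * (real (card R) * (\<Sum>t\<in>R. (\<phi> t x)\<^sup>2)) + 2)"
      using R by (intro Bochner_Integration.integrable_add integrable_mult_right Bochner_Integration.integrable_sum \<phi>_sq) auto
    show "(\<lambda>x. (g x)\<^sup>2) \<in> borel_measurable P" using g_meas by simp
    have "(g x)\<^sup>2 \<le> 2 * (real (card R) * (\<Sum>t\<in>R. (\<phi> t x)\<^sup>2)) + 2" for x
    proof -
      have "(\<Sum>t\<in>R. \<bar>\<phi> t x\<bar>)\<^sup>2 \<le> real (card R) * (\<Sum>t\<in>R. (\<phi> t x)\<^sup>2)"
        using sum_squared_le_sum_of_squares[of "\<lambda>t. \<bar>\<phi> t x\<bar>" R] R by (simp add: mult.commute)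
      moreover have "(a + 1)\<^sup>2 \<le> 2 * a\<^sup>2 + 2" for a :: real
        using zero_le_power2[of "a - 1"] by (simp add: power2_diff power2_sum)
      ultimately show ?thesis unfolding g_def by (smt (verit))
    qed
    thus "AE x in P. norm ((g x)\<^sup>2) \<le> norm (2 * (real (card R) * (\<Sum>t\<in>R. (\<phi> t x)\<^sup>2)) + 2)"
      by (intro AE_I2) (simp add: sum_nonneg)
  qed
  define a where "a = (P.expectation (\<lambda>x. (g x)\<^sup>2) + 1) / 2 * (1 * (ln (real (card R)) + 16))"
  \<comment> \<open>A threshold for Markov's inequality: \<open>a\<close> bounds the expected
    maximum and \<open>\<eta> / 2\<close> is the admissible failure probability; adding 1 makes it
    positive.\<close>
  define C where "C = \<bar>a\<bar> / (\<eta> / 2) + 1"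
  have "C * (\<eta> / 2) = \<bar>a\<bar> + \<eta> / 2" using \<eta> by (simp add: C_def field_simps)
  hence C: "a \<le> C * (\<eta> / 2)" using \<eta> by linarith
  have Cpos: "C > 0" unfolding C_def using \<eta> by (intro add_nonneg_pos) auto
  show ?thesis
  proof (intro exI[of _ "C + 1"] allI impI)
    fix n :: nat assume n: "n \<ge> 1"
    obtain A where A: "A \<in> sets M" "measure M A \<ge> 1 - \<eta> / 2"
      "\<And>\<omega> s t. \<omega> \<in> A \<Longrightarrow> s \<in> T \<Longrightarrow> t \<in> T \<Longrightarrow> dd s t \<le> \<delta> \<Longrightarrow> \<bar>G n s \<omega> - G n t \<omega>\<bar> \<le> 1"
      using \<delta>(2)[OF n] by blast
    have "(\<integral>\<^sup>+\<omega>. ennreal (mx R (\<lambda>t. G n t \<omega>)) \<partial>M) \<le> ennreal a"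
      unfolding G_def a_def
    proof (rule maximal_inequality[OF R(1,2) _ _ _ n])
      fix t x assume "t \<in> R"
      thus "\<bar>\<phi> t x\<bar> \<le> 1 * g x" using member_le_sum[of t R "\<lambda>t. \<bar>\<phi> t x\<bar>"] R by (simp add: g_def)
    qed (use R \<phi>_int \<phi>_mean g_ge g_meas g_sq in auto)
    moreover have "(\<lambda>\<omega>. ennreal (mx R (\<lambda>t. G n t \<omega>))) \<in> borel_measurable M"
    proof -
      have [measurable]: "t \<in> R \<Longrightarrow> G n t \<in> borel_measurable M" for t using R G_measurable by auto
      show ?thesis using R(1) by measurable
    qed
    ultimately obtain A' where A': "A' \<in> sets M" "measure M A' \<ge> 1 - \<eta> / 2"
      "\<And>\<omega>. \<omega> \<in> A' \<Longrightarrow> ennreal (mx R (\<lambda>t. G n t \<omega>)) \<le> ennreal C"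
      using M.markov_event[of "\<lambda>\<omega>. ennreal (mx R (\<lambda>t. G n t \<omega>))" a C "\<eta> / 2"] C Cpos \<eta> by auto
    show "\<exists>A\<in>sets M. measure M A \<ge> 1 - \<eta> \<and> (\<forall>\<omega>\<in>A. \<forall>t\<in>T. \<bar>G n t \<omega>\<bar> \<le> C + 1)"
    proof (intro bexI[of _ "A \<inter> A'"] conjI ballI)
      show "A \<inter> A' \<in> sets M" "measure M (A \<inter> A') \<ge> 1 - \<eta>"
        using M.events_Int[OF A(1) A'(1) A(2) A'(2)] by auto
      fix \<omega> t assume \<omega>: "\<omega> \<in> A \<inter> A'" and t: "t \<in> T"
      have "\<bar>G n (rep N t) \<omega>\<bar> \<le> mx R (\<lambda>t. G n t \<omega>)" using t R by (intro mx_ge) (auto simp: R_def)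
      also have "\<dots> \<le> C" using A'(3)[of \<omega>] \<omega> Cpos by (simp add: ennreal_le_iff)
      finally have "\<bar>G n (rep N t) \<omega>\<bar> \<le> C" .
      moreover have "\<bar>G n t \<omega> - G n (rep N t) \<omega>\<bar> \<le> 1"
        using \<omega> t rep(1)[OF t] dd_rep[OF t, of N] N by (intro A(3)) auto
      ultimately show "\<bar>G n t \<omega>\<bar> \<le> C + 1" by linarith
    qed
  qed
qed

end

section \<open>Gaussian variables and characteristic functions\<close>

text \<open>The centred normal law of variance \<open>v\<close>, including the point mass for
  \<open>v = 0\<close>, expressed by its characteristic function. This form passes to limits and to
  sums of independent variables without a case distinction on the variance.\<close>

definition gauss_char :: "'w measure \<Rightarrow> ('w \<Rightarrow> real) \<Rightarrow> real \<Rightarrow> bool" where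
  "gauss_char N Y v \<longleftrightarrow> Y \<in> borel_measurable N \<and>
     (\<forall>t. char (distr N borel Y) t = complex_of_real (exp (- (v * t\<^sup>2 / 2))))"

lemma char_distr: "Y \<in> borel_measurable N \<Longrightarrow> char (distr N borel Y) t = (CLINT \<omega>|N. iexp (t * Y \<omega>))"
  unfolding char_def by (subst integral_distr) auto

lemma char_scale:
  assumes "Y \<in> borel_measurable N"
  shows "char (distr N borel (\<lambda>\<omega>. Y \<omega> * a)) t = char (distr N borel Y) (a * t)"
proof -
  have "(\<lambda>\<omega>. Y \<omega> * a) \<in> borel_measurable N" using assms by simp
  thus ?thesis using assms by (simp add: char_distr mult_ac)
qed

context prob_space
begin

lemma std_normal_distr:
  "distributed M lborel Z std_normal_density \<longleftrightarrow>
    Z \<in> borel_measurable M \<and> distr M borel Z = std_normal_distribution"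
  by (auto simp: distributed_def cong: distr_cong)

lemma gauss_char_std: "distributed M lborel Z std_normal_density \<longleftrightarrow> gauss_char M Z 1"
proof
  assume "distributed M lborel Z std_normal_density"
  thus "gauss_char M Z 1"
    by (simp add: std_normal_distr gauss_char_def char_std_normal_distribution)
next
  assume *: "gauss_char M Z 1"
  hence Z: "Z \<in> borel_measurable M" by (simp add: gauss_char_def)
  have "distr M borel Z = std_normal_distribution"
  proof (rule Levy_uniqueness)
    show "real_distribution (distr M borel Z)" using Z by simp
    show "char (distr M borel Z) = char std_normal_distribution"
      using * by (simp add: gauss_char_def fun_eq_iff char_std_normal_distribution)
  qed (rule real_dist_normal_dist)
  thus "distributed M lborel Z std_normal_density" using Z by (simp add: std_normal_distr)
qed

lemma gauss_char_scale:
  assumes "gauss_char M Y v" shows "gauss_char M (\<lambda>\<omega>. Y \<omega> * a) (v * a\<^sup>2)"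
proof -
  have Y: "Y \<in> borel_measurable M" using assms by (simp add: gauss_char_def)
  have "char (distr M borel (\<lambda>\<omega>. Y \<omega> * a)) t = complex_of_real (exp (- (v * a\<^sup>2 * t\<^sup>2 / 2)))" for t
  proof -
    have "v * (a * t)\<^sup>2 = v * a\<^sup>2 * t\<^sup>2" by (simp add: power_mult_distrib)
    thus ?thesis using assms char_scale[OF Y, of a t] by (simp add: gauss_char_def)
  qed
  thus ?thesis using Y by (simp add: gauss_char_def)
qed

lemma gauss_char_normal:
  assumes "s > 0"
  shows "distributed M lborel Y (normal_density 0 s) \<longleftrightarrow> gauss_char M Y (s\<^sup>2)"
proof -
  have "distributed M lborel Y (normal_density 0 s) \<longleftrightarrow> gauss_char M (\<lambda>\<omega>. Y \<omega> * (1 / s)) 1"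
    using normal_standard_normal_convert[OF assms, of Y 0] by (simp add: gauss_char_std)
  also have "\<dots> \<longleftrightarrow> gauss_char M Y (s\<^sup>2)"
    using gauss_char_scale[of Y "s\<^sup>2" "1 / s"] gauss_char_scale[of "\<lambda>\<omega>. Y \<omega> * (1 / s)" 1 s] assms
    by (auto simp: power_divide)
  finally show ?thesis .
qed

lemma gauss_char_0: "gauss_char M Y 0 \<longleftrightarrow> Y \<in> borel_measurable M \<and> (AE \<omega> in M. Y \<omega> = 0)"
proof
  assume *: "gauss_char M Y 0"
  hence Y: "Y \<in> borel_measurable M" by (simp add: gauss_char_def)
  interpret R: prob_space "return borel (0::real)" by (rule prob_space_return) simp
  have "distr M borel Y = return borel 0"
  proof (rule Levy_uniqueness)
    show "real_distribution (distr M borel Y)" using Y by simp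
    show "real_distribution (return borel (0::real))" by unfold_locales auto
    show "char (distr M borel Y) = char (return borel 0)"
      using * by (simp add: gauss_char_def fun_eq_iff char_def integral_return)
  qed
  moreover have "AE y in return borel (0::real). y = 0" by (simp add: AE_return)
  ultimately have "AE y in distr M borel Y. y = 0" by (simp only:)
  thus "Y \<in> borel_measurable M \<and> (AE \<omega> in M. Y \<omega> = 0)" using Y by (simp add: AE_distr_iff)
next
  assume *: "Y \<in> borel_measurable M \<and> (AE \<omega> in M. Y \<omega> = 0)"
  have "char (distr M borel Y) t = 1" for t
  proof -
    have "(CLINT \<omega>|M. iexp (t * Y \<omega>)) = (CLINT \<omega>|M. 1)"
      using * by (intro integral_cong_AE) auto
    thus ?thesis using * by (simp add: char_distr prob_space)
  qed
  thus "gauss_char M Y 0" using * by (simp add: gauss_char_def)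
qed

lemma gauss_char_imp:
  assumes Y: "gauss_char M Y v" and v: "v \<ge> 0"
  shows "normal_rv M Y" "integrable M (\<lambda>\<omega>. (Y \<omega>)\<^sup>2)" "expectation Y = 0" "expectation (\<lambda>\<omega>. (Y \<omega>)\<^sup>2) = v"
proof -
  have m: "Y \<in> borel_measurable M" using Y by (simp add: gauss_char_def)
  have "normal_rv M Y \<and> integrable M (\<lambda>\<omega>. (Y \<omega>)\<^sup>2) \<and> expectation Y = 0 \<and> expectation (\<lambda>\<omega>. (Y \<omega>)\<^sup>2) = v"
  proof (cases "v = 0")
    case True
    hence AE: "AE \<omega> in M. Y \<omega> = 0" using Y by (simp add: gauss_char_0)
    have "expectation Y = expectation (\<lambda>_. 0)"
      by (rule integral_cong_AE) (use m AE in auto)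
    moreover have "expectation (\<lambda>\<omega>. (Y \<omega>)\<^sup>2) = expectation (\<lambda>_. 0)"
      by (rule integral_cong_AE) (use m AE in auto)
    moreover have "integrable M (\<lambda>\<omega>. (Y \<omega>)\<^sup>2) \<longleftrightarrow> integrable M (\<lambda>_. 0::real)"
      using m AE by (intro integrable_cong_AE) auto
    ultimately show ?thesis using m AE True by (auto simp: normal_rv_def)
  next
    case False
    define s where "s = sqrt v"
    have s: "s > 0" "v = s\<^sup>2" using v False by (auto simp: s_def)
    hence D: "distributed M lborel Y (normal_density 0 s)" using Y by (simp add: gauss_char_normal)
    have E: "expectation Y = 0" using normal_distributed_expectation[OF s(1) D] .
    moreover have "expectation (\<lambda>\<omega>. (Y \<omega>)\<^sup>2) = v"
      using normal_distributed_variance[OF s(1) D] E s by simp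
    \<comment> \<open>A non-integrable function has integral 0 by convention, so a nonzero second
      moment already implies integrability.\<close>
    moreover have "integrable M (\<lambda>\<omega>. (Y \<omega>)\<^sup>2)"
      using calculation(2) False not_integrable_integral_eq by force
    ultimately show ?thesis using m D s by (auto simp: normal_rv_def)
  qed
  thus "normal_rv M Y" "integrable M (\<lambda>\<omega>. (Y \<omega>)\<^sup>2)" "expectation Y = 0" "expectation (\<lambda>\<omega>. (Y \<omega>)\<^sup>2) = v" by auto
qed

text \<open>A vanishing expectation forces the centre \<open>c\<close> to be 0 in both cases of
  \<open>normal_rv\<close>; the variance is then the second moment.\<close>

lemma normal_rv_imp_gauss_char:
  assumes Y: "normal_rv M Y" and E: "expectation Y = 0"
  shows "gauss_char M Y (expectation (\<lambda>\<omega>. (Y \<omega>)\<^sup>2))" "integrable M (\<lambda>\<omega>. (Y \<omega>)\<^sup>2)"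
proof -
  have "\<exists>v\<ge>0. gauss_char M Y v"
  proof -
    have m: "Y \<in> borel_measurable M" using Y by (simp add: normal_rv_def)
    from Y consider c s where "0 < s" "distributed M lborel Y (normal_density c s)" | c where "AE \<omega> in M. Y \<omega> = c"
      unfolding normal_rv_def by blast
    thus ?thesis
    proof cases
      case 1
      hence "c = 0" using normal_distributed_expectation E by metis
      thus ?thesis using 1 gauss_char_normal by (intro exI[of _ "s\<^sup>2"]) auto
    next
      case 2
      hence "expectation Y = expectation (\<lambda>_. c)" using m by (intro integral_cong_AE) auto
      hence "c = 0" using E by (simp add: prob_space)
      thus ?thesis using 2 m by (intro exI[of _ 0]) (simp add: gauss_char_0)
    qed
  qed
  thus "gauss_char M Y (expectation (\<lambda>\<omega>. (Y \<omega>)\<^sup>2))" "integrable M (\<lambda>\<omega>. (Y \<omega>)\<^sup>2)"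
    using gauss_char_imp by auto
qed

section \<open>Slutsky's theorem and the central limit theorem for characteristic functions\<close>

lemma iexp_diff_le: "cmod (iexp a - iexp b) \<le> \<bar>a - b\<bar>"
proof -
  have "iexp a - iexp b = iexp b * (iexp (a - b) - 1)"
    by (simp add: algebra_simps flip: exp_add)
  hence "cmod (iexp a - iexp b) = cmod (iexp (a - b) - 1)" by (simp add: norm_mult)
  also have "\<dots> \<le> \<bar>a - b\<bar>" using iexp_approx1[of "a - b" 0] by simp
  finally show ?thesis .
qed

text \<open>On the good event the two exponentials differ by at most
  \<open>\<bar>t\<bar> * \<epsilon>\<close>, off it by at most 2. Nearness in probability is phrased
  through events, the form in which the estimates for the empirical process are available.\<close>

lemma slutsky_char:
  assumes X: "\<And>n. X n \<in> borel_measurable M" and Y: "\<And>n. Y n \<in> borel_measurable M"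
    and lim: "(\<lambda>n. char (distr M borel (X n)) t) \<longlonglongrightarrow> c"
    and close: "\<And>\<epsilon> \<eta>. \<epsilon> > 0 \<Longrightarrow> \<eta> > 0 \<Longrightarrow> \<forall>\<^sub>F n in sequentially. \<exists>A\<in>events. prob A \<ge> 1 - \<eta> \<and> (\<forall>\<omega>\<in>A. \<bar>Y n \<omega> - X n \<omega>\<bar> \<le> \<epsilon>)"
  shows "(\<lambda>n. char (distr M borel (Y n)) t) \<longlonglongrightarrow> c"
proof -
  have "(\<lambda>n. char (distr M borel (Y n)) t - char (distr M borel (X n)) t) \<longlonglongrightarrow> 0"
  proof (rule tendstoI)
    fix e :: real assume e: "e > 0"
    define \<epsilon> where "\<epsilon> = e / (2 * (\<bar>t\<bar> + 1))"
    have \<epsilon>: "\<epsilon> > 0" "\<bar>t\<bar> * \<epsilon> \<le> e / 2" using e by (auto simp: \<epsilon>_def field_simps)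
    from close[OF \<epsilon>(1), of "e / 8"] e
    have "\<forall>\<^sub>F n in sequentially. \<exists>A\<in>events. prob A \<ge> 1 - e / 8 \<and> (\<forall>\<omega>\<in>A. \<bar>Y n \<omega> - X n \<omega>\<bar> \<le> \<epsilon>)" by simp
    thus "\<forall>\<^sub>F n in sequentially. dist (char (distr M borel (Y n)) t - char (distr M borel (X n)) t) 0 < e"
    proof eventually_elim
      case (elim n)
      then obtain A where A: "A \<in> events" "prob A \<ge> 1 - e / 8" "\<And>\<omega>. \<omega> \<in> A \<Longrightarrow> \<bar>Y n \<omega> - X n \<omega>\<bar> \<le> \<epsilon>" by blast
      note [measurable] = A(1) X Y
      have int: "integrable M (\<lambda>\<omega>. iexp (t * Z \<omega>))" if "Z \<in> borel_measurable M" for Z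
        using that by (intro integrable_iexp) auto
      have "cmod (char (distr M borel (Y n)) t - char (distr M borel (X n)) t) =
          cmod (CLINT \<omega>|M. iexp (t * Y n \<omega>) - iexp (t * X n \<omega>))"
        unfolding char_distr[OF X] char_distr[OF Y] by (subst Bochner_Integration.integral_diff[OF int[OF Y] int[OF X]]) (rule refl)
      also have "\<dots> \<le> (LINT \<omega>|M. cmod (iexp (t * Y n \<omega>) - iexp (t * X n \<omega>)))"
        by (rule integral_norm_bound)
      also have "\<dots> \<le> (LINT \<omega>|M. \<bar>t\<bar> * \<epsilon> + 2 * indicator (space M - A) \<omega>)"
      proof (rule integral_mono)
        fix \<omega> assume \<omega>: "\<omega> \<in> space M"
        show "cmod (iexp (t * Y n \<omega>) - iexp (t * X n \<omega>)) \<le> \<bar>t\<bar> * \<epsilon> + 2 * indicator (space M - A) \<omega>"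
        proof (cases "\<omega> \<in> A")
          case True
          have "cmod (iexp (t * Y n \<omega>) - iexp (t * X n \<omega>)) \<le> \<bar>t * Y n \<omega> - t * X n \<omega>\<bar>" by (rule iexp_diff_le)
          also have "\<dots> = \<bar>t\<bar> * \<bar>Y n \<omega> - X n \<omega>\<bar>" by (simp flip: right_diff_distrib add: abs_mult)
          also have "\<dots> \<le> \<bar>t\<bar> * \<epsilon>" using A(3)[OF True] by (intro mult_left_mono) auto
          finally show ?thesis using True by simp
        next
          case False
          have "cmod (iexp (t * Y n \<omega>) - iexp (t * X n \<omega>)) \<le> cmod (iexp (t * Y n \<omega>)) + cmod (iexp (t * X n \<omega>))"
            by (rule norm_triangle_ineq4)
          thus ?thesis using False \<omega> \<epsilon>(1) by (simp add: add_increasing)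
        qed
      next
        show "integrable M (\<lambda>\<omega>. cmod (iexp (t * Y n \<omega>) - iexp (t * X n \<omega>)))"
          by (intro Bochner_Integration.integrable_norm Bochner_Integration.integrable_diff int X Y)
        show "integrable M (\<lambda>\<omega>. \<bar>t\<bar> * \<epsilon> + 2 * indicator (space M - A) \<omega>)"
          by (intro Bochner_Integration.integrable_add integrable_mult_right integrable_const
              integrable_real_indicator) (auto simp: emeasure_eq_measure)
      qed
      also have "\<dots> = \<bar>t\<bar> * \<epsilon> + 2 * prob (space M - A)"
        by (subst Bochner_Integration.integral_add)
          (auto simp: prob_space emeasure_eq_measure intro!: integrable_mult_right integrable_real_indicator)
      also have "\<dots> \<le> e / 2 + 2 * (e / 8)" using \<epsilon>(2) A(2) prob_compl[OF A(1)] by simp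
      finally show ?case using e by simp
    qed
  qed
  from tendsto_add[OF this lim] show ?thesis by simp
qed

end

text \<open>The normalized theorem divides by the standard deviation \<open>\<sigma>\<close>. If
  \<open>\<sigma> = 0\<close> the sums vanish almost everywhere; otherwise the characteristic
  function at \<open>t\<close> is that of the normalized sum at \<open>\<sigma> * t\<close>.\<close>

lemma (in iid_sample) clt:
  assumes h: "h \<in> borel_measurable P" "integrable P (\<lambda>x. (h x)\<^sup>2)" "P.expectation h = 0"
  shows "(\<lambda>n. char (distr M borel (\<lambda>\<omega>. (\<Sum>i=1..n. h (Xs i \<omega>)) / sqrt (real n))) t)
    \<longlonglongrightarrow> complex_of_real (exp (- (P.expectation (\<lambda>x. (h x)\<^sup>2) * t\<^sup>2 / 2)))"
proof -
  note [measurable] = h(1)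
  have X[measurable]: "(\<lambda>\<omega>. h (Xs (Suc i) \<omega>)) \<in> borel_measurable M" for i
    by (rule measurable_compose[OF Xs_measurable]) auto
  have dist: "distr M borel (\<lambda>\<omega>. h (Xs (Suc i) \<omega>)) = distr P borel h" for i
    using distr_distr[OF h(1) Xs_measurable[of "Suc i"]] Xs_distr[of "Suc i"] by (simp add: comp_def)
  have tr: "integral\<^sup>L M (\<lambda>\<omega>. k (h (Xs (Suc i) \<omega>))) = P.expectation (\<lambda>x. k (h x))"
    and tri: "integrable M (\<lambda>\<omega>. k (h (Xs (Suc i) \<omega>))) \<longleftrightarrow> integrable P (\<lambda>x. k (h x))"
    if [measurable]: "k \<in> borel_measurable borel" for k :: "real \<Rightarrow> real" and i
    using integral_distr[of "\<lambda>\<omega>. h (Xs (Suc i) \<omega>)" M borel k] integral_distr[of h P borel k]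
      integrable_distr_eq[of "\<lambda>\<omega>. h (Xs (Suc i) \<omega>)" M borel k] integrable_distr_eq[of h P borel k]
    by (simp_all add: dist)
  define \<sigma> where "\<sigma> = sqrt (P.expectation (\<lambda>x. (h x)\<^sup>2))"
  have \<sigma>2: "\<sigma>\<^sup>2 = P.expectation (\<lambda>x. (h x)\<^sup>2)" by (simp add: \<sigma>_def)
  have S: "(\<Sum>i=1..n. h (Xs i \<omega>)) = (\<Sum>i<n. h (Xs (Suc i) \<omega>))" for n \<omega> by (rule sum_shift)
  have Sm[measurable]: "(\<lambda>\<omega>. (\<Sum>i=1..n. h (Xs i \<omega>)) / sqrt (real n)) \<in> borel_measurable M" for n
    unfolding S by measurable
  show ?thesis
  proof (cases "\<sigma> = 0")
    case True
    have "AE \<omega> in M. h (Xs (Suc i) \<omega>) = 0" for i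
    proof -
      have "AE x in P. (h x)\<^sup>2 = 0"
        using True \<sigma>2 h(2) by (subst integral_nonneg_eq_0_iff_AE[symmetric]) auto
      hence "AE x in distr M P (Xs (Suc i)). h x = 0"
        by (subst Xs_distr) auto
      thus ?thesis by (rule AE_distrD[OF Xs_measurable, rotated]) simp
    qed
    hence "AE \<omega> in M. \<forall>i. h (Xs (Suc i) \<omega>) = 0" by (simp add: AE_all_countable)
    hence "AE \<omega> in M. (\<Sum>i=1..n. h (Xs i \<omega>)) / sqrt (real n) = 0" for n
      unfolding S by eventually_elim simp
    hence "gauss_char M (\<lambda>\<omega>. (\<Sum>i=1..n. h (Xs i \<omega>)) / sqrt (real n)) 0" for n
      using Sm by (simp add: M.gauss_char_0 del: One_nat_def)
    thus ?thesis using True \<sigma>2 by (simp add: gauss_char_def del: One_nat_def)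
  next
    case False
    hence \<sigma>: "\<sigma> > 0" by (simp add: \<sigma>_def less_le)
    have "weak_conv_m (\<lambda>n. distr M borel (\<lambda>\<omega>. (\<Sum>i<n. h (Xs (Suc i) \<omega>)) / sqrt (real n * \<sigma>\<^sup>2))) std_normal_distribution"
    proof (rule M.central_limit_theorem_zero_mean[OF _ _ \<sigma>])
      show "M.indep_vars (\<lambda>_. borel) (\<lambda>i \<omega>. h (Xs (Suc i) \<omega>)) UNIV"
        using M.indep_vars_compose2[OF indep_Suc, of UNIV "\<lambda>_. h" "\<lambda>_. borel"] by simp
      show 0: "M.expectation (\<lambda>\<omega>. h (Xs (Suc n) \<omega>)) = 0" for n using tr[of "\<lambda>x. x" n] h(3) by simp
      show "integrable M (\<lambda>\<omega>. (h (Xs (Suc n) \<omega>))\<^sup>2)" for n using tri[of "\<lambda>x. x\<^sup>2" n] h(2) by simp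
      show "M.variance (\<lambda>\<omega>. h (Xs (Suc n) \<omega>)) = \<sigma>\<^sup>2" for n using tr[of "\<lambda>x. x\<^sup>2" n] 0 \<sigma>2 by simp
    qed (rule dist)
    from levy_continuity1[OF _ real_dist_normal_dist this, of "\<sigma> * t"]
    have "(\<lambda>n. char (distr M borel (\<lambda>\<omega>. (\<Sum>i<n. h (Xs (Suc i) \<omega>)) / sqrt (real n * \<sigma>\<^sup>2))) (\<sigma> * t))
      \<longlonglongrightarrow> complex_of_real (exp (- ((\<sigma> * t)\<^sup>2) / 2))"
      by (simp add: char_std_normal_distribution)
    moreover have "char (distr M borel (\<lambda>\<omega>. (\<Sum>i<n. h (Xs (Suc i) \<omega>)) / sqrt (real n * \<sigma>\<^sup>2))) (\<sigma> * t) =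
      char (distr M borel (\<lambda>\<omega>. (\<Sum>i=1..n. h (Xs i \<omega>)) / sqrt (real n))) t" for n
    proof -
      have "(\<lambda>\<omega>. (\<Sum>i<n. h (Xs (Suc i) \<omega>)) / sqrt (real n * \<sigma>\<^sup>2)) =
        (\<lambda>\<omega>. (\<Sum>i=1..n. h (Xs i \<omega>)) / sqrt (real n) * (1 / \<sigma>))"
        using \<sigma> by (simp add: S real_sqrt_mult del: One_nat_def)
      thus ?thesis using char_scale[OF Sm, of n "1 / \<sigma>" "\<sigma> * t"] \<sigma> by simp
    qed
    ultimately show ?thesis by (simp add: \<sigma>2 power_mult_distrib)
  qed
qed

section \<open>Gaussian processes\<close>

definition L2 :: "'x measure \<Rightarrow> ('x \<Rightarrow> real) set" where
  "L2 P = {f. f \<in> borel_measurable P \<and> integrable P (\<lambda>x. (f x)\<^sup>2)}"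

definition ip :: "'x measure \<Rightarrow> ('x \<Rightarrow> real) \<Rightarrow> ('x \<Rightarrow> real) \<Rightarrow> real" where
  "ip P f g = (\<integral>x. f x * g x \<partial>P)"

lemma L2_mult: assumes "f \<in> L2 P" "g \<in> L2 P" shows "integrable P (\<lambda>x. f x * g x)"
proof (rule Bochner_Integration.integrable_bound)
  show "integrable P (\<lambda>x. (f x)\<^sup>2 + (g x)\<^sup>2)" using assms by (auto simp: L2_def)
  have "\<bar>a * b\<bar> \<le> a\<^sup>2 + b\<^sup>2" for a b :: real
  proof -
    have "2 * \<bar>a * b\<bar> \<le> a\<^sup>2 + b\<^sup>2" using sum_squares_bound[of "\<bar>a\<bar>" "\<bar>b\<bar>"] by (simp add: abs_mult)
    thus ?thesis using abs_ge_zero[of "a * b"] by linarith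
  qed
  thus "AE x in P. norm (f x * g x) \<le> norm ((f x)\<^sup>2 + (g x)\<^sup>2)" by (intro AE_I2) simp
qed (use assms in \<open>auto simp: L2_def\<close>)

lemma L2_add: assumes "f \<in> L2 P" "g \<in> L2 P" shows "(\<lambda>x. f x + g x) \<in> L2 P"
  using assms L2_mult[OF assms] by (auto simp: L2_def power2_sum mult.assoc)

lemma L2_cmult: "f \<in> L2 P \<Longrightarrow> (\<lambda>x. a * f x) \<in> L2 P"
  by (auto simp: L2_def power_mult_distrib)

lemma L2_diff: assumes "f \<in> L2 P" "g \<in> L2 P" shows "(\<lambda>x. f x - g x) \<in> L2 P"
  using L2_add[OF assms(1) L2_cmult[OF assms(2), of "-1"]] by simp

lemma L2_sum: "(\<And>i. i \<in> S \<Longrightarrow> f i \<in> L2 P) \<Longrightarrow> (\<lambda>x. \<Sum>i\<in>S. f i x) \<in> L2 P"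
proof (induction S rule: infinite_finite_induct)
  case (insert i S)
  thus ?case using L2_add[of "f i" P "\<lambda>x. \<Sum>i\<in>S. f i x"] by simp
qed (auto simp: L2_def)

lemma ip_commute: "ip P f g = ip P g f"
  by (simp add: ip_def mult.commute)

lemma ip_sum_left:
  assumes "\<And>i. i \<in> S \<Longrightarrow> f i \<in> L2 P" "g \<in> L2 P"
  shows "ip P (\<lambda>x. \<Sum>i\<in>S. a i * f i x) g = (\<Sum>i\<in>S. a i * ip P (f i) g)"
proof -
  have "ip P (\<lambda>x. \<Sum>i\<in>S. a i * f i x) g = (\<integral>x. (\<Sum>i\<in>S. a i * (f i x * g x)) \<partial>P)"
    by (simp add: ip_def sum_distrib_right mult.assoc)
  also have "\<dots> = (\<Sum>i\<in>S. a i * ip P (f i) g)"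
    unfolding ip_def using L2_mult assms
    by (subst Bochner_Integration.integral_sum) (auto intro!: integrable_mult_right)
  finally show ?thesis .
qed

lemma ip_diff_left: "f \<in> L2 P \<Longrightarrow> f' \<in> L2 P \<Longrightarrow> g \<in> L2 P \<Longrightarrow> ip P (\<lambda>x. f x - f' x) g = ip P f g - ip P f' g"
  unfolding ip_def using L2_mult[of f P g] L2_mult[of f' P g] by (simp add: left_diff_distrib)

lemma ip_self_nonneg: "ip P f f \<ge> 0"
  by (auto simp: ip_def intro!: integral_nonneg_AE)

lemma ip_self_0: assumes "f \<in> L2 P" "ip P f f = 0" shows "AE x in P. f x = 0"
proof -
  have "AE x in P. f x * f x = 0"
    using assms L2_mult[OF assms(1,1)] unfolding ip_def
    by (subst integral_nonneg_eq_0_iff_AE[symmetric]) auto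
  thus ?thesis by simp
qed

text \<open>Gram--Schmidt; a function that depends on its predecessors yields \<open>0\<close>, since \<open>r / 0 = 0\<close>.\<close>

fun gram_schmidt :: "'x measure \<Rightarrow> (nat \<Rightarrow> 'x \<Rightarrow> real) \<Rightarrow> nat \<Rightarrow> 'x \<Rightarrow> real" where
  "gram_schmidt P \<phi> n =
     (let r = (\<lambda>x. \<phi> n x - (\<Sum>i<n. ip P (\<phi> n) (gram_schmidt P \<phi> i) * gram_schmidt P \<phi> i x))
      in (\<lambda>x. r x / sqrt (ip P r r)))"

declare gram_schmidt.simps [simp del]

context
  fixes P :: "'x measure" and \<phi> :: "nat \<Rightarrow> 'x \<Rightarrow> real"
  assumes \<phi>: "\<And>n. \<phi> n \<in> L2 P"
begin

abbreviation (input) gs where "gs \<equiv> gram_schmidt P \<phi>"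

definition gs_residual :: "nat \<Rightarrow> 'x \<Rightarrow> real" where
  "gs_residual n = (\<lambda>x. \<phi> n x - (\<Sum>i<n. ip P (\<phi> n) (gs i) * gs i x))"

lemma gs_eq: "gs n = (\<lambda>x. gs_residual n x / sqrt (ip P (gs_residual n) (gs_residual n)))"
  by (subst gram_schmidt.simps) (simp add: gs_residual_def Let_def)

lemma gs_L2: "gs n \<in> L2 P"
proof (induction n rule: less_induct)
  case (less n)
  have "gs_residual n \<in> L2 P" unfolding gs_residual_def
    by (intro L2_diff[OF \<phi>] L2_sum L2_cmult) (use less in auto)
  thus ?case unfolding gs_eq[of n] using L2_cmult[of "gs_residual n" P "1 / sqrt (ip P (gs_residual n) (gs_residual n))"] by simp
qed

lemma gs_residual_L2: "gs_residual n \<in> L2 P"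
  unfolding gs_residual_def by (intro L2_diff[OF \<phi>] L2_sum L2_cmult gs_L2)

text \<open>In the degenerate case the vector is the zero function itself, not merely zero almost
  everywhere, since the division by 0 yields 0 at every point.\<close>

lemma gs_norm: "ip P (gs n) (gs n) = 1 \<or> gs n = (\<lambda>_. 0)"
proof (cases "ip P (gs_residual n) (gs_residual n) = 0")
  case True thus ?thesis by (simp add: gs_eq)
next
  case False
  hence pos: "ip P (gs_residual n) (gs_residual n) > 0" using ip_self_nonneg[of P "gs_residual n"] by simp
  have "ip P (\<lambda>x. f x / a) (\<lambda>x. f x / a) = ip P f f / a\<^sup>2" for f :: "'x \<Rightarrow> real" and a
    by (simp add: ip_def power2_eq_square)
  hence "ip P (gs n) (gs n) = ip P (gs_residual n) (gs_residual n) / (sqrt (ip P (gs_residual n) (gs_residual n)))\<^sup>2"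
    by (simp only: gs_eq)
  thus ?thesis using pos by simp
qed

lemma gs_scale: "ip P f (gs n) = ip P f (gs_residual n) / sqrt (ip P (gs_residual n) (gs_residual n))"
proof -
  have "ip P f (\<lambda>x. h x / a) = ip P f h / a" for h :: "'x \<Rightarrow> real" and a
    by (simp add: ip_def)
  thus ?thesis by (simp only: gs_eq)
qed

lemma gs_orth: "i < n \<Longrightarrow> ip P (gs i) (gs n) = 0"
proof (induction n arbitrary: i rule: less_induct)
  case (less n)
  have orth: "ip P (gs j) (gs i) = 0" if j: "j < n" "j \<noteq> i" for j
  proof (cases "j < i")
    case True thus ?thesis by (rule less.IH[OF less.prems])
  next
    case False
    hence "i < j" using j by simp
    from less.IH[OF j(1) this] show ?thesis by (subst ip_commute)
  qed
  have "(\<Sum>j<n. ip P (\<phi> n) (gs j) * ip P (gs j) (gs i)) = (\<Sum>j<n. if j = i then ip P (\<phi> n) (gs i) * ip P (gs i) (gs i) else 0)"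
    by (rule sum.cong) (simp_all add: orth)
  also have "\<dots> = ip P (\<phi> n) (gs i) * ip P (gs i) (gs i)" using less.prems by simp
  \<comment> \<open>Either \<open>gs i\<close> has norm 1, or it is the zero function and both sides
    vanish.\<close>
  also have "\<dots> = ip P (\<phi> n) (gs i)"
  proof (cases "gs i = (\<lambda>_. 0)")
    case False thus ?thesis using gs_norm[of i] by simp
  qed (simp add: ip_def)
  finally have sum: "(\<Sum>j<n. ip P (\<phi> n) (gs j) * ip P (gs j) (gs i)) = ip P (\<phi> n) (gs i)" .
  have "ip P (gs_residual n) (gs i) = ip P (\<phi> n) (gs i) - ip P (\<lambda>x. \<Sum>j<n. ip P (\<phi> n) (gs j) * gs j x) (gs i)"
    unfolding gs_residual_def by (rule ip_diff_left[OF \<phi> L2_sum[OF L2_cmult[OF gs_L2]] gs_L2])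
  also have "ip P (\<lambda>x. \<Sum>j<n. ip P (\<phi> n) (gs j) * gs j x) (gs i) = ip P (\<phi> n) (gs i)"
    unfolding sum[symmetric] by (rule ip_sum_left[OF gs_L2 gs_L2])
  finally have "ip P (gs i) (gs_residual n) = 0" by (simp add: ip_commute[of P "gs i"])
  thus ?case by (simp add: gs_scale[of "gs i"])
qed

text \<open>A residual of norm 0 vanishes almost everywhere; otherwise the last coefficient is the
  norm of the residual, so the last term of the sum restores it.\<close>

lemma gs_expand: "AE x in P. \<phi> n x = (\<Sum>i\<le>n. ip P (\<phi> n) (gs i) * gs i x)"
proof (cases "ip P (gs_residual n) (gs_residual n) = 0")
  case True
  hence "gs n = (\<lambda>_. 0)" by (subst gs_eq) simp
  hence "(\<Sum>i\<le>n. ip P (\<phi> n) (gs i) * gs i x) = (\<Sum>i<n. ip P (\<phi> n) (gs i) * gs i x)" for x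
    unfolding lessThan_Suc_atMost[symmetric] sum.lessThan_Suc by simp
  with ip_self_0[OF gs_residual_L2 True] show ?thesis by (simp add: gs_residual_def)
next
  case False
  hence pos: "ip P (gs_residual n) (gs_residual n) > 0" using ip_self_nonneg[of P "gs_residual n"] by simp
  have "ip P (\<lambda>x. \<Sum>i<n. ip P (\<phi> n) (gs i) * gs i x) (gs_residual n) = (\<Sum>i<n. ip P (\<phi> n) (gs i) * ip P (gs i) (gs_residual n))"
    by (rule ip_sum_left[OF gs_L2 gs_residual_L2])
  also have "\<dots> = 0"
  proof (rule sum.neutral, rule ballI)
    fix i assume "i \<in> {..<n}"
    hence "ip P (gs i) (gs n) = 0" by (intro gs_orth) simp
    hence "ip P (gs i) (gs_residual n) = 0" unfolding gs_scale[of "gs i" n] using pos by simp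
    thus "ip P (\<phi> n) (gs i) * ip P (gs i) (gs_residual n) = 0" by simp
  qed
  finally have 0: "ip P (\<lambda>x. \<Sum>i<n. ip P (\<phi> n) (gs i) * gs i x) (gs_residual n) = 0" .
  have "ip P (gs_residual n) (gs_residual n) = ip P (\<phi> n) (gs_residual n) - ip P (\<lambda>x. \<Sum>i<n. ip P (\<phi> n) (gs i) * gs i x) (gs_residual n)"
    by (subst (1) gs_residual_def) (rule ip_diff_left[OF \<phi> L2_sum[OF L2_cmult[OF gs_L2]] gs_residual_L2])
  hence "ip P (\<phi> n) (gs_residual n) = ip P (gs_residual n) (gs_residual n)" using 0 by simp
  hence en: "ip P (\<phi> n) (gs n) = sqrt (ip P (gs_residual n) (gs_residual n))"
    unfolding gs_scale[of "\<phi> n" n] using pos by (simp add: real_div_sqrt)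
  have "ip P (\<phi> n) (gs n) * gs n x = gs_residual n x" for x
    unfolding en fun_cong[OF gs_eq[of n], of x] using pos by simp
  hence "(\<Sum>i\<le>n. ip P (\<phi> n) (gs i) * gs i x) = (\<Sum>i<n. ip P (\<phi> n) (gs i) * gs i x) + gs_residual n x" for x
    unfolding lessThan_Suc_atMost[symmetric] sum.lessThan_Suc by simp
  thus ?thesis by (simp add: gs_residual_def)
qed

text \<open>A lower triangular matrix, in effect a Cholesky factor of the Gram matrix of
  \<open>\<phi>\<close>.\<close>

definition gs_coeff :: "nat \<Rightarrow> nat \<Rightarrow> real" where
  "gs_coeff n i = (if i \<le> n then ip P (\<phi> n) (gs i) else 0)"

text \<open>Parseval's identity for linear combinations. The map \<open>r\<close> need not be
  injective, so the same function may occur under several labels.\<close>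

lemma ip_lincomb:
  assumes S: "finite S" and N: "\<And>a. a \<in> S \<Longrightarrow> r a \<le> N"
  shows "(\<integral>x. (\<Sum>a\<in>S. c a * \<phi> (r a) x)\<^sup>2 \<partial>P) = (\<Sum>i\<le>N. (\<Sum>a\<in>S. c a * gs_coeff (r a) i)\<^sup>2)"
proof -
  define d where "d i = (\<Sum>a\<in>S. c a * gs_coeff (r a) i)" for i
  have ex: "AE x in P. \<phi> (r a) x = (\<Sum>i\<le>N. gs_coeff (r a) i * gs i x)" if "a \<in> S" for a
    using gs_expand[of "r a"]
  proof eventually_elim
    case (elim x)
    have "(\<Sum>i\<le>N. gs_coeff (r a) i * gs i x) = (\<Sum>i\<le>r a. gs_coeff (r a) i * gs i x)"
      using N[OF that] by (intro sum.mono_neutral_right) (auto simp: gs_coeff_def)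
    thus ?case using elim by (simp add: gs_coeff_def)
  qed
  have "AE x in P. \<forall>a\<in>S. \<phi> (r a) x = (\<Sum>i\<le>N. gs_coeff (r a) i * gs i x)"
    using S ex by (intro AE_finite_allI)
  hence AE: "AE x in P. (\<Sum>a\<in>S. c a * \<phi> (r a) x)\<^sup>2 = (\<Sum>i\<le>N. d i * gs i x)\<^sup>2"
  proof eventually_elim
    case (elim x)
    have "(\<Sum>a\<in>S. c a * \<phi> (r a) x) = (\<Sum>a\<in>S. \<Sum>i\<le>N. c a * gs_coeff (r a) i * gs i x)"
      using elim by (intro sum.cong) (auto simp: sum_distrib_left mult.assoc)
    also have "\<dots> = (\<Sum>i\<le>N. d i * gs i x)" unfolding d_def sum_distrib_right by (rule sum.swap)
    finally show ?case by simp
  qed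
  have [measurable]: "\<phi> i \<in> borel_measurable P" "gs i \<in> borel_measurable P" for i
    using \<phi> gs_L2 by (auto simp: L2_def)
  have "(\<integral>x. (\<Sum>a\<in>S. c a * \<phi> (r a) x)\<^sup>2 \<partial>P) = (\<integral>x. (\<Sum>i\<le>N. d i * gs i x)\<^sup>2 \<partial>P)"
    by (rule integral_cong_AE[OF _ _ AE]) measurable
  also have "\<dots> = ip P (\<lambda>x. \<Sum>i\<le>N. d i * gs i x) (\<lambda>x. \<Sum>i\<le>N. d i * gs i x)"
    by (simp add: ip_def power2_eq_square)
  also have "\<dots> = (\<Sum>i\<le>N. d i * ip P (gs i) (\<lambda>x. \<Sum>i\<le>N. d i * gs i x))"
    by (rule ip_sum_left[OF gs_L2 L2_sum[OF L2_cmult[OF gs_L2]]])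
  also have "\<dots> = (\<Sum>i\<le>N. d i * (\<Sum>j\<le>N. d j * ip P (gs j) (gs i)))"
    by (simp only: ip_commute[of P _ "\<lambda>x. \<Sum>i\<le>N. d i * gs i x"] ip_sum_left[OF gs_L2 gs_L2])
  also have "\<dots> = (\<Sum>i\<le>N. (d i)\<^sup>2)"
  proof (rule sum.cong, rule refl)
    fix i assume i: "i \<in> {..N}"
    have "(\<Sum>j\<le>N. d j * ip P (gs j) (gs i)) = (\<Sum>j\<le>N. if j = i then d i * ip P (gs i) (gs i) else 0)"
    proof (rule sum.cong)
      fix j
      have "ip P (gs j) (gs i) = 0" if "j \<noteq> i"
        using that gs_orth[of i j] gs_orth[of j i] ip_commute[of P "gs i" "gs j"] by linarith
      thus "d j * ip P (gs j) (gs i) = (if j = i then d i * ip P (gs i) (gs i) else 0)" by simp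
    qed simp
    also have "\<dots> = d i * ip P (gs i) (gs i)" using i by simp
    \<comment> \<open>A zero vector has zero coefficients, so \<open>d i\<close> vanishes with
      it.\<close>
    also have "\<dots> = d i"
    proof (cases "ip P (gs i) (gs i) = 1")
      case False
      hence "gs i = (\<lambda>_. 0)" using gs_norm by blast
      hence "gs_coeff n i = 0" for n by (simp add: gs_coeff_def ip_def)
      thus ?thesis by (simp add: d_def)
    qed simp
    finally show "d i * (\<Sum>j\<le>N. d j * ip P (gs j) (gs i)) = (d i)\<^sup>2" by (simp add: power2_eq_square)
  qed
  finally show ?thesis by (simp add: d_def)
qed

end

section \<open>Gaussian sequences from white noise\<close>

definition white_noise :: "(nat \<Rightarrow> real) measure" where
  "white_noise = PiM UNIV (\<lambda>_. std_normal_distribution)"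

lemma white_noise_prob: "prob_space white_noise"
  unfolding white_noise_def by (intro prob_space_PiM prob_space_normal_density) simp

lemma white_noise_coord: "(\<lambda>\<omega>. \<omega> i) \<in> borel_measurable white_noise"
  unfolding white_noise_def using measurable_component_singleton[of i UNIV "\<lambda>_. std_normal_distribution"]
  by (simp cong: measurable_cong_sets)

lemma white_noise_distr: "distr white_noise borel (\<lambda>\<omega>. \<omega> i) = std_normal_distribution"
proof -
  interpret product_prob_space "\<lambda>_::nat. std_normal_distribution" UNIV
    by (simp add: product_prob_space_def product_sigma_finite_def product_prob_space_axioms_def
        prob_space_normal_density prob_space_imp_sigma_finite)
  have "distr white_noise borel (\<lambda>\<omega>. \<omega> i) = distr (PiM UNIV (\<lambda>_. std_normal_distribution)) std_normal_distribution (\<lambda>\<omega>. \<omega> i)"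
    unfolding white_noise_def by (rule distr_cong) auto
  also have "\<dots> = std_normal_distribution" using PiM_component[of i] by simp
  finally show ?thesis .
qed

lemma white_noise_indep: "prob_space.indep_vars white_noise (\<lambda>_. borel) (\<lambda>i \<omega>. \<omega> i) UNIV"
proof -
  interpret W: prob_space white_noise by (rule white_noise_prob)
  have s: "sets white_noise = sets (PiM UNIV (\<lambda>_. borel :: real measure))"
    unfolding white_noise_def by (rule sets_PiM_cong) auto
  have "distr white_noise (PiM UNIV (\<lambda>_. borel)) (\<lambda>x. \<lambda>i\<in>UNIV. x i) = white_noise"
    unfolding restrict_UNIV by (rule distr_id2[OF s[symmetric]])
  also have "\<dots> = PiM UNIV (\<lambda>i. distr white_noise borel (\<lambda>\<omega>. \<omega> i))"
    by (simp add: white_noise_distr) (simp add: white_noise_def)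
  finally show ?thesis
    using white_noise_coord by (subst W.indep_vars_iff_distr_eq_PiM) auto
qed

lemma white_noise_lincomb: "gauss_char white_noise (\<lambda>\<omega>. \<Sum>i\<le>N. d i * \<omega> i) (\<Sum>i\<le>N. (d i)\<^sup>2)"
proof -
  interpret W: prob_space white_noise by (rule white_noise_prob)
  note [measurable] = white_noise_coord
  have g: "gauss_char white_noise (\<lambda>\<omega>. d i * \<omega> i) ((d i)\<^sup>2)" for i
  proof -
    have "gauss_char white_noise (\<lambda>\<omega>. \<omega> i) 1"
      using white_noise_coord by (simp add: gauss_char_def white_noise_distr char_std_normal_distribution)
    from W.gauss_char_scale[OF this, of "d i"] show ?thesis by (simp add: mult.commute)
  qed
  have "char (distr white_noise borel (\<lambda>\<omega>. \<Sum>i\<le>N. d i * \<omega> i)) t = (\<Prod>i\<le>N. char (distr white_noise borel (\<lambda>\<omega>. d i * \<omega> i)) t)" for t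
  proof (rule W.char_distr_sum)
    have "W.indep_vars (\<lambda>_. borel) (\<lambda>i \<omega>. (\<lambda>y. d i * y) (\<omega> i)) UNIV"
      by (rule W.indep_vars_compose2[OF white_noise_indep]) auto
    thus "W.indep_vars (\<lambda>_. borel) (\<lambda>i \<omega>. d i * \<omega> i) {..N}"
      by (rule W.indep_vars_subset) auto
  qed
  also have "(\<Prod>i\<le>N. char (distr white_noise borel (\<lambda>\<omega>. d i * \<omega> i)) t) =
     complex_of_real (exp (- ((\<Sum>i\<le>N. (d i)\<^sup>2) * t\<^sup>2 / 2)))" for t
  proof -
    have "(\<Prod>i\<le>N. char (distr white_noise borel (\<lambda>\<omega>. d i * \<omega> i)) t) = (\<Prod>i\<le>N. complex_of_real (exp (- ((d i)\<^sup>2 * t\<^sup>2 / 2))))"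
      using g by (intro prod.cong) (auto simp: gauss_char_def)
    also have "\<dots> = complex_of_real (exp (\<Sum>i\<le>N. - ((d i)\<^sup>2 * t\<^sup>2 / 2)))"
      by (simp only: exp_sum[OF finite_atMost] of_real_prod)
    also have "(\<Sum>i\<le>N. - ((d i)\<^sup>2 * t\<^sup>2 / 2)) = - ((\<Sum>i\<le>N. (d i)\<^sup>2) * t\<^sup>2 / 2)"
      by (simp add: sum_negf sum_distrib_right sum_divide_distrib)
    finally show ?thesis .
  qed
  finally show ?thesis by (simp add: gauss_char_def)
qed

text \<open>The witness applies the triangular matrix \<open>gs_coeff\<close> to independent
  standard normals, so the variances agree with the L2 norms by \<open>ip_lincomb\<close>. Labels
  with a map \<open>r\<close> are kept because the nets later send distinct indices to one skeleton
  point.\<close>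

theorem gaussian_sequence:
  assumes \<phi>: "\<And>n::nat. \<phi> n \<in> L2 P"
  shows "\<exists>Y. \<forall>(S :: 'a set) r c. finite S \<longrightarrow>
    gauss_char white_noise (\<lambda>\<omega>. \<Sum>a\<in>S. c a * Y (r a) \<omega>) (\<integral>x. (\<Sum>a\<in>S. c a * \<phi> (r a) x)\<^sup>2 \<partial>P)"
proof (intro exI allI impI)
  let ?Y = "\<lambda>n \<omega>. \<Sum>i\<le>n. gs_coeff P \<phi> n i * \<omega> i"
  fix S :: "'a set" and r :: "'a \<Rightarrow> nat" and c :: "'a \<Rightarrow> real" assume S: "finite S"
  \<comment> \<open>Inserting 0 gives the maximum a meaning for empty \<open>S\<close>.\<close>
  define N where "N = Max (insert 0 (r ` S))"
  have N: "r a \<le> N" if "a \<in> S" for a unfolding N_def using S that by (intro Max_ge) auto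
  have Y: "?Y (r a) \<omega> = (\<Sum>i\<le>N. gs_coeff P \<phi> (r a) i * \<omega> i)" if "a \<in> S" for a \<omega>
    using N[OF that] by (intro sum.mono_neutral_left) (auto simp: gs_coeff_def[OF \<phi>])
  have "(\<Sum>a\<in>S. c a * ?Y (r a) \<omega>) = (\<Sum>i\<le>N. (\<Sum>a\<in>S. c a * gs_coeff P \<phi> (r a) i) * \<omega> i)" for \<omega>
  proof -
    have "(\<Sum>a\<in>S. c a * ?Y (r a) \<omega>) = (\<Sum>a\<in>S. \<Sum>i\<le>N. c a * gs_coeff P \<phi> (r a) i * \<omega> i)"
      using Y by (intro sum.cong) (auto simp: sum_distrib_left mult.assoc)
    thus ?thesis unfolding sum_distrib_right by (subst sum.swap)
  qed
  moreover have "(\<integral>x. (\<Sum>a\<in>S. c a * \<phi> (r a) x)\<^sup>2 \<partial>P) = (\<Sum>i\<le>N. (\<Sum>a\<in>S. c a * gs_coeff P \<phi> (r a) i)\<^sup>2)"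
    by (rule ip_lincomb[OF \<phi> S N])
  ultimately show "gauss_char white_noise (\<lambda>\<omega>. \<Sum>a\<in>S. c a * ?Y (r a) \<omega>) (\<integral>x. (\<Sum>a\<in>S. c a * \<phi> (r a) x)\<^sup>2 \<partial>P)"
    by (simp only: white_noise_lincomb)
qed

text \<open>Completing the square turns the tilted density into that of the normal law with mean
  \<open>a * v\<close>; variance 0 means the constant 0.\<close>

lemma (in prob_space) gauss_char_exp:
  assumes Y: "gauss_char M Y v" and v: "v \<ge> 0"
  shows "(\<integral>\<^sup>+\<omega>. ennreal (exp (a * Y \<omega>)) \<partial>M) = ennreal (exp (a\<^sup>2 * v / 2))"
proof (cases "v = 0")
  case True
  hence "AE \<omega> in M. Y \<omega> = 0" using Y by (simp add: gauss_char_0)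
  hence "(\<integral>\<^sup>+\<omega>. ennreal (exp (a * Y \<omega>)) \<partial>M) = (\<integral>\<^sup>+\<omega>. 1 \<partial>M)"
    by (intro nn_integral_cong_AE) auto
  thus ?thesis using True by (simp add: emeasure_space_1)
next
  case False
  define s where "s = sqrt v"
  have s: "s > 0" "v = s\<^sup>2" using v False by (auto simp: s_def)
  hence D: "distributed M lborel Y (normal_density 0 s)" using Y by (simp add: gauss_char_normal)
  have "(\<integral>\<^sup>+\<omega>. ennreal (exp (a * Y \<omega>)) \<partial>M) = (\<integral>\<^sup>+y. ennreal (normal_density 0 s y) * ennreal (exp (a * y)) \<partial>lborel)"
    by (rule distributed_nn_integral[OF D, symmetric]) auto
  also have "\<dots> = (\<integral>\<^sup>+y. ennreal (exp (a\<^sup>2 * v / 2)) * ennreal (normal_density (a * v) s y) \<partial>lborel)"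
  proof (rule nn_integral_cong)
    fix y
    have "- (y\<^sup>2 / (2 * s\<^sup>2)) + a * y = a\<^sup>2 * v / 2 + - ((y - a * v)\<^sup>2 / (2 * s\<^sup>2))"
      using s by (simp add: power2_diff field_simps)
    hence "normal_density 0 s y * exp (a * y) = exp (a\<^sup>2 * v / 2) * normal_density (a * v) s y"
      unfolding normal_density_def by (simp add: mult_exp_exp[symmetric] mult_ac flip: exp_add)
    thus "ennreal (normal_density 0 s y) * ennreal (exp (a * y)) = ennreal (exp (a\<^sup>2 * v / 2)) * ennreal (normal_density (a * v) s y)"
      by (simp flip: ennreal_mult)
  qed
  also have "\<dots> = ennreal (exp (a\<^sup>2 * v / 2)) * (\<integral>\<^sup>+y. ennreal (normal_density (a * v) s y) \<partial>lborel)"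
    by (rule nn_integral_cmult) auto
  also have "(\<integral>\<^sup>+y. ennreal (normal_density (a * v) s y) \<partial>lborel) = 1"
    using s by (subst nn_integral_eq_integral) auto
  finally show ?thesis by simp
qed

lemma cosh_le_add_exp: "2 * cosh (x::real) = exp x + exp (- x)"
  by (simp add: cosh_def scaleR_conv_of_real)

text \<open>The soft maximum with \<open>l = 1 / \<sigma>\<close>, now averaged by Gaussian
  exponential moments. These are at most \<open>exp 1\<close>; they are rounded up to 8 to give the
  same constant 16 as in the empirical case, so that \<open>tail_expectation\<close> serves
  both.\<close>

lemma (in prob_space) gauss_maximal_inequality:
  assumes H: "finite H" "H \<noteq> {}" and \<sigma>: "\<sigma> > 0"
    and V: "\<And>h. h \<in> H \<Longrightarrow> gauss_char M (V h) (v h)" "\<And>h. h \<in> H \<Longrightarrow> 0 \<le> v h" "\<And>h. h \<in> H \<Longrightarrow> v h \<le> \<sigma>\<^sup>2"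
  shows "(\<integral>\<^sup>+\<omega>. ennreal (mx H (\<lambda>h. V h \<omega>)) \<partial>M) \<le> ennreal (\<sigma> * (ln (real (card H)) + 16))"
proof -
  let ?N = "real (card H)"
  have N: "?N \<ge> 1" using H by (simp add: Suc_le_eq card_gt_0_iff)
  have [measurable]: "h \<in> H \<Longrightarrow> V h \<in> borel_measurable M" for h using V(1) by (simp add: gauss_char_def)
  have E: "(\<integral>\<^sup>+\<omega>. ennreal (exp (a * V h \<omega>)) \<partial>M) \<le> ennreal 8" if h: "h \<in> H" and a: "a\<^sup>2 = 1 / \<sigma>\<^sup>2" for h a
  proof -
    have "a\<^sup>2 * v h / 2 \<le> 1" using V(2,3)[OF h] \<sigma> unfolding a by (simp add: divide_simps)
    hence "exp (a\<^sup>2 * v h / 2) \<le> exp 1" by simp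
    also have "exp (1::real) \<le> 8" using e_less_272 by linarith
    finally show ?thesis unfolding gauss_char_exp[OF V(1)[OF h] V(2)[OF h], of a] by (rule ennreal_leI)
  qed
  have sq: "(1 / \<sigma>)\<^sup>2 = 1 / \<sigma>\<^sup>2" "(- (1 / \<sigma>))\<^sup>2 = 1 / \<sigma>\<^sup>2" by (simp_all add: power_divide)
  have "(\<integral>\<^sup>+\<omega>. ennreal (mx H (\<lambda>h. V h \<omega>)) \<partial>M)
    \<le> (\<integral>\<^sup>+\<omega>. ennreal (\<sigma> * ln ?N) + ennreal (\<sigma> / ?N) * (\<Sum>h\<in>H. ennreal (exp ((1 / \<sigma>) * V h \<omega>)) + ennreal (exp (- (1 / \<sigma>) * V h \<omega>))) \<partial>M)"
  proof (rule nn_integral_mono)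
    fix \<omega>
    have "mx H (\<lambda>h. V h \<omega>) \<le> (ln ?N + (2 / ?N) * (\<Sum>h\<in>H. cosh ((1 / \<sigma>) * V h \<omega>))) / (1 / \<sigma>)"
      using \<sigma> by (intro mx_le_cosh H) simp
    also have "\<dots> = \<sigma> * ln ?N + (\<sigma> / ?N) * (\<Sum>h\<in>H. 2 * cosh ((1 / \<sigma>) * V h \<omega>))"
      using \<sigma> by (simp add: sum_distrib_left[symmetric] algebra_simps)
    also have "(\<Sum>h\<in>H. 2 * cosh ((1 / \<sigma>) * V h \<omega>)) = (\<Sum>h\<in>H. exp ((1 / \<sigma>) * V h \<omega>) + exp (- (1 / \<sigma>) * V h \<omega>))"
      by (simp only: cosh_le_add_exp mult_minus_left)
    finally have "ennreal (mx H (\<lambda>h. V h \<omega>)) \<le> ennreal (\<sigma> * ln ?N + (\<sigma> / ?N) * (\<Sum>h\<in>H. exp ((1 / \<sigma>) * V h \<omega>) + exp (- (1 / \<sigma>) * V h \<omega>)))"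
      by (rule ennreal_leI)
    also have "\<dots> = ennreal (\<sigma> * ln ?N) + ennreal (\<sigma> / ?N) * (\<Sum>h\<in>H. ennreal (exp ((1 / \<sigma>) * V h \<omega>)) + ennreal (exp (- (1 / \<sigma>) * V h \<omega>)))"
    proof -
      have split: "ennreal (r + a * (\<Sum>h\<in>H. f h + g h)) = ennreal r + ennreal a * (\<Sum>h\<in>H. ennreal (f h) + ennreal (g h))"
        if "r \<ge> 0" "a \<ge> 0" "\<And>h. f h \<ge> 0" "\<And>h. g h \<ge> 0" for r a and f g :: "_ \<Rightarrow> real"
      proof -
        have "(\<Sum>h\<in>H. ennreal (f h) + ennreal (g h)) = ennreal (\<Sum>h\<in>H. f h + g h)"
          using that by (simp add: sum_ennreal ennreal_plus[symmetric] del: ennreal_plus)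
        moreover have "0 \<le> (\<Sum>h\<in>H. f h + g h)" using that by (intro sum_nonneg) simp
        ultimately show ?thesis using that(1,2) by (simp only: ennreal_plus ennreal_mult mult_nonneg_nonneg)
      qed
      show ?thesis by (rule split) (use \<sigma> N in auto)
    qed
    finally show "ennreal (mx H (\<lambda>h. V h \<omega>)) \<le> \<dots>" .
  qed
  also have "\<dots> = ennreal (\<sigma> * ln ?N) + ennreal (\<sigma> / ?N) * (\<Sum>h\<in>H. (\<integral>\<^sup>+\<omega>. ennreal (exp ((1 / \<sigma>) * V h \<omega>)) \<partial>M) + (\<integral>\<^sup>+\<omega>. ennreal (exp (- (1 / \<sigma>) * V h \<omega>)) \<partial>M))"
    by (simp add: nn_integral_add nn_integral_cmult nn_integral_sum emeasure_space_1)
  also have "\<dots> \<le> ennreal (\<sigma> * ln ?N) + ennreal (\<sigma> / ?N) * (\<Sum>h\<in>H. ennreal 8 + ennreal 8)"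
    by (intro add_left_mono mult_left_mono sum_mono add_mono E sq) auto
  also have "\<dots> = ennreal (\<sigma> * ln ?N + (\<sigma> / ?N) * (?N * 16))"
  proof -
    have "ennreal r + ennreal a * (\<Sum>h\<in>H. ennreal 8 + ennreal 8) = ennreal (r + a * (?N * 16))" if "r \<ge> 0" "a \<ge> 0" for r a
    proof -
      have "ennreal 8 + ennreal 8 = ennreal 16" by (subst ennreal_plus[symmetric]) auto
      thus ?thesis using that by (simp add: ennreal_plus ennreal_mult ennreal_of_nat_eq_real_of_nat flip: ennreal_numeral)
    qed
    from this[of "\<sigma> * ln ?N" "\<sigma> / ?N"] \<sigma> N show ?thesis by simp
  qed
  also have "\<sigma> * ln ?N + (\<sigma> / ?N) * (?N * 16) = \<sigma> * (ln ?N + 16)" using N by (simp add: distrib_left)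
  finally show ?thesis .
qed

section \<open>Continuous Gaussian processes indexed by a Lipschitz class\<close>

context lip_class
begin

lemma \<phi>_L2: "t \<in> T \<Longrightarrow> \<phi> t \<in> L2 P"
  using \<phi>_meas \<phi>_sq by (simp add: L2_def)

lemma \<phi>_rep_le:
  assumes t: "t \<in> T" and x: "x \<in> space P"
  shows "\<bar>\<phi> (rep n t) x - \<phi> t x\<bar> \<le> \<Gamma> x * (1/2) ^ n"
proof -
  have d: "dd (rep n t) t \<le> (1/2) ^ n" using dd_rep[OF t] by (simp add: dd_commute)
  also have "(1/2::real) ^ n \<le> 1" by (simp add: power_le_one)
  finally have d3: "dd (rep n t) t \<le> 3" by simp
  have "\<bar>\<phi> (rep n t) x - \<phi> t x\<bar> \<le> \<Gamma> x * dd (rep n t) t" by (rule \<phi>_lip[OF rep(1)[OF t] t d3 x])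
  also have "\<dots> \<le> \<Gamma> x * (1/2) ^ n" using d \<Gamma>_ge[OF x] by (intro mult_left_mono) auto
  finally show ?thesis .
qed

lemma \<phi>_rep_tendsto:
  assumes t: "t \<in> T" and x: "x \<in> space P"
  shows "(\<lambda>n. \<phi> (rep n t) x) \<longlonglongrightarrow> \<phi> t x"
proof -
  have "(\<lambda>n. (1/2::real) ^ n) \<longlonglongrightarrow> 0" by (rule LIMSEQ_power_zero) simp
  hence lim: "(\<lambda>n. \<Gamma> x * (1/2::real) ^ n) \<longlonglongrightarrow> 0" by (rule tendsto_mult_right_zero)
  have "(\<lambda>n. \<phi> (rep n t) x - \<phi> t x) \<longlonglongrightarrow> 0"
    by (rule Lim_null_comparison[OF always_eventually lim]) (unfold real_norm_def, rule allI, rule \<phi>_rep_le[OF t x])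
  thus ?thesis by (rule LIM_zero_cancel)
qed

text \<open>Dominated convergence: the net points are within distance 1, so the functions there are
  bounded by \<open>\<bar>\<phi> t x\<bar> + \<Gamma> x\<close>, which is square-integrable.\<close>

lemma variance_rep_tendsto:
  assumes S: "finite S" "S \<subseteq> T"
  shows "(\<lambda>n. \<integral>x. (\<Sum>t\<in>S. a t * \<phi> (rep n t) x)\<^sup>2 \<partial>P) \<longlonglongrightarrow> (\<integral>x. (\<Sum>t\<in>S. a t * \<phi> t x)\<^sup>2 \<partial>P)"
proof (rule integral_dominated_convergence)
  let ?w = "\<lambda>x. \<Sum>t\<in>S. \<bar>a t\<bar> * (\<bar>\<phi> t x\<bar> + \<Gamma> x)"
  have m: "t \<in> S \<Longrightarrow> \<phi> t \<in> borel_measurable P" "t \<in> S \<Longrightarrow> \<phi> (rep n t) \<in> borel_measurable P" for t n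
    using S \<phi>_meas rep(1) by auto
  show "(\<lambda>x. (\<Sum>t\<in>S. a t * \<phi> t x)\<^sup>2) \<in> borel_measurable P" using m by measurable
  show "(\<lambda>x. (\<Sum>t\<in>S. a t * \<phi> (rep n t) x)\<^sup>2) \<in> borel_measurable P" for n using m by measurable
  have "?w \<in> L2 P"
  proof (intro L2_sum L2_cmult L2_add)
    fix t assume "t \<in> S"
    hence "\<phi> t \<in> L2 P" using \<phi>_L2 S by auto
    thus "(\<lambda>x. \<bar>\<phi> t x\<bar>) \<in> L2 P" by (auto simp: L2_def)
    show "\<Gamma> \<in> L2 P" using \<Gamma>_meas \<Gamma>_sq by (simp add: L2_def)
  qed
  thus "integrable P (\<lambda>x. (?w x)\<^sup>2)" by (simp add: L2_def)
  show "AE x in P. (\<lambda>n. (\<Sum>t\<in>S. a t * \<phi> (rep n t) x)\<^sup>2) \<longlonglongrightarrow> (\<Sum>t\<in>S. a t * \<phi> t x)\<^sup>2"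
    using S by (intro AE_I2 tendsto_power tendsto_sum tendsto_mult tendsto_const \<phi>_rep_tendsto) auto
  show "AE x in P. norm ((\<Sum>t\<in>S. a t * \<phi> (rep n t) x)\<^sup>2) \<le> (?w x)\<^sup>2" for n
  proof (rule AE_I2)
    fix x assume x: "x \<in> space P"
    have "\<bar>\<Sum>t\<in>S. a t * \<phi> (rep n t) x\<bar> \<le> ?w x"
    proof (rule order_trans[OF sum_abs], rule sum_mono)
      fix t assume t: "t \<in> S"
      have "\<bar>\<phi> (rep n t) x - \<phi> t x\<bar> \<le> \<Gamma> x * (1/2) ^ n" using t S by (intro \<phi>_rep_le x) auto
      also have "\<dots> \<le> \<Gamma> x * 1" using \<Gamma>_ge[OF x] by (intro mult_left_mono) (auto simp: power_le_one)
      finally have "\<bar>\<phi> (rep n t) x\<bar> \<le> \<bar>\<phi> t x\<bar> + \<Gamma> x" by linarith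
      thus "\<bar>a t * \<phi> (rep n t) x\<bar> \<le> \<bar>a t\<bar> * (\<bar>\<phi> t x\<bar> + \<Gamma> x)"
        unfolding abs_mult by (rule mult_left_mono) simp
    qed
    hence "\<bar>\<Sum>t\<in>S. a t * \<phi> (rep n t) x\<bar>\<^sup>2 \<le> (?w x)\<^sup>2" by (intro power_mono) auto
    thus "norm ((\<Sum>t\<in>S. a t * \<phi> (rep n t) x)\<^sup>2) \<le> (?w x)\<^sup>2" by simp
  qed
qed

lemma summable_osc:
  assumes "tail z 0 < top" shows "summable (osc z)"
proof (rule summable_suminf_not_top)
  show "(\<Sum>i. ennreal (osc z i)) \<noteq> top" using assms by (simp add: tail_def)
qed (rule osc_nonneg)

lemma tail_tendsto_0:
  assumes "tail z 0 < top" shows "(\<lambda>N. tail z N) \<longlonglongrightarrow> 0"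
proof -
  have s: "summable (osc z)" by (rule summable_osc[OF assms])
  have "tail z N = ennreal (suminf (osc z) - (\<Sum>i<N. osc z i))" for N
  proof -
    have "tail z N = ennreal (\<Sum>i. osc z (i + N))"
      unfolding tail_def using summable_ignore_initial_segment[OF s, of N]
      by (subst add.commute, intro suminf_ennreal2) (auto simp: osc_nonneg add.commute)
    thus ?thesis using suminf_minus_initial_segment[OF s, of N] by simp
  qed
  moreover have "(\<lambda>N. suminf (osc z) - (\<Sum>i<N. osc z i)) \<longlonglongrightarrow> suminf (osc z) - suminf (osc z)"
    by (intro tendsto_diff tendsto_const summable_LIMSEQ s)
  hence "(\<lambda>N. ennreal (suminf (osc z) - (\<Sum>i<N. osc z i))) \<longlonglongrightarrow> ennreal 0"
    by (intro tendsto_ennrealI) simp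
  ultimately show ?thesis by simp
qed

text \<open>The increments along successive nets are dominated by the oscillations, whose sum is
  finite.\<close>

lemma convergent_rep:
  assumes "tail z 0 < top" and t: "t \<in> T" shows "convergent (\<lambda>n. z (rep n t))"
proof -
  have "summable (\<lambda>n. z (rep (Suc n) t) - z (rep n t))"
  proof (rule summable_comparison_test[OF _ summable_osc[OF assms(1)]], intro exI allI impI)
    fix n show "norm (z (rep (Suc n) t) - z (rep n t)) \<le> osc z n"
      using osc_ge[OF link_rep[OF t, of n]] by simp
  qed
  hence "convergent (\<lambda>n. \<Sum>i<n. z (rep (Suc i) t) - z (rep i t))" by (simp add: summable_iff_convergent)
  hence "convergent (\<lambda>n. z (rep n t) - z (rep 0 t))" by (simp only: sum_lessThan_telescope[of "\<lambda>n. z (rep n t)"])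
  thus ?thesis by (simp add: convergent_diff_const_right_iff)
qed

text \<open>A continuous modification: the Gaussian sequence is indexed by the skeleton, and its
  almost surely finite \<open>tail\<close> makes it converge along the nets to a process on all of
  \<open>T\<close>. Gaussianity passes to the limit through characteristic functions, the variances
  by \<open>variance_rep_tendsto\<close>. Continuity is obtained for every \<open>\<omega>\<close>,
  not only for almost all.\<close>

theorem gaussian_process:
  "\<exists>W. (\<forall>S a. finite S \<longrightarrow> S \<subseteq> T \<longrightarrow>
         gauss_char white_noise (\<lambda>\<omega>. \<Sum>t\<in>S. a t * W t \<omega>) (\<integral>x. (\<Sum>t\<in>S. a t * \<phi> t x)\<^sup>2 \<partial>P)) \<and>
       (\<forall>\<omega>. \<forall>e>0. \<exists>\<delta>>0. \<forall>s\<in>T. \<forall>t\<in>T. dd s t \<le> \<delta> \<longrightarrow> \<bar>W s \<omega> - W t \<omega>\<bar> \<le> e)"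
proof -
  interpret N: prob_space white_noise by (rule white_noise_prob)
  let ?R = skeleton
  have Rne: "?R \<noteq> {}" using Tne rep_skeleton by auto
  define \<psi> where "\<psi> = (\<lambda>n. \<phi> (from_nat_into ?R n))"
  have "\<psi> n \<in> L2 P" for n
    unfolding \<psi>_def using from_nat_into[OF Rne, of n] skeleton_sub by (intro \<phi>_L2) auto
  from gaussian_sequence[of \<psi>, OF this, where 'a = 't] obtain Y where
    Y: "\<And>(S :: 't set) r c. finite S \<Longrightarrow> gauss_char white_noise (\<lambda>\<omega>. \<Sum>a\<in>S. c a * Y (r a) \<omega>) (\<integral>x. (\<Sum>a\<in>S. c a * \<psi> (r a) x)\<^sup>2 \<partial>P)"
    by blast
  define Z where "Z = (\<lambda>t. Y (to_nat_on ?R t))"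
  have Z: "gauss_char white_noise (\<lambda>\<omega>. \<Sum>t\<in>S. c t * Z (p t) \<omega>) (\<integral>x. (\<Sum>t\<in>S. c t * \<phi> (p t) x)\<^sup>2 \<partial>P)"
    if S: "finite S" "\<And>t. t \<in> S \<Longrightarrow> p t \<in> ?R" for S :: "'t set" and p c
  proof -
    have "\<psi> (to_nat_on ?R (p t)) = \<phi> (p t)" if "t \<in> S" for t
      using S(2)[OF that] countable_skeleton by (simp add: \<psi>_def)
    hence "(\<Sum>t\<in>S. c t * \<psi> (to_nat_on ?R (p t)) x) = (\<Sum>t\<in>S. c t * \<phi> (p t) x)" for x
      by (intro sum.cong) auto
    with Y[OF S(1), of c "\<lambda>t. to_nat_on ?R (p t)"] show ?thesis by (simp add: Z_def)
  qed
  have Z1: "gauss_char white_noise (Z t) (\<integral>x. (\<phi> t x)\<^sup>2 \<partial>P)" if "t \<in> ?R" for t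
    using Z[of "{t}" "\<lambda>t. t" "\<lambda>_. 1"] that by simp
  have Zm: "Z t \<in> borel_measurable white_noise" if "t \<in> ?R" for t
    using Z1[OF that] by (simp add: gauss_char_def)
  have Z2: "gauss_char white_noise (\<lambda>\<omega>. Z s \<omega> - Z t \<omega>) (\<integral>x. (\<phi> s x - \<phi> t x)\<^sup>2 \<partial>P)" if st: "s \<in> ?R" "t \<in> ?R" for s t
  proof (cases "s = t")
    case True thus ?thesis by (simp add: N.gauss_char_0)
  next
    case False
    from Z[of "{s, t}" "\<lambda>t. t" "\<lambda>u. if u = s then 1 else -1"] st False show ?thesis by auto
  qed
  \<comment> \<open>The L2 norm of the Lipschitz factor: increments at distance
    \<open>\<sigma>\<close> have standard deviation at most \<open>g * \<sigma>\<close>.\<close>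
  define g where "g = sqrt (P.expectation (\<lambda>x. (\<Gamma> x)\<^sup>2))"
  have "1 \<le> P.expectation (\<lambda>x. (\<Gamma> x)\<^sup>2)"
    using \<Gamma>_ge by (intro P.integral_ge_const[OF \<Gamma>_sq] AE_I2) auto
  hence g: "g \<ge> 1" "g\<^sup>2 = P.expectation (\<lambda>x. (\<Gamma> x)\<^sup>2)" by (auto simp: g_def)
  have inc: "(\<integral>\<^sup>+\<omega>. ennreal (Max ((\<lambda>(s, t). \<bar>Z s \<omega> - Z t \<omega>\<bar>) ` Q)) \<partial>white_noise) \<le> ennreal (g * (\<sigma> * (ln (real (card Q)) + 16)))"
    if Q: "finite Q" "Q \<noteq> {}" "Q \<subseteq> ?R \<times> ?R" and \<sigma>: "0 < \<sigma>" "\<sigma> \<le> 3" and d: "\<And>s t. (s, t) \<in> Q \<Longrightarrow> dd s t \<le> \<sigma>" for Q \<sigma>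
  proof -
    let ?v = "\<lambda>(s, t). \<integral>x. (\<phi> s x - \<phi> t x)\<^sup>2 \<partial>P"
    have mxQ: "Max ((\<lambda>(s, t). \<bar>Z s \<omega> - Z t \<omega>\<bar>) ` Q) = mx Q (\<lambda>h. (\<lambda>(s, t) \<omega>. Z s \<omega> - Z t \<omega>) h \<omega>)" for \<omega>
      unfolding mx_def by (intro arg_cong[where f = Max] image_cong) auto
    have "(\<integral>\<^sup>+\<omega>. ennreal (mx Q (\<lambda>h. (\<lambda>(s, t) \<omega>. Z s \<omega> - Z t \<omega>) h \<omega>)) \<partial>white_noise) \<le> ennreal ((g * \<sigma>) * (ln (real (card Q)) + 16))"
    proof (rule N.gauss_maximal_inequality[OF Q(1,2), where v = ?v])
      fix h assume h: "h \<in> Q"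
      obtain s t where st: "h = (s, t)" by (cases h)
      have R: "s \<in> ?R" "t \<in> ?R" and T: "s \<in> T" "t \<in> T" and dst: "dd s t \<le> \<sigma>"
        using Q(3) h st skeleton_sub d by auto
      show "gauss_char white_noise ((\<lambda>(s, t) \<omega>. Z s \<omega> - Z t \<omega>) h) (?v h)" using Z2[OF R] st by simp
      show "0 \<le> ?v h" using st by simp
      have "(\<integral>x. (\<phi> s x - \<phi> t x)\<^sup>2 \<partial>P) \<le> (\<integral>x. \<sigma>\<^sup>2 * (\<Gamma> x)\<^sup>2 \<partial>P)"
      proof (rule integral_mono)
        show "integrable P (\<lambda>x. (\<phi> s x - \<phi> t x)\<^sup>2)" using L2_diff[OF \<phi>_L2[OF T(1)] \<phi>_L2[OF T(2)]] by (simp add: L2_def)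
        show "integrable P (\<lambda>x. \<sigma>\<^sup>2 * (\<Gamma> x)\<^sup>2)" using \<Gamma>_sq by simp
        fix x assume x: "x \<in> space P"
        have "\<bar>\<phi> s x - \<phi> t x\<bar> \<le> \<Gamma> x * dd s t" using dst \<sigma> by (intro \<phi>_lip T x) simp
        also have "\<dots> \<le> \<Gamma> x * \<sigma>" using dst \<Gamma>_ge[OF x] by (intro mult_left_mono) auto
        finally have "\<bar>\<phi> s x - \<phi> t x\<bar>\<^sup>2 \<le> (\<Gamma> x * \<sigma>)\<^sup>2" by (intro power_mono) auto
        thus "(\<phi> s x - \<phi> t x)\<^sup>2 \<le> \<sigma>\<^sup>2 * (\<Gamma> x)\<^sup>2" by (simp add: power_mult_distrib mult.commute)
      qed
      also have "\<dots> = (g * \<sigma>)\<^sup>2" by (simp add: power_mult_distrib g(2))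
      finally show "?v h \<le> (g * \<sigma>)\<^sup>2" using st by simp
    qed (use g \<sigma> in simp)
    thus ?thesis by (simp only: mxQ mult.assoc)
  qed
  let ?tl = "\<lambda>\<omega>. tail (\<lambda>t. Z t \<omega>) 0"
  have tl: "?tl \<in> borel_measurable white_noise" by (rule tail_measurable[OF Zm])
  have "(\<integral>\<^sup>+\<omega>. ?tl \<omega> \<partial>white_noise) \<le> ennreal (g * J 0)"
    by (rule tail_expectation[OF Zm _ inc]) (use g in auto)
  hence "(\<integral>\<^sup>+\<omega>. ?tl \<omega> \<partial>white_noise) \<noteq> \<infinity>" by (metis ennreal_neq_top infinity_ennreal_def neq_top_trans)
  from nn_integral_PInf_AE[OF tl this] have AE: "AE \<omega> in white_noise. ?tl \<omega> < top"
    by eventually_elim (simp add: less_top)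
  \<comment> \<open>Where the \<open>tail\<close> is infinite the path is set to 0, so that every
    path is continuous and \<open>W t\<close> stays measurable.\<close>
  define W where "W t \<omega> = (if ?tl \<omega> < top then lim (\<lambda>n. Z (rep n t) \<omega>) else 0)" for t \<omega>
  have lim: "(\<lambda>n. Z (rep n t) \<omega>) \<longlonglongrightarrow> W t \<omega>" if "t \<in> T" "?tl \<omega> < top" for t \<omega>
    using convergent_rep[OF that(2,1)] that(2) by (simp add: W_def convergent_LIMSEQ_iff)
  have Wm: "W t \<in> borel_measurable white_noise" if t: "t \<in> T" for t
  proof (rule borel_measurable_LIMSEQ_real)
    show "(\<lambda>n. if ?tl \<omega> < top then Z (rep n t) \<omega> else 0) \<longlonglongrightarrow> W t \<omega>" for \<omega>
      using lim[OF t, of \<omega>] by (cases "?tl \<omega> < top") (auto simp: W_def)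
    show "(\<lambda>\<omega>. if ?tl \<omega> < top then Z (rep n t) \<omega> else 0) \<in> borel_measurable white_noise" for n
      using tl Zm[OF rep_skeleton[OF t]] by measurable
  qed
  have cont: "\<exists>\<delta>>0. \<forall>s\<in>T. \<forall>t\<in>T. dd s t \<le> \<delta> \<longrightarrow> \<bar>W s \<omega> - W t \<omega>\<bar> \<le> e" if e: "e > 0" for \<omega> e
  proof (cases "?tl \<omega> < top")
    case True
    have "(\<lambda>N. 3 * tail (\<lambda>t. Z t \<omega>) N) \<longlonglongrightarrow> 3 * 0"
      using tail_tendsto_0[OF True] by (intro ennreal_tendsto_cmult) auto
    hence "\<forall>\<^sub>F N in sequentially. 3 * tail (\<lambda>t. Z t \<omega>) N < ennreal e"
      using e by (intro order_tendstoD(2)) auto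
    then obtain N where N: "3 * tail (\<lambda>t. Z t \<omega>) N < ennreal e" by (auto simp: eventually_sequentially)
    show ?thesis
    proof (intro exI[of _ "(1/2) ^ N"] conjI ballI impI)
      fix s t assume st: "s \<in> T" "t \<in> T" "dd s t \<le> (1/2) ^ N"
      have "ennreal \<bar>W s \<omega> - W t \<omega>\<bar> \<le> 3 * tail (\<lambda>t. Z t \<omega>) N"
        by (rule chaining[OF st, where w = "\<lambda>t. W t \<omega>"]) (intro lim st True)+
      also have "\<dots> \<le> ennreal e" using N by simp
      finally show "\<bar>W s \<omega> - W t \<omega>\<bar> \<le> e" using e by (simp add: ennreal_le_iff)
    qed simp
  next
    case False thus ?thesis using e by (intro exI[of _ 1]) (simp add: W_def)
  qed
  have gauss: "gauss_char white_noise (\<lambda>\<omega>. \<Sum>t\<in>S. a t * W t \<omega>) (\<integral>x. (\<Sum>t\<in>S. a t * \<phi> t x)\<^sup>2 \<partial>P)"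
    if S: "finite S" "S \<subseteq> T" for S a
  proof -
    let ?A = "\<lambda>n \<omega>. \<Sum>t\<in>S. a t * Z (rep n t) \<omega>" and ?B = "\<lambda>\<omega>. \<Sum>t\<in>S. a t * W t \<omega>"
    let ?v = "\<lambda>n. \<integral>x. (\<Sum>t\<in>S. a t * \<phi> (rep n t) x)\<^sup>2 \<partial>P"
    have A: "gauss_char white_noise (?A n) (?v n)" for n
      using S by (intro Z rep_skeleton) auto
    have Am: "?A n \<in> borel_measurable white_noise" for n using A by (simp add: gauss_char_def)
    have Bm: "?B \<in> borel_measurable white_noise"
      using S by (intro borel_measurable_sum borel_measurable_times borel_measurable_const Wm) auto
    have "char (distr white_noise borel ?B) t = complex_of_real (exp (- ((\<integral>x. (\<Sum>t\<in>S. a t * \<phi> t x)\<^sup>2 \<partial>P) * t\<^sup>2 / 2)))" for t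
    proof (rule LIMSEQ_unique)
      show "(\<lambda>n. char (distr white_noise borel (?A n)) t) \<longlonglongrightarrow> char (distr white_noise borel ?B) t"
        unfolding char_distr[OF Am] char_distr[OF Bm]
      proof (rule integral_dominated_convergence[where w = "\<lambda>_. 1"])
        show "AE \<omega> in white_noise. (\<lambda>n. iexp (t * ?A n \<omega>)) \<longlonglongrightarrow> iexp (t * ?B \<omega>)"
          using AE
        proof eventually_elim
          case (elim \<omega>)
          hence "(\<lambda>n. ?A n \<omega>) \<longlonglongrightarrow> ?B \<omega>"
            using S by (intro tendsto_sum tendsto_mult tendsto_const lim) auto
          thus ?case by (intro tendsto_exp tendsto_mult tendsto_const tendsto_of_real)
        qed
      next
        have m: "(\<lambda>\<omega>. iexp (t * V \<omega>)) \<in> borel_measurable white_noise" if [measurable]: "V \<in> borel_measurable white_noise" for V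
          by measurable
        show "(\<lambda>\<omega>. iexp (t * ?B \<omega>)) \<in> borel_measurable white_noise" by (rule m[OF Bm])
        show "(\<lambda>\<omega>. iexp (t * ?A n \<omega>)) \<in> borel_measurable white_noise" for n by (rule m[OF Am])
      qed auto
      have "(\<lambda>n. complex_of_real (exp (- (?v n * t\<^sup>2 / 2)))) \<longlonglongrightarrow> complex_of_real (exp (- ((\<integral>x. (\<Sum>t\<in>S. a t * \<phi> t x)\<^sup>2 \<partial>P) * t\<^sup>2 / 2)))"
        by (intro tendsto_of_real tendsto_exp tendsto_minus tendsto_divide tendsto_mult tendsto_const variance_rep_tendsto S) auto
      thus "(\<lambda>n. char (distr white_noise borel (?A n)) t) \<longlonglongrightarrow> complex_of_real (exp (- ((\<integral>x. (\<Sum>t\<in>S. a t * \<phi> t x)\<^sup>2 \<partial>P) * t\<^sup>2 / 2)))"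
        using A by (simp add: gauss_char_def)
    qed
    thus ?thesis using Bm by (simp add: gauss_char_def)
  qed
  show ?thesis using gauss cont by blast
qed

end

section \<open>Differentiation in coordinates\<close>

text \<open>The l1 distance: it adds over coordinates, dominates \<open>vdist\<close>, and lets all
  estimates be made coordinate by coordinate.\<close>

definition dist1 :: "nat \<Rightarrow> (nat \<Rightarrow> real) \<Rightarrow> (nat \<Rightarrow> real) \<Rightarrow> real" where
  "dist1 p v w = (\<Sum>b<p. \<bar>v b - w b\<bar>)"

lemma dist1_nonneg [simp]: "0 \<le> dist1 p v w"
  unfolding dist1_def by (rule sum_nonneg) simp

lemma dist1_self [simp]: "dist1 p v v = 0"
  by (simp add: dist1_def)

lemma dist1_triangle: "dist1 p u w \<le> dist1 p u v + dist1 p v w"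
  unfolding dist1_def sum.distrib[symmetric] by (rule sum_mono) auto

lemma dist1_coord: "b < p \<Longrightarrow> \<bar>v b - w b\<bar> \<le> dist1 p v w"
  unfolding dist1_def by (rule member_le_sum[of b "{..<p}" "\<lambda>b. \<bar>v b - w b\<bar>"]) auto

lemma dist1_pos: assumes "v \<in> Rn p" "w \<in> Rn p" "v \<noteq> w" shows "dist1 p v w > 0"
proof -
  obtain b where b: "v b \<noteq> w b" using assms(3) by auto
  hence "b < p" using assms(1,2) by (metis (mono_tags, lifting) mem_Collect_eq not_le topspace_Euclidean_space)
  hence "\<bar>v b - w b\<bar> \<le> dist1 p v w" by (rule dist1_coord)
  thus ?thesis using b by linarith
qed

lemma vdist_le_dist1: "vdist p v w \<le> dist1 p v w"
  unfolding vdist_def vnorm_def dist1_def by (rule L2_set_le_sum_abs)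

lemma coord_le_vnorm: "a < p \<Longrightarrow> \<bar>v a\<bar> \<le> vnorm p v"
proof -
  assume "a < p"
  hence "(v a)\<^sup>2 \<le> (\<Sum>i<p. (v i)\<^sup>2)" by (intro member_le_sum[of a "{..<p}" "\<lambda>i. (v i)\<^sup>2"]) auto
  thus ?thesis unfolding vnorm_def L2_set_def by (metis real_sqrt_abs real_sqrt_le_iff)
qed

lemma coord_le_vdist: "a < p \<Longrightarrow> \<bar>v a - w a\<bar> \<le> vdist p v w"
  unfolding vdist_def by (rule coord_le_vnorm)

text \<open>The product topology of real lines is the topology of the function type, so notions
  stated for \<open>Euclidean_space\<close> reduce to subspace topologies and to sequences.\<close>

lemma Euclidean_space_top_of_set: "Euclidean_space p = top_of_set (Rn p)"
  by (simp add: Euclidean_space_def topspace_Euclidean_space euclidean_product_topology)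

lemma Rn_tendsto:
  assumes v: "\<And>i. v i \<in> Rn p" and w: "w \<in> Rn p" and lim: "(\<lambda>i. dist1 p (v i) w) \<longlonglongrightarrow> 0"
  shows "v \<longlonglongrightarrow> (w :: nat \<Rightarrow> real)"
proof -
  have "(\<lambda>i. v i b) \<longlonglongrightarrow> w b" for b
  proof (cases "b < p")
    case True
    have "(\<lambda>i. v i b - w b) \<longlonglongrightarrow> 0"
      by (rule Lim_null_comparison[OF always_eventually lim]) (use dist1_coord[OF True] in auto)
    thus ?thesis by (rule LIM_zero_cancel)
  next
    case False
    hence "v i b = w b" for i using v[of i] w by (simp add: topspace_Euclidean_space)
    thus ?thesis by simp
  qed
  hence "limitin (product_topology (\<lambda>_. euclideanreal) UNIV) v w sequentially"
    by (simp add: limitin_componentwise)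
  thus ?thesis by (simp add: euclidean_product_topology)
qed

lemma dist1_tendsto:
  assumes "\<And>b. b < p \<Longrightarrow> (\<lambda>i. v i b) \<longlonglongrightarrow> w b"
  shows "(\<lambda>i. dist1 p (v i) w) \<longlonglongrightarrow> 0"
proof -
  have "(\<lambda>i. dist1 p (v i) w) \<longlonglongrightarrow> (\<Sum>b<p. \<bar>w b - w b\<bar>)"
    unfolding dist1_def by (intro tendsto_sum tendsto_rabs tendsto_diff tendsto_const assms) auto
  thus ?thesis by simp
qed

text \<open>Otherwise points outside \<open>S\<close> would converge to \<open>w\<close> and so
  enter the open interior.\<close>

lemma interior_dist1:
  assumes "w \<in> Euclidean_space p interior_of S"
  shows "\<exists>r>0. \<forall>v\<in>Rn p. dist1 p v w \<le> r \<longrightarrow> v \<in> S"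
proof (rule ccontr)
  assume not: "\<not> ?thesis"
  define O' where "O' = Euclidean_space p interior_of S"
  have "openin (top_of_set (Rn p)) O'"
    using openin_interior_of[of "Euclidean_space p" S] Euclidean_space_top_of_set[of p] by (simp add: O'_def)
  then obtain V where V: "open V" "O' = Rn p \<inter> V" by (auto simp: openin_open)
  have w: "w \<in> Rn p" "w \<in> V" using assms V by (auto simp: O'_def[symmetric])
  have "\<forall>i::nat. \<exists>v\<in>Rn p. dist1 p v w \<le> 1 / real (Suc i) \<and> v \<notin> S"
    using not by (metis of_nat_0_less_iff zero_less_Suc zero_less_divide_1_iff)
  then obtain v where v: "\<And>i. v i \<in> Rn p" "\<And>i. dist1 p (v i) w \<le> 1 / real (Suc i)" "\<And>i. v i \<notin> S" by metis
  have "(\<lambda>i. dist1 p (v i) w) \<longlonglongrightarrow> 0"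
    by (rule Lim_null_comparison[OF always_eventually LIMSEQ_Suc[OF lim_1_over_n]]) (use v(2) in auto)
  hence "v \<longlonglongrightarrow> w" by (rule Rn_tendsto[OF v(1) w(1)])
  hence "\<forall>\<^sub>F i in sequentially. v i \<in> V" using V(1) w(2) by (rule topological_tendstoD)
  then obtain i where "v i \<in> V" by (auto simp: eventually_sequentially)
  hence "v i \<in> O'" using v(1) V(2) by auto
  hence "v i \<in> S" unfolding O'_def by (rule subsetD[OF interior_of_subset])
  thus False using v(3) by auto
qed

section \<open>Segments and the mean value theorem\<close>

definition seg :: "(nat \<Rightarrow> real) \<Rightarrow> (nat \<Rightarrow> real) \<Rightarrow> real \<Rightarrow> nat \<Rightarrow> real" where
  "seg v w t = (\<lambda>b. v b + t * (w b - v b))"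

lemma seg_Rn: "v \<in> Rn p \<Longrightarrow> w \<in> Rn p \<Longrightarrow> seg v w t \<in> Rn p"
  by (simp add: topspace_Euclidean_space seg_def)

lemma seg_0_1 [simp]: "seg v w 0 = v" "seg v w 1 = w"
  by (simp_all add: seg_def)

lemma differentiable_Rn_coord:
  assumes D: "differentiable_Rn p q F \<eta>" and a: "a < q" and e: "e > 0"
  shows "\<exists>d>0. \<forall>v\<in>Rn p. dist1 p v \<eta> < d \<longrightarrow>
    \<bar>F v a - F \<eta> a - (\<Sum>b<p. jac_entry F \<eta> a b * (v b - \<eta> b))\<bar> \<le> e * dist1 p v \<eta>"
proof -
  obtain d where d: "d > 0" "\<And>v. v \<in> Rn p \<Longrightarrow> vdist p v \<eta> < d \<Longrightarrow>
        vnorm q (\<lambda>a. F v a - F \<eta> a - (\<Sum>b<p. jac_entry F \<eta> a b * (v b - \<eta> b))) \<le> e * vdist p v \<eta>"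
    using D e unfolding differentiable_Rn_def by blast
  have "\<bar>F v a - F \<eta> a - (\<Sum>b<p. jac_entry F \<eta> a b * (v b - \<eta> b))\<bar> \<le> e * dist1 p v \<eta>"
    if v: "v \<in> Rn p" "dist1 p v \<eta> < d" for v
  proof -
    have "\<bar>F v a - F \<eta> a - (\<Sum>b<p. jac_entry F \<eta> a b * (v b - \<eta> b))\<bar> \<le>
      vnorm q (\<lambda>a. F v a - F \<eta> a - (\<Sum>b<p. jac_entry F \<eta> a b * (v b - \<eta> b)))"
      using coord_le_vnorm[OF a, of "\<lambda>a. F v a - F \<eta> a - (\<Sum>b<p. jac_entry F \<eta> a b * (v b - \<eta> b))"] by simp
    also have "\<dots> \<le> e * vdist p v \<eta>" using vdist_le_dist1[of p v \<eta>] v by (intro d(2)) auto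
    also have "\<dots> \<le> e * dist1 p v \<eta>" using vdist_le_dist1 e by (intro mult_left_mono) auto
    finally show ?thesis .
  qed
  thus ?thesis using d(1) by blast
qed

lemma differentiable_Rn_seg:
  assumes D: "\<And>\<eta>. \<eta> \<in> Rn p \<Longrightarrow> differentiable_Rn p q F \<eta>" and a: "a < q" and v: "v \<in> Rn p" and w: "w \<in> Rn p"
  shows "((\<lambda>t. F (seg v w t) a) has_real_derivative (\<Sum>b<p. jac_entry F (seg v w t) a b * (w b - v b))) (at t)"
proof -
  let ?D = "\<Sum>b<p. jac_entry F (seg v w t) a b * (w b - v b)"
  let ?L = "dist1 p w v"
  have d: "dist1 p (seg v w s) (seg v w t) = \<bar>s - t\<bar> * ?L" for s
    unfolding dist1_def seg_def sum_distrib_left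
    by (intro sum.cong refl) (simp add: abs_mult[symmetric] algebra_simps)
  have "((\<lambda>s. (F (seg v w s) a - F (seg v w t) a) / (s - t)) \<longlongrightarrow> ?D) (at t)"
  proof (rule LIM_I)
    fix e :: real assume e: "e > 0"
    \<comment> \<open>\<open>?L\<close> vanishes if the end points coincide, whence the added
      1.\<close>
    let ?e = "e / (2 * (?L + 1))"
    have L1: "?L + 1 > 0" by (simp add: add_nonneg_pos)
    hence e': "?e > 0" using e by simp
    obtain r where r: "r > 0" "\<And>y. y \<in> Rn p \<Longrightarrow> dist1 p y (seg v w t) < r \<Longrightarrow>
      \<bar>F y a - F (seg v w t) a - (\<Sum>b<p. jac_entry F (seg v w t) a b * (y b - seg v w t b))\<bar> \<le> ?e * dist1 p y (seg v w t)"
      using differentiable_Rn_coord[OF D[OF seg_Rn[OF v w, of t]] a e'] by blast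
    show "\<exists>s>0. \<forall>x. x \<noteq> t \<and> norm (x - t) < s \<longrightarrow> norm ((F (seg v w x) a - F (seg v w t) a) / (x - t) - ?D) < e"
    proof (intro exI[of _ "r / (?L + 1)"] conjI allI impI)
      show "r / (?L + 1) > 0" using r L1 by simp
      fix x assume x: "x \<noteq> t \<and> norm (x - t) < r / (?L + 1)"
      have "\<bar>x - t\<bar> * ?L \<le> \<bar>x - t\<bar> * (?L + 1)" by (intro mult_left_mono) auto
      also have "\<dots> < r" using x L1 by (simp add: pos_less_divide_eq)
      finally have "dist1 p (seg v w x) (seg v w t) < r" by (simp add: d)
      from r(2)[OF seg_Rn[OF v w] this]
      have "\<bar>F (seg v w x) a - F (seg v w t) a - (\<Sum>b<p. jac_entry F (seg v w t) a b * (seg v w x b - seg v w t b))\<bar> \<le> ?e * (\<bar>x - t\<bar> * ?L)"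
        by (simp add: d)
      also have "(\<Sum>b<p. jac_entry F (seg v w t) a b * (seg v w x b - seg v w t b)) = (x - t) * ?D"
        unfolding sum_distrib_left by (intro sum.cong refl) (simp add: seg_def algebra_simps)
      finally have "\<bar>F (seg v w x) a - F (seg v w t) a - (x - t) * ?D\<bar> / \<bar>x - t\<bar> \<le> ?e * ?L"
        using x by (simp add: divide_le_eq mult_ac)
      also have "?e * ?L \<le> ?e * (?L + 1)" using e' by (intro mult_left_mono) auto
      also have "\<dots> = e / 2"
      proof -
        have "e / (2 * y) * y = e / 2" if "y > 0" for y :: real using that by simp
        thus ?thesis using L1 by blast
      qed
      also have "e / 2 < e" using e by simp
      finally have "\<bar>(F (seg v w x) a - F (seg v w t) a - (x - t) * ?D) / (x - t)\<bar> < e"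
        by (simp only: abs_divide)
      moreover have "(F (seg v w x) a - F (seg v w t) a - (x - t) * ?D) / (x - t) = (F (seg v w x) a - F (seg v w t) a) / (x - t) - ?D"
        using x by (simp add: diff_divide_distrib)
      ultimately show "norm ((F (seg v w x) a - F (seg v w t) a) / (x - t) - ?D) < e" by simp
    qed
  qed
  thus ?thesis by (simp add: has_field_derivative_iff)
qed

text \<open>The scalar theorem applied to one component along the segment; the intermediate point
  depends on the component \<open>a\<close>.\<close>

lemma mean_value_Rn:
  assumes D: "\<And>\<eta>. \<eta> \<in> Rn p \<Longrightarrow> differentiable_Rn p q F \<eta>" and a: "a < q" and v: "v \<in> Rn p" and w: "w \<in> Rn p"
  shows "\<exists>t\<in>{0..1}. F w a - F v a = (\<Sum>b<p. jac_entry F (seg v w t) a b * (w b - v b))"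
proof -
  obtain t where t: "0 < t" "t < 1" "F (seg v w 1) a - F (seg v w 0) a = (1 - 0) * (\<Sum>b<p. jac_entry F (seg v w t) a b * (w b - v b))"
    using MVT2[of 0 1 "\<lambda>t. F (seg v w t) a" "\<lambda>t. \<Sum>b<p. jac_entry F (seg v w t) a b * (w b - v b)"]
      differentiable_Rn_seg[OF D a v w] by auto
  thus ?thesis by (intro bexI[of _ t]) auto
qed

lemma dist1_seg:
  assumes "t \<in> {0..1}" shows "dist1 p (seg v w t) z \<le> dist1 p v z + dist1 p w z"
proof -
  have "\<bar>seg v w t b - z b\<bar> \<le> \<bar>v b - z b\<bar> + \<bar>w b - z b\<bar>" for b
  proof -
    have "seg v w t b - z b = (1 - t) * (v b - z b) + t * (w b - z b)" by (simp add: seg_def algebra_simps)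
    also have "\<bar>\<dots>\<bar> \<le> \<bar>(1 - t) * (v b - z b)\<bar> + \<bar>t * (w b - z b)\<bar>" by (rule abs_triangle_ineq)
    also have "\<dots> \<le> 1 * \<bar>v b - z b\<bar> + 1 * \<bar>w b - z b\<bar>"
      unfolding abs_mult using assms by (intro add_mono mult_right_mono) auto
    finally show ?thesis by simp
  qed
  thus ?thesis unfolding dist1_def sum.distrib[symmetric] by (rule sum_mono)
qed

text \<open>Difference quotients along \<open>1 / real (Suc n)\<close> exhibit the entries as limits
  of sequences. This yields both their measurability in the sample point and their bound by the
  Lipschitz factor.\<close>

lemma jac_entry_tendsto:
  assumes D: "differentiable_Rn p q F \<eta>" and a: "a < q" and b: "b < p" and \<eta>: "\<eta> \<in> Rn p"
  shows "(\<lambda>n. real (Suc n) * (F (\<eta>(b := \<eta> b + 1 / real (Suc n))) a - F \<eta> a)) \<longlonglongrightarrow> jac_entry F \<eta> a b"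
proof (rule LIMSEQ_I)
  fix e :: real assume e: "e > 0"
  obtain d where d: "d > 0" "\<And>v. v \<in> Rn p \<Longrightarrow> dist1 p v \<eta> < d \<Longrightarrow>
    \<bar>F v a - F \<eta> a - (\<Sum>b<p. jac_entry F \<eta> a b * (v b - \<eta> b))\<bar> \<le> e / 2 * dist1 p v \<eta>"
    using differentiable_Rn_coord[OF D a, of "e / 2"] e by auto
  obtain N where N: "1 / real (Suc N) < d" using reals_Archimedean[OF d(1)] by (auto simp: inverse_eq_divide)
  show "\<exists>n0. \<forall>n\<ge>n0. norm (real (Suc n) * (F (\<eta>(b := \<eta> b + 1 / real (Suc n))) a - F \<eta> a) - jac_entry F \<eta> a b) < e"
  proof (intro exI[of _ N] allI impI)
    fix n assume n: "n \<ge> N"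
    let ?s = "1 / real (Suc n)" let ?v = "\<eta>(b := \<eta> b + ?s)"
    have s: "?s > 0" by simp
    have "?s \<le> 1 / real (Suc N)" using n by (intro divide_left_mono) auto
    hence sd: "?s < d" using N by simp
    have "dist1 p ?v \<eta> = (\<Sum>c<p. if c = b then ?s else 0)" unfolding dist1_def by (intro sum.cong) auto
    hence dv: "dist1 p ?v \<eta> = ?s" using b by simp
    have "(\<Sum>c<p. jac_entry F \<eta> a c * (?v c - \<eta> c)) = (\<Sum>c<p. if c = b then jac_entry F \<eta> a b * ?s else 0)"
      by (intro sum.cong) auto
    hence sum: "(\<Sum>c<p. jac_entry F \<eta> a c * (?v c - \<eta> c)) = jac_entry F \<eta> a b * ?s" using b by simp
    have "?v \<in> Rn p" using \<eta> b by (simp add: topspace_Euclidean_space)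
    from d(2)[OF this] sd have *: "\<bar>F ?v a - F \<eta> a - jac_entry F \<eta> a b * ?s\<bar> \<le> e / 2 * ?s"
      unfolding dv sum by simp
    have "real (Suc n) * (F ?v a - F \<eta> a) - jac_entry F \<eta> a b = real (Suc n) * (F ?v a - F \<eta> a - jac_entry F \<eta> a b * ?s)"
      by (simp add: right_diff_distrib del: of_nat_Suc)
    hence "\<bar>real (Suc n) * (F ?v a - F \<eta> a) - jac_entry F \<eta> a b\<bar> = real (Suc n) * \<bar>F ?v a - F \<eta> a - jac_entry F \<eta> a b * ?s\<bar>"
      by (simp add: abs_mult del: of_nat_Suc)
    also have "\<dots> \<le> real (Suc n) * (e / 2 * ?s)" using * by (intro mult_left_mono) auto
    also have "\<dots> = e / 2" by (simp del: of_nat_Suc)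
    finally show "norm (real (Suc n) * (F ?v a - F \<eta> a) - jac_entry F \<eta> a b) < e" using e by simp
  qed
qed

lemma continuous_map_seq:
  assumes C: "continuous_map (prod_topology (top_of_set U) (Euclidean_space p)) euclideanreal (\<lambda>(u, \<eta>). h u \<eta>)"
    and u: "\<And>i. u i \<in> U" "u' \<in> U" "u \<longlonglongrightarrow> u'" and v: "\<And>i. v i \<in> Rn p" "w \<in> Rn p" "(\<lambda>i. dist1 p (v i) w) \<longlonglongrightarrow> 0"
  shows "(\<lambda>i. h (u i) (v i)) \<longlonglongrightarrow> (h u' w :: real)"
proof -
  have "continuous_map (prod_topology (top_of_set U) (top_of_set (Rn p))) euclideanreal (\<lambda>(u, \<eta>). h u \<eta>)"
    using C by (subst (asm) Euclidean_space_top_of_set)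
  hence "continuous_map (top_of_set (U \<times> Rn p)) euclideanreal (\<lambda>(u, \<eta>). h u \<eta>)"
    by (simp only: prod_topology_subtopology_eu)
  hence c: "continuous_on (U \<times> Rn p) (\<lambda>(u, \<eta>). h u \<eta>)" by simp
  have "(\<lambda>i. (u i, v i)) \<longlonglongrightarrow> (u', w)" by (intro tendsto_Pair u(3) Rn_tendsto[OF v])
  from continuous_on_tendsto_compose[OF c this] u v show ?thesis by auto
qed

section \<open>The delta method for nested compositions\<close>

text \<open>A uniform setting in which all levels have one form: the recursion of
  \<open>nested\<close> starts from the zero function, and the innermost function of the problem
  becomes level \<open>K\<close>. Bounds are per coordinate, in terms of \<open>dist1\<close>. The
  condition \<open>val_interior\<close> condenses the inclusions that select the sets
  \<open>I j\<close>.\<close>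

locale composite = P: prob_space P for P :: "'x measure" +
  fixes K :: nat and m :: "nat \<Rightarrow> nat" and U :: "'u::euclidean_space set" and uhat :: 'u
    and F :: "nat \<Rightarrow> 'u \<Rightarrow> (nat \<Rightarrow> real) \<Rightarrow> 'x \<Rightarrow> nat \<Rightarrow> real"
    and I :: "nat \<Rightarrow> (nat \<Rightarrow> real) set" and \<gamma> :: "nat \<Rightarrow> 'x \<Rightarrow> real"
  assumes K1: "K \<ge> 1" and m0: "m 0 = 1"
    and U: "compact U" and uhat: "uhat \<in> U"
    and I_cpt: "\<And>j. j \<in> {1..K} \<Longrightarrow> compact (I j)"
    and I_Rn: "\<And>j. j \<in> {1..K} \<Longrightarrow> I j \<subseteq> Rn (m j)"
    and F_Rn: "\<And>j u \<eta> x. j \<in> {1..K} \<Longrightarrow> u \<in> U \<Longrightarrow> \<eta> \<in> Rn (m j) \<Longrightarrow> x \<in> space P \<Longrightarrow> F j u \<eta> x \<in> Rn (m (j - 1))"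
    and F_meas: "\<And>j u \<eta> a. j \<in> {1..K} \<Longrightarrow> u \<in> U \<Longrightarrow> \<eta> \<in> Rn (m j) \<Longrightarrow> (\<lambda>x. F j u \<eta> x a) \<in> borel_measurable P"
    and F_sq: "\<And>j u \<eta> a. j \<in> {1..K} \<Longrightarrow> u \<in> U \<Longrightarrow> \<eta> \<in> I j \<Longrightarrow> a < m (j - 1) \<Longrightarrow> integrable P (\<lambda>x. (F j u \<eta> x a)\<^sup>2)"
    and F_lip: "\<And>j u u' \<eta> \<eta>' x a. j \<in> {1..K} \<Longrightarrow> u \<in> U \<Longrightarrow> u' \<in> U \<Longrightarrow> \<eta> \<in> I j \<Longrightarrow> \<eta>' \<in> I j \<Longrightarrow> x \<in> space P \<Longrightarrow>
       a < m (j - 1) \<Longrightarrow> \<bar>F j u \<eta> x a - F j u' \<eta>' x a\<bar> \<le> \<gamma> j x * (norm (u - u') + dist1 (m j) \<eta> \<eta>')"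
    and \<gamma>_ge: "\<And>j x. 0 \<le> \<gamma> j x"
    and \<gamma>_meas: "\<And>j. j \<in> {1..K} \<Longrightarrow> \<gamma> j \<in> borel_measurable P"
    and \<gamma>_sq: "\<And>j. j \<in> {1..K} \<Longrightarrow> integrable P (\<lambda>x. (\<gamma> j x)\<^sup>2)"
    and F_diff: "\<And>j u \<eta> x. j \<in> {1..K} \<Longrightarrow> u \<in> U \<Longrightarrow> \<eta> \<in> Rn (m j) \<Longrightarrow> x \<in> space P \<Longrightarrow>
       differentiable_Rn (m j) (m (j - 1)) (\<lambda>\<eta>. F j u \<eta> x) \<eta>"
    and F_C1: "\<And>j x a b. j \<in> {1..K} \<Longrightarrow> x \<in> space P \<Longrightarrow> a < m (j - 1) \<Longrightarrow> b < m j \<Longrightarrow>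
       continuous_map (prod_topology (top_of_set U) (Euclidean_space (m j))) euclideanreal
         (\<lambda>(u, \<eta>). jac_entry (\<lambda>\<eta>. F j u \<eta> x) \<eta> a b)"
    and val_interior: "\<And>j u. j \<in> {1..K} \<Longrightarrow> u \<in> U \<Longrightarrow>
       nested (vexp P) K F (\<lambda>_ _ _. 0) u (Suc j) \<in> Euclidean_space (m j) interior_of (I j)"
begin

definition val :: "'u \<Rightarrow> nat \<Rightarrow> nat \<Rightarrow> real" where
  "val = nested (vexp P) K F (\<lambda>_ _ _. 0)"

definition fbar :: "nat \<Rightarrow> 'u \<Rightarrow> (nat \<Rightarrow> real) \<Rightarrow> nat \<Rightarrow> real" where
  "fbar j u \<eta> = vexp P (F j u \<eta>)"

definition lip :: "nat \<Rightarrow> real" where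
  "lip j = P.expectation (\<gamma> j)"

lemma val_step: "j \<le> K \<Longrightarrow> val u j = fbar j u (val u (Suc j))"
  unfolding val_def fbar_def by (subst nested.simps) simp

lemma val_last: "val u (Suc K) = (\<lambda>_. 0)"
  unfolding val_def by (subst nested.simps) (simp add: vexp_def)

lemma val_I: "j \<in> {1..K} \<Longrightarrow> u \<in> U \<Longrightarrow> val u (Suc j) \<in> I j"
  unfolding val_def by (rule subsetD[OF interior_of_subset val_interior])

lemma \<gamma>_int: "j \<in> {1..K} \<Longrightarrow> integrable P (\<gamma> j)"
  by (rule P.square_integrable_imp_integrable[OF \<gamma>_meas \<gamma>_sq])

lemma lip_ge: "0 \<le> lip j"
  unfolding lip_def using \<gamma>_ge by (intro integral_nonneg_AE) auto

lemma F_int: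
  assumes "j \<in> {1..K}" "u \<in> U" "\<eta> \<in> I j" "a < m (j - 1)" shows "integrable P (\<lambda>x. F j u \<eta> x a)"
  by (rule P.square_integrable_imp_integrable[OF F_meas F_sq]) (use assms I_Rn in auto)

lemma Rn_0: "v \<in> Rn p \<Longrightarrow> p \<le> b \<Longrightarrow> v b = 0"
  by (simp add: topspace_Euclidean_space)

lemma fbar_lip:
  assumes j: "j \<in> {1..K}" and u: "u \<in> U" "u' \<in> U" and \<eta>: "\<eta> \<in> I j" "\<eta>' \<in> I j" and a: "a < m (j - 1)"
  shows "\<bar>fbar j u \<eta> a - fbar j u' \<eta>' a\<bar> \<le> lip j * (norm (u - u') + dist1 (m j) \<eta> \<eta>')"
proof -
  have "fbar j u \<eta> a - fbar j u' \<eta>' a = (\<integral>x. F j u \<eta> x a - F j u' \<eta>' x a \<partial>P)"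
    unfolding fbar_def vexp_def by (rule Bochner_Integration.integral_diff[symmetric, OF F_int[OF j u(1) \<eta>(1) a] F_int[OF j u(2) \<eta>(2) a]])
  also have "\<bar>\<dots>\<bar> \<le> (\<integral>x. \<bar>F j u \<eta> x a - F j u' \<eta>' x a\<bar> \<partial>P)" by (rule integral_abs_bound)
  also have "\<dots> \<le> (\<integral>x. \<gamma> j x * (norm (u - u') + dist1 (m j) \<eta> \<eta>') \<partial>P)"
    by (rule integral_mono) (auto intro!: F_int j u \<eta> a \<gamma>_int F_lip)
  also have "\<dots> = lip j * (norm (u - u') + dist1 (m j) \<eta> \<eta>')" by (simp add: lip_def)
  finally show ?thesis .
qed

text \<open>Induction from the innermost level outwards, the direction in which
  \<open>nested\<close> and \<open>xi\<close> are computed.\<close>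

lemma down_induct [consumes 1, case_names base step]:
  assumes "j \<in> {1..Suc K}" and "Q (Suc K)" and "\<And>j. j \<in> {1..K} \<Longrightarrow> Q (Suc j) \<Longrightarrow> Q j"
  shows "Q j"
proof -
  have "j \<le> Suc K" using assms(1) by simp
  thus ?thesis
  proof (induction rule: inc_induct)
    case (step i)
    show ?case by (rule assms(3)) (use step assms(1) in auto)
  qed (rule assms(2))
qed

text \<open>A composition of Lipschitz maps, since the values stay in the sets \<open>I j\<close>,
  where \<open>fbar\<close> is Lipschitz.\<close>

lemma val_lip:
  assumes "j \<in> {1..Suc K}"
  shows "\<exists>C\<ge>0. \<forall>u\<in>U. \<forall>u'\<in>U. dist1 (m (j - 1)) (val u j) (val u' j) \<le> C * norm (u - u')"
  using assms
proof (induction rule: down_induct)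
  case base
  show ?case by (intro exI[of _ 0]) (simp add: val_last)
next
  case (step j)
  then obtain C where C: "C \<ge> 0" "\<And>u u'. u \<in> U \<Longrightarrow> u' \<in> U \<Longrightarrow> dist1 (m j) (val u (Suc j)) (val u' (Suc j)) \<le> C * norm (u - u')"
    by auto
  show ?case
  proof (intro exI conjI ballI)
    show "0 \<le> real (m (j - 1)) * (lip j * (1 + C))" using lip_ge C by simp
    fix u u' assume u: "u \<in> U" "u' \<in> U"
    have "\<bar>val u j a - val u' j a\<bar> \<le> lip j * (1 + C) * norm (u - u')" if a: "a < m (j - 1)" for a
    proof -
      have "\<bar>val u j a - val u' j a\<bar> \<le> lip j * (norm (u - u') + dist1 (m j) (val u (Suc j)) (val u' (Suc j)))"
        using step(1) by (simp add: val_step) (intro fbar_lip step u val_I a)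
      also have "\<dots> \<le> lip j * (norm (u - u') + C * norm (u - u'))"
        using C(2)[OF u] lip_ge by (intro mult_left_mono) auto
      finally show ?thesis by (simp add: algebra_simps)
    qed
    hence "dist1 (m (j - 1)) (val u j) (val u' j) \<le> (\<Sum>a<m (j - 1). lip j * (1 + C) * norm (u - u'))"
      unfolding dist1_def by (intro sum_mono) auto
    thus "dist1 (m (j - 1)) (val u j) (val u' j) \<le> real (m (j - 1)) * (lip j * (1 + C)) * norm (u - u')" by simp
  qed
qed

lemma val_Rn: "j \<in> {1..K} \<Longrightarrow> u \<in> U \<Longrightarrow> val u (Suc j) \<in> Rn (m j)"
  using val_I I_Rn by blast

text \<open>The margin to the boundary of \<open>I j\<close> is uniform in \<open>u\<close>:
  offending points would, by compactness of \<open>U\<close> and continuity of \<open>val\<close>,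
  accumulate at one interior value.\<close>

lemma radius_one:
  assumes j: "j \<in> {1..K}"
  shows "\<exists>r>0. \<forall>u\<in>U. \<forall>v\<in>Rn (m j). dist1 (m j) v (val u (Suc j)) \<le> r \<longrightarrow> v \<in> I j"
proof (rule ccontr)
  assume not: "\<not> ?thesis"
  have "\<forall>i::nat. \<exists>u v. u \<in> U \<and> v \<in> Rn (m j) \<and> dist1 (m j) v (val u (Suc j)) \<le> 1 / real (Suc i) \<and> v \<notin> I j"
    using not by (metis of_nat_0_less_iff zero_less_Suc zero_less_divide_1_iff)
  then obtain u v where uv: "\<And>i. u i \<in> U" "\<And>i. v i \<in> Rn (m j)" "\<And>i. dist1 (m j) (v i) (val (u i) (Suc j)) \<le> 1 / real (Suc i)"
    "\<And>i. v i \<notin> I j" by metis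
  obtain u' s where us: "u' \<in> U" "strict_mono s" "(u \<circ> s) \<longlonglongrightarrow> u'"
    using U uv(1) unfolding compact_def by blast
  obtain r where r: "r > 0" "\<And>w. w \<in> Rn (m j) \<Longrightarrow> dist1 (m j) w (val u' (Suc j)) \<le> r \<Longrightarrow> w \<in> I j"
    using interior_dist1[OF val_interior[OF j us(1)]] unfolding val_def by blast
  obtain C where C: "C \<ge> 0" "\<And>u u'. u \<in> U \<Longrightarrow> u' \<in> U \<Longrightarrow> dist1 (m j) (val u (Suc j)) (val u' (Suc j)) \<le> C * norm (u - u')"
    using val_lip[of "Suc j"] j by auto
  have "(\<lambda>i. 1 / real (Suc i) + C * norm (u (s i) - u')) \<longlonglongrightarrow> 0 + C * norm (u' - u')"
    using us(3) unfolding comp_def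
    by (intro tendsto_add tendsto_mult tendsto_const tendsto_norm tendsto_diff LIMSEQ_Suc[OF lim_1_over_n])
  hence "\<forall>\<^sub>F i in sequentially. 1 / real (Suc i) + C * norm (u (s i) - u') < r"
    using r(1) by (intro order_tendstoD(2)) auto
  then obtain i where i: "1 / real (Suc i) + C * norm (u (s i) - u') < r" by (auto simp: eventually_sequentially)
  have "dist1 (m j) (v (s i)) (val u' (Suc j)) \<le> dist1 (m j) (v (s i)) (val (u (s i)) (Suc j)) + dist1 (m j) (val (u (s i)) (Suc j)) (val u' (Suc j))"
    by (rule dist1_triangle)
  also have "\<dots> \<le> 1 / real (Suc (s i)) + C * norm (u (s i) - u')" by (intro add_mono uv C us)
  also have "\<dots> \<le> 1 / real (Suc i) + C * norm (u (s i) - u')"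
    using seq_suble[OF us(2), of i] by (intro add_right_mono divide_left_mono) auto
  finally have "v (s i) \<in> I j" using i by (intro r(2) uv) simp
  thus False using uv(4) by simp
qed

lemma radius:
  "\<exists>r>0. \<forall>j\<in>{1..K}. \<forall>u\<in>U. \<forall>v\<in>Rn (m j). dist1 (m j) v (val u (Suc j)) \<le> r \<longrightarrow> v \<in> I j"
proof -
  have "\<forall>j\<in>{1..K}. \<exists>r>0. \<forall>u\<in>U. \<forall>v\<in>Rn (m j). dist1 (m j) v (val u (Suc j)) \<le> r \<longrightarrow> v \<in> I j"
    using radius_one by blast
  then obtain r where r: "\<And>j. j \<in> {1..K} \<Longrightarrow> r j > 0 \<and> (\<forall>u\<in>U. \<forall>v\<in>Rn (m j). dist1 (m j) v (val u (Suc j)) \<le> r j \<longrightarrow> v \<in> I j)"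
    by metis
  have ne: "r ` {1..K} \<noteq> {}" using K1 by auto
  show ?thesis
  proof (intro exI conjI ballI impI)
    show "Min (r ` {1..K}) > 0" using r ne by (subst Min_gr_iff) auto
    fix j u v assume *: "j \<in> {1..K}" "u \<in> U" "v \<in> Rn (m j)" "dist1 (m j) v (val u (Suc j)) \<le> Min (r ` {1..K})"
    have "Min (r ` {1..K}) \<le> r j" using *(1) by (intro Min_le) auto
    thus "v \<in> I j" using r[OF *(1)] * by fastforce
  qed
qed

definition jac :: "nat \<Rightarrow> 'x \<Rightarrow> nat \<Rightarrow> nat \<Rightarrow> real" where
  "jac j x a b = jac_entry (\<lambda>\<eta>. F j uhat \<eta> x) (val uhat (Suc j)) a b"

definition jac_mean :: "nat \<Rightarrow> nat \<Rightarrow> nat \<Rightarrow> real" where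
  "jac_mean j a b = P.expectation (\<lambda>x. jac j x a b)"

text \<open>The entry is a limit of difference quotients of \<open>F\<close>. Since the value at
  \<open>uhat\<close> is interior to \<open>I j\<close>, the shifted points eventually lie in
  \<open>I j\<close>, where the Lipschitz factor bounds each quotient.\<close>

lemma jac_bound:
  assumes j: "j \<in> {1..K}" and a: "a < m (j - 1)" and b: "b < m j"
  shows "(\<lambda>x. jac j x a b) \<in> borel_measurable P" "\<And>x. x \<in> space P \<Longrightarrow> \<bar>jac j x a b\<bar> \<le> \<gamma> j x"
proof -
  let ?\<mu> = "val uhat (Suc j)"
  let ?v = "\<lambda>n. ?\<mu>(b := ?\<mu> b + 1 / real (Suc n))"
  have \<mu>: "?\<mu> \<in> Rn (m j)" "?\<mu> \<in> I j" using val_Rn val_I j uhat by auto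
  have v: "?v n \<in> Rn (m j)" for n using \<mu> b by (simp add: topspace_Euclidean_space)
  have lim: "(\<lambda>n. real (Suc n) * (F j uhat (?v n) x a - F j uhat ?\<mu> x a)) \<longlonglongrightarrow> jac j x a b" if "x \<in> space P" for x
    unfolding jac_def by (rule jac_entry_tendsto[OF F_diff[OF j uhat \<mu>(1) that] a b \<mu>(1)])
  show "(\<lambda>x. jac j x a b) \<in> borel_measurable P"
    by (rule borel_measurable_LIMSEQ_real[OF lim])
      (assumption, rule borel_measurable_times[OF borel_measurable_const borel_measurable_diff[OF F_meas[OF j uhat v] F_meas[OF j uhat \<mu>(1)]]])
  fix x assume x: "x \<in> space P"
  obtain r where r: "r > 0" "\<And>w. w \<in> Rn (m j) \<Longrightarrow> dist1 (m j) w ?\<mu> \<le> r \<Longrightarrow> w \<in> I j"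
    using radius j uhat by blast
  obtain N where N: "1 / real (Suc N) < r" using reals_Archimedean[OF r(1)] by (auto simp: inverse_eq_divide)
  show "\<bar>jac j x a b\<bar> \<le> \<gamma> j x"
  proof (rule LIMSEQ_le_const2[OF tendsto_rabs[OF lim[OF x]]], rule exI[of _ N], rule allI, rule impI)
    fix n assume n: "n \<ge> N"
    have "dist1 (m j) (?v n) ?\<mu> = (\<Sum>c<m j. if c = b then 1 / real (Suc n) else 0)" unfolding dist1_def by (intro sum.cong) auto
    hence d: "dist1 (m j) (?v n) ?\<mu> = 1 / real (Suc n)" using b by simp
    have "1 / real (Suc n) \<le> 1 / real (Suc N)" using n by (intro divide_left_mono) auto
    hence "?v n \<in> I j" using N d by (intro r(2) v) simp
    hence "\<bar>F j uhat (?v n) x a - F j uhat ?\<mu> x a\<bar> \<le> \<gamma> j x * (norm (uhat - uhat) + dist1 (m j) (?v n) ?\<mu>)"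
      by (intro F_lip j uhat \<mu> x a)
    also have "\<dots> = \<gamma> j x / real (Suc n)" unfolding d by simp
    finally have "real (Suc n) * \<bar>F j uhat (?v n) x a - F j uhat ?\<mu> x a\<bar> \<le> \<gamma> j x"
      by (simp add: pos_le_divide_eq mult.commute del: of_nat_Suc)
    thus "\<bar>real (Suc n) * (F j uhat (?v n) x a - F j uhat ?\<mu> x a)\<bar> \<le> \<gamma> j x"
      by (simp add: abs_mult del: of_nat_Suc)
  qed
qed

lemma jac_int:
  assumes j: "j \<in> {1..K}" and a: "a < m (j - 1)" and b: "b < m j"
  shows "integrable P (\<lambda>x. jac j x a b)"
  by (rule Bochner_Integration.integrable_bound[OF \<gamma>_int[OF j] jac_bound(1)[OF assms]])
    (use jac_bound(2)[OF assms] \<gamma>_ge in \<open>auto intro!: AE_I2\<close>)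

text \<open>Strict differentiability at the optimal solution, uniformly in \<open>u\<close> near it; the interchange of
  derivative and expectation is dominated convergence with the Lipschitz constant as bound.\<close>

lemma fbar_strict_diff_coord:
  assumes j: "j \<in> {1..K}" and a: "a < m (j - 1)" and \<epsilon>: "\<epsilon> > 0"
  shows "\<exists>\<delta>>0. \<forall>u\<in>U. \<forall>\<eta>\<in>Rn (m j). \<forall>\<eta>'\<in>Rn (m j).
    norm (u - uhat) \<le> \<delta> \<longrightarrow> dist1 (m j) \<eta> (val uhat (Suc j)) \<le> \<delta> \<longrightarrow> dist1 (m j) \<eta>' (val uhat (Suc j)) \<le> \<delta> \<longrightarrow>
    \<bar>fbar j u \<eta>' a - fbar j u \<eta> a - (\<Sum>b<m j. jac_mean j a b * (\<eta>' b - \<eta> b))\<bar> \<le> \<epsilon> * dist1 (m j) \<eta>' \<eta>"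
proof (rule ccontr)
  assume not: "\<not> ?thesis"
  let ?\<mu> = "val uhat (Suc j)"
  let ?p = "m j"
  have \<mu>: "?\<mu> \<in> Rn ?p" using val_Rn j uhat by auto
  obtain r where r: "r > 0" "\<And>w. w \<in> Rn ?p \<Longrightarrow> dist1 ?p w ?\<mu> \<le> r \<Longrightarrow> w \<in> I j"
    using radius j uhat by blast
  let ?Q = "\<lambda>\<delta> u \<eta> \<eta>'. u \<in> U \<and> \<eta> \<in> Rn ?p \<and> \<eta>' \<in> Rn ?p \<and> norm (u - uhat) \<le> \<delta> \<and> dist1 ?p \<eta> ?\<mu> \<le> \<delta> \<and> dist1 ?p \<eta>' ?\<mu> \<le> \<delta> \<and>
    \<bar>fbar j u \<eta>' a - fbar j u \<eta> a - (\<Sum>b<?p. jac_mean j a b * (\<eta>' b - \<eta> b))\<bar> > \<epsilon> * dist1 ?p \<eta>' \<eta>"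
  have "\<exists>u \<eta> \<eta>'. ?Q \<delta> u \<eta> \<eta>'" if "\<delta> > 0" for \<delta> using not that by (meson not_le)
  hence ex: "\<exists>w. ?Q (r / real (Suc i)) (fst w) (fst (snd w)) (snd (snd w))" for i
  proof -
    have "r / real (Suc i) > 0" using r(1) by simp
    with \<open>\<And>\<delta>. \<delta> > 0 \<Longrightarrow> \<exists>u \<eta> \<eta>'. ?Q \<delta> u \<eta> \<eta>'\<close> obtain u \<eta> \<eta>' where "?Q (r / real (Suc i)) u \<eta> \<eta>'" by blast
    thus ?thesis by (intro exI[of _ "(u, \<eta>, \<eta>')"]) (unfold fst_conv snd_conv)
  qed
  \<comment> \<open>A sequence of counterexamples at scales \<open>r / real (Suc i)\<close>; the
    factor \<open>r\<close> keeps all points inside \<open>I j\<close>, where the bounds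
    hold.\<close>
  define w where "w i = (SOME w. ?Q (r / real (Suc i)) (fst w) (fst (snd w)) (snd (snd w)))" for i
  have w: "?Q (r / real (Suc i)) (fst (w i)) (fst (snd (w i))) (snd (snd (w i)))" for i
    unfolding w_def by (rule someI_ex[OF ex])
  define u \<eta> \<eta>' where "u i = fst (w i)" and "\<eta> i = fst (snd (w i))" and "\<eta>' i = snd (snd (w i))" for i
  have Q: "?Q (r / real (Suc i)) (u i) (\<eta> i) (\<eta>' i)" for i unfolding u_def \<eta>_def \<eta>'_def by (rule w)
  have u: "u i \<in> U" and \<eta>: "\<eta> i \<in> Rn ?p" and \<eta>': "\<eta>' i \<in> Rn ?p" for i using Q[of i] by auto
  have rS: "r / real (Suc i) \<le> r" for i using r(1) by (simp add: divide_le_eq)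
  have I: "\<eta> i \<in> I j" "\<eta>' i \<in> I j" for i using Q[of i] rS[of i] by (auto intro!: r(2))
  have r0: "(\<lambda>i. r / real (Suc i)) \<longlonglongrightarrow> 0"
    using tendsto_mult_right_zero[OF LIMSEQ_Suc[OF lim_1_over_n], of r] by simp
  have u_lim: "u \<longlonglongrightarrow> uhat"
  proof (rule LIM_zero_cancel)
    have le: "norm (u i - uhat) \<le> r / real (Suc i)" for i using Q[of i] by blast
    show "(\<lambda>i. u i - uhat) \<longlonglongrightarrow> 0" by (rule Lim_null_comparison[OF always_eventually[OF allI[OF le]] r0])
  qed
  have e_lim: "(\<lambda>i. dist1 ?p (\<eta> i) ?\<mu>) \<longlonglongrightarrow> 0" "(\<lambda>i. dist1 ?p (\<eta>' i) ?\<mu>) \<longlonglongrightarrow> 0"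
  proof -
    have le: "norm (dist1 ?p (\<eta> i) ?\<mu>) \<le> r / real (Suc i)" "norm (dist1 ?p (\<eta>' i) ?\<mu>) \<le> r / real (Suc i)" for i
      using Q[of i] unfolding real_norm_def abs_of_nonneg[OF dist1_nonneg] by blast+
    show "(\<lambda>i. dist1 ?p (\<eta> i) ?\<mu>) \<longlonglongrightarrow> 0" by (rule Lim_null_comparison[OF always_eventually[OF allI[OF le(1)]] r0])
    show "(\<lambda>i. dist1 ?p (\<eta>' i) ?\<mu>) \<longlonglongrightarrow> 0" by (rule Lim_null_comparison[OF always_eventually[OF allI[OF le(2)]] r0])
  qed
  define L where "L i = dist1 ?p (\<eta>' i) (\<eta> i)" for i
  have L: "L i > 0" for i
  proof -
    have "\<eta>' i \<noteq> \<eta> i" using Q[of i] by auto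
    thus ?thesis unfolding L_def by (rule dist1_pos[OF \<eta>' \<eta>])
  qed
  \<comment> \<open>The linearization error relative to the size of the increment. At each
    \<open>x\<close> it tends to 0 by the mean value theorem and the continuity of the derivative,
    and it is dominated by \<open>2 * \<gamma> j x\<close>.\<close>
  define q where "q i x = \<bar>F j (u i) (\<eta>' i) x a - F j (u i) (\<eta> i) x a - (\<Sum>b<?p. jac j x a b * (\<eta>' i b - \<eta> i b))\<bar> / L i" for i x
  have lin: "\<bar>\<Sum>b<?p. c b * (\<eta>' i b - \<eta> i b)\<bar> \<le> C * L i" if "\<And>b. b < ?p \<Longrightarrow> \<bar>c b\<bar> \<le> C" for c C i
  proof -
    have "\<bar>\<Sum>b<?p. c b * (\<eta>' i b - \<eta> i b)\<bar> \<le> (\<Sum>b<?p. C * \<bar>\<eta>' i b - \<eta> i b\<bar>)"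
      by (rule order_trans[OF sum_abs], rule sum_mono) (auto simp: abs_mult intro!: mult_right_mono that)
    thus ?thesis by (simp add: L_def dist1_def sum_distrib_left)
  qed
  have q_lim: "(\<lambda>i. q i x) \<longlonglongrightarrow> 0" if x: "x \<in> space P" for x
  proof -
    let ?J = "\<lambda>i t b. jac_entry (\<lambda>\<eta>. F j (u i) \<eta> x) (seg (\<eta> i) (\<eta>' i) t) a b"
    let ?E = "\<lambda>i t. t \<in> {0..1} \<and> F j (u i) (\<eta>' i) x a - F j (u i) (\<eta> i) x a = (\<Sum>b<?p. ?J i t b * (\<eta>' i b - \<eta> i b))"
    have ex: "\<exists>t. ?E i t" for i
      using mean_value_Rn[OF F_diff[OF j u _ x] a \<eta> \<eta>', of i i i] by blast
    obtain t where "\<forall>i. ?E i (t i)" using choice[OF allI[OF ex]] by (rule exE)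
    hence E: "?E i (t i)" for i by (rule spec)
    note t = conjunct1[OF E] conjunct2[OF E]
    let ?z = "\<lambda>i. seg (\<eta> i) (\<eta>' i) (t i)"
    have zR: "?z i \<in> Rn ?p" for i by (rule seg_Rn[OF \<eta> \<eta>'])
    have z_lim: "(\<lambda>i. dist1 ?p (?z i) ?\<mu>) \<longlonglongrightarrow> 0"
    proof (rule Lim_null_comparison)
      show "\<forall>\<^sub>F i in sequentially. norm (dist1 ?p (?z i) ?\<mu>) \<le> dist1 ?p (\<eta> i) ?\<mu> + dist1 ?p (\<eta>' i) ?\<mu>"
        using dist1_seg[OF t(1)] by (intro always_eventually allI) simp
      show "(\<lambda>i. dist1 ?p (\<eta> i) ?\<mu> + dist1 ?p (\<eta>' i) ?\<mu>) \<longlonglongrightarrow> 0" using tendsto_add[OF e_lim] by simp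
    qed
    have J_lim: "(\<lambda>i. ?J i (t i) b) \<longlonglongrightarrow> jac j x a b" if b: "b < ?p" for b
      unfolding jac_def using u uhat u_lim zR \<mu> z_lim
      by (rule continuous_map_seq[OF F_C1[OF j x a b], where u = u and v = ?z and w = ?\<mu>])
    have "(\<lambda>i. \<Sum>b<?p. \<bar>?J i (t i) b - jac j x a b\<bar>) \<longlonglongrightarrow> (\<Sum>b<?p. \<bar>jac j x a b - jac j x a b\<bar>)"
      by (intro tendsto_sum tendsto_rabs tendsto_diff tendsto_const J_lim) auto
    hence S: "(\<lambda>i. \<Sum>b<?p. \<bar>?J i (t i) b - jac j x a b\<bar>) \<longlonglongrightarrow> 0" by simp
    show ?thesis
    proof (rule Lim_null_comparison[OF always_eventually S], rule allI)
      fix i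
      have "F j (u i) (\<eta>' i) x a - F j (u i) (\<eta> i) x a - (\<Sum>b<?p. jac j x a b * (\<eta>' i b - \<eta> i b)) =
        (\<Sum>b<?p. (?J i (t i) b - jac j x a b) * (\<eta>' i b - \<eta> i b))"
        unfolding t(2) by (simp add: sum_subtractf left_diff_distrib)
      moreover have "\<bar>\<Sum>b<?p. (?J i (t i) b - jac j x a b) * (\<eta>' i b - \<eta> i b)\<bar> \<le> (\<Sum>b<?p. \<bar>?J i (t i) b - jac j x a b\<bar>) * L i"
      proof (rule lin)
        fix b assume "b < ?p"
        thus "\<bar>?J i (t i) b - jac j x a b\<bar> \<le> (\<Sum>b<?p. \<bar>?J i (t i) b - jac j x a b\<bar>)"
          by (intro member_le_sum[of b "{..<?p}" "\<lambda>b. \<bar>?J i (t i) b - jac j x a b\<bar>"]) auto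
      qed
      ultimately show "norm (q i x) \<le> (\<Sum>b<?p. \<bar>?J i (t i) b - jac j x a b\<bar>)"
        using L[of i] by (simp add: q_def divide_le_eq)
    qed
  qed
  have qm: "q i \<in> borel_measurable P" for i
  proof -
    note [measurable] = F_meas[OF j u \<eta>'] F_meas[OF j u \<eta>] jac_bound(1)[OF j a]
    show ?thesis unfolding q_def[abs_def] by measurable
  qed
  have q_le: "\<bar>q i x\<bar> \<le> 2 * \<gamma> j x" if x: "x \<in> space P" for i x
  proof -
    have "\<bar>F j (u i) (\<eta>' i) x a - F j (u i) (\<eta> i) x a\<bar> \<le> \<gamma> j x * L i"
      using F_lip[OF j u u I(2) I(1) x a, of i i i i] by (simp add: L_def)
    moreover have "\<bar>\<Sum>b<?p. jac j x a b * (\<eta>' i b - \<eta> i b)\<bar> \<le> \<gamma> j x * L i"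
      by (rule lin) (rule jac_bound(2)[OF j a _ x])
    ultimately have "\<bar>F j (u i) (\<eta>' i) x a - F j (u i) (\<eta> i) x a - (\<Sum>b<?p. jac j x a b * (\<eta>' i b - \<eta> i b))\<bar> \<le> 2 * \<gamma> j x * L i"
      by linarith
    thus ?thesis using L[of i] by (simp add: q_def divide_le_eq)
  qed
  have "(\<lambda>i. \<integral>x. q i x \<partial>P) \<longlonglongrightarrow> (\<integral>x. 0 \<partial>P)"
  proof (rule integral_dominated_convergence[where w = "\<lambda>x. 2 * \<gamma> j x"])
    show "integrable P (\<lambda>x. 2 * \<gamma> j x)" using \<gamma>_int[OF j] by simp
    show "AE x in P. (\<lambda>i. q i x) \<longlonglongrightarrow> 0" by (rule AE_I2) (rule q_lim)
    show "AE x in P. norm (q i x) \<le> 2 * \<gamma> j x" for i unfolding real_norm_def by (rule AE_I2) (rule q_le)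
  qed (rule borel_measurable_const qm)+
  hence "\<forall>\<^sub>F i in sequentially. (\<integral>x. q i x \<partial>P) < \<epsilon>" using \<epsilon> by (intro order_tendstoD(2)) auto
  then obtain i where i: "(\<integral>x. q i x \<partial>P) < \<epsilon>" by (auto simp: eventually_sequentially)
  let ?d = "\<lambda>x. F j (u i) (\<eta>' i) x a - F j (u i) (\<eta> i) x a - (\<Sum>b<?p. jac j x a b * (\<eta>' i b - \<eta> i b))"
  have int: "integrable P (\<lambda>x. \<Sum>b<?p. jac j x a b * (\<eta>' i b - \<eta> i b))"
    by (intro Bochner_Integration.integrable_sum integrable_mult_left jac_int j a) auto
  have sum: "(\<integral>x. (\<Sum>b<?p. jac j x a b * (\<eta>' i b - \<eta> i b)) \<partial>P) = (\<Sum>b<?p. jac_mean j a b * (\<eta>' i b - \<eta> i b))"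
    unfolding jac_mean_def using jac_int[OF j a] by (subst Bochner_Integration.integral_sum) auto
  have F': "integrable P (\<lambda>x. F j (u i) (\<eta> i) x a)" "integrable P (\<lambda>x. F j (u i) (\<eta>' i) x a)"
    by (rule F_int[OF j u I(1) a], rule F_int[OF j u I(2) a])
  have eq: "fbar j (u i) (\<eta>' i) a - fbar j (u i) (\<eta> i) a - (\<Sum>b<?p. jac_mean j a b * (\<eta>' i b - \<eta> i b)) = (\<integral>x. ?d x \<partial>P)"
    unfolding sum[symmetric] fbar_def vexp_def Bochner_Integration.integral_diff[OF Bochner_Integration.integrable_diff[OF F'(2,1)] int]
      Bochner_Integration.integral_diff[OF F'(2,1)] ..
  have "\<bar>\<integral>x. ?d x \<partial>P\<bar> \<le> (\<integral>x. \<bar>?d x\<bar> \<partial>P)" by (rule integral_abs_bound)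
  moreover have "(\<integral>x. \<bar>?d x\<bar> \<partial>P) = L i * (\<integral>x. q i x \<partial>P)" using L[of i] by (simp add: q_def)
  moreover have "L i * (\<integral>x. q i x \<partial>P) \<le> \<epsilon> * L i" using i L[of i] by (simp add: mult.commute)
  ultimately have "\<bar>\<integral>x. ?d x \<partial>P\<bar> \<le> \<epsilon> * L i" by linarith
  moreover have "\<bar>\<integral>x. ?d x \<partial>P\<bar> > \<epsilon> * L i" unfolding eq[symmetric] L_def using Q[of i] by blast
  ultimately show False by linarith
qed

lemma fbar_strict_diff:
  assumes j: "j \<in> {1..K}" and \<epsilon>: "\<epsilon> > 0"
  shows "\<exists>\<delta>>0. \<forall>a<m (j - 1). \<forall>u\<in>U. \<forall>\<eta>\<in>Rn (m j). \<forall>\<eta>'\<in>Rn (m j).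
    norm (u - uhat) \<le> \<delta> \<longrightarrow> dist1 (m j) \<eta> (val uhat (Suc j)) \<le> \<delta> \<longrightarrow> dist1 (m j) \<eta>' (val uhat (Suc j)) \<le> \<delta> \<longrightarrow>
    \<bar>fbar j u \<eta>' a - fbar j u \<eta> a - (\<Sum>b<m j. jac_mean j a b * (\<eta>' b - \<eta> b))\<bar> \<le> \<epsilon> * dist1 (m j) \<eta>' \<eta>"
proof -
  let ?Q = "\<lambda>a \<delta>. \<forall>u\<in>U. \<forall>\<eta>\<in>Rn (m j). \<forall>\<eta>'\<in>Rn (m j).
    norm (u - uhat) \<le> \<delta> \<longrightarrow> dist1 (m j) \<eta> (val uhat (Suc j)) \<le> \<delta> \<longrightarrow> dist1 (m j) \<eta>' (val uhat (Suc j)) \<le> \<delta> \<longrightarrow>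
    \<bar>fbar j u \<eta>' a - fbar j u \<eta> a - (\<Sum>b<m j. jac_mean j a b * (\<eta>' b - \<eta> b))\<bar> \<le> \<epsilon> * dist1 (m j) \<eta>' \<eta>"
  have mono: "?Q a \<delta>" if "?Q a \<delta>'" "\<delta> \<le> \<delta>'" for a \<delta> \<delta>' using that by (meson order_trans)
  define d where "d a = (SOME \<delta>. \<delta> > 0 \<and> ?Q a \<delta>)" for a
  have d: "d a > 0 \<and> ?Q a (d a)" if "a < m (j - 1)" for a
    unfolding d_def by (rule someI_ex[OF fbar_strict_diff_coord[OF j that \<epsilon>]])
  define D where "D = Min (insert 1 (d ` {..<m (j - 1)}))"
  have "D > 0" unfolding D_def using d by (subst Min_gr_iff) auto
  moreover have "?Q a D" if a: "a < m (j - 1)" for a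
  proof (rule mono[OF conjunct2[OF d[OF a]]])
    show "D \<le> d a" unfolding D_def using a by (intro Min_le) auto
  qed
  ultimately show ?thesis by blast
qed

end

section \<open>Expansion of perturbed compositions\<close>

context composite
begin

text \<open>A sample of size \<open>n\<close> acts as a perturbation \<open>h / sqrt n\<close> of the level functions \<open>fbar\<close>; \<open>v\<close> is the
  resulting perturbed composition.\<close>

definition perturbed :: "nat \<Rightarrow> (nat \<Rightarrow> 'u \<Rightarrow> (nat \<Rightarrow> real) \<Rightarrow> nat \<Rightarrow> real) \<Rightarrow> ('u \<Rightarrow> nat \<Rightarrow> nat \<Rightarrow> real) \<Rightarrow> bool" where
  "perturbed n h v \<longleftrightarrow> (\<forall>u\<in>U. v u (Suc K) = (\<lambda>_. 0)) \<and>
     (\<forall>u\<in>U. \<forall>j\<in>{1..K}. v u (Suc j) \<in> Rn (m j)) \<and>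
     (\<forall>u\<in>U. \<forall>j\<in>{1..K}. \<forall>a<m (j - 1). v u j a = fbar j u (v u (Suc j)) a + h j u (v u (Suc j)) a / sqrt (real n))"

text \<open>The perturbation is controlled on the sets \<open>I j\<close> only;
  \<open>perturbed_close\<close> has to bring the perturbed values there before the bound can be
  used.\<close>

definition bounded_by :: "real \<Rightarrow> (nat \<Rightarrow> 'u \<Rightarrow> (nat \<Rightarrow> real) \<Rightarrow> nat \<Rightarrow> real) \<Rightarrow> bool" where
  "bounded_by C h \<longleftrightarrow> (\<forall>j\<in>{1..K}. \<forall>u\<in>U. \<forall>\<eta>\<in>I j. \<forall>a<m (j - 1). \<bar>h j u \<eta> a\<bar> \<le> C)"

definition modulus :: "real \<Rightarrow> real \<Rightarrow> (nat \<Rightarrow> 'u \<Rightarrow> (nat \<Rightarrow> real) \<Rightarrow> nat \<Rightarrow> real) \<Rightarrow> bool" where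
  "modulus \<rho> e h \<longleftrightarrow> (\<forall>j\<in>{1..K}. \<forall>u\<in>U. \<forall>u'\<in>U. \<forall>\<eta>\<in>I j. \<forall>\<eta>'\<in>I j. \<forall>a<m (j - 1).
     norm (u - u') + dist1 (m j) \<eta> \<eta>' \<le> \<rho> \<longrightarrow> \<bar>h j u \<eta> a - h j u' \<eta>' a\<bar> \<le> e)"

lemma modulus_mono: "modulus \<rho> e h \<Longrightarrow> e \<le> e' \<Longrightarrow> modulus \<rho> e' h"
  unfolding modulus_def by (meson order_trans)

lemma perturbedD:
  assumes "perturbed n h v" "u \<in> U"
  shows "v u (Suc K) = (\<lambda>_. 0)" "j \<in> {1..K} \<Longrightarrow> v u (Suc j) \<in> Rn (m j)"
    "j \<in> {1..K} \<Longrightarrow> a < m (j - 1) \<Longrightarrow> v u j a = fbar j u (v u (Suc j)) a + h j u (v u (Suc j)) a / sqrt (real n)"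
  using assms unfolding perturbed_def by blast+

text \<open>From the innermost level outwards: an error of order \<open>1 / sqrt (real n)\<close> at
  one level is eventually smaller than the margin of \<open>radius\<close>, so the next level is
  evaluated inside \<open>I j\<close>, where \<open>fbar\<close> is Lipschitz and \<open>h\<close>
  bounded.\<close>

lemma perturbed_close:
  assumes "j \<in> {1..Suc K}" and C: "C \<ge> 0"
  shows "\<exists>C'\<ge>0. \<exists>n0. \<forall>n\<ge>n0. \<forall>h v. n \<ge> 1 \<longrightarrow> perturbed n h v \<longrightarrow> bounded_by C h \<longrightarrow>
    (\<forall>u\<in>U. dist1 (m (j - 1)) (v u j) (val u j) \<le> C' / sqrt (real n))"
  using assms(1)
proof (induction rule: down_induct)
  case base
  show ?case by (intro exI[of _ 0]) (auto simp: val_last perturbedD(1))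
next
  case (step j)
  then obtain C' n0 where C': "C' \<ge> 0" "\<And>n h v u. n \<ge> n0 \<Longrightarrow> n \<ge> 1 \<Longrightarrow> perturbed n h v \<Longrightarrow> bounded_by C h \<Longrightarrow> u \<in> U \<Longrightarrow>
    dist1 (m j) (v u (Suc j)) (val u (Suc j)) \<le> C' / sqrt (real n)" unfolding diff_Suc_1 by blast
  obtain r where r: "r > 0" "\<And>u v. u \<in> U \<Longrightarrow> v \<in> Rn (m j) \<Longrightarrow> dist1 (m j) v (val u (Suc j)) \<le> r \<Longrightarrow> v \<in> I j"
    using radius step(1) by blast
  obtain n1 :: nat where n1: "n1 \<ge> (C' / r)\<^sup>2" using real_arch_simple by blast
  let ?D = "real (m (j - 1)) * (lip j * C' + C)"
  have D: "?D \<ge> 0" using lip_ge[of j] C' C by simp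
  have "\<forall>u\<in>U. dist1 (m (j - 1)) (v u j) (val u j) \<le> ?D / sqrt (real n)"
    if n: "n \<ge> max n0 n1" "n \<ge> 1" and v: "perturbed n h v" and h: "bounded_by C h" for n h v
  proof
    fix u assume u: "u \<in> U"
    have cl: "dist1 (m j) (v u (Suc j)) (val u (Suc j)) \<le> C' / sqrt (real n)" using n by (intro C'(2)[OF _ _ v h u]) auto
    have "C' / r \<le> sqrt (real n)"
    proof (rule real_le_rsqrt)
      show "(C' / r)\<^sup>2 \<le> real n" using n1 n(1) by linarith
    qed
    hence "C' / sqrt (real n) \<le> r" using r(1) n(2) by (simp add: divide_le_eq mult.commute)
    hence vI: "v u (Suc j) \<in> I j" using cl by (intro r(2)[OF u perturbedD(2)[OF v u step(1)]]) simp
    have "\<bar>v u j a - val u j a\<bar> \<le> (lip j * C' + C) / sqrt (real n)" if a: "a < m (j - 1)" for a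
    proof -
      have "v u j a - val u j a = (fbar j u (v u (Suc j)) a - fbar j u (val u (Suc j)) a) + h j u (v u (Suc j)) a / sqrt (real n)"
        using perturbedD(3)[OF v u step(1) a] step(1) by (simp add: val_step)
      moreover have "\<bar>fbar j u (v u (Suc j)) a - fbar j u (val u (Suc j)) a\<bar> \<le> lip j * (norm (u - u) + dist1 (m j) (v u (Suc j)) (val u (Suc j)))"
        by (rule fbar_lip[OF step(1) u u vI val_I[OF step(1) u] a])
      moreover have "\<dots> \<le> lip j * (C' / sqrt (real n))" using cl lip_ge[of j] by (intro mult_left_mono) auto
      moreover have "\<bar>h j u (v u (Suc j)) a / sqrt (real n)\<bar> \<le> C / sqrt (real n)"
        using h step(1) u vI a unfolding bounded_by_def by (simp add: divide_right_mono)
      ultimately show ?thesis unfolding add_divide_distrib times_divide_eq_right by linarith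
    qed
    hence "dist1 (m (j - 1)) (v u j) (val u j) \<le> (\<Sum>a<m (j - 1). (lip j * C' + C) / sqrt (real n))"
      unfolding dist1_def by (intro sum_mono) auto
    thus "dist1 (m (j - 1)) (v u j) (val u j) \<le> ?D / sqrt (real n)" by simp
  qed
  thus ?case using D by blast
qed

text \<open>The innermost vector is 0 because \<open>val u (Suc K)\<close> is the constant 0; the
  normal vector of the problem enters as the functional argument of level \<open>K\<close>.\<close>

definition Xi :: "(nat \<Rightarrow> 'u \<Rightarrow> (nat \<Rightarrow> real) \<Rightarrow> nat \<Rightarrow> real) \<Rightarrow> nat \<Rightarrow> nat \<Rightarrow> real" where
  "Xi h = xi P K m F uhat (val uhat) (\<lambda>j \<eta> a. h j uhat \<eta> a, \<lambda>_. 0)"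

lemma Xi_last: "Xi h (Suc K) = (\<lambda>_. 0)"
  unfolding Xi_def by (subst xi.simps) simp

lemma Xi_step:
  assumes j: "j \<in> {1..K}" and a: "a < m (j - 1)"
  shows "Xi h j a = (\<Sum>b<m j. jac_mean j a b * Xi h (Suc j) b) + h j uhat (val uhat (Suc j)) a"
proof -
  have "Xi h j a = (\<integral>x. (\<Sum>b<m j. jac j x a b * Xi h (Suc j) b) \<partial>P) + h j uhat (val uhat (Suc j)) a"
    unfolding Xi_def using j by (subst xi.simps) (simp add: jac_def)
  also have "(\<integral>x. (\<Sum>b<m j. jac j x a b * Xi h (Suc j) b) \<partial>P) = (\<Sum>b<m j. jac_mean j a b * Xi h (Suc j) b)"
    unfolding jac_mean_def using jac_int[OF j a] by (subst Bochner_Integration.integral_sum) auto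
  finally show ?thesis .
qed

text \<open>The order of quantifiers anticipates the probabilistic use: the tolerance
  \<open>e\<close> is fixed before \<open>\<rho>\<close> is known, since equicontinuity answers a
  given \<open>e\<close> with some \<open>\<rho>\<close>; only then are \<open>\<delta>\<close> and
  \<open>n0\<close> determined.\<close>

lemma perturbed_expansion:
  assumes "j \<in> {1..Suc K}" and C: "C \<ge> 0"
  shows "\<forall>\<epsilon>>0. \<exists>e>0. \<forall>\<rho>>0. \<exists>\<delta>>0. \<exists>n0. \<forall>n\<ge>n0. \<forall>h v. n \<ge> 1 \<longrightarrow> perturbed n h v \<longrightarrow> bounded_by C h \<longrightarrow> modulus \<rho> e h \<longrightarrow>
    (\<forall>u\<in>U. norm (u - uhat) \<le> \<delta> \<longrightarrow> (\<forall>a<m (j - 1). \<bar>sqrt (real n) * (v u j a - val u j a) - Xi h j a\<bar> \<le> \<epsilon>))"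
  using assms(1)
proof (induction rule: down_induct)
  case base
  show ?case
  proof (intro allI impI)
    fix \<epsilon> :: real assume "\<epsilon> > 0"
    thus "\<exists>e>0. \<forall>\<rho>>0. \<exists>\<delta>>0. \<exists>n0. \<forall>n\<ge>n0. \<forall>h v. n \<ge> 1 \<longrightarrow> perturbed n h v \<longrightarrow> bounded_by C h \<longrightarrow> modulus \<rho> e h \<longrightarrow>
      (\<forall>u\<in>U. norm (u - uhat) \<le> \<delta> \<longrightarrow> (\<forall>a<m (Suc K - 1). \<bar>sqrt (real n) * (v u (Suc K) a - val u (Suc K) a) - Xi h (Suc K) a\<bar> \<le> \<epsilon>))"
      by (intro exI[of _ 1]) (auto simp: val_last Xi_last perturbedD(1) intro!: exI[of _ "1::real"])
  qed
next
  case (step j)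
  let ?\<mu> = "val uhat (Suc j)"
  have Sj: "Suc j \<in> {1..Suc K}" using step(1) by simp
  have \<mu>: "?\<mu> \<in> Rn (m j)" "?\<mu> \<in> I j" using val_Rn[OF step(1) uhat] val_I[OF step(1) uhat] .
  obtain C1 n1 where C1: "C1 \<ge> 0" "\<And>n h v u. n \<ge> n1 \<Longrightarrow> n \<ge> 1 \<Longrightarrow> perturbed n h v \<Longrightarrow> bounded_by C h \<Longrightarrow> u \<in> U \<Longrightarrow>
    dist1 (m j) (v u (Suc j)) (val u (Suc j)) \<le> C1 / sqrt (real n)"
    using perturbed_close[OF Sj C] unfolding diff_Suc_1 by blast
  obtain C2 where C2: "C2 \<ge> 0" "\<And>u u'. u \<in> U \<Longrightarrow> u' \<in> U \<Longrightarrow> dist1 (m j) (val u (Suc j)) (val u' (Suc j)) \<le> C2 * norm (u - u')"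
    using val_lip[of "Suc j"] step(1) by auto
  obtain r where r: "r > 0" "\<And>w. w \<in> Rn (m j) \<Longrightarrow> dist1 (m j) w ?\<mu> \<le> r \<Longrightarrow> w \<in> I j"
    using radius step(1) uhat by blast
  define A where "A = (\<Sum>a<m (j - 1). \<Sum>b<m j. \<bar>jac_mean j a b\<bar>)"
  have A: "A \<ge> 0" "a < m (j - 1) \<Longrightarrow> (\<Sum>b<m j. \<bar>jac_mean j a b\<bar>) \<le> A" for a
  proof -
    show "A \<ge> 0" unfolding A_def by (intro sum_nonneg abs_ge_zero)
    assume "a < m (j - 1)"
    thus "(\<Sum>b<m j. \<bar>jac_mean j a b\<bar>) \<le> A" unfolding A_def
      by (intro member_le_sum[of a "{..<m (j - 1)}" "\<lambda>a. \<Sum>b<m j. \<bar>jac_mean j a b\<bar>"] sum_nonneg) auto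
  qed
  show ?case
  proof (intro allI impI)
    fix \<epsilon> :: real assume \<epsilon>: "\<epsilon> > 0"
    \<comment> \<open>The error is split into thirds: the remainder of strict differentiability, the
      error of the inner level transported by the mean Jacobian, and the modulus of
      \<open>h\<close>. The added 1 excludes division by 0.\<close>
    define \<epsilon>1 where "\<epsilon>1 = \<epsilon> / (3 * (C1 + 1))"
    define \<epsilon>2 where "\<epsilon>2 = \<epsilon> / (3 * (A + 1))"
    have \<epsilon>1: "\<epsilon>1 > 0" "\<epsilon>1 * C1 \<le> \<epsilon> / 3" using \<epsilon> C1(1) by (auto simp: \<epsilon>1_def field_simps)
    have \<epsilon>2: "\<epsilon>2 > 0" "A * \<epsilon>2 \<le> \<epsilon> / 3" using \<epsilon> A(1) by (auto simp: \<epsilon>2_def field_simps)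
    obtain e2 where e2: "e2 > 0" "\<forall>\<rho>>0. \<exists>\<delta>>0. \<exists>n0. \<forall>n\<ge>n0. \<forall>h v. n \<ge> 1 \<longrightarrow> perturbed n h v \<longrightarrow> bounded_by C h \<longrightarrow> modulus \<rho> e2 h \<longrightarrow>
      (\<forall>u\<in>U. norm (u - uhat) \<le> \<delta> \<longrightarrow> (\<forall>a<m (Suc j - 1). \<bar>sqrt (real n) * (v u (Suc j) a - val u (Suc j) a) - Xi h (Suc j) a\<bar> \<le> \<epsilon>2))"
      using step.IH[rule_format, OF \<epsilon>2(1)] by (rule exE, elim conjE) (rule that)
    obtain \<delta>1 where \<delta>1: "\<delta>1 > 0" "\<And>a u \<eta> \<eta>'. a < m (j - 1) \<Longrightarrow> u \<in> U \<Longrightarrow> \<eta> \<in> Rn (m j) \<Longrightarrow> \<eta>' \<in> Rn (m j) \<Longrightarrow>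
      norm (u - uhat) \<le> \<delta>1 \<Longrightarrow> dist1 (m j) \<eta> ?\<mu> \<le> \<delta>1 \<Longrightarrow> dist1 (m j) \<eta>' ?\<mu> \<le> \<delta>1 \<Longrightarrow>
      \<bar>fbar j u \<eta>' a - fbar j u \<eta> a - (\<Sum>b<m j. jac_mean j a b * (\<eta>' b - \<eta> b))\<bar> \<le> \<epsilon>1 * dist1 (m j) \<eta>' \<eta>"
      using fbar_strict_diff[OF step(1) \<epsilon>1(1)] by blast
    define e where "e = min e2 (\<epsilon> / 3)"
    have e: "e > 0" "e \<le> e2" "e \<le> \<epsilon> / 3" using e2(1) \<epsilon> by (auto simp: e_def)
    have main: "\<exists>\<delta>>0. \<exists>n0. \<forall>n\<ge>n0. \<forall>h v. n \<ge> 1 \<longrightarrow> perturbed n h v \<longrightarrow> bounded_by C h \<longrightarrow> modulus \<rho> e h \<longrightarrow>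
      (\<forall>u\<in>U. norm (u - uhat) \<le> \<delta> \<longrightarrow> (\<forall>a<m (j - 1). \<bar>sqrt (real n) * (v u j a - val u j a) - Xi h j a\<bar> \<le> \<epsilon>))" if \<rho>: "\<rho> > 0" for \<rho>
    proof -
      obtain \<delta>2 n2 where d2: "\<delta>2 > 0" "\<forall>n\<ge>n2. \<forall>h v. n \<ge> 1 \<longrightarrow> perturbed n h v \<longrightarrow> bounded_by C h \<longrightarrow> modulus \<rho> e2 h \<longrightarrow>
        (\<forall>u\<in>U. norm (u - uhat) \<le> \<delta>2 \<longrightarrow> (\<forall>b<m j. \<bar>sqrt (real n) * (v u (Suc j) b - val u (Suc j) b) - Xi h (Suc j) b\<bar> \<le> \<epsilon>2))"
        using e2(2)[rule_format, OF \<rho>] unfolding diff_Suc_1 by (elim exE conjE) (rule that)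
      \<comment> \<open>The true value at \<open>u\<close> will be within \<open>s\<close> of the
        one at \<open>uhat\<close> and the perturbed value within \<open>2 * s\<close>; together
        with \<open>norm (u - uhat)\<close> the total is at most \<open>3 * s\<close>.\<close>
      define s where "s = min (min \<delta>1 r) \<rho> / 3"
      have s: "s > 0" "3 * s \<le> \<delta>1" "3 * s \<le> r" "3 * s \<le> \<rho>" using \<delta>1(1) r(1) \<rho> by (auto simp: s_def)
      define \<delta> where "\<delta> = min (min \<delta>2 s) (s / (C2 + 1))"
      have \<delta>: "\<delta> > 0" "\<delta> \<le> \<delta>2" "\<delta> \<le> s" using d2(1) s(1) C2(1) by (auto simp: \<delta>_def)
      have "C2 * \<delta> \<le> C2 * (s / (C2 + 1))" using C2(1) by (intro mult_left_mono) (auto simp: \<delta>_def)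
      also have "\<dots> \<le> s" using C2(1) s(1) by (simp add: field_simps)
      finally have C2\<delta>: "C2 * \<delta> \<le> s" .
      obtain n3 :: nat where n3: "n3 \<ge> (C1 / s)\<^sup>2" using real_arch_simple by blast
      have "\<bar>sqrt (real n) * (v u j a - val u j a) - Xi h j a\<bar> \<le> \<epsilon>"
        if n: "n \<ge> max (max n1 n2) n3" "n \<ge> 1" and v: "perturbed n h v" and h: "bounded_by C h" and mo: "modulus \<rho> e h"
          and u: "u \<in> U" "norm (u - uhat) \<le> \<delta>" and a: "a < m (j - 1)" for n h v u a
      proof -
        let ?q = "sqrt (real n)"
        let ?w = "v u (Suc j)" and ?z = "val u (Suc j)"
        have q: "?q > 0" using n(2) by simp
        have w: "?w \<in> Rn (m j)" by (rule perturbedD(2)[OF v u(1) step(1)])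
        have z: "?z \<in> Rn (m j)" by (rule val_Rn[OF step(1) u(1)])
        have cl: "dist1 (m j) ?w ?z \<le> C1 / ?q" using n by (intro C1(2)[OF _ _ v h u(1)]) auto
        have "C1 / s \<le> ?q"
        proof (rule real_le_rsqrt)
          show "(C1 / s)\<^sup>2 \<le> real n" using n3 n(1) by linarith
        qed
        hence C1s: "C1 / ?q \<le> s" using s(1) q by (simp add: divide_le_eq mult.commute)
        have "dist1 (m j) ?z ?\<mu> \<le> C2 * norm (u - uhat)" by (rule C2(2)[OF u(1) uhat])
        also have "\<dots> \<le> C2 * \<delta>" using u(2) C2(1) by (intro mult_left_mono) auto
        finally have zs: "dist1 (m j) ?z ?\<mu> \<le> s" using C2\<delta> by simp
        have ws: "dist1 (m j) ?w ?\<mu> \<le> 2 * s" using dist1_triangle[of "m j" ?w ?\<mu> ?z] cl C1s zs by linarith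
        have wI: "?w \<in> I j" using ws s by (intro r(2) w) linarith
        have t1: "\<bar>fbar j u ?w a - fbar j u ?z a - (\<Sum>b<m j. jac_mean j a b * (?w b - ?z b))\<bar> \<le> \<epsilon>1 * (C1 / ?q)"
        proof -
          have "\<bar>fbar j u ?w a - fbar j u ?z a - (\<Sum>b<m j. jac_mean j a b * (?w b - ?z b))\<bar> \<le> \<epsilon>1 * dist1 (m j) ?w ?z"
            using u(2) \<delta>(3) s zs ws by (intro \<delta>1(2) a u w z) linarith+
          also have "\<dots> \<le> \<epsilon>1 * (C1 / ?q)" using cl \<epsilon>1(1) by (intro mult_left_mono) auto
          finally show ?thesis .
        qed
        have T1: "\<bar>?q * (fbar j u ?w a - fbar j u ?z a - (\<Sum>b<m j. jac_mean j a b * (?w b - ?z b)))\<bar> \<le> \<epsilon> / 3"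
        proof -
          have "?q * \<bar>fbar j u ?w a - fbar j u ?z a - (\<Sum>b<m j. jac_mean j a b * (?w b - ?z b))\<bar> \<le> ?q * (\<epsilon>1 * (C1 / ?q))"
            using t1 q by (intro mult_left_mono) auto
          also have "\<dots> = \<epsilon>1 * C1" using q by simp
          also have "\<dots> \<le> \<epsilon> / 3" by (rule \<epsilon>1(2))
          finally show ?thesis using q by (simp add: abs_mult)
        qed
        have T2: "\<bar>\<Sum>b<m j. jac_mean j a b * (?q * (?w b - ?z b) - Xi h (Suc j) b)\<bar> \<le> \<epsilon> / 3"
        proof -
          have "\<bar>\<Sum>b<m j. jac_mean j a b * (?q * (?w b - ?z b) - Xi h (Suc j) b)\<bar> \<le> (\<Sum>b<m j. \<bar>jac_mean j a b\<bar> * \<epsilon>2)"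
          proof (rule order_trans[OF sum_abs], rule sum_mono)
            fix b assume b: "b \<in> {..<m j}"
            have "\<bar>?q * (?w b - ?z b) - Xi h (Suc j) b\<bar> \<le> \<epsilon>2"
              by (rule d2(2)[rule_format, OF _ n(2) v h modulus_mono[OF mo e(2)] u(1)]) (use n u(2) \<delta>(2) b in auto)
            thus "\<bar>jac_mean j a b * (?q * (?w b - ?z b) - Xi h (Suc j) b)\<bar> \<le> \<bar>jac_mean j a b\<bar> * \<epsilon>2"
              unfolding abs_mult by (rule mult_left_mono) simp
          qed
          also have "\<dots> = (\<Sum>b<m j. \<bar>jac_mean j a b\<bar>) * \<epsilon>2" by (simp add: sum_distrib_right)
          also have "\<dots> \<le> A * \<epsilon>2" using A(2)[OF a] \<epsilon>2(1) by (intro mult_right_mono) auto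
          finally show ?thesis using \<epsilon>2(2) by linarith
        qed
        have T3: "\<bar>h j u ?w a - h j uhat ?\<mu> a\<bar> \<le> \<epsilon> / 3"
        proof -
          have "norm (u - uhat) + dist1 (m j) ?w ?\<mu> \<le> \<rho>" using u(2) \<delta>(3) ws s by linarith
          hence "\<bar>h j u ?w a - h j uhat ?\<mu> a\<bar> \<le> e"
            using mo step(1) u(1) uhat wI \<mu>(2) a unfolding modulus_def by blast
          thus ?thesis using e(3) by linarith
        qed
        \<comment> \<open>Both values are taken at the same \<open>u\<close>, so no expansion in
          \<open>u\<close> is needed: \<open>uhat\<close> enters only through the mean Jacobian and
          through \<open>h\<close>.\<close>
        have "?q * (v u j a - val u j a) - Xi h j a =
          ?q * (fbar j u ?w a - fbar j u ?z a - (\<Sum>b<m j. jac_mean j a b * (?w b - ?z b)))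
          + (\<Sum>b<m j. jac_mean j a b * (?q * (?w b - ?z b) - Xi h (Suc j) b)) + (h j u ?w a - h j uhat ?\<mu> a)"
        proof -
          have vv: "v u j a = fbar j u ?w a + h j u ?w a / ?q" by (rule perturbedD(3)[OF v u(1) step(1) a])
          have zz: "val u j a = fbar j u ?z a" using step(1) by (subst val_step) auto
          have sm: "(\<Sum>b<m j. jac_mean j a b * (?q * (?w b - ?z b) - Xi h (Suc j) b)) =
            ?q * (\<Sum>b<m j. jac_mean j a b * (?w b - ?z b)) - (\<Sum>b<m j. jac_mean j a b * Xi h (Suc j) b)"
            unfolding sum_distrib_left sum_subtractf[symmetric] by (intro sum.cong refl) (simp add: algebra_simps)
          have "?q * (x + y / ?q) = ?q * x + y" for x y using q by (simp add: distrib_left)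
          thus ?thesis unfolding vv zz sm Xi_step[OF step(1) a] by (simp add: right_diff_distrib)
        qed
        thus ?thesis using T1 T2 T3 by linarith
      qed
      thus ?thesis using \<delta>(1) by blast
    qed
    show "\<exists>e>0. \<forall>\<rho>>0. \<exists>\<delta>>0. \<exists>n0. \<forall>n\<ge>n0. \<forall>h v. n \<ge> 1 \<longrightarrow> perturbed n h v \<longrightarrow> bounded_by C h \<longrightarrow> modulus \<rho> e h \<longrightarrow>
      (\<forall>u\<in>U. norm (u - uhat) \<le> \<delta> \<longrightarrow> (\<forall>a<m (j - 1). \<bar>sqrt (real n) * (v u j a - val u j a) - Xi h j a\<bar> \<le> \<epsilon>))"
      using e(1) main by blast
  qed
qed

text \<open>Far from \<open>uhat\<close> the gap \<open>val u 1 0 - val uhat 1 0\<close> is bounded below, so minimizing over \<open>U\<close> costs nothing.\<close>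

lemma perturbed_min:
  assumes unique: "\<forall>u\<in>U. u \<noteq> uhat \<longrightarrow> val uhat 1 0 < val u 1 0" and C: "C \<ge> 0" and \<epsilon>: "\<epsilon> > 0"
  shows "\<exists>e>0. \<forall>\<rho>>0. \<exists>n0. \<forall>n\<ge>n0. \<forall>h v. n \<ge> 1 \<longrightarrow> perturbed n h v \<longrightarrow> bounded_by C h \<longrightarrow> modulus \<rho> e h \<longrightarrow>
    \<bar>sqrt (real n) * ((INF u\<in>U. v u 1 0) - val uhat 1 0) - Xi h 1 0\<bar> \<le> \<epsilon>"
proof -
  have one: "1 \<in> {1..Suc K}" "0 < m (1 - 1)" using m0 by auto
  obtain e where e: "e > 0" "\<forall>\<rho>>0. \<exists>\<delta>>0. \<exists>n0. \<forall>n\<ge>n0. \<forall>h v. n \<ge> 1 \<longrightarrow> perturbed n h v \<longrightarrow> bounded_by C h \<longrightarrow> modulus \<rho> e h \<longrightarrow>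
    (\<forall>u\<in>U. norm (u - uhat) \<le> \<delta> \<longrightarrow> (\<forall>a<m (1 - 1). \<bar>sqrt (real n) * (v u 1 a - val u 1 a) - Xi h 1 a\<bar> \<le> \<epsilon>))"
    using perturbed_expansion[OF one(1) C, rule_format, OF \<epsilon>] by (rule exE, elim conjE) (rule that)
  obtain C1 n1 where C1: "C1 \<ge> 0" "\<And>n h v u. n \<ge> n1 \<Longrightarrow> n \<ge> 1 \<Longrightarrow> perturbed n h v \<Longrightarrow> bounded_by C h \<Longrightarrow> u \<in> U \<Longrightarrow>
    dist1 (m (1 - 1)) (v u 1) (val u 1) \<le> C1 / sqrt (real n)"
    using perturbed_close[OF one(1) C] by blast
  obtain C2 where C2: "C2 \<ge> 0" "\<And>u u'. u \<in> U \<Longrightarrow> u' \<in> U \<Longrightarrow> dist1 (m (1 - 1)) (val u 1) (val u' 1) \<le> C2 * norm (u - u')"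
    using val_lip[OF one(1)] by blast
  have cont: "continuous_on U (\<lambda>u. val u 1 0)"
  proof (rule lipschitz_on_continuous_on, rule lipschitz_onI)
    show "dist (val u 1 0) (val u' 1 0) \<le> C2 * dist u u'" if "u \<in> U" "u' \<in> U" for u u'
      using C2(2)[OF that] dist1_coord[OF one(2), of "val u 1" "val u' 1"] by (simp add: dist_norm)
  qed (rule C2(1))
  \<comment> \<open>Away from \<open>uhat\<close> the set \<open>U\<close> is still compact, so the
    strict inequality becomes uniform there.\<close>
  have gap: "\<exists>\<kappa>>0. \<forall>u\<in>U. norm (u - uhat) \<ge> \<delta> \<longrightarrow> val uhat 1 0 + \<kappa> \<le> val u 1 0" if \<delta>: "\<delta> > 0" for \<delta>
  proof -
    define V where "V = U \<inter> {u. \<delta> \<le> norm (u - uhat)}"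
    have "closed {u. \<delta> \<le> norm (u - uhat)}" by (intro closed_Collect_le continuous_intros)
    hence V: "compact V" "V \<subseteq> U" unfolding V_def using U by auto
    show ?thesis
    proof (cases "V = {}")
      case True thus ?thesis by (intro exI[of _ 1]) (auto simp: V_def)
    next
      case False
      obtain w where w: "w \<in> V" "\<And>u. u \<in> V \<Longrightarrow> val w 1 0 \<le> val u 1 0"
        using continuous_attains_inf[OF V(1) False continuous_on_subset[OF cont V(2)]] by blast
      have "w \<noteq> uhat" using w(1) \<delta> by (auto simp: V_def)
      hence "val uhat 1 0 < val w 1 0" using w(1) V(2) by (intro unique[rule_format]) auto
      thus ?thesis using w(2) by (intro exI[of _ "val w 1 0 - val uhat 1 0"]) (auto simp: V_def)
    qed
  qed
  have "\<exists>n0. \<forall>n\<ge>n0. \<forall>h v. n \<ge> 1 \<longrightarrow> perturbed n h v \<longrightarrow> bounded_by C h \<longrightarrow> modulus \<rho> e h \<longrightarrow>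
    \<bar>sqrt (real n) * ((INF u\<in>U. v u 1 0) - val uhat 1 0) - Xi h 1 0\<bar> \<le> \<epsilon>" if \<rho>: "\<rho> > 0" for \<rho>
  proof -
    obtain \<delta> n2 where d: "\<delta> > 0" "\<forall>n\<ge>n2. \<forall>h v. n \<ge> 1 \<longrightarrow> perturbed n h v \<longrightarrow> bounded_by C h \<longrightarrow> modulus \<rho> e h \<longrightarrow>
      (\<forall>u\<in>U. norm (u - uhat) \<le> \<delta> \<longrightarrow> (\<forall>a<m (1 - 1). \<bar>sqrt (real n) * (v u 1 a - val u 1 a) - Xi h 1 a\<bar> \<le> \<epsilon>))"
      using e(2)[rule_format, OF \<rho>] by (elim exE conjE) (rule that)
    obtain \<kappa> where \<kappa>: "\<kappa> > 0" "\<And>u. u \<in> U \<Longrightarrow> norm (u - uhat) \<ge> \<delta> \<Longrightarrow> val uhat 1 0 + \<kappa> \<le> val u 1 0"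
      using gap[OF d(1)] by blast
    \<comment> \<open>Beyond \<open>n3\<close> the scaled gap is at least twice the uniform bound
      \<open>C1\<close> on the scaled perturbation, which settles the points far from
      \<open>uhat\<close>.\<close>
    obtain n3 :: nat where n3: "n3 \<ge> (2 * C1 / \<kappa>)\<^sup>2" using real_arch_simple by blast
    have "\<bar>sqrt (real n) * ((INF u\<in>U. v u 1 0) - val uhat 1 0) - Xi h 1 0\<bar> \<le> \<epsilon>"
      if n: "n \<ge> max (max n1 n2) n3" "n \<ge> 1" and v: "perturbed n h v" and h: "bounded_by C h" and mo: "modulus \<rho> e h" for n h v
    proof -
      let ?q = "sqrt (real n)"
      have q: "?q > 0" using n(2) by simp
      have "2 * C1 / \<kappa> \<le> ?q"
      proof (rule real_le_rsqrt)
        show "(2 * C1 / \<kappa>)\<^sup>2 \<le> real n" using n3 n(1) by linarith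
      qed
      hence q\<kappa>: "2 * C1 \<le> ?q * \<kappa>" using \<kappa>(1) by (simp add: divide_le_eq)
      have B: "\<bar>?q * (v u 1 0 - val u 1 0)\<bar> \<le> C1" if u: "u \<in> U" for u
      proof -
        have "\<bar>v u 1 0 - val u 1 0\<bar> \<le> C1 / ?q"
          using dist1_coord[OF one(2), of "v u 1" "val u 1"] C1(2)[OF _ n(2) v h u] n(1) by linarith
        hence "?q * \<bar>v u 1 0 - val u 1 0\<bar> \<le> C1" using q by (simp add: pos_le_divide_eq mult.commute)
        thus ?thesis using q by (simp add: abs_mult)
      qed
      have near: "\<bar>?q * (v u 1 0 - val u 1 0) - Xi h 1 0\<bar> \<le> \<epsilon>" if "u \<in> U" "norm (u - uhat) \<le> \<delta>" for u
        by (rule d(2)[rule_format, OF _ n(2) v h mo that one(2)]) (use n(1) in simp)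
      have hat: "\<bar>?q * (v uhat 1 0 - val uhat 1 0) - Xi h 1 0\<bar> \<le> \<epsilon>" using uhat d(1) by (intro near) auto
      have low: "Xi h 1 0 - \<epsilon> \<le> ?q * (v u 1 0 - val uhat 1 0)" if u: "u \<in> U" for u
      proof (cases "norm (u - uhat) \<le> \<delta>")
        case True
        have "val uhat 1 0 \<le> val u 1 0" using unique u by (cases "u = uhat") auto
        hence "?q * (v u 1 0 - val u 1 0) \<le> ?q * (v u 1 0 - val uhat 1 0)" using q by (intro mult_left_mono) auto
        thus ?thesis using near[OF u True] by linarith
      next
        case False
        have "?q * (v u 1 0 - val uhat 1 0) = ?q * (v u 1 0 - val u 1 0) + ?q * (val u 1 0 - val uhat 1 0)"
          by (simp add: algebra_simps)
        moreover have "?q * \<kappa> \<le> ?q * (val u 1 0 - val uhat 1 0)"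
          using \<kappa>(2)[OF u] False q by (intro mult_left_mono) auto
        ultimately show ?thesis using B[OF u] B[OF uhat] hat q\<kappa> \<epsilon> by linarith
      qed
      have low': "val uhat 1 0 + (Xi h 1 0 - \<epsilon>) / ?q \<le> v u 1 0" if "u \<in> U" for u
      proof -
        have "(Xi h 1 0 - \<epsilon>) / ?q \<le> v u 1 0 - val uhat 1 0"
          using low[OF that] q by (simp add: divide_le_eq mult.commute)
        thus ?thesis by linarith
      qed
      have "val uhat 1 0 + (Xi h 1 0 - \<epsilon>) / ?q \<le> (INF u\<in>U. v u 1 0)"
        using uhat low' by (intro cINF_greatest) auto
      hence "(Xi h 1 0 - \<epsilon>) / ?q \<le> (INF u\<in>U. v u 1 0) - val uhat 1 0" by linarith
      hence 1: "Xi h 1 0 - \<epsilon> \<le> ?q * ((INF u\<in>U. v u 1 0) - val uhat 1 0)"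
        using q by (simp add: divide_le_eq mult.commute)
      have "(INF u\<in>U. v u 1 0) \<le> v uhat 1 0"
        using uhat low' by (intro cINF_lower bdd_belowI2) auto
      hence "?q * ((INF u\<in>U. v u 1 0) - val uhat 1 0) \<le> ?q * (v uhat 1 0 - val uhat 1 0)"
        using q by (intro mult_left_mono) auto
      thus ?thesis using 1 hat by linarith
    qed
    thus ?thesis by blast
  qed
  thus ?thesis using e(1) by blast
qed

end

section \<open>Joint continuity of the level functions on the whole space\<close>

context composite
begin

text \<open>Continuity is taken from differentiability, because the Lipschitz bound is confined to
  \<open>I j\<close>, which empirical values may leave.\<close>

lemma F_continuous_eta:
  assumes j: "j \<in> {1..K}" and u: "u \<in> U" and x: "x \<in> space P" and a: "a < m (j - 1)"
    and v: "\<And>i. v i \<in> Rn (m j)" and \<eta>: "\<eta> \<in> Rn (m j)" and lim: "(\<lambda>i. dist1 (m j) (v i) \<eta>) \<longlonglongrightarrow> 0"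
  shows "(\<lambda>i. F j u (v i) x a) \<longlonglongrightarrow> F j u \<eta> x a"
proof -
  let ?J = "\<lambda>b. jac_entry (\<lambda>\<eta>. F j u \<eta> x) \<eta> a b"
  obtain d where d: "d > 0" "\<And>w. w \<in> Rn (m j) \<Longrightarrow> dist1 (m j) w \<eta> < d \<Longrightarrow>
    \<bar>F j u w x a - F j u \<eta> x a - (\<Sum>b<m j. ?J b * (w b - \<eta> b))\<bar> \<le> 1 * dist1 (m j) w \<eta>"
    using differentiable_Rn_coord[OF F_diff[OF j u \<eta> x] a zero_less_one] by blast
  have ev: "\<forall>\<^sub>F i in sequentially. norm (F j u (v i) x a - F j u \<eta> x a) \<le> (\<Sum>b<m j. \<bar>?J b\<bar> * \<bar>v i b - \<eta> b\<bar>) + dist1 (m j) (v i) \<eta>"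
    using order_tendstoD(2)[OF lim d(1)]
  proof eventually_elim
    case (elim i)
    have "\<bar>\<Sum>b<m j. ?J b * (v i b - \<eta> b)\<bar> \<le> (\<Sum>b<m j. \<bar>?J b\<bar> * \<bar>v i b - \<eta> b\<bar>)"
      by (rule order_trans[OF sum_abs]) (simp add: abs_mult)
    thus ?case using d(2)[OF v elim] by simp
  qed
  have "(\<lambda>i. \<bar>v i b - \<eta> b\<bar>) \<longlonglongrightarrow> 0" if b: "b < m j" for b
    by (rule Lim_null_comparison[OF always_eventually lim]) (use dist1_coord[OF b] in auto)
  hence "(\<lambda>i. (\<Sum>b<m j. \<bar>?J b\<bar> * \<bar>v i b - \<eta> b\<bar>) + dist1 (m j) (v i) \<eta>) \<longlonglongrightarrow> (\<Sum>b<m j. \<bar>?J b\<bar> * 0) + 0"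
    by (intro tendsto_add tendsto_sum tendsto_mult tendsto_const lim) auto
  hence z: "(\<lambda>i. (\<Sum>b<m j. \<bar>?J b\<bar> * \<bar>v i b - \<eta> b\<bar>) + dist1 (m j) (v i) \<eta>) \<longlonglongrightarrow> 0" by simp
  show ?thesis by (rule LIM_zero_cancel[OF Lim_null_comparison[OF ev z]])
qed

text \<open>Continuity in \<open>u\<close> off the sets \<open>I j\<close> has to come from the
  derivative. The mean value theorem for the difference of \<open>F j (u i)\<close> and
  \<open>F j u'\<close> along a fixed segment expresses the change of the increment by differences
  of Jacobians, which tend to 0.\<close>

lemma F_increment_tendsto:
  assumes j: "j \<in> {1..K}" and x: "x \<in> space P" and a: "a < m (j - 1)"
    and u: "\<And>i. u i \<in> U" "u' \<in> U" "u \<longlonglongrightarrow> u'" and v: "v \<in> Rn (m j)" and w: "w \<in> Rn (m j)"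
  shows "(\<lambda>i. F j (u i) w x a - F j (u i) v x a) \<longlonglongrightarrow> F j u' w x a - F j u' v x a"
proof -
  let ?J = "\<lambda>u t b. jac_entry (\<lambda>\<eta>. F j u \<eta> x) (seg v w t) a b"
  let ?g = "\<lambda>i t. F j (u i) (seg v w t) x a - F j u' (seg v w t) x a"
  have "\<exists>t\<in>{0..1}. ?g i 1 - ?g i 0 = (\<Sum>b<m j. (?J (u i) t b - ?J u' t b) * (w b - v b))" for i
  proof -
    have "(?g i has_real_derivative (\<Sum>b<m j. ?J (u i) t b * (w b - v b)) - (\<Sum>b<m j. ?J u' t b * (w b - v b))) (at t)" for t
      by (intro DERIV_diff differentiable_Rn_seg[OF F_diff[OF j _ _ x] a v w] u)
    from MVT2[of 0 1 "?g i", OF _ this] obtain t where "0 < t" "t < 1"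
      "?g i 1 - ?g i 0 = (1 - 0) * ((\<Sum>b<m j. ?J (u i) t b * (w b - v b)) - (\<Sum>b<m j. ?J u' t b * (w b - v b)))" by auto
    thus ?thesis by (intro bexI[of _ t]) (auto simp: sum_subtractf left_diff_distrib)
  qed
  hence "\<forall>i. \<exists>t. t \<in> {0..1} \<and> ?g i 1 - ?g i 0 = (\<Sum>b<m j. (?J (u i) t b - ?J u' t b) * (w b - v b))" by blast
  from choice[OF this] obtain t where "\<forall>i. t i \<in> {0..1} \<and> ?g i 1 - ?g i 0 = (\<Sum>b<m j. (?J (u i) (t i) b - ?J u' (t i) b) * (w b - v b))"
    by (rule exE)
  hence E: "t i \<in> {0..1::real} \<and> ?g i 1 - ?g i 0 = (\<Sum>b<m j. (?J (u i) (t i) b - ?J u' (t i) b) * (w b - v b))" for i by (rule spec)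
  note t = conjunct1[OF E] conjunct2[OF E]
  have "(\<lambda>i. ?g i 1 - ?g i 0) \<longlonglongrightarrow> 0"
  proof (rule ccontr)
    assume "\<not> (\<lambda>i. ?g i 1 - ?g i 0) \<longlonglongrightarrow> 0"
    then obtain e where e: "e > 0" "\<And>N. \<exists>i\<ge>N. \<bar>?g i 1 - ?g i 0\<bar> \<ge> e"
      by (auto simp: LIMSEQ_iff not_less)
    have "infinite {i. \<bar>?g i 1 - ?g i 0\<bar> \<ge> e}" unfolding infinite_nat_iff_unbounded_le using e(2) by blast
    then obtain s :: "nat \<Rightarrow> nat" where s: "strict_mono s" "\<And>i. s i \<in> {i. \<bar>?g i 1 - ?g i 0\<bar> \<ge> e}"
      using infinite_enumerate by blast
    \<comment> \<open>The intermediate points \<open>t i\<close> need not converge; along a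
      subsequence they do, and joint continuity of the derivative then applies.\<close>
    have "compact {0..1::real}" by simp
    then obtain t' r where r: "t' \<in> {0..1}" "strict_mono r" "((\<lambda>i. t (s i)) \<circ> r) \<longlonglongrightarrow> t'"
      unfolding compact_def using t(1) by (metis (no_types, lifting))
    let ?k = "\<lambda>i. s (r i)"
    have k: "strict_mono ?k" using strict_mono_o[OF s(1) r(2)] by (simp add: comp_def)
    have tl: "(\<lambda>i. t (?k i)) \<longlonglongrightarrow> t'" using r(3) by (simp add: comp_def)
    have ul: "(\<lambda>i. u (?k i)) \<longlonglongrightarrow> u'" using LIMSEQ_subseq_LIMSEQ[OF u(3) k] by (simp add: comp_def)
    have zl: "(\<lambda>i. dist1 (m j) (seg v w (t (?k i))) (seg v w t')) \<longlonglongrightarrow> 0"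
      unfolding seg_def by (intro dist1_tendsto tendsto_add tendsto_mult tendsto_const tl)
    have J: "(\<lambda>i. ?J (u (?k i)) (t (?k i)) b) \<longlonglongrightarrow> ?J u' t' b" "(\<lambda>i. ?J u' (t (?k i)) b) \<longlonglongrightarrow> ?J u' t' b" if b: "b < m j" for b
    proof -
      have R: "seg v w s \<in> Rn (m j)" for s by (rule seg_Rn[OF v w])
      show "(\<lambda>i. ?J (u (?k i)) (t (?k i)) b) \<longlonglongrightarrow> ?J u' t' b"
        by (rule continuous_map_seq[OF F_C1[OF j x a b], where u = "\<lambda>i. u (?k i)" and v = "\<lambda>i. seg v w (t (?k i))", OF u(1) u(2) ul R R zl])
      show "(\<lambda>i. ?J u' (t (?k i)) b) \<longlonglongrightarrow> ?J u' t' b"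
        by (rule continuous_map_seq[OF F_C1[OF j x a b], where u = "\<lambda>i. u'" and v = "\<lambda>i. seg v w (t (?k i))", OF u(2) u(2) tendsto_const R R zl])
    qed
    have "(\<lambda>i. \<Sum>b<m j. (?J (u (?k i)) (t (?k i)) b - ?J u' (t (?k i)) b) * (w b - v b)) \<longlonglongrightarrow> (\<Sum>b<m j. (?J u' t' b - ?J u' t' b) * (w b - v b))"
      by (intro tendsto_sum tendsto_mult tendsto_diff tendsto_const J) auto
    hence "(\<lambda>i. ?g (?k i) 1 - ?g (?k i) 0) \<longlonglongrightarrow> 0" unfolding t(2) by simp
    hence "(\<lambda>i. \<bar>?g (?k i) 1 - ?g (?k i) 0\<bar>) \<longlonglongrightarrow> 0" by (rule tendsto_rabs_zero)
    from order_tendstoD(2)[OF this e(1)] obtain i where "\<bar>?g (?k i) 1 - ?g (?k i) 0\<bar> < e"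
      unfolding eventually_sequentially by blast
    thus False using s(2)[of "r i"] unfolding mem_Collect_eq by linarith
  qed
  hence "(\<lambda>i. (F j (u i) w x a - F j (u i) v x a) - (F j u' w x a - F j u' v x a)) \<longlonglongrightarrow> 0"
    by (simp add: algebra_simps)
  thus ?thesis by (rule LIM_zero_cancel)
qed

text \<open>The value at \<open>w\<close> is reached from a base point in \<open>I j\<close>, where
  the Lipschitz bound gives continuity in \<open>u\<close>, by adding the increment of
  \<open>F_increment_tendsto\<close>; the remaining step from \<open>w\<close> to \<open>v i\<close>
  is small by the mean value theorem.\<close>

lemma F_continuous:
  assumes j: "j \<in> {1..K}" and x: "x \<in> space P" and a: "a < m (j - 1)"
    and u: "\<And>i. u i \<in> U" "u' \<in> U" "u \<longlonglongrightarrow> u'"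
    and v: "\<And>i. v i \<in> Rn (m j)" and w: "w \<in> Rn (m j)" and lim: "(\<lambda>i. dist1 (m j) (v i) w) \<longlonglongrightarrow> 0"
  shows "(\<lambda>i. F j (u i) (v i) x a) \<longlonglongrightarrow> F j u' w x a"
proof -
  let ?J = "\<lambda>i t b. jac_entry (\<lambda>\<eta>. F j (u i) \<eta> x) (seg w (v i) t) a b"
  let ?z = "val uhat (Suc j)"
  have z: "?z \<in> Rn (m j)" "?z \<in> I j" using val_Rn[OF j uhat] val_I[OF j uhat] .
  have base: "(\<lambda>i. F j (u i) ?z x a) \<longlonglongrightarrow> F j u' ?z x a"
  proof -
    have le: "norm (F j (u i) ?z x a - F j u' ?z x a) \<le> \<gamma> j x * norm (u i - u')" for i
      using F_lip[OF j u(1) u(2) z(2) z(2) x a, of i] by simp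
    have "(\<lambda>i. \<gamma> j x * norm (u i - u')) \<longlonglongrightarrow> \<gamma> j x * norm (u' - u')" by (intro tendsto_intros u(3))
    hence l0: "(\<lambda>i. \<gamma> j x * norm (u i - u')) \<longlonglongrightarrow> 0" by simp
    show ?thesis by (rule LIM_zero_cancel[OF Lim_null_comparison[OF always_eventually[OF allI[OF le]] l0]])
  qed
  have "(\<lambda>i. F j (u i) w x a) \<longlonglongrightarrow> F j u' w x a"
    using tendsto_add[OF F_increment_tendsto[OF j x a u z(1) w] base] by simp
  moreover have "(\<lambda>i. F j (u i) (v i) x a - F j (u i) w x a) \<longlonglongrightarrow> 0"
  proof -
    have ex: "\<exists>t. t \<in> {0..1} \<and> F j (u i) (v i) x a - F j (u i) w x a = (\<Sum>b<m j. ?J i t b * (v i b - w b))" for i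
      using mean_value_Rn[OF F_diff[OF j u(1) _ x] a w v, of i i] by blast
    from choice[OF allI[OF ex]] obtain t where "\<forall>i. t i \<in> {0..1} \<and> F j (u i) (v i) x a - F j (u i) w x a = (\<Sum>b<m j. ?J i (t i) b * (v i b - w b))"
      by (rule exE)
    hence E: "t i \<in> {0..1} \<and> F j (u i) (v i) x a - F j (u i) w x a = (\<Sum>b<m j. ?J i (t i) b * (v i b - w b))" for i by (rule spec)
    note t = conjunct1[OF E] conjunct2[OF E]
    have R: "seg w (v i) (t i) \<in> Rn (m j)" for i by (rule seg_Rn[OF w v])
    have le: "norm (dist1 (m j) (seg w (v i) (t i)) w) \<le> dist1 (m j) (v i) w" for i
      using dist1_seg[OF t(1), where p = "m j" and v = w and w = "v i" and z = w, of i] by simp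
    have zl: "(\<lambda>i. dist1 (m j) (seg w (v i) (t i)) w) \<longlonglongrightarrow> 0"
      by (rule Lim_null_comparison[OF always_eventually[OF allI[OF le]] lim])
    have vl: "(\<lambda>i. v i b - w b) \<longlonglongrightarrow> 0" if b: "b < m j" for b
      by (rule Lim_null_comparison[OF always_eventually lim]) (use dist1_coord[OF b] in auto)
    have "(\<lambda>i. ?J i (t i) b) \<longlonglongrightarrow> jac_entry (\<lambda>\<eta>. F j u' \<eta> x) w a b" if b: "b < m j" for b
      by (rule continuous_map_seq[OF F_C1[OF j x a b], where v = "\<lambda>i. seg w (v i) (t i)", OF u(1) u(2) u(3) R w zl])
    hence "(\<lambda>i. \<Sum>b<m j. ?J i (t i) b * (v i b - w b)) \<longlonglongrightarrow> (\<Sum>b<m j. jac_entry (\<lambda>\<eta>. F j u' \<eta> x) w a b * 0)"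
      by (intro tendsto_sum tendsto_mult vl) auto
    thus ?thesis unfolding t(2) by simp
  qed
  ultimately show ?thesis using tendsto_add by fastforce
qed

end

section \<open>Measurability of the empirical optimal value\<close>

lemma measurable_map_count_space:
  assumes "\<And>b. b \<in> set xs \<Longrightarrow> g b \<in> M \<rightarrow>\<^sub>M count_space (UNIV :: int set)"
  shows "(\<lambda>\<omega>. map (\<lambda>b. g b \<omega>) xs) \<in> M \<rightarrow>\<^sub>M count_space UNIV"
  using assms
proof (induction xs)
  case (Cons y xs)
  have IH: "(\<lambda>\<omega>. map (\<lambda>b. g b \<omega>) xs) \<in> M \<rightarrow>\<^sub>M count_space UNIV" by (rule Cons.IH) (rule Cons.prems, simp)
  have "(\<lambda>\<omega>. g y \<omega> # map (\<lambda>b. g b \<omega>) xs) \<in> M \<rightarrow>\<^sub>M count_space UNIV"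
  proof (rule measurable_compose_countable[where f = "\<lambda>z \<omega>. z # map (\<lambda>b. g b \<omega>) xs"])
    show "(\<lambda>\<omega>. z # map (\<lambda>b. g b \<omega>) xs) \<in> M \<rightarrow>\<^sub>M count_space UNIV" for z
      by (rule measurable_compose[OF IH]) simp
    show "g y \<in> M \<rightarrow>\<^sub>M count_space UNIV" by (rule Cons.prems) simp
  qed
  thus ?case by simp
qed simp

locale composite_sample = composite P K m U uhat F I \<gamma> + iid_sample M P Xs
  for P :: "'x measure" and K m and U :: "'u::euclidean_space set" and uhat F I \<gamma> and M :: "'w measure" and Xs
begin

text \<open>A function measurable in the sample and continuous in the vector argument is composed
  with a random argument. Rounding the argument to a grid leaves countably many values, for which
  the composition is measurable; refining the grid gives a pointwise limit.\<close>

lemma caratheodory_measurable: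
  assumes j: "j \<in> {1..K}" and u: "u \<in> U" and a: "a < m (j - 1)"
    and A: "\<And>b. (\<lambda>\<omega>. A \<omega> b) \<in> borel_measurable M" and AR: "\<And>\<omega>. \<omega> \<in> space M \<Longrightarrow> A \<omega> \<in> Rn (m j)"
    and Y: "Y \<in> M \<rightarrow>\<^sub>M P"
  shows "(\<lambda>\<omega>. F j u (A \<omega>) (Y \<omega>) a) \<in> borel_measurable M"
proof -
  \<comment> \<open>Rounded vectors are coded as lists of integers, which form a countable
    type.\<close>
  define q where "q i \<omega> = map (\<lambda>b. \<lfloor>A \<omega> b * real (Suc i)\<rfloor>) [0..<m j]" for i \<omega>
  define vec where "vec i l = (\<lambda>b. if b < m j then real_of_int (l ! b) / real (Suc i) else 0)" for i :: nat and l :: "int list"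
  have R: "vec i l \<in> Rn (m j)" for i l by (simp add: vec_def topspace_Euclidean_space)
  have qm: "q i \<in> M \<rightarrow>\<^sub>M count_space UNIV" for i
    unfolding q_def[abs_def]
  proof (rule measurable_map_count_space)
    fix b note [measurable] = A[of b]
    show "(\<lambda>\<omega>. \<lfloor>A \<omega> b * real (Suc i)\<rfloor>) \<in> M \<rightarrow>\<^sub>M count_space UNIV" by measurable
  qed
  have m: "(\<lambda>\<omega>. F j u (vec i (q i \<omega>)) (Y \<omega>) a) \<in> borel_measurable M" for i
    by (rule measurable_compose_countable[OF measurable_compose[OF Y F_meas[OF j u R]] qm])
  show ?thesis
  proof (rule borel_measurable_LIMSEQ_real[OF _ m])
    fix \<omega> assume \<omega>: "\<omega> \<in> space M"
    have le: "norm (vec i (q i \<omega>) b - A \<omega> b) \<le> 1 / real (Suc i)" if b: "b < m j" for b i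
    proof -
      have "\<bar>real_of_int \<lfloor>A \<omega> b * real (Suc i)\<rfloor> - A \<omega> b * real (Suc i)\<bar> \<le> 1" by linarith
      hence "\<bar>real_of_int \<lfloor>A \<omega> b * real (Suc i)\<rfloor> - A \<omega> b * real (Suc i)\<bar> / real (Suc i) \<le> 1 / real (Suc i)"
        by (intro divide_right_mono) auto
      moreover have "vec i (q i \<omega>) b - A \<omega> b = (real_of_int \<lfloor>A \<omega> b * real (Suc i)\<rfloor> - A \<omega> b * real (Suc i)) / real (Suc i)"
        using b by (simp add: vec_def q_def diff_divide_distrib del: of_nat_Suc)
      ultimately show ?thesis by (simp only: real_norm_def abs_divide abs_of_nat)
    qed
    have "(\<lambda>i. vec i (q i \<omega>) b) \<longlonglongrightarrow> A \<omega> b" if b: "b < m j" for b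
      by (rule LIM_zero_cancel[OF Lim_null_comparison[OF always_eventually[OF allI[OF le[OF b]]] LIMSEQ_Suc[OF lim_1_over_n]]])
    hence "(\<lambda>i. dist1 (m j) (vec i (q i \<omega>)) (A \<omega>)) \<longlonglongrightarrow> 0" by (rule dist1_tendsto)
    thus "(\<lambda>i. F j u (vec i (q i \<omega>)) (Y \<omega>) a) \<longlonglongrightarrow> F j u (A \<omega>) (Y \<omega>) a"
      using measurable_space[OF Y \<omega>] by (intro F_continuous_eta[OF j u _ a R AR[OF \<omega>]])
  qed
qed

definition emp :: "nat \<Rightarrow> 'w \<Rightarrow> 'u \<Rightarrow> nat \<Rightarrow> nat \<Rightarrow> real" where
  "emp n \<omega> = nested (emp_mean n (\<lambda>i. Xs i \<omega>)) K F (\<lambda>_ _ _. 0)"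

lemma emp_step: "j \<le> K \<Longrightarrow> emp n \<omega> u j = emp_mean n (\<lambda>i. Xs i \<omega>) (F j u (emp n \<omega> u (Suc j)))"
  unfolding emp_def by (subst nested.simps) simp

lemma emp_last: "emp n \<omega> u (Suc K) = (\<lambda>_. 0)"
  unfolding emp_def by (subst nested.simps) (simp add: emp_mean_def)

lemma emp_mean_Rn:
  assumes "\<And>l. l \<in> {1..n} \<Longrightarrow> h (x l) \<in> Rn p" shows "emp_mean n x h \<in> Rn p"
  using assms by (auto simp: emp_mean_def topspace_Euclidean_space)

lemma emp_Rn:
  assumes "j \<in> {1..Suc K}" "u \<in> U" "\<omega> \<in> space M" shows "emp n \<omega> u j \<in> Rn (m (j - 1))"
  using assms(1)
proof (induction rule: down_induct)
  case base
  show ?case by (simp add: emp_last topspace_Euclidean_space)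
next
  case (step j)
  have "F j u (emp n \<omega> u (Suc j)) (Xs l \<omega>) \<in> Rn (m (j - 1))" if "l \<in> {1..n}" for l
    by (rule F_Rn[OF step(1) assms(2)]) (use step(2) Xs_space assms(3) that in auto)
  thus ?case using step(1) by (subst emp_step) (auto intro!: emp_mean_Rn)
qed

lemma emp_measurable:
  assumes "j \<in> {1..Suc K}" "u \<in> U" shows "\<forall>b. (\<lambda>\<omega>. emp n \<omega> u j b) \<in> borel_measurable M"
  using assms(1)
proof (induction rule: down_induct)
  case base
  show ?case by (simp add: emp_last)
next
  case (step j)
  have eq: "emp n \<omega> u j b = (\<Sum>l = 1..n. (1 / real n) * F j u (emp n \<omega> u (Suc j)) (Xs l \<omega>) b)" for \<omega> b
    using step(1) by (subst emp_step) (auto simp: emp_mean_def)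
  have F: "(\<lambda>\<omega>. F j u (emp n \<omega> u (Suc j)) (Xs l \<omega>) b) \<in> borel_measurable M" if l: "l \<in> {1..n}" for l b
  proof (cases "b < m (j - 1)")
    case True
    show ?thesis
    proof (rule caratheodory_measurable[OF step(1) assms(2) True])
      show "(\<lambda>\<omega>. emp n \<omega> u (Suc j) b) \<in> borel_measurable M" for b using step(2) by (rule spec)
      show "emp n \<omega> u (Suc j) \<in> Rn (m j)" if "\<omega> \<in> space M" for \<omega>
        using emp_Rn[of "Suc j" u \<omega> n] step(1) assms(2) that by simp
      show "Xs l \<in> M \<rightarrow>\<^sub>M P" using l by (intro Xs_measurable) simp
    qed
  next
    case False
    \<comment> \<open>Coordinates beyond the dimension vanish on \<open>space M\<close>; nothing is
      known elsewhere, hence measurability by congruence.\<close>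
    have "F j u (emp n \<omega> u (Suc j)) (Xs l \<omega>) b = 0" if \<omega>: "\<omega> \<in> space M" for \<omega>
    proof -
      have "emp n \<omega> u (Suc j) \<in> Rn (m j)" using emp_Rn[of "Suc j" u \<omega> n] step(1) assms(2) \<omega> by simp
      from F_Rn[OF step(1) assms(2) this Xs_space[OF _ \<omega>], of l] l False show ?thesis by (auto intro: Rn_0)
    qed
    hence "(\<lambda>\<omega>. F j u (emp n \<omega> u (Suc j)) (Xs l \<omega>) b) \<in> borel_measurable M \<longleftrightarrow> (\<lambda>_. 0 :: real) \<in> borel_measurable M"
      by (intro measurable_cong)
    thus ?thesis by simp
  qed
  show ?case unfolding eq by (intro allI borel_measurable_sum borel_measurable_times borel_measurable_const F)
qed

text \<open>Continuity of the empirical objective in \<open>u\<close> along a fixed path is what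
  allows the minimum to be taken over a countable dense set.\<close>

lemma emp_continuous:
  assumes "j \<in> {1..Suc K}" and \<omega>: "\<omega> \<in> space M" and u: "\<And>i. u i \<in> U" "u' \<in> U" "u \<longlonglongrightarrow> u'"
  shows "\<forall>b<m (j - 1). (\<lambda>i. emp n \<omega> (u i) j b) \<longlonglongrightarrow> emp n \<omega> u' j b"
  using assms(1)
proof (induction rule: down_induct)
  case base
  show ?case by (simp add: emp_last)
next
  case (step j)
  have eq: "emp n \<omega> u j b = (\<Sum>l = 1..n. (1 / real n) * F j u (emp n \<omega> u (Suc j)) (Xs l \<omega>) b)" for u b
    using step(1) by (subst emp_step) (auto simp: emp_mean_def)
  have R: "emp n \<omega> v (Suc j) \<in> Rn (m j)" if "v \<in> U" for v
    using emp_Rn[of "Suc j" v \<omega> n] step(1) \<omega> that by simp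
  have d: "(\<lambda>i. dist1 (m j) (emp n \<omega> (u i) (Suc j)) (emp n \<omega> u' (Suc j))) \<longlonglongrightarrow> 0"
    using step(2) by (intro dist1_tendsto) simp
  show ?case
  proof (intro allI impI)
    fix b assume b: "b < m (j - 1)"
    have "(\<lambda>i. F j (u i) (emp n \<omega> (u i) (Suc j)) (Xs l \<omega>) b) \<longlonglongrightarrow> F j u' (emp n \<omega> u' (Suc j)) (Xs l \<omega>) b"
      if "l \<in> {1..n}" for l
      by (rule F_continuous[OF step(1) Xs_space[OF _ \<omega>] b u R[OF u(1)] R[OF u(2)] d]) (use that in simp)
    thus "(\<lambda>i. emp n \<omega> (u i) j b) \<longlonglongrightarrow> emp n \<omega> u' j b"
      unfolding eq by (intro tendsto_sum tendsto_mult tendsto_const) auto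
  qed
qed

text \<open>By continuity the infimum falls below a level iff the objective does so at some point of
  a countable dense subset of \<open>U\<close>. Boundedness below, which a real-valued infimum
  requires here, comes from compactness.\<close>

lemma emp_min_measurable: "(\<lambda>\<omega>. INF u\<in>U. emp n \<omega> u 1 0) \<in> borel_measurable M"
proof -
  have one: "1 \<in> {1..Suc K}" "0 < m (1 - 1)" using m0 by auto
  have seq: "(\<lambda>i. emp n \<omega> (u i) 1 0) \<longlonglongrightarrow> emp n \<omega> u' 1 0"
    if "\<omega> \<in> space M" "\<And>i. u i \<in> U" "u' \<in> U" "u \<longlonglongrightarrow> u'" for \<omega> u u'
    by (rule emp_continuous[OF one(1) that, rule_format, OF one(2)])
  have bdd: "bdd_below ((\<lambda>u. emp n \<omega> u 1 0) ` U)" if \<omega>: "\<omega> \<in> space M" for \<omega>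
  proof -
    have "continuous_on U (\<lambda>u. emp n \<omega> u 1 0)"
      unfolding continuous_on_sequentially comp_def using seq[OF \<omega>] by blast
    from compact_continuous_image[OF this U] show ?thesis by (intro bounded_imp_bdd_below compact_imp_bounded)
  qed
  obtain D where D: "countable D" "D \<subseteq> U" "U \<subseteq> closure D" by (rule separable[of U])
  have iff: "(INF u\<in>U. emp n \<omega> u 1 0) < c \<longleftrightarrow> (\<exists>u\<in>D. emp n \<omega> u 1 0 < c)" if \<omega>: "\<omega> \<in> space M" for \<omega> c
  proof -
    have "(INF u\<in>U. emp n \<omega> u 1 0) < c \<longleftrightarrow> (\<exists>u\<in>U. emp n \<omega> u 1 0 < c)"
      using uhat bdd[OF \<omega>] by (intro cINF_less_iff) auto
    also have "\<dots> \<longleftrightarrow> (\<exists>u\<in>D. emp n \<omega> u 1 0 < c)"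
    proof
      assume "\<exists>u\<in>U. emp n \<omega> u 1 0 < c"
      then obtain u' where u': "u' \<in> U" "emp n \<omega> u' 1 0 < c" by blast
      then obtain u where u: "\<forall>i::nat. u i \<in> D" "u \<longlonglongrightarrow> u'" using D(3) closure_sequential by blast
      have uU: "u i \<in> U" for i using u(1) D(2) by auto
      from order_tendstoD(2)[OF seq[OF \<omega> uU u'(1) u(2)] u'(2)]
      obtain i where "emp n \<omega> (u i) 1 0 < c" unfolding eventually_sequentially by blast
      thus "\<exists>u\<in>D. emp n \<omega> u 1 0 < c" using u(1) by blast
    qed (use D(2) in blast)
    finally show ?thesis .
  qed
  show ?thesis
  proof (rule borel_measurableI_less)
    fix c
    have "{\<omega> \<in> space M. (INF u\<in>U. emp n \<omega> u 1 0) < c} = (\<Union>u\<in>D. {\<omega> \<in> space M. emp n \<omega> u 1 0 < c})"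
      using iff by blast
    also have "\<dots> \<in> sets M"
    proof (rule sets.countable_UN'[OF D(1)], rule image_subsetI)
      fix u assume "u \<in> D"
      hence [measurable]: "(\<lambda>\<omega>. emp n \<omega> u 1 0) \<in> borel_measurable M" using emp_measurable[OF one(1), of u n] D(2) by blast
      show "{\<omega> \<in> space M. emp n \<omega> u 1 0 < c} \<in> sets M" by measurable
    qed
    finally show "{\<omega> \<in> space M. (INF u\<in>U. emp n \<omega> u 1 0) < c} \<in> sets M" .
  qed
qed

end

section \<open>The limit law of the empirical optimal value\<close>

context composite
begin

text \<open>One index set for all levels and components, so that a single application of chaining
  controls them jointly.\<close>

definition params :: "(nat \<times> nat \<times> 'u \<times> (nat \<Rightarrow> real)) set" where
  "params = {(j, a, u, \<eta>). j \<in> {1..K} \<and> a < m (j - 1) \<and> u \<in> U \<and> \<eta> \<in> I j}"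

definition width :: nat where
  "width = (\<Sum>j\<le>K. m j)"

text \<open>Axes \<open>Inl 0\<close> and \<open>Inl 1\<close> carry the level and the component,
  \<open>Inl (b + 2)\<close> the coordinate \<open>b\<close> of \<open>\<eta>\<close>, and
  \<open>Inr e\<close> the coordinates of \<open>u\<close>. All levels share \<open>width\<close>
  coordinates, shorter vectors being padded by 0.\<close>

definition axes :: "(nat + 'u) set" where
  "axes = Inl ` {..<Suc (Suc width)} \<union> Inr ` Basis"

text \<open>The factor 4 separates the components with different indices \<open>(j, a)\<close> by more than the distance 3
  up to which the Lipschitz bound is required.\<close>

definition crd :: "nat \<times> nat \<times> 'u \<times> (nat \<Rightarrow> real) \<Rightarrow> nat + 'u \<Rightarrow> real" where
  "crd = (\<lambda>(j, a, u, \<eta>) b. case b of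
     Inl i \<Rightarrow> (case i of 0 \<Rightarrow> 4 * real j | Suc i' \<Rightarrow> (case i' of 0 \<Rightarrow> 4 * real a | Suc b \<Rightarrow> \<eta> b))
   | Inr e \<Rightarrow> u \<bullet> e)"

definition phi :: "nat \<times> nat \<times> 'u \<times> (nat \<Rightarrow> real) \<Rightarrow> 'x \<Rightarrow> real" where
  "phi = (\<lambda>(j, a, u, \<eta>) x. F j u \<eta> x a - fbar j u \<eta> a)"

text \<open>\<open>\<gamma> j\<close> bounds the increments of \<open>F\<close>,
  \<open>lip j\<close> those of the centring term \<open>fbar\<close>; the sum over the levels
  serves every component at once.\<close>

definition env :: "'x \<Rightarrow> real" where
  "env x = (\<Sum>j=1..K. \<gamma> j x + lip j) + 1"

lemma phi_apply: "phi (j, a, u, \<eta>) x = F j u \<eta> x a - fbar j u \<eta> a"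
  by (simp add: phi_def)

lemma m_width: "j \<le> K \<Longrightarrow> m j \<le> width"
  unfolding width_def by (rule member_le_sum) auto

lemma crd_sum:
  "(\<Sum>b\<in>axes. \<bar>crd (j, a, u, \<eta>) b - crd (j', a', u', \<eta>') b\<bar>) =
     \<bar>4 * real j - 4 * real j'\<bar> + (\<bar>4 * real a - 4 * real a'\<bar> + dist1 width \<eta> \<eta>') + (\<Sum>e\<in>Basis. \<bar>(u - u') \<bullet> e\<bar>)"
proof -
  let ?f = "\<lambda>b. \<bar>crd (j, a, u, \<eta>) b - crd (j', a', u', \<eta>') b\<bar>"
  have "sum ?f axes = sum ?f (Inl ` {..<Suc (Suc width)}) + sum ?f (Inr ` Basis)"
    unfolding axes_def by (rule sum.union_disjoint) auto
  also have "sum ?f (Inl ` {..<Suc (Suc width)}) = (\<Sum>i<Suc (Suc width). ?f (Inl i))"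
    by (subst sum.reindex) (auto simp: inj_on_def)
  also have "\<dots> = \<bar>4 * real j - 4 * real j'\<bar> + (\<bar>4 * real a - 4 * real a'\<bar> + dist1 width \<eta> \<eta>')"
    unfolding sum.lessThan_Suc_shift by (simp add: crd_def dist1_def)
  also have "sum ?f (Inr ` Basis) = (\<Sum>e\<in>Basis. \<bar>(u - u') \<bullet> e\<bar>)"
    by (subst sum.reindex) (auto simp: inj_on_def crd_def inner_diff_left)
  finally show ?thesis .
qed

lemma dist1_width: assumes "j \<le> K" "v \<in> Rn (m j)" "w \<in> Rn (m j)" shows "dist1 width v w = dist1 (m j) v w"
  unfolding dist1_def
proof (rule sum.mono_neutral_right)
  show "{..<m j} \<subseteq> {..<width}" using m_width[OF assms(1)] by auto
  show "\<forall>b\<in>{..<width} - {..<m j}. \<bar>v b - w b\<bar> = 0"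
    using Rn_0[OF assms(2)] Rn_0[OF assms(3)] by simp
qed simp

lemma crd_bounded: "\<exists>C. \<forall>t\<in>params. \<forall>b\<in>axes. \<bar>crd t b\<bar> \<le> C"
proof -
  have "compact ((\<lambda>\<eta>. \<eta> b) ` I j)" if "j \<in> {1..K}" for j and b :: nat
    by (intro compact_continuous_image I_cpt that continuous_on_subset[OF continuous_on_product_coordinates]) auto
  hence "bounded (\<Union>j\<in>{1..K}. \<Union>b\<in>{..<width}. (\<lambda>\<eta>. \<eta> b) ` I j)"
    by (intro bounded_UN ballI finite_atLeastAtMost finite_lessThan compact_imp_bounded)
  then obtain C1 where "\<forall>y\<in>(\<Union>j\<in>{1..K}. \<Union>b\<in>{..<width}. (\<lambda>\<eta>. \<eta> b) ` I j). norm y \<le> C1"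
    unfolding bounded_iff by blast
  hence C1: "\<bar>\<eta> b\<bar> \<le> C1" if "j \<in> {1..K}" "b < width" "\<eta> \<in> I j" for j b and \<eta> :: "nat \<Rightarrow> real"
    using that by fastforce
  obtain C2 where C2: "\<And>u. u \<in> U \<Longrightarrow> norm u \<le> C2"
    using compact_imp_bounded[OF U] unfolding bounded_iff by blast
  have "\<bar>crd t b\<bar> \<le> 4 * real K + 4 * real width + \<bar>C1\<bar> + \<bar>C2\<bar>" if t: "t \<in> params" and b: "b \<in> axes" for t b
  proof -
    obtain j a u \<eta> where teq: "t = (j, a, u, \<eta>)" and *: "j \<in> {1..K}" "a < m (j - 1)" "u \<in> U" "\<eta> \<in> I j"
      using t by (auto simp: params_def)
    have "m (j - 1) \<le> width" using *(1) by (intro m_width) auto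
    hence aw: "a < width" using *(2) by linarith
    from b consider "b = Inl 0" | "b = Inl (Suc 0)" | i where "b = Inl (Suc (Suc i))" "i < width" | e where "b = Inr e" "e \<in> Basis"
      unfolding axes_def by (auto elim!: lessThan_iff[THEN iffD1, elim_format]) (metis less_Suc_eq_0_disj not_less_eq)
    thus ?thesis
    proof cases
      case 1
      have "real j \<le> real K" using *(1) by simp
      thus ?thesis using 1 by (simp add: teq crd_def)
    next
      case 2 thus ?thesis using aw by (simp add: teq crd_def)
    next
      case 3 thus ?thesis using C1[OF *(1) _ *(4), of i] by (simp add: teq crd_def)
    next
      case 4 thus ?thesis using C2[OF *(3)] Basis_le_norm[of e u] by (simp add: teq crd_def)
    qed
  qed
  thus ?thesis by blast
qed

definition crd_bound :: real where
  "crd_bound = (SOME C. \<forall>t\<in>params. \<forall>b\<in>axes. \<bar>crd t b\<bar> \<le> C)"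

lemma env_L2: "env \<in> L2 P"
proof -
  have g: "\<gamma> j \<in> L2 P" if "j \<in> {1..K}" for j using \<gamma>_meas[OF that] \<gamma>_sq[OF that] by (simp add: L2_def)
  have c: "(\<lambda>_. c) \<in> L2 P" for c :: real by (simp add: L2_def)
  show ?thesis unfolding env_def[abs_def] by (intro L2_add L2_sum g c)
qed

lemma env_ge: "env x \<ge> 1"
  unfolding env_def using \<gamma>_ge lip_ge by (simp add: sum_nonneg)

lemma env_level: assumes "j \<in> {1..K}" shows "\<gamma> j x + lip j \<le> env x"
proof -
  have "\<gamma> j x + lip j \<le> (\<Sum>j=1..K. \<gamma> j x + lip j)"
    using \<gamma>_ge lip_ge by (intro member_le_sum[of j "{1..K}" "\<lambda>j. \<gamma> j x + lip j"] assms add_nonneg_nonneg) auto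
  thus ?thesis by (simp add: env_def)
qed

lemma phi_meas: assumes "(j, a, u, \<eta>) \<in> params" shows "phi (j, a, u, \<eta>) \<in> borel_measurable P"
proof -
  have [measurable]: "(\<lambda>x. F j u \<eta> x a) \<in> borel_measurable P"
    using assms I_Rn by (intro F_meas) (auto simp: params_def)
  show ?thesis unfolding phi_def by simp
qed

sublocale lip_class params axes crd crd_bound P phi env
proof unfold_locales
  show "finite axes" by (simp add: axes_def)
  have "(1, 0, uhat, val uhat (Suc 1)) \<in> params" using K1 m0 uhat val_I[of 1 uhat] by (simp add: params_def)
  thus "params \<noteq> {}" by blast
  show "\<bar>crd t b\<bar> \<le> crd_bound" if "t \<in> params" "b \<in> axes" for t b
    using someI_ex[OF crd_bounded] that unfolding crd_bound_def by blast
  fix t assume "t \<in> params"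
  then obtain j a u \<eta> where teq: "t = (j, a, u, \<eta>)" and t: "(j, a, u, \<eta>) \<in> params" by (cases t) auto
  hence *: "j \<in> {1..K}" "a < m (j - 1)" "u \<in> U" "\<eta> \<in> I j" by (auto simp: params_def)
  show "phi t \<in> borel_measurable P" using phi_meas[OF t] teq by simp
  have "(\<lambda>x. F j u \<eta> x a - fbar j u \<eta> a) \<in> L2 P"
  proof (rule L2_diff)
    show "(\<lambda>x. F j u \<eta> x a) \<in> L2 P" unfolding L2_def
      using F_sq[OF *(1,3,4,2)] F_meas[OF *(1,3)] I_Rn[OF *(1)] *(4) by auto
  qed (simp add: L2_def)
  thus "integrable P (\<lambda>x. (phi t x)\<^sup>2)" by (simp add: teq phi_def L2_def)
  show "P.expectation (phi t) = 0"
    using F_int[OF *(1,3,4,2)] by (simp add: teq phi_def fbar_def vexp_def P.prob_space)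
next
  show "env x \<ge> 1" for x by (rule env_ge)
  show "env \<in> borel_measurable P" "integrable P (\<lambda>x. (env x)\<^sup>2)" using env_L2 by (auto simp: L2_def)
next
  fix s t x assume st: "s \<in> params" "t \<in> params" "bounded_coords.dd axes crd s t \<le> 3" and x: "x \<in> space P"
  obtain j a u \<eta> where s: "s = (j, a, u, \<eta>)" "j \<in> {1..K}" "a < m (j - 1)" "u \<in> U" "\<eta> \<in> I j"
    using st(1) by (auto simp: params_def)
  obtain j' a' u' \<eta>' where t: "t = (j', a', u', \<eta>')" "j' \<in> {1..K}" "a' < m (j' - 1)" "u' \<in> U" "\<eta>' \<in> I j'"
    using st(2) by (auto simp: params_def)
  interpret ci: bounded_coords params axes crd crd_bound
  proof
    show "finite axes" by (simp add: axes_def)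
    show "params \<noteq> {}" using st(1) by blast
    show "\<bar>crd t b\<bar> \<le> crd_bound" if "t \<in> params" "b \<in> axes" for t b
      using someI_ex[OF crd_bounded] that unfolding crd_bound_def by blast
  qed
  have dd: "ci.dd s t = \<bar>4 * real j - 4 * real j'\<bar> + (\<bar>4 * real a - 4 * real a'\<bar> + dist1 width \<eta> \<eta>') + (\<Sum>e\<in>Basis. \<bar>(u - u') \<bullet> e\<bar>)"
    unfolding ci.dd_def s(1) t(1) by (rule crd_sum)
  have nn: "0 \<le> dist1 width \<eta> \<eta>'" "0 \<le> (\<Sum>e\<in>Basis. \<bar>(u - u') \<bullet> e\<bar>)" by (auto intro: sum_nonneg)
  have "\<bar>real j - real j'\<bar> < 1" "\<bar>real a - real a'\<bar> < 1" using st(3) nn unfolding dd by linarith+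
  hence eq: "j' = j" "a' = a" by linarith+
  have w: "dist1 width \<eta> \<eta>' = dist1 (m j) \<eta> \<eta>'"
    using s t eq I_Rn[of j] by (intro dist1_width) auto
  have le: "norm (u - u') + dist1 (m j) \<eta> \<eta>' \<le> ci.dd s t"
    unfolding dd w[symmetric] eq using norm_le_l1[of "u - u'"] by simp
  have "\<bar>phi s x - phi t x\<bar> \<le> \<bar>F j u \<eta> x a - F j u' \<eta>' x a\<bar> + \<bar>fbar j u \<eta> a - fbar j u' \<eta>' a\<bar>"
    unfolding s(1) t(1) eq phi_def by simp
  also have "\<dots> \<le> \<gamma> j x * (norm (u - u') + dist1 (m j) \<eta> \<eta>') + lip j * (norm (u - u') + dist1 (m j) \<eta> \<eta>')"
    using s t eq x by (intro add_mono F_lip fbar_lip) auto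
  also have "\<dots> = (\<gamma> j x + lip j) * (norm (u - u') + dist1 (m j) \<eta> \<eta>')" by (simp add: algebra_simps)
  also have "\<dots> \<le> env x * ci.dd s t"
    using env_level[OF s(2), of x] env_ge[of x] le by (intro mult_mono) auto
  finally show "\<bar>phi s x - phi t x\<bar> \<le> env x * ci.dd s t" .
qed

lemma dd_eq:
  "dd (j, a, u, \<eta>) (j', a', u', \<eta>') =
     \<bar>4 * real j - 4 * real j'\<bar> + (\<bar>4 * real a - 4 * real a'\<bar> + dist1 width \<eta> \<eta>') + (\<Sum>e\<in>Basis. \<bar>(u - u') \<bullet> e\<bar>)"
  unfolding dd_def by (rule crd_sum)

lemma dd_same:
  assumes "j \<in> {1..K}" "\<eta> \<in> I j" "\<eta>' \<in> I j"
  shows "dd (j, a, u, \<eta>) (j, a, u', \<eta>') \<le> (1 + real DIM('u)) * (norm (u - u') + dist1 (m j) \<eta> \<eta>')"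
proof -
  have w: "dist1 width \<eta> \<eta>' = dist1 (m j) \<eta> \<eta>'" using assms I_Rn[of j] by (intro dist1_width) auto
  have "(\<Sum>e\<in>Basis. \<bar>(u - u') \<bullet> e\<bar>) \<le> (\<Sum>e\<in>(Basis :: 'u set). norm (u - u'))" by (intro sum_mono Basis_le_norm)
  hence "dd (j, a, u, \<eta>) (j, a, u', \<eta>') \<le> dist1 (m j) \<eta> \<eta>' + real DIM('u) * norm (u - u')" unfolding dd_eq w by simp
  also have "\<dots> \<le> (1 + real DIM('u)) * (norm (u - u') + dist1 (m j) \<eta> \<eta>')" by (simp add: algebra_simps)
  finally show ?thesis .
qed

section \<open>The influence function of the optimal value\<close>

definition levels :: "(nat \<times> nat) set" where
  "levels = Sigma {1..K} (\<lambda>j. {..<m (j - 1)})"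

definition pt :: "nat \<times> nat \<Rightarrow> nat \<times> nat \<times> 'u \<times> (nat \<Rightarrow> real)" where
  "pt s = (fst s, snd s, uhat, val uhat (Suc (fst s)))"

lemma finite_levels: "finite levels"
  by (simp add: levels_def)

lemma pt_params: "s \<in> levels \<Longrightarrow> pt s \<in> params"
  using val_I uhat by (auto simp: levels_def pt_def params_def)

text \<open>Unfolding the recursion of \<open>xi\<close>, each value of \<open>h\<close> enters with
  a weight made of sums of products of mean Jacobians, independent of \<open>h\<close>.\<close>

lemma Xi_linear_level:
  assumes "j \<in> {1..Suc K}"
  shows "\<forall>a<m (j - 1). \<exists>c. \<forall>h. Xi h j a = (\<Sum>s\<in>levels. c s * h (fst s) uhat (val uhat (Suc (fst s))) (snd s))"
  using assms
proof (induction rule: down_induct)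
  case base
  show ?case by (intro allI impI exI[of _ "\<lambda>_. 0"]) (simp add: Xi_last)
next
  case (step j)
  let ?H = "\<lambda>h s. h (fst s) uhat (val uhat (Suc (fst s))) (snd s) :: real"
  have "\<forall>b. \<exists>c. b < m j \<longrightarrow> (\<forall>h. Xi h (Suc j) b = (\<Sum>s\<in>levels. c s * ?H h s))"
    using step(2) unfolding diff_Suc_1 by blast
  from choice[OF this] obtain c where "\<forall>b. b < m j \<longrightarrow> (\<forall>h. Xi h (Suc j) b = (\<Sum>s\<in>levels. c b s * ?H h s))"
    by (rule exE)
  hence c: "Xi h (Suc j) b = (\<Sum>s\<in>levels. c b s * ?H h s)" if "b < m j" for b h using that by blast
  show ?case
  proof (intro allI impI)
    fix a assume a: "a < m (j - 1)"
    have ja: "(j, a) \<in> levels" using step(1) a by (simp add: levels_def)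
    show "\<exists>c. \<forall>h. Xi h j a = (\<Sum>s\<in>levels. c s * ?H h s)"
    proof (intro exI allI)
      fix h
      have "Xi h j a = (\<Sum>b<m j. \<Sum>s\<in>levels. jac_mean j a b * (c b s * ?H h s)) + ?H h (j, a)"
        unfolding Xi_step[OF step(1) a] sum_distrib_left[symmetric] using c by simp
      also have "(\<Sum>b<m j. \<Sum>s\<in>levels. jac_mean j a b * (c b s * ?H h s)) = (\<Sum>s\<in>levels. (\<Sum>b<m j. jac_mean j a b * c b s) * ?H h s)"
        by (subst sum.swap) (simp add: sum_distrib_right mult.assoc)
      also have "?H h (j, a) = (\<Sum>s\<in>levels. (if s = (j, a) then 1 else 0) * ?H h s)"
      proof -
        have "(\<Sum>s\<in>levels. (if s = (j, a) then 1 else 0) * ?H h s) = (\<Sum>s\<in>levels. if s = (j, a) then ?H h (j, a) else 0)"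
          by (intro sum.cong) auto
        thus ?thesis using finite_levels ja by simp
      qed
      finally show "Xi h j a = (\<Sum>s\<in>levels. ((\<Sum>b<m j. jac_mean j a b * c b s) + (if s = (j, a) then 1 else 0)) * ?H h s)"
        by (simp only: sum.distrib[symmetric] distrib_right)
    qed
  qed
qed

lemma Xi_linear: "\<exists>c. \<forall>h. Xi h 1 0 = (\<Sum>s\<in>levels. c s * h (fst s) uhat (val uhat (Suc (fst s))) (snd s))"
  using Xi_linear_level[of 1] m0 by auto

definition weight :: "nat \<times> nat \<Rightarrow> real" where
  "weight = (SOME c. \<forall>h. Xi h 1 0 = (\<Sum>s\<in>levels. c s * h (fst s) uhat (val uhat (Suc (fst s))) (snd s)))"

lemma Xi_weight: "Xi h 1 0 = (\<Sum>s\<in>levels. weight s * h (fst s) uhat (val uhat (Suc (fst s))) (snd s))"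
  using someI_ex[OF Xi_linear] unfolding weight_def by blast

text \<open>The first-order effect of one observation on the optimal value: \<open>Xi\<close> of the
  empirical process is the normalized sum of this function over the sample.\<close>

definition influence :: "'x \<Rightarrow> real" where
  "influence x = (\<Sum>s\<in>levels. weight s * phi (pt s) x)"

lemma influence_L2: "influence \<in> L2 P"
  unfolding influence_def[abs_def] by (intro L2_sum L2_cmult \<phi>_L2 pt_params)

lemma influence_mean: "P.expectation influence = 0"
proof -
  have "P.expectation influence = (\<Sum>s\<in>levels. weight s * P.expectation (phi (pt s)))"
    unfolding influence_def[abs_def] using \<phi>_int[OF pt_params]
    by (subst Bochner_Integration.integral_sum) auto
  also have "\<dots> = 0" using \<phi>_mean[OF pt_params] by (intro sum.neutral) auto
  finally show ?thesis .
qed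

text \<open>A double sum of covariances is the form in which the variance of \<open>xi\<close> of a
  limit process is computed as well.\<close>

lemma influence_variance:
  "P.expectation (\<lambda>x. (influence x)\<^sup>2) =
     (\<Sum>s\<in>levels. \<Sum>t\<in>levels. weight s * weight t * P.expectation (\<lambda>x. phi (pt s) x * phi (pt t) x))"
proof -
  have "(influence x)\<^sup>2 = (\<Sum>s\<in>levels. \<Sum>t\<in>levels. weight s * weight t * (phi (pt s) x * phi (pt t) x))" for x
    unfolding influence_def power2_eq_square sum_product by (intro sum.cong refl) (simp add: mult_ac)
  moreover have "integrable P (\<lambda>x. weight s * weight t * (phi (pt s) x * phi (pt t) x))" if "s \<in> levels" "t \<in> levels" for s t
    by (intro integrable_mult_right L2_mult \<phi>_L2 pt_params that)
  ultimately show ?thesis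
    by (simp add: Bochner_Integration.integral_sum Bochner_Integration.integrable_sum)
qed

end

section \<open>The empirical process as a random perturbation\<close>

context composite_sample
begin

sublocale empirical_process params axes crd crd_bound P phi env M Xs ..

definition pert :: "nat \<Rightarrow> 'w \<Rightarrow> nat \<Rightarrow> 'u \<Rightarrow> (nat \<Rightarrow> real) \<Rightarrow> nat \<Rightarrow> real" where
  "pert n \<omega> j u \<eta> a = G n (j, a, u, \<eta>) \<omega>"

text \<open>An algebraic identity for each path: an empirical mean is the expectation plus the
  empirical process divided by \<open>sqrt (real n)\<close>. It holds at every argument, inside
  \<open>I j\<close> or not.\<close>

lemma perturbed_emp:
  assumes n: "n \<ge> 1" and \<omega>: "\<omega> \<in> space M" shows "perturbed n (pert n \<omega>) (emp n \<omega>)"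
  unfolding perturbed_def
proof (intro conjI ballI allI impI)
  show "emp n \<omega> u (Suc K) = (\<lambda>_. 0)" for u by (rule emp_last)
  show "emp n \<omega> u (Suc j) \<in> Rn (m j)" if "u \<in> U" "j \<in> {1..K}" for u j
    using emp_Rn[of "Suc j" u \<omega> n] that \<omega> by simp
  fix u j a assume "j \<in> {1..K}"
  let ?f = "\<lambda>i. F j u (emp n \<omega> u (Suc j)) (Xs i \<omega>) a" and ?b = "fbar j u (emp n \<omega> u (Suc j)) a"
  have "emp n \<omega> u j a = (\<Sum>i=1..n. (1 / real n) * ?f i)"
    using \<open>j \<in> {1..K}\<close> by (subst emp_step) (auto simp: emp_mean_def)
  also have "\<dots> = (\<Sum>i=1..n. ?f i) / real n" by (simp add: sum_divide_distrib)
  also have "(\<Sum>i=1..n. ?f i) = real n * ?b + (\<Sum>i=1..n. ?f i - ?b)" by (simp add: sum_subtractf)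
  also have "(real n * ?b + (\<Sum>i=1..n. ?f i - ?b)) / real n = ?b + (\<Sum>i=1..n. ?f i - ?b) / sqrt (real n) / sqrt (real n)"
    using n by (simp add: add_divide_distrib)
  finally show "emp n \<omega> u j a = ?b + pert n \<omega> j u (emp n \<omega> u (Suc j)) a / sqrt (real n)"
    by (simp only: pert_def G_def phi_apply)
qed

lemma bounded_pert:
  assumes "\<eta> > 0"
  shows "\<exists>C\<ge>0. \<forall>n\<ge>1. \<exists>A\<in>sets M. measure M A \<ge> 1 - \<eta> \<and> (\<forall>\<omega>\<in>A. bounded_by C (pert n \<omega>))"
proof -
  obtain C where C: "\<And>n. n \<ge> 1 \<Longrightarrow> \<exists>A\<in>sets M. measure M A \<ge> 1 - \<eta> \<and> (\<forall>\<omega>\<in>A. \<forall>t\<in>params. \<bar>G n t \<omega>\<bar> \<le> C)"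
    using stochastic_boundedness[OF assms] by blast
  have "bounded_by \<bar>C\<bar> (pert n \<omega>)" if "\<forall>t\<in>params. \<bar>G n t \<omega>\<bar> \<le> C" for n \<omega>
    unfolding bounded_by_def pert_def
  proof (intro ballI allI impI)
    fix j u \<eta> a assume "j \<in> {1..K}" "u \<in> U" "\<eta> \<in> I j" "a < m (j - 1)"
    hence "(j, a, u, \<eta>) \<in> params" by (simp add: params_def)
    with that have "\<bar>G n (j, a, u, \<eta>) \<omega>\<bar> \<le> C" by blast
    thus "\<bar>G n (j, a, u, \<eta>) \<omega>\<bar> \<le> \<bar>C\<bar>" by linarith
  qed
  thus ?thesis using C by (intro exI[of _ "\<bar>C\<bar>"]) (simp, meson)
qed

lemma modulus_pert:
  assumes "e > 0" "\<eta> > 0"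
  shows "\<exists>\<rho>>0. \<forall>n\<ge>1. \<exists>A\<in>sets M. measure M A \<ge> 1 - \<eta> \<and> (\<forall>\<omega>\<in>A. modulus \<rho> e (pert n \<omega>))"
proof -
  obtain \<delta> where \<delta>: "\<delta> > 0" "\<And>n. n \<ge> 1 \<Longrightarrow> \<exists>A\<in>sets M. measure M A \<ge> 1 - \<eta> \<and>
    (\<forall>\<omega>\<in>A. \<forall>s\<in>params. \<forall>t\<in>params. dd s t \<le> \<delta> \<longrightarrow> \<bar>G n s \<omega> - G n t \<omega>\<bar> \<le> e)"
    using stochastic_equicontinuity[OF assms] by blast
  let ?D = "1 + real DIM('u)"
  have D: "?D > 0" by simp
  have "modulus (\<delta> / ?D) e (pert n \<omega>)"
    if G: "\<forall>s\<in>params. \<forall>t\<in>params. dd s t \<le> \<delta> \<longrightarrow> \<bar>G n s \<omega> - G n t \<omega>\<bar> \<le> e" for n \<omega>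
    unfolding modulus_def pert_def
  proof (intro ballI allI impI)
    fix j u u' \<eta> \<eta>' a
    assume *: "j \<in> {1..K}" "u \<in> U" "u' \<in> U" "\<eta> \<in> I j" "\<eta>' \<in> I j" "a < m (j - 1)"
      and le: "norm (u - u') + dist1 (m j) \<eta> \<eta>' \<le> \<delta> / ?D"
    have p: "(j, a, u, \<eta>) \<in> params" "(j, a, u', \<eta>') \<in> params" using * by (simp_all add: params_def)
    have "dd (j, a, u, \<eta>) (j, a, u', \<eta>') \<le> ?D * (norm (u - u') + dist1 (m j) \<eta> \<eta>')" by (rule dd_same[OF *(1,4,5)])
    also have "\<dots> \<le> \<delta>" using le D by (simp add: pos_le_divide_eq mult.commute)
    finally show "\<bar>G n (j, a, u, \<eta>) \<omega> - G n (j, a, u', \<eta>') \<omega>\<bar> \<le> e" using G p by blast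
  qed
  thus ?thesis using \<delta> D by (intro exI[of _ "\<delta> / ?D"]) (simp, meson)
qed

text \<open>The constants are chosen in the order \<open>C\<close> from boundedness,
  \<open>e\<close> from the delta method, \<open>\<rho>\<close> from equicontinuity at
  \<open>e\<close>, and \<open>n0\<close> last. On the intersection of the two events the scaled
  error differs from the normalized sum of \<open>influence\<close> by at most
  \<open>\<epsilon>\<close>.\<close>

theorem char_tendsto:
  assumes unique: "\<And>u. u \<in> U \<Longrightarrow> u \<noteq> uhat \<Longrightarrow> val uhat 1 0 < val u 1 0"
  shows "(\<lambda>n. char (distr M borel (\<lambda>\<omega>. sqrt (real n) * ((INF u\<in>U. emp n \<omega> u 1 0) - val uhat 1 0))) t)
    \<longlonglongrightarrow> complex_of_real (exp (- (P.expectation (\<lambda>x. (influence x)\<^sup>2) * t\<^sup>2 / 2)))"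
proof (rule M.slutsky_char)
  have uniq: "\<forall>u\<in>U. u \<noteq> uhat \<longrightarrow> val uhat 1 0 < val u 1 0" using unique by blast
  let ?X = "\<lambda>n \<omega>. (\<Sum>i=1..n. influence (Xs i \<omega>)) / sqrt (real n)"
  have X: "Xi (pert n \<omega>) 1 0 = ?X n \<omega>" for n \<omega>
  proof -
    have "Xi (pert n \<omega>) 1 0 = (\<Sum>s\<in>levels. weight s * ((\<Sum>i=1..n. phi (pt s) (Xs i \<omega>)) / sqrt (real n)))"
      unfolding Xi_weight by (simp add: pert_def G_def pt_def)
    also have "\<dots> = (\<Sum>s\<in>levels. \<Sum>i=1..n. weight s * phi (pt s) (Xs i \<omega>)) / sqrt (real n)"
      by (simp add: sum_divide_distrib sum_distrib_left)
    also have "\<dots> = ?X n \<omega>" unfolding influence_def by (subst sum.swap) simp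
    finally show ?thesis .
  qed
  have inf: "influence \<in> borel_measurable P" "integrable P (\<lambda>x. (influence x)\<^sup>2)" using influence_L2 by (auto simp: L2_def)
  show "?X n \<in> borel_measurable M" for n
  proof -
    have "(\<lambda>\<omega>. influence (Xs i \<omega>)) \<in> borel_measurable M" if "i \<in> {1..n}" for i
      by (rule measurable_compose[OF Xs_measurable inf(1)]) (use that in simp)
    thus ?thesis by (intro borel_measurable_divide borel_measurable_sum borel_measurable_const)
  qed
  show "(\<lambda>\<omega>. sqrt (real n) * ((INF u\<in>U. emp n \<omega> u 1 0) - val uhat 1 0)) \<in> borel_measurable M" for n
    using emp_min_measurable[of n] by measurable
  show "(\<lambda>n. char (distr M borel (?X n)) t) \<longlonglongrightarrow> complex_of_real (exp (- (P.expectation (\<lambda>x. (influence x)\<^sup>2) * t\<^sup>2 / 2)))"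
    by (rule clt[OF inf influence_mean])
  fix \<epsilon> \<eta> :: real assume \<epsilon>: "\<epsilon> > 0" and \<eta>: "\<eta> > 0"
  hence \<eta>2: "\<eta> / 2 > 0" by simp
  obtain C where C: "C \<ge> 0" "\<And>n. n \<ge> 1 \<Longrightarrow> \<exists>A\<in>sets M. measure M A \<ge> 1 - \<eta> / 2 \<and> (\<forall>\<omega>\<in>A. bounded_by C (pert n \<omega>))"
    using bounded_pert[OF \<eta>2] by blast
  obtain e where e: "e > 0" "\<forall>\<rho>>0. \<exists>n0. \<forall>n\<ge>n0. \<forall>h v. n \<ge> 1 \<longrightarrow> perturbed n h v \<longrightarrow> bounded_by C h \<longrightarrow> modulus \<rho> e h \<longrightarrow>
    \<bar>sqrt (real n) * ((INF u\<in>U. v u 1 0) - val uhat 1 0) - Xi h 1 0\<bar> \<le> \<epsilon>"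
    using perturbed_min[OF uniq C(1) \<epsilon>] by (rule exE, elim conjE) (rule that)
  obtain \<rho> where \<rho>: "\<rho> > 0" "\<And>n. n \<ge> 1 \<Longrightarrow> \<exists>A\<in>sets M. measure M A \<ge> 1 - \<eta> / 2 \<and> (\<forall>\<omega>\<in>A. modulus \<rho> e (pert n \<omega>))"
    using modulus_pert[OF e(1) \<eta>2] by blast
  obtain n0 where n0: "\<forall>n\<ge>n0. \<forall>h v. n \<ge> 1 \<longrightarrow> perturbed n h v \<longrightarrow> bounded_by C h \<longrightarrow> modulus \<rho> e h \<longrightarrow>
    \<bar>sqrt (real n) * ((INF u\<in>U. v u 1 0) - val uhat 1 0) - Xi h 1 0\<bar> \<le> \<epsilon>"
    using e(2)[rule_format, OF \<rho>(1)] by (rule exE) (rule that)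
  show "\<forall>\<^sub>F n in sequentially. \<exists>A\<in>sets M. measure M A \<ge> 1 - \<eta> \<and>
    (\<forall>\<omega>\<in>A. \<bar>sqrt (real n) * ((INF u\<in>U. emp n \<omega> u 1 0) - val uhat 1 0) - ?X n \<omega>\<bar> \<le> \<epsilon>)"
    unfolding eventually_sequentially
  proof (intro exI[of _ "max n0 1"] allI impI)
    fix n assume "max n0 1 \<le> n"
    hence n: "n \<ge> n0" "n \<ge> 1" by auto
    obtain A where A: "A \<in> sets M" "measure M A \<ge> 1 - \<eta> / 2" "\<forall>\<omega>\<in>A. bounded_by C (pert n \<omega>)" using C(2)[OF n(2)] by blast
    obtain A' where A': "A' \<in> sets M" "measure M A' \<ge> 1 - \<eta> / 2" "\<forall>\<omega>\<in>A'. modulus \<rho> e (pert n \<omega>)" using \<rho>(2)[OF n(2)] by blast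
    show "\<exists>A\<in>sets M. measure M A \<ge> 1 - \<eta> \<and>
      (\<forall>\<omega>\<in>A. \<bar>sqrt (real n) * ((INF u\<in>U. emp n \<omega> u 1 0) - val uhat 1 0) - ?X n \<omega>\<bar> \<le> \<epsilon>)"
    proof (intro bexI[of _ "A \<inter> A'"] conjI ballI)
      show "A \<inter> A' \<in> sets M" "measure M (A \<inter> A') \<ge> 1 - \<eta>"
        using M.events_Int[OF A(1) A'(1) A(2) A'(2)] by auto
      fix \<omega> assume \<omega>: "\<omega> \<in> A \<inter> A'"
      have sp: "\<omega> \<in> space M" using A(1) \<omega> sets.sets_into_space by auto
      show "\<bar>sqrt (real n) * ((INF u\<in>U. emp n \<omega> u 1 0) - val uhat 1 0) - ?X n \<omega>\<bar> \<le> \<epsilon>"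
        unfolding X[symmetric]
        by (rule n0[rule_format, OF n perturbed_emp[OF n(2) sp]]) (use A(3) A'(3) \<omega> in auto)
    qed
  qed
qed

end

section \<open>Covariances and the law of the limit\<close>

lemma L2_of_gauss:
  assumes "prob_space N" "gauss_char N Y v" "v \<ge> 0" shows "Y \<in> L2 N"
  using prob_space.gauss_char_imp(2)[OF assms] assms(2) by (simp add: L2_def gauss_char_def)

lemma L2_polarization:
  assumes "a \<in> L2 Q" "b \<in> L2 Q"
  shows "integral\<^sup>L Q (\<lambda>x. (a x + b x)\<^sup>2) =
    integral\<^sup>L Q (\<lambda>x. (a x)\<^sup>2) + integral\<^sup>L Q (\<lambda>x. (b x)\<^sup>2) + 2 * integral\<^sup>L Q (\<lambda>x. a x * b x)"
proof -
  have "(\<lambda>x. (a x + b x)\<^sup>2) = (\<lambda>x. (a x)\<^sup>2 + (b x)\<^sup>2 + 2 * (a x * b x))" by (simp add: power2_sum mult.assoc)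
  thus ?thesis using L2_mult[OF assms] assms by (simp add: L2_def)
qed

text \<open>\<open>gaussian_process\<close> provides variances of linear combinations; the
  covariances follow by polarization.\<close>

lemma (in lip_class) gaussian_covariance:
  assumes N: "prob_space N"
    and W': "\<forall>S a. finite S \<longrightarrow> S \<subseteq> T \<longrightarrow>
      gauss_char N (\<lambda>\<omega>. \<Sum>t\<in>S. a t * W t \<omega>) (\<integral>x. (\<Sum>t\<in>S. a t * \<phi> t x)\<^sup>2 \<partial>P)"
    and s: "s \<in> T" and t: "t \<in> T"
  shows "integral\<^sup>L N (W s) = 0" "covar N (W s) (W t) = (\<integral>x. \<phi> s x * \<phi> t x \<partial>P)"
proof -
  interpret N: prob_space N by (rule N)
  note W = W'[rule_format]
  have g1: "gauss_char N (W u) (\<integral>x. (\<phi> u x)\<^sup>2 \<partial>P)" if "u \<in> T" for u using W[of "{u}" "\<lambda>_. 1"] that by simp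
  have L: "W u \<in> L2 N" if "u \<in> T" for u by (rule L2_of_gauss[OF N g1[OF that]]) simp
  have m: "integral\<^sup>L N (W u) = 0" if "u \<in> T" for u by (rule N.gauss_char_imp(3)[OF g1[OF that]]) simp
  have v: "(\<integral>\<omega>. (W u \<omega>)\<^sup>2 \<partial>N) = (\<integral>x. (\<phi> u x)\<^sup>2 \<partial>P)" if "u \<in> T" for u
    by (rule N.gauss_char_imp(4)[OF g1[OF that]]) simp
  show "integral\<^sup>L N (W s) = 0" by (rule m[OF s])
  have "(\<integral>\<omega>. W s \<omega> * W t \<omega> \<partial>N) = (\<integral>x. \<phi> s x * \<phi> t x \<partial>P)"
  proof (cases "s = t")
    case True thus ?thesis using v[OF t] by (simp add: power2_eq_square)
  next
    case False
    have "gauss_char N (\<lambda>\<omega>. W s \<omega> + W t \<omega>) (\<integral>x. (\<phi> s x + \<phi> t x)\<^sup>2 \<partial>P)"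
      using W[of "{s, t}" "\<lambda>_. 1"] s t False by simp
    hence "(\<integral>\<omega>. (W s \<omega> + W t \<omega>)\<^sup>2 \<partial>N) = (\<integral>x. (\<phi> s x + \<phi> t x)\<^sup>2 \<partial>P)"
      by (rule N.gauss_char_imp(4)) simp
    thus ?thesis using L2_polarization[OF L[OF s] L[OF t]] L2_polarization[OF \<phi>_L2[OF s] \<phi>_L2[OF t]] v[OF s] v[OF t] by simp
  qed
  thus "covar N (W s) (W t) = (\<integral>x. \<phi> s x * \<phi> t x \<partial>P)" by (simp add: covar_def m s t)
qed

text \<open>\<open>Y\<close> stands for the coordinates of an arbitrary limit process at the points
  \<open>pt s\<close>. A centred Gaussian combination is determined by its variance, and the
  prescribed covariances fix that variance to be the one of \<open>influence\<close>.\<close>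

lemma (in composite) limit_gauss_char:
  assumes N: "prob_space N"
    and Y: "\<And>c. normal_rv N (\<lambda>\<omega>. \<Sum>s\<in>levels. c s * Y s \<omega>)" and Ys: "\<And>s. s \<in> levels \<Longrightarrow> normal_rv N (Y s)"
    and Y0: "\<And>s. s \<in> levels \<Longrightarrow> integral\<^sup>L N (Y s) = 0"
    and cov: "\<And>s t. s \<in> levels \<Longrightarrow> t \<in> levels \<Longrightarrow> covar N (Y s) (Y t) = (\<integral>x. phi (pt s) x * phi (pt t) x \<partial>P)"
  shows "gauss_char N (\<lambda>\<omega>. \<Sum>s\<in>levels. weight s * Y s \<omega>) (P.expectation (\<lambda>x. (influence x)\<^sup>2))"
proof -
  interpret N: prob_space N by (rule N)
  have L: "Y s \<in> L2 N" if "s \<in> levels" for s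
    using N.normal_rv_imp_gauss_char[OF Ys[OF that] Y0[OF that]] by (simp add: L2_def gauss_char_def)
  have int: "integrable N (Y s)" if "s \<in> levels" for s
    by (rule N.square_integrable_imp_integrable) (use L[OF that] in \<open>simp_all add: L2_def\<close>)
  let ?Z = "\<lambda>\<omega>. \<Sum>s\<in>levels. weight s * Y s \<omega>"
  have Z0: "N.expectation ?Z = 0"
    using int Y0 by (subst Bochner_Integration.integral_sum) auto
  have "(?Z \<omega>)\<^sup>2 = (\<Sum>s\<in>levels. \<Sum>t\<in>levels. weight s * weight t * (Y s \<omega> * Y t \<omega>))" for \<omega>
    unfolding power2_eq_square sum_product by (intro sum.cong refl) (simp add: mult_ac)
  moreover have "integrable N (\<lambda>\<omega>. weight s * weight t * (Y s \<omega> * Y t \<omega>))" if "s \<in> levels" "t \<in> levels" for s t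
    by (intro integrable_mult_right L2_mult L that)
  ultimately have "N.expectation (\<lambda>\<omega>. (?Z \<omega>)\<^sup>2) = (\<Sum>s\<in>levels. \<Sum>t\<in>levels. weight s * weight t * N.expectation (\<lambda>\<omega>. Y s \<omega> * Y t \<omega>))"
    by (simp add: Bochner_Integration.integral_sum Bochner_Integration.integrable_sum)
  also have "\<dots> = P.expectation (\<lambda>x. (influence x)\<^sup>2)"
    unfolding influence_variance using cov Y0 by (intro sum.cong refl) (simp add: covar_def)
  finally show ?thesis using N.normal_rv_imp_gauss_char(1)[OF Y[of weight] Z0] by (simp only:)
qed

text \<open>The innermost function is treated as a further level \<open>k + 1\<close> with a \<open>0\<close>-dimensional argument.\<close>

definition level_fun ::
  "nat \<Rightarrow> (nat \<Rightarrow> 'u \<Rightarrow> (nat \<Rightarrow> real) \<Rightarrow> 'x \<Rightarrow> nat \<Rightarrow> real) \<Rightarrow> ('u \<Rightarrow> 'x \<Rightarrow> nat \<Rightarrow> real) \<Rightarrow>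
   nat \<Rightarrow> 'u \<Rightarrow> (nat \<Rightarrow> real) \<Rightarrow> 'x \<Rightarrow> nat \<Rightarrow> real" where
  "level_fun k f g j u \<eta> = (if j \<le> k then f j u \<eta> else g u)"

definition level_dim :: "nat \<Rightarrow> (nat \<Rightarrow> nat) \<Rightarrow> nat \<Rightarrow> nat" where
  "level_dim k m j = (if j \<le> k then m j else 0)"

definition level_set :: "nat \<Rightarrow> (nat \<Rightarrow> (nat \<Rightarrow> real) set) \<Rightarrow> nat \<Rightarrow> (nat \<Rightarrow> real) set" where
  "level_set k I j = (if j \<le> k then I j else {\<lambda>_. 0})"

lemma nested_level_fun:
  assumes "j \<le> Suc k"
  shows "nested E (Suc k) (level_fun k f g) (\<lambda>_ _ _. 0) u j = nested E k f g u j"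
  using assms
proof (induction rule: inc_induct)
  case base
  show ?case by (simp add: nested.simps[of _ _ _ _ _ "Suc k"] level_fun_def)
next
  case (step n)
  show ?case using step
    by (simp add: nested.simps[of _ _ _ _ _ n]) (simp add: level_fun_def)
qed

text \<open>At level \<open>k + 1\<close> the dimension is 0, so the Jacobian sum is empty and the
  extended recursion yields the vector \<open>e\<close>, where the original recursion
  starts.\<close>

lemma xi_level_fun:
  assumes "j \<le> Suc k" "j \<ge> 1" and \<mu>: "\<And>j. j \<in> {1..k} \<Longrightarrow> \<mu> (Suc j) = v (Suc j)"
  shows "xi P (Suc k) (level_dim k m) (level_fun k f g) u v (\<lambda>j \<eta>. if j \<le> k then d j \<eta> else e, \<lambda>_. 0) j
    = xi P k m f u \<mu> (d, e) j"
  using assms(1,2)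
proof (induction rule: inc_induct)
  case base
  show ?case by (simp add: xi.simps[of _ _ _ _ _ _ _ "Suc k"] level_dim_def fun_eq_iff)
next
  case (step n)
  have "\<mu> (Suc n) = v (Suc n)" using step by (intro \<mu>) auto
  thus ?case using step
    by (simp add: xi.simps[of _ _ _ _ _ _ _ n]) (simp add: level_dim_def level_fun_def)
qed

lemma compactin_Euclidean_space: "compactin (Euclidean_space p) S \<longleftrightarrow> compact S \<and> S \<subseteq> Rn p"
  by (subst Euclidean_space_top_of_set) (auto simp: compactin_subtopology)

lemma differentiable_Rn_0: "differentiable_Rn 0 q (\<lambda>_. c) \<eta>"
  by (auto simp: differentiable_Rn_def vdist_def vnorm_def L2_set_def intro!: exI[of _ 1])

lemma weak_conv_m_char:
  assumes "\<And>n. Y n \<in> borel_measurable M" "Z \<in> borel_measurable N" "prob_space M" "prob_space N"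
    and "\<And>t. (\<lambda>n. char (distr M borel (Y n)) t) \<longlonglongrightarrow> char (distr N borel Z) t"
  shows "weak_conv_m (\<lambda>n. distr M borel (Y n)) (distr N borel Z)"
proof (rule levy_continuity)
  interpret M: prob_space M by (rule assms(3))
  interpret N: prob_space N by (rule assms(4))
  show "real_distribution (distr M borel (Y n))" for n using assms(1) by simp
  show "real_distribution (distr N borel Z)" using assms(2) by simp
qed (rule assms(5))

text \<open>The limit law does not depend on which process with the given covariance represents it,
  so convergence is asserted for all of them; the existence conjunct shows that there is
  one.\<close>

theorem theorem4p1:
  fixes k :: nat and m :: "nat \<Rightarrow> nat"
    and U :: "'u::euclidean_space set" and uhat :: 'u
    and \<X> :: "(real ^ 'm) set"
    and N\<^sub>X :: "'a measure" and X :: "'a \<Rightarrow> real ^ 'm" and P :: "(real ^ 'm) measure"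
    and M :: "'b measure" and Xs :: "nat \<Rightarrow> 'b \<Rightarrow> real ^ 'm"
    and f :: "nat \<Rightarrow> 'u \<Rightarrow> (nat \<Rightarrow> real) \<Rightarrow> real ^ 'm \<Rightarrow> nat \<Rightarrow> real"
    and g :: "'u \<Rightarrow> real ^ 'm \<Rightarrow> nat \<Rightarrow> real"
    and I :: "nat \<Rightarrow> (nat \<Rightarrow> real) set"
    and \<gamma> :: "nat \<Rightarrow> real ^ 'm \<Rightarrow> real"
    and \<rho> :: real and \<rho>\<^sub>n :: "nat \<Rightarrow> 'b \<Rightarrow> real" and \<mu> :: "nat \<Rightarrow> nat \<Rightarrow> real"
  assumes k: "k \<ge> 1" and m0: "m 0 = 1" and m_pos: "\<And>j. j \<in> {1..k} \<Longrightarrow> m j \<ge> 1"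
    and U: "compact U"
    \<comment> \<open>the random vector with values in \<open>\<X>\<close> and its distribution; i.i.d. observations\<close>
    and N\<^sub>X: "prob_space N\<^sub>X" and X: "X \<in> N\<^sub>X \<rightarrow>\<^sub>M restrict_space borel \<X>"
    and P: "P = distr N\<^sub>X (restrict_space borel \<X>) X"
    and M: "prob_space M"
    and Xs_indep: "prob_space.indep_vars M (\<lambda>_. restrict_space borel \<X>) Xs {1..}"
    and Xs_distr: "\<And>i. i \<ge> 1 \<Longrightarrow> distr M (restrict_space borel \<X>) (Xs i) = P"
    \<comment> \<open>ranges of the functions, and their measurability in the last argument\<close>
    and f_range: "\<And>j u \<eta> x. j \<in> {1..k} \<Longrightarrow> u \<in> U \<Longrightarrow> \<eta> \<in> Rn (m j) \<Longrightarrow> x \<in> \<X> \<Longrightarrow>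
                    f j u \<eta> x \<in> Rn (m (j - 1))"
    and g_range: "\<And>u x. u \<in> U \<Longrightarrow> x \<in> \<X> \<Longrightarrow> g u x \<in> Rn (m k)"
    and f_meas: "\<And>j u \<eta> a. j \<in> {1..k} \<Longrightarrow> u \<in> U \<Longrightarrow> \<eta> \<in> Rn (m j) \<Longrightarrow>
                    (\<lambda>x. f j u \<eta> x a) \<in> borel_measurable P"
    and g_meas: "\<And>u a. u \<in> U \<Longrightarrow> (\<lambda>x. g u x a) \<in> borel_measurable P"
    \<comment> \<open>the optimal value, the unique optimal solution and the empirical estimator\<close>
    and rho: "\<rho> = comp_min (\<lambda>h. vexp N\<^sub>X (\<lambda>\<omega>. h (X \<omega>))) k f g U"
    and uhat: "is_arg_min (\<lambda>u. nested (\<lambda>h. vexp N\<^sub>X (\<lambda>\<omega>. h (X \<omega>))) k f g u 1 0) (\<lambda>u. u \<in> U) uhat"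
    and uhat_unique:
      "\<And>u. is_arg_min (\<lambda>u. nested (\<lambda>h. vexp N\<^sub>X (\<lambda>\<omega>. h (X \<omega>))) k f g u 1 0) (\<lambda>u. u \<in> U) u \<Longrightarrow> u = uhat"
    and rho_n: "\<And>n \<omega>. \<rho>\<^sub>n n \<omega> = comp_min (emp_mean n (\<lambda>i. Xs i \<omega>)) k f g U"
    and mu_last: "\<mu> (Suc k) = vexp P (g uhat)"
    and mu: "\<And>j. j \<in> {1..k} \<Longrightarrow> \<mu> j = vexp P (f j uhat (\<mu> (Suc j)))"
    \<comment> \<open>the compact sets\<close>
    and I_compact: "\<And>j. j \<in> {1..k} \<Longrightarrow> compactin (Euclidean_space (m j)) (I j)"
    and I_last: "(\<lambda>u. vexp P (g u)) ` U \<subseteq> Euclidean_space (m k) interior_of I k"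
    and I_step: "\<And>j. j \<in> {1..k - 1} \<Longrightarrow>
                   {vexp P (f (Suc j) u \<eta>) | u \<eta>. u \<in> U \<and> \<eta> \<in> I (Suc j)}
                     \<subseteq> Euclidean_space (m j) interior_of I j"
    \<comment> \<open>condition (i)\<close>
    and f_L2: "\<And>j u \<eta>. j \<in> {1..k} \<Longrightarrow> u \<in> U \<Longrightarrow> \<eta> \<in> I j \<Longrightarrow>
                 integrable P (\<lambda>x. (vnorm (m (j - 1)) (f j u \<eta> x))\<^sup>2)"
    and g_L2: "\<And>u. u \<in> U \<Longrightarrow> integrable P (\<lambda>x. (vnorm (m k) (g u x))\<^sup>2)"
    \<comment> \<open>condition (ii)\<close>
    and f_lip: "\<And>j u' u'' \<eta>' \<eta>'' x. j \<in> {1..k} \<Longrightarrow> u' \<in> U \<Longrightarrow> u'' \<in> U \<Longrightarrow>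
                  \<eta>' \<in> I j \<Longrightarrow> \<eta>'' \<in> I j \<Longrightarrow> x \<in> \<X> \<Longrightarrow>
                  vdist (m (j - 1)) (f j u' \<eta>' x) (f j u'' \<eta>'' x)
                    \<le> \<gamma> j x * (norm (u' - u'') + vdist (m j) \<eta>' \<eta>'')"
    and g_lip: "\<And>u' u'' x. u' \<in> U \<Longrightarrow> u'' \<in> U \<Longrightarrow> x \<in> \<X> \<Longrightarrow>
                  vdist (m k) (g u' x) (g u'' x) \<le> \<gamma> (Suc k) x * norm (u' - u'')"
    and gamma_meas: "\<And>j. j \<in> {1..Suc k} \<Longrightarrow> \<gamma> j \<in> borel_measurable P"
    and gamma_L2: "\<And>j. j \<in> {1..Suc k} \<Longrightarrow> integrable P (\<lambda>x. (\<gamma> j x)\<^sup>2)"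
    \<comment> \<open>condition (iii)\<close>
    and f_diff: "\<And>j u \<eta> x. j \<in> {1..k} \<Longrightarrow> u \<in> U \<Longrightarrow> \<eta> \<in> Rn (m j) \<Longrightarrow> x \<in> \<X> \<Longrightarrow>
                   differentiable_Rn (m j) (m (j - 1)) (\<lambda>\<eta>. f j u \<eta> x) \<eta>"
    and f_C1: "\<And>j x a b. j \<in> {1..k} \<Longrightarrow> x \<in> \<X> \<Longrightarrow> a < m (j - 1) \<Longrightarrow> b < m j \<Longrightarrow>
                 continuous_map (prod_topology (top_of_set U) (Euclidean_space (m j))) euclideanreal
                   (\<lambda>(u, \<eta>). jac_entry (\<lambda>\<eta>. f j u \<eta> x) \<eta> a b)"
  shows "(\<exists>(N :: (nat \<Rightarrow> real) measure) W V.
            zero_mean_brownian k m I N W V \<and> has_limit_covariance P k m I f g uhat N W V)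
       \<and> (\<forall>(N :: 'w measure) W V.
            zero_mean_brownian k m I N W V \<and> has_limit_covariance P k m I f g uhat N W V \<longrightarrow>
            weak_conv_m
              (\<lambda>n. distr M borel (\<lambda>\<omega>. sqrt (real n) * (\<rho>\<^sub>n n \<omega> - \<rho>)))
              (distr N borel (\<lambda>\<omega>. xi P k m f uhat \<mu> (\<lambda>j \<eta>. W j \<eta> \<omega>, V \<omega>) 1 0)))"

proof -
  let ?K = "Suc k" and ?m = "level_dim k m" and ?F = "level_fun k f g" and ?I = "level_set k I"
  \<comment> \<open>The hypotheses leave the sign of \<open>\<gamma>\<close> open; its absolute
    value satisfies the same bounds and is nonnegative.\<close>
  let ?\<gamma> = "\<lambda>j x. \<bar>\<gamma> j x\<bar>"
  let ?v = "\<lambda>u. nested (vexp P) ?K ?F (\<lambda>_ _ _. 0) u"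
  interpret NX: prob_space N\<^sub>X by (rule N\<^sub>X)
  have sP: "sets P = sets (restrict_space borel \<X>)" "space P = \<X>" by (simp_all add: P space_restrict_space)
  have PP: "prob_space P" unfolding P by (rule NX.prob_space_distr[OF X])
  interpret PP: prob_space P by (rule PP)
  have uU: "uhat \<in> U" using uhat by (simp add: is_arg_min_def)
  have I_sub: "I j \<subseteq> Rn (m j)" "compact (I j)" if "j \<in> {1..k}" for j
    using I_compact[OF that] unfolding compactin_Euclidean_space by auto
  have int_sub: "X' interior_of S \<subseteq> S" for X' :: "(nat \<Rightarrow> real) topology" and S by (rule interior_of_subset)
  have val_step: "?v u j = vexp P (?F j u (?v u (Suc j)))" if "j \<le> ?K" for u j
    using that by (subst nested.simps) simp
  have val_last: "?v u (Suc ?K) = (\<lambda>_. 0)" for u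
    by (subst nested.simps) (simp add: vexp_def)
  \<comment> \<open>Downwards from level \<open>k + 1\<close>, whose space is a single point and
    hence its own interior; the two inclusions for \<open>I\<close> supply the other levels.\<close>
  have val_int: "?v u (Suc j) \<in> Euclidean_space (?m j) interior_of (?I j)" if u: "u \<in> U" and j: "j \<in> {1..?K}" for u j
  proof -
    have "j \<le> ?K" "1 \<le> j" using j by auto
    thus ?thesis
    proof (induction rule: inc_induct)
      case base
      have "topspace (Euclidean_space 0) = {\<lambda>_. 0}" by (auto simp: topspace_Euclidean_space)
      hence "Euclidean_space 0 interior_of {\<lambda>_. 0} = {\<lambda>_. 0}" by (metis interior_of_topspace)
      thus ?case by (simp add: val_last level_dim_def level_set_def)
    next
      case (step n)
      show ?case
      proof (cases "n = k")
        case True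
        have "?v u (Suc k) = vexp P (g u)" by (subst val_step) (auto simp: level_fun_def)
        thus ?thesis using I_last u True by (auto simp: level_dim_def level_set_def)
      next
        case False
        hence n: "n \<in> {1..k - 1}" "Suc n \<le> k" using step by auto
        have "?v u (Suc (Suc n)) \<in> I (Suc n)"
          using step(3) n int_sub[of "Euclidean_space (?m (Suc n))" "?I (Suc n)"] by (auto simp: level_set_def)
        moreover have "?v u (Suc n) = vexp P (f (Suc n) u (?v u (Suc (Suc n))))"
          using n by (subst val_step) (auto simp: level_fun_def)
        ultimately have "?v u (Suc n) \<in> Euclidean_space (m n) interior_of I n"
          using I_step[OF n(1)] u by blast
        thus ?thesis using n by (simp add: level_dim_def level_set_def)
      qed
    qed
  qed
  have lv: "j \<in> {1..k} \<or> j = ?K" if "j \<in> {1..?K}" for j using that by auto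
  have vn: "integrable P (\<lambda>x. (h x a)\<^sup>2)"
    if h: "integrable P (\<lambda>x. (vnorm p (h x))\<^sup>2)" and hm: "(\<lambda>x. h x a) \<in> borel_measurable P" and a: "a < p"
    for h :: "real ^ 'm \<Rightarrow> nat \<Rightarrow> real" and p a
  proof (rule Bochner_Integration.integrable_bound[OF h])
    show "(\<lambda>x. (h x a)\<^sup>2) \<in> borel_measurable P" using hm by simp
    have "\<bar>h x a\<bar>\<^sup>2 \<le> (vnorm p (h x))\<^sup>2" for x using coord_le_vnorm[OF a] by (intro power_mono) auto
    thus "AE x in P. norm ((h x a)\<^sup>2) \<le> norm ((vnorm p (h x))\<^sup>2)" by simp
  qed
  \<comment> \<open>Each condition is checked at levels up to \<open>k\<close>, where Euclidean
    norms are compared with \<open>dist1\<close> and with single coordinates, and at level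
    \<open>k + 1\<close>, where the argument is 0-dimensional.\<close>
  have comp: "composite P ?K ?m U uhat ?F ?I ?\<gamma>"
  proof
    show "?K \<ge> 1" "?m 0 = 1" "compact U" "uhat \<in> U" using m0 U uU by (auto simp: level_dim_def)
    show "compact (?I j)" if "j \<in> {1..?K}" for j using lv[OF that] I_sub by (auto simp: level_set_def)
    show "?I j \<subseteq> Rn (?m j)" if "j \<in> {1..?K}" for j
      using lv[OF that] I_sub by (auto simp: level_set_def level_dim_def topspace_Euclidean_space)
    show "?F j u \<eta> x \<in> Rn (?m (j - 1))" if "j \<in> {1..?K}" "u \<in> U" "\<eta> \<in> Rn (?m j)" "x \<in> space P" for j u \<eta> x
      using lv[OF that(1)]
    proof
      assume j: "j \<in> {1..k}"
      hence "?F j u \<eta> x = f j u \<eta> x" "?m (j - 1) = m (j - 1)" "?m j = m j" by (auto simp: level_fun_def level_dim_def)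
      thus ?thesis using f_range[OF j that(2)] that sP(2) by simp
    next
      assume "j = ?K"
      thus ?thesis using g_range[OF that(2)] that sP(2) by (simp add: level_fun_def level_dim_def)
    qed
    show "(\<lambda>x. ?F j u \<eta> x a) \<in> borel_measurable P" if "j \<in> {1..?K}" "u \<in> U" "\<eta> \<in> Rn (?m j)" for j u \<eta> a
      using lv[OF that(1)] that f_meas[of j u \<eta> a] g_meas[of u a] by (auto simp: level_fun_def level_dim_def)
    show "integrable P (\<lambda>x. (?F j u \<eta> x a)\<^sup>2)" if "j \<in> {1..?K}" "u \<in> U" "\<eta> \<in> ?I j" "a < ?m (j - 1)" for j u \<eta> a
      using lv[OF that(1)]
    proof
      assume j: "j \<in> {1..k}"
      hence e: "\<eta> \<in> I j" "a < m (j - 1)" "?F j u \<eta> = f j u \<eta>" using that by (auto simp: level_fun_def level_dim_def level_set_def split: if_splits)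
      have "\<eta> \<in> Rn (m j)" using I_sub(1)[OF j] e(1) by blast
      thus ?thesis unfolding e(3) by (intro vn[OF f_L2[OF j that(2) e(1)] _ e(2)] f_meas[OF j that(2)])
    next
      assume j: "j = ?K"
      hence e: "a < m k" "?F j u \<eta> = g u" using that by (auto simp: level_fun_def level_dim_def)
      show ?thesis unfolding e(2) by (rule vn[OF g_L2[OF that(2)] g_meas[OF that(2)] e(1)])
    qed
    show "\<bar>?F j u \<eta> x a - ?F j u' \<eta>' x a\<bar> \<le> ?\<gamma> j x * (norm (u - u') + dist1 (?m j) \<eta> \<eta>')"
      if "j \<in> {1..?K}" "u \<in> U" "u' \<in> U" "\<eta> \<in> ?I j" "\<eta>' \<in> ?I j" "x \<in> space P" "a < ?m (j - 1)" for j u u' \<eta> \<eta>' x a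
      using lv[OF that(1)]
    proof
      assume j: "j \<in> {1..k}"
      hence e: "\<eta> \<in> I j" "\<eta>' \<in> I j" "a < m (j - 1)" "?F j = f j" "?m j = m j"
        using that by (auto simp: level_fun_def level_dim_def level_set_def fun_eq_iff split: if_splits)
      have "\<bar>f j u \<eta> x a - f j u' \<eta>' x a\<bar> \<le> vdist (m (j - 1)) (f j u \<eta> x) (f j u' \<eta>' x)" by (rule coord_le_vdist[OF e(3)])
      also have "\<dots> \<le> \<gamma> j x * (norm (u - u') + vdist (m j) \<eta> \<eta>')"
        using that sP(2) e by (intro f_lip[OF j]) auto
      also have "\<dots> \<le> ?\<gamma> j x * (norm (u - u') + dist1 (m j) \<eta> \<eta>')"
        by (intro mult_mono add_left_mono vdist_le_dist1) (auto simp: vdist_def vnorm_def)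
      finally show ?thesis unfolding e(4,5) .
    next
      assume j: "j = ?K"
      hence e: "a < m k" "?F j u \<eta> = g u" "?F j u' \<eta>' = g u'" using that by (auto simp: level_fun_def level_dim_def)
      have "\<bar>g u x a - g u' x a\<bar> \<le> vdist (m k) (g u x) (g u' x)" by (rule coord_le_vdist[OF e(1)])
      also have "\<dots> \<le> \<gamma> ?K x * norm (u - u')" using that sP(2) by (intro g_lip) auto
      also have "\<dots> \<le> ?\<gamma> ?K x * (norm (u - u') + dist1 (?m j) \<eta> \<eta>')" by (intro mult_mono) auto
      finally show ?thesis unfolding e(2,3) unfolding j .
    qed
    show "0 \<le> ?\<gamma> j x" for j x by simp
    show "?\<gamma> j \<in> borel_measurable P" "integrable P (\<lambda>x. (?\<gamma> j x)\<^sup>2)" if "j \<in> {1..?K}" for j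
      using gamma_meas[OF that] gamma_L2[OF that] by auto
    show "differentiable_Rn (?m j) (?m (j - 1)) (\<lambda>\<eta>. ?F j u \<eta> x) \<eta>"
      if "j \<in> {1..?K}" "u \<in> U" "\<eta> \<in> Rn (?m j)" "x \<in> space P" for j u \<eta> x
      using lv[OF that(1)]
    proof
      assume j: "j \<in> {1..k}"
      hence "?F j = f j" "?m (j - 1) = m (j - 1)" "?m j = m j" by (auto simp: level_fun_def level_dim_def fun_eq_iff)
      thus ?thesis using f_diff[OF j that(2)] that sP(2) by simp
    next
      assume "j = ?K"
      thus ?thesis by (simp add: level_fun_def level_dim_def differentiable_Rn_0)
    qed
    show "continuous_map (prod_topology (top_of_set U) (Euclidean_space (?m j))) euclideanreal
         (\<lambda>(u, \<eta>). jac_entry (\<lambda>\<eta>. ?F j u \<eta> x) \<eta> a b)"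
      if "j \<in> {1..?K}" "x \<in> space P" "a < ?m (j - 1)" "b < ?m j" for j x a b
      using lv[OF that(1)]
    proof
      assume j: "j \<in> {1..k}"
      hence "?F j = f j" "?m (j - 1) = m (j - 1)" "?m j = m j" by (auto simp: level_fun_def level_dim_def fun_eq_iff)
      thus ?thesis using f_C1[OF j, of x a b] that sP(2) by simp
    next
      assume "j = ?K"
      thus ?thesis using that(4) by (simp add: level_dim_def)
    qed
    show "?v u (Suc j) \<in> Euclidean_space (?m j) interior_of (?I j)" if "j \<in> {1..?K}" "u \<in> U" for j u
      by (rule val_int[OF that(2,1)])
  qed
  interpret M: prob_space M by (rule M)
  have iid: "iid_sample M P Xs"
  proof
    show "M.indep_vars (\<lambda>_. P) Xs {1..}"
      using Xs_indep by (simp add: M.indep_vars_def2 sP(1) cong: measurable_cong_sets)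
    show "distr M P (Xs i) = P" if "i \<ge> 1" for i
      using Xs_distr[OF that] by (simp add: sP(1) cong: distr_cong)
  qed
  interpret C: composite P ?K ?m U uhat ?F ?I ?\<gamma> by (rule comp)
  interpret S: composite_sample P ?K ?m U uhat ?F ?I ?\<gamma> M Xs
    by (intro composite_sample.intro comp iid)
  \<comment> \<open>Expectation under \<open>N\<^sub>X\<close> equals integration against
    \<open>P\<close> for measurable functions; measurability at the nested values is known level by
    level, whence the induction.\<close>
  have valE: "C.val u j = nested (\<lambda>h. vexp N\<^sub>X (\<lambda>\<omega>. h (X \<omega>))) k f g u j" if u: "u \<in> U" and j: "j \<in> {1..?K}" for u j
  proof -
    let ?E = "\<lambda>h. vexp N\<^sub>X (\<lambda>\<omega>. h (X \<omega>))"
    have E: "?E h = vexp P h" if "\<And>a. (\<lambda>x. h x a) \<in> borel_measurable P" for h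
    proof
      fix a
      have "(\<lambda>x. h x a) \<in> borel_measurable (restrict_space borel \<X>)"
        using that[of a] by (simp add: sP(1) cong: measurable_cong_sets)
      thus "?E h a = vexp P h a" unfolding vexp_def P by (simp add: integral_distr[OF X])
    qed
    have "j \<le> ?K" "1 \<le> j" using j by auto
    hence "C.val u j = nested ?E ?K ?F (\<lambda>_ _ _. 0) u j"
    proof (induction rule: inc_induct)
      case base
      show ?case unfolding C.val_def
        by (simp add: nested.simps[of _ _ _ _ _ ?K] level_fun_def E g_meas[OF u])
    next
      case (step n)
      have n: "n \<in> {1..?K}" using step by auto
      have "C.val u n = vexp P (?F n u (C.val u (Suc n)))"
        using step by (subst C.val_step) (auto simp: C.fbar_def)
      also have "\<dots> = ?E (?F n u (C.val u (Suc n)))"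
        by (rule E[symmetric]) (rule C.F_meas[OF n u C.val_Rn[OF n u]])
      also have "\<dots> = nested ?E ?K ?F (\<lambda>_ _ _. 0) u n"
        using step by (simp add: nested.simps[of _ _ _ _ _ n])
      finally show ?case .
    qed
    also have "\<dots> = nested ?E k f g u j" using j by (intro nested_level_fun) auto
    finally show ?thesis .
  qed
  have mu_val: "\<mu> (Suc j) = C.val uhat (Suc j)" if "j \<in> {1..k}" for j
  proof -
    have "j \<le> k" "1 \<le> j" using that by auto
    thus ?thesis
    proof (induction rule: inc_induct)
      case base
      show ?case unfolding mu_last by (subst C.val_step) (auto simp: C.fbar_def level_fun_def)
    next
      case (step n)
      have "\<mu> (Suc n) = vexp P (f (Suc n) uhat (C.val uhat (Suc (Suc n))))"
        using step mu[of "Suc n"] by auto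
      thus ?case using step by (subst C.val_step) (auto simp: C.fbar_def level_fun_def)
    qed
  qed
  have one: "(1::nat) \<in> {1..?K}" by simp
  have rho_val: "\<rho> = C.val uhat 1 0"
  proof -
    have "C.val uhat 1 0 \<le> C.val u 1 0" if "u \<in> U" for u
      using uhat that valE[OF that one] valE[OF uU one] by (auto simp: is_arg_min_def not_less)
    hence "(INF u\<in>U. C.val u 1 0) = C.val uhat 1 0"
      using uU by (intro antisym cINF_lower cINF_greatest bdd_belowI2) auto
    moreover have "(INF u\<in>U. C.val u 1 0) = \<rho>"
      unfolding rho comp_min_def using valE[OF _ one] by (intro INF_cong) auto
    ultimately show ?thesis by simp
  qed
  \<comment> \<open>A further point attaining the minimum would contradict uniqueness, so the
    minimum at \<open>uhat\<close> is strict.\<close>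
  have unique: "C.val uhat 1 0 < C.val u 1 0" if u: "u \<in> U" "u \<noteq> uhat" for u
  proof (rule ccontr)
    assume "\<not> ?thesis"
    hence le: "C.val u 1 0 \<le> C.val w 1 0" if "w \<in> U" for w
      using uhat that valE[OF that one] valE[OF uU one] by (force simp: is_arg_min_def not_less)
    have "is_arg_min (\<lambda>u. nested (\<lambda>h. vexp N\<^sub>X (\<lambda>\<omega>. h (X \<omega>))) k f g u 1 0) (\<lambda>u. u \<in> U) u"
      using le u(1) valE[OF _ one] by (auto simp: is_arg_min_def not_less)
    thus False using uhat_unique u(2) by blast
  qed
  have rho_n_emp: "\<rho>\<^sub>n n \<omega> = (INF u\<in>U. S.emp n \<omega> u 1 0)" for n \<omega>
    unfolding rho_n comp_min_def S.emp_def by (simp add: nested_level_fun)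
  \<comment> \<open>Pairs of level and component are matched with scalar coordinates of the process:
    levels up to \<open>k\<close> with \<open>W\<close> at the nested expectation, level
    \<open>k + 1\<close> with the vector \<open>V\<close>. Injectivity lets sums over
    \<open>levels\<close> be read as sums over coordinates in
    \<open>jointly_gaussian\<close>.\<close>
  define idx where "idx s = (if fst s \<le> k then Inl (fst s, C.val uhat (Suc (fst s)), snd s) else Inr (snd s))" for s :: "nat \<times> nat"
  have idx_inj: "inj_on idx C.levels"
    unfolding inj_on_def idx_def C.levels_def by (auto split: if_splits)
  have idx_range: "idx s \<in> coord_index k m I" if s: "s \<in> C.levels" for s
  proof (cases "fst s \<le> k")
    case True
    hence "fst s \<in> {1..k}" "snd s < m (fst s - 1)" using s by (auto simp: C.levels_def level_dim_def split: if_splits)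
    moreover have "C.val uhat (Suc (fst s)) \<in> I (fst s)"
      using C.val_I[of "fst s" uhat] calculation(1) uU True by (auto simp: level_set_def)
    ultimately show ?thesis using True by (auto simp: idx_def coord_index_def)
  next
    case False
    hence "fst s = ?K" using s by (auto simp: C.levels_def)
    thus ?thesis using s by (auto simp: idx_def coord_index_def C.levels_def level_dim_def)
  qed
  have covar_commute: "covar N A B = covar N B A" for N :: "'z measure" and A B by (simp add: covar_def mult.commute)
  have weak: "weak_conv_m (\<lambda>n. distr M borel (\<lambda>\<omega>. sqrt (real n) * (\<rho>\<^sub>n n \<omega> - \<rho>)))
              (distr N borel (\<lambda>\<omega>. xi P k m f uhat \<mu> (\<lambda>j \<eta>. W j \<eta> \<omega>, V \<omega>) 1 0))"
    if ZB: "zero_mean_brownian k m I N W V" and LC: "has_limit_covariance P k m I f g uhat N W V" for N :: "'w measure" and W V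
  proof -
    note ZB' = ZB[unfolded zero_mean_brownian_def]
    have N: "prob_space N" by (rule ZB'[THEN conjunct1])
    have JG: "jointly_gaussian N (coord_index k m I) (coord W V)"
      by (rule ZB'[THEN conjunct2, THEN conjunct2, THEN conjunct2, THEN conjunct1])
    have mean: "(\<integral>\<omega>. coord W V s \<omega> \<partial>N) = 0" if "s \<in> coord_index k m I" for s
      by (rule bspec[OF ZB'[THEN conjunct2, THEN conjunct2, THEN conjunct2, THEN conjunct2] that])
    let ?h = "\<lambda>\<omega> j u \<eta> a. if j \<le> k then W j \<eta> \<omega> a else V \<omega> a"
    let ?Y = "\<lambda>s. coord W V (idx s)"
    have xi: "xi P k m f uhat \<mu> (\<lambda>j \<eta>. W j \<eta> \<omega>, V \<omega>) 1 0 = (\<Sum>s\<in>C.levels. C.weight s * ?Y s \<omega>)" for \<omega>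
    proof -
      have d: "(\<lambda>j \<eta> a. ?h \<omega> j uhat \<eta> a) = (\<lambda>j \<eta>. if j \<le> k then W j \<eta> \<omega> else V \<omega>)" by (auto simp: fun_eq_iff)
      have X: "xi P k m f uhat \<mu> (\<lambda>j \<eta>. W j \<eta> \<omega>, V \<omega>) 1 = C.Xi (?h \<omega>) 1"
        unfolding C.Xi_def d by (rule xi_level_fun[symmetric]) (auto simp: mu_val)
      show ?thesis
        unfolding X C.Xi_weight by (intro sum.cong refl) (simp add: idx_def coord_def)
    qed
    have gc: "gauss_char N (\<lambda>\<omega>. \<Sum>s\<in>C.levels. C.weight s * ?Y s \<omega>) (PP.expectation (\<lambda>x. (C.influence x)\<^sup>2))"
    proof (rule C.limit_gauss_char[OF N])
      show "normal_rv N (\<lambda>\<omega>. \<Sum>s\<in>C.levels. c s * ?Y s \<omega>)" for c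
      proof -
        have "normal_rv N (\<lambda>\<omega>. \<Sum>q\<in>idx ` C.levels. c (the_inv_into C.levels idx q) * coord W V q \<omega>)"
          by (rule JG[unfolded jointly_gaussian_def, rule_format]) (use C.finite_levels idx_range in auto)
        thus ?thesis by (simp add: sum.reindex[OF idx_inj] the_inv_into_f_f[OF idx_inj])
      qed
      fix s assume s: "s \<in> C.levels"
      have "normal_rv N (\<lambda>\<omega>. \<Sum>q\<in>{idx s}. 1 * coord W V q \<omega>)"
        using JG[unfolded jointly_gaussian_def, rule_format, of "{idx s}" "\<lambda>_. 1"] idx_range[OF s] by simp
      thus "normal_rv N (?Y s)" by simp
      show "integral\<^sup>L N (?Y s) = 0" by (rule mean[OF idx_range[OF s]])
    next
      fix s t assume st: "s \<in> C.levels" "t \<in> C.levels"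
      have lvlW: "j \<in> {1..k}" "C.val uhat (Suc j) \<in> I j" "a < m (j - 1)"
          "coord W V (idx (j, a)) = (\<lambda>\<omega>. W j (C.val uhat (Suc j)) \<omega> a)"
          "C.phi (C.pt (j, a)) = (\<lambda>x. f j uhat (C.val uhat (Suc j)) x a - vexp P (f j uhat (C.val uhat (Suc j))) a)"
        if "(j, a) \<in> C.levels" "j \<le> k" for j a
        using C.val_I[of j uhat] that uU
        by (auto simp: level_set_def C.levels_def level_dim_def idx_def coord_def C.pt_def C.phi_def C.fbar_def level_fun_def fun_eq_iff
            split: if_splits)
      have lvlV: "a < m k" "coord W V (idx (j, a)) = (\<lambda>\<omega>. V \<omega> a)"
          "C.phi (C.pt (j, a)) = (\<lambda>x. g uhat x a - vexp P (g uhat) a)"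
        if "(j, a) \<in> C.levels" "\<not> j \<le> k" for j a
      proof -
        have "j = ?K" using that by (auto simp: C.levels_def)
        thus "a < m k" "coord W V (idx (j, a)) = (\<lambda>\<omega>. V \<omega> a)" "C.phi (C.pt (j, a)) = (\<lambda>x. g uhat x a - vexp P (g uhat) a)"
          using that by (auto simp: idx_def coord_def C.pt_def C.phi_def C.fbar_def level_fun_def C.levels_def level_dim_def fun_eq_iff)
      qed
      obtain j a i b where eq: "s = (j, a)" "t = (i, b)" by (cases s, cases t) auto
      note sj = st(1)[unfolded eq] and ti = st(2)[unfolded eq]
      note LC' = LC[unfolded has_limit_covariance_def]
      note WW = LC'[THEN conjunct1, rule_format] and WV = LC'[THEN conjunct2, THEN conjunct1, rule_format]
        and VV = LC'[THEN conjunct2, THEN conjunct2, rule_format]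
      show "covar N (?Y s) (?Y t) = (\<integral>x. C.phi (C.pt s) x * C.phi (C.pt t) x \<partial>P)"
      proof (cases "j \<le> k"; cases "i \<le> k")
        assume l: "j \<le> k" "i \<le> k"
        note A = lvlW[OF sj l(1)] and B = lvlW[OF ti l(2)]
        show ?thesis unfolding eq A(4,5) B(4,5) by (rule WW[OF A(1) B(1) A(2) B(2) A(3) B(3)])
      next
        assume l: "j \<le> k" "\<not> i \<le> k"
        note A = lvlW[OF sj l(1)] and B = lvlV[OF ti l(2)]
        show ?thesis unfolding eq A(4,5) B(2,3) by (rule WV[OF A(1) A(2) A(3) B(1)])
      next
        \<comment> \<open>\<open>has_limit_covariance\<close> lists the mixed covariance in one
          order only; the other order follows by symmetry.\<close>
        assume l: "\<not> j \<le> k" "i \<le> k"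
        note A = lvlV[OF sj l(1)] and B = lvlW[OF ti l(2)]
        show ?thesis unfolding eq A(2,3) B(4,5) covar_commute[of N "\<lambda>\<omega>. V \<omega> a"]
          by (subst mult.commute) (rule WV[OF B(1) B(2) B(3) A(1)])
      next
        assume l: "\<not> j \<le> k" "\<not> i \<le> k"
        note A = lvlV[OF sj l(1)] and B = lvlV[OF ti l(2)]
        show ?thesis unfolding eq A(2,3) B(2,3) by (rule VV[OF A(1) B(1)])
      qed
    qed
    show ?thesis unfolding xi
    proof (rule weak_conv_m_char[OF _ _ M N])
      show "(\<lambda>\<omega>. sqrt (real n) * (\<rho>\<^sub>n n \<omega> - \<rho>)) \<in> borel_measurable M" for n
        unfolding rho_n_emp using S.emp_min_measurable[of n] by simp
      show "(\<lambda>\<omega>. \<Sum>s\<in>C.levels. C.weight s * ?Y s \<omega>) \<in> borel_measurable N" using gc by (simp add: gauss_char_def)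
      show "(\<lambda>n. char (distr M borel (\<lambda>\<omega>. sqrt (real n) * (\<rho>\<^sub>n n \<omega> - \<rho>))) t)
        \<longlonglongrightarrow> char (distr N borel (\<lambda>\<omega>. \<Sum>s\<in>C.levels. C.weight s * ?Y s \<omega>)) t" for t
        using S.char_tendsto[OF unique, of t] gc unfolding rho_n_emp rho_val gauss_char_def by simp
    qed
  qed
  have exist: "\<exists>(N :: (nat \<Rightarrow> real) measure) W V.
            zero_mean_brownian k m I N W V \<and> has_limit_covariance P k m I f g uhat N W V"
  proof -
    obtain W0 where
      W0: "\<forall>S a. finite S \<longrightarrow> S \<subseteq> C.params \<longrightarrow>
         gauss_char white_noise (\<lambda>\<omega>. \<Sum>t\<in>S. a t * W0 t \<omega>) (\<integral>x. (\<Sum>t\<in>S. a t * C.phi t x)\<^sup>2 \<partial>P)"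
      and cont: "\<forall>\<omega>. \<forall>e>0. \<exists>\<delta>>0. \<forall>s\<in>C.params. \<forall>t\<in>C.params. C.dd s t \<le> \<delta> \<longrightarrow> \<bar>W0 s \<omega> - W0 t \<omega>\<bar> \<le> e"
      using C.gaussian_process by (elim exE conjE) (rule that)
    note G = W0[rule_format]
    have wn: "prob_space white_noise" by (rule white_noise_prob)
    note cov = C.gaussian_covariance[OF wn W0]
    \<comment> \<open>Components beyond the dimension are set to 0, which places the vectors in
      \<open>Rn\<close>; the vector \<open>Vp\<close> is the process at level \<open>k + 1\<close>
      and its single argument 0.\<close>
    define Wp where "Wp j \<eta> \<omega> = (\<lambda>a. if a < m (j - 1) then W0 (j, a, uhat, \<eta>) \<omega> else 0)" for j \<eta> \<omega>
    define Vp where "Vp \<omega> = (\<lambda>a. if a < m k then W0 (?K, a, uhat, \<lambda>_. 0) \<omega> else 0)" for \<omega>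
    define \<tau> where "\<tau> q = (case q of Inl (j, \<eta>, a) \<Rightarrow> (j, a, uhat, \<eta>) | Inr a \<Rightarrow> (?K, a, uhat, \<lambda>_. 0))"
      for q :: "(nat \<times> (nat \<Rightarrow> real) \<times> nat) + nat"
    have pW: "(j, a, uhat, \<eta>) \<in> C.params" if "j \<in> {1..k}" "\<eta> \<in> I j" "a < m (j - 1)" for j a \<eta>
    proof -
      have "j - 1 \<le> k" using that(1) by auto
      thus ?thesis using that uU by (simp add: C.params_def level_dim_def level_set_def)
    qed
    have pV: "(?K, a, uhat, \<lambda>_. 0) \<in> C.params" if "a < m k" for a
      using that uU by (simp add: C.params_def level_dim_def level_set_def)
    have \<tau>: "\<tau> q \<in> C.params" "coord Wp Vp q = W0 (\<tau> q)" if "q \<in> coord_index k m I" for q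
      using that pW pV by (auto simp: coord_index_def \<tau>_def coord_def Wp_def Vp_def fun_eq_iff)
    have \<tau>_inj: "inj_on \<tau> (coord_index k m I)"
      by (auto simp: inj_on_def coord_index_def \<tau>_def)
    have phiW: "C.phi (j, a, uhat, \<eta>) = (\<lambda>x. f j uhat \<eta> x a - vexp P (f j uhat \<eta>) a)" if "j \<in> {1..k}" for j a \<eta>
      using that by (simp add: fun_eq_iff C.phi_def C.fbar_def level_fun_def)
    have phiV: "C.phi (?K, a, uhat, \<lambda>_. 0) = (\<lambda>x. g uhat x a - vexp P (g uhat) a)" for a
      by (simp add: fun_eq_iff C.phi_def C.fbar_def level_fun_def)
    have Wp_eq: "(\<lambda>\<omega>. Wp j \<eta> \<omega> a) = W0 (j, a, uhat, \<eta>)" if "a < m (j - 1)" for j \<eta> a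
      using that by (simp add: Wp_def fun_eq_iff)
    have Vp_eq: "(\<lambda>\<omega>. Vp \<omega> a) = W0 (?K, a, uhat, \<lambda>_. 0)" if "a < m k" for a
      using that by (simp add: Vp_def fun_eq_iff)
    have "has_limit_covariance P k m I f g uhat white_noise Wp Vp"
      unfolding has_limit_covariance_def
    proof (intro conjI ballI allI impI)
      fix i j \<eta> \<theta> a b
      assume *: "i \<in> {1..k}" "j \<in> {1..k}" "\<eta> \<in> I i" "\<theta> \<in> I j" "a < m (i - 1)" "b < m (j - 1)"
      show "covar white_noise (\<lambda>\<omega>. Wp i \<eta> \<omega> a) (\<lambda>\<omega>. Wp j \<theta> \<omega> b) =
          (\<integral>x. (f i uhat \<eta> x a - vexp P (f i uhat \<eta>) a) * (f j uhat \<theta> x b - vexp P (f j uhat \<theta>) b) \<partial>P)"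
        using cov(2)[OF pW[OF *(1,3,5)] pW[OF *(2,4,6)]] unfolding Wp_eq[OF *(5)] Wp_eq[OF *(6)] phiW[OF *(1)] phiW[OF *(2)] .
    next
      fix i \<eta> a b
      assume *: "i \<in> {1..k}" "\<eta> \<in> I i" "a < m (i - 1)" "b < m k"
      show "covar white_noise (\<lambda>\<omega>. Wp i \<eta> \<omega> a) (\<lambda>\<omega>. Vp \<omega> b) =
          (\<integral>x. (f i uhat \<eta> x a - vexp P (f i uhat \<eta>) a) * (g uhat x b - vexp P (g uhat) b) \<partial>P)"
        using cov(2)[OF pW[OF *(1,2,3)] pV[OF *(4)]] unfolding Wp_eq[OF *(3)] Vp_eq[OF *(4)] phiW[OF *(1)] phiV .
    next
      fix a b
      assume *: "a < m k" "b < m k"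
      show "covar white_noise (\<lambda>\<omega>. Vp \<omega> a) (\<lambda>\<omega>. Vp \<omega> b) =
          (\<integral>x. (g uhat x a - vexp P (g uhat) a) * (g uhat x b - vexp P (g uhat) b) \<partial>P)"
        using cov(2)[OF pV[OF *(1)] pV[OF *(2)]] unfolding Vp_eq[OF *(1)] Vp_eq[OF *(2)] phiV .
    qed
    moreover have "zero_mean_brownian k m I white_noise Wp Vp"
      unfolding zero_mean_brownian_def
    proof (intro conjI ballI)
      show "prob_space white_noise" by (rule wn)
      show "Vp \<omega> \<in> Rn (m k)" for \<omega> by (simp add: Vp_def topspace_Euclidean_space)
      fix \<omega> j assume j: "j \<in> {1..k}"
      \<comment> \<open>Continuity with respect to \<open>dd\<close> gives continuity on
        \<open>I j\<close>, because \<open>dd\<close> is controlled by \<open>dist1\<close> when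
        level, component and \<open>u\<close> agree.\<close>
      have "continuous_on (I j) (\<lambda>\<eta>. W0 (j, a, uhat, \<eta>) \<omega>)" if a: "a < m (j - 1)" for a
        unfolding continuous_on_sequentially
      proof (intro allI ballI impI, elim conjE)
        fix z \<eta> assume \<eta>: "\<eta> \<in> I j" and z: "\<forall>n. z n \<in> I j" "z \<longlonglongrightarrow> \<eta>"
        have "(\<lambda>n. z n b) \<longlonglongrightarrow> \<eta> b" for b
          by (rule continuous_on_tendsto_compose[OF continuous_on_product_coordinates z(2)]) auto
        hence d: "(\<lambda>n. dist1 (m j) (z n) \<eta>) \<longlonglongrightarrow> 0" by (intro dist1_tendsto)
        show "((\<lambda>\<eta>. W0 (j, a, uhat, \<eta>) \<omega>) \<circ> z) \<longlonglongrightarrow> W0 (j, a, uhat, \<eta>) \<omega>"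
        proof (rule tendstoI)
          fix e :: real assume e: "e > 0"
          hence "e / 2 > 0" by simp
          with cont obtain \<delta> where \<delta>: "\<delta> > 0" "\<forall>s\<in>C.params. \<forall>t\<in>C.params. C.dd s t \<le> \<delta> \<longrightarrow> \<bar>W0 s \<omega> - W0 t \<omega>\<bar> \<le> e / 2"
            by blast
          let ?D = "1 + real DIM('u)"
          have D: "?D > 0" by simp
          have "\<forall>\<^sub>F n in sequentially. dist1 (m j) (z n) \<eta> < \<delta> / ?D"
            using \<delta>(1) D by (intro order_tendstoD(2)[OF d]) (rule divide_pos_pos)
          thus "\<forall>\<^sub>F n in sequentially. dist (((\<lambda>\<eta>. W0 (j, a, uhat, \<eta>) \<omega>) \<circ> z) n) (W0 (j, a, uhat, \<eta>) \<omega>) < e"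
          proof eventually_elim
            case (elim n)
            have K: "j \<in> {1..?K}" "z n \<in> ?I j" "\<eta> \<in> ?I j" "?m j = m j" using j z(1) \<eta> by (auto simp: level_set_def level_dim_def)
            have "C.dd (j, a, uhat, z n) (j, a, uhat, \<eta>) \<le> ?D * (norm (uhat - uhat) + dist1 (?m j) (z n) \<eta>)"
              by (rule C.dd_same[OF K(1-3)])
            also have "\<dots> \<le> \<delta>" using elim D K(4) by (simp add: pos_less_divide_eq mult.commute)
            finally have "\<bar>W0 (j, a, uhat, z n) \<omega> - W0 (j, a, uhat, \<eta>) \<omega>\<bar> \<le> e / 2"
              using \<delta>(2) pW[OF j _ a] z(1) \<eta> by blast
            thus ?case using e by (simp add: dist_real_def)
          qed
        qed
      qed
      hence "\<forall>a<m (j - 1). continuous_map (subtopology (Euclidean_space (m j)) (I j)) euclideanreal (\<lambda>\<eta>. W0 (j, a, uhat, \<eta>) \<omega>)"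
        using I_sub(1)[OF j] by (subst Euclidean_space_top_of_set) (auto simp: subtopology_subtopology Int_absorb1)
      thus "continuous_map (subtopology (Euclidean_space (m j)) (I j)) (Euclidean_space (m (j - 1))) (\<lambda>\<eta>. Wp j \<eta> \<omega>)"
        unfolding Wp_def by (simp only: continuous_map_componentwise_Euclidean_space)
    next
      show "jointly_gaussian white_noise (coord_index k m I) (coord Wp Vp)"
        unfolding jointly_gaussian_def
      proof (intro allI impI, elim conjE)
        fix S c assume S: "finite S" "S \<subseteq> coord_index k m I"
        have inj: "inj_on \<tau> S" by (rule inj_on_subset[OF \<tau>_inj S(2)])
        have "(\<Sum>q\<in>S. c q * coord Wp Vp q \<omega>) = (\<Sum>t\<in>\<tau> ` S. c (the_inv_into S \<tau> t) * W0 t \<omega>)" for \<omega>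
          unfolding sum.reindex[OF inj] using S(2) \<tau>(2) by (intro sum.cong) (auto simp: the_inv_into_f_f[OF inj])
        moreover have "normal_rv white_noise (\<lambda>\<omega>. \<Sum>t\<in>\<tau> ` S. c (the_inv_into S \<tau> t) * W0 t \<omega>)"
          by (rule prob_space.gauss_char_imp(1)[OF wn G]) (use S \<tau>(1) in auto)
        ultimately show "normal_rv white_noise (\<lambda>\<omega>. \<Sum>q\<in>S. c q * coord Wp Vp q \<omega>)" by simp
      qed
      show "(\<integral>\<omega>. coord Wp Vp q \<omega> \<partial>white_noise) = 0" if "q \<in> coord_index k m I" for q
        using cov(1)[OF \<tau>(1)[OF that] \<tau>(1)[OF that]] \<tau>(2)[OF that] by simp
    qed
    ultimately show ?thesis by blast
  qed
  show ?thesis using exist weak by blast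
qed

end
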